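(* Let $\mathcal A$ and $U$ be linear, uniformly closed, $C_{ub}$-invariant subsets of $L^1_{loc}(\mathbb J,X)$, let $\mathcal A$ satisfy $(L_U)$, let $m\in\mathbb N_0$, and let $\phi\in\mathcal M^mL^\infty(\mathbb R,X)$ be such that $sp_{\mathcal A,\mathcal D_{L^1}}\phi$ is at most countable and $\phi|\,\mathbb J\in\mathcal M^mC_u(\mathbb J,X)$. Assume that for all $\omega\in sp_{\mathcal A,\mathcal D_{L^1}}\phi$ one has $\gamma_\omega\mathcal A\subset\mathcal A$, $\gamma_{-\omega}\mathcal A\subset\mathcal A$ and $(\gamma_{-\omega}\phi)|\,\mathbb J\in\mathcal M^{q(\omega)}U$ with some integer $q(\omega)\ge m$. Then $\phi|\,\mathbb J\in\mathcal M^m\mathcal A$.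
   Context: $X$ is a complex Banach space; $\mathbb J$ is an interval of the form $\mathbb R$, $(\alpha,\infty)$ or $[\alpha,\infty)$, $\alpha\in\mathbb R$. $\gamma_\omega(t)=e^{i\omega t}$. $C_u$, $C_{ub}$: uniformly continuous, respectively bounded uniformly continuous functions. $f_a(t)=f(t+a)$, $\Delta_hf=f_h-f$. A class $\mathcal A\subset L^1_{loc}(\mathbb J,X)$ is uniformly closed if $(\phi_n)\subset\mathcal A$, $\phi_n\to\phi$ uniformly on $\mathbb J$ implies $\phi\in\mathcal A$; it is $C_{ub}$-invariant if for each $f\in C_{ub}(\mathbb R,X)$ with $f|\,\mathbb J\in\mathcal A$ one has $f_a|\,\mathbb J\in\mathcal A$ for all $a\in\mathbb R$. $(L_U)$ for $\mathcal A$: if $\psi\in U$ and $\Delta_h\psi\in\mathcal A$ for all $h>0$, then $\psi\in\mathcal A$. For $\mathcal B\subset L^1_{loc}(\mathbb I,X)$ ($\mathbb I=\mathbb R$ or $\mathbb J$): $\mathcal M\mathcal B=\{f\in L^1_{loc}(\mathbb I,X):M_hf\in\mathcal B\ \forall h>0\}$ with $M_hf(t)=\frac1h\int_0^hf(t+s)\,ds$; $\mathcal M^0\mathcal B=\mathcal B$, $\mathcal M^k\mathcal B=\mathcal M(\mathcal M^{k-1}\mathcal B)$. $\mathcal D_{L^1}(\mathbb R,\mathbb C)$: all $\varphi\in C^\infty(\mathbb R,\mathbb C)$ with $\varphi^{(j)}\in L^1$ for all $j\ge0$, where $\varphi_k\to0$ means $\varphi_k^{(j)}\to0$ in $L^1$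 for each $j$; $(\mathcal D_{L^1})'(\mathbb R,X)$: linear continuous maps $\mathcal D_{L^1}(\mathbb R,\mathbb C)\to X$. Each $\phi\in\mathcal M^mL^\infty(\mathbb R,X)$, viewed as a distribution $\varphi\mapsto\int\varphi\phi\,dt$ on the Schwartz test functions $\mathcal D(\mathbb R,\mathbb C)$, extends uniquely to an element of $(\mathcal D_{L^1})'(\mathbb R,X)$. For $S\in(\mathcal D_{L^1})'(\mathbb R,X)$ and $\varphi\in\mathcal D_{L^1}(\mathbb R,\mathbb C)$, $(S*\varphi)(x)=S(y\mapsto\varphi(x-y))$, a $C^\infty$ function, and $sp_{\mathcal A,\mathcal D_{L^1}}S=\{\omega\in\mathbb R:$ for every $\varphi\in\mathcal D_{L^1}(\mathbb R,\mathbb C)$ with $(S*\varphi)|\,\mathbb J\in\mathcal A$ one has $\hat\varphi(\omega)=0\}$, where $\hat\varphi(\omega)=\int_{\mathbb R}e^{-i\omega t}\varphi(t)\,dt$. *)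

theory Defs
  imports "HOL-Analysis.Analysis"
begin

section \<open>Complex Banach spaces\<close>

class scaleC =
  fixes scaleC :: "complex \<Rightarrow> 'a \<Rightarrow> 'a" (infixr \<open>*\<^sub>C\<close> 75)

class complex_banach = banach + scaleC +
  assumes scaleC_add_right: "a *\<^sub>C (x + y) = a *\<^sub>C x + a *\<^sub>C y"
    and scaleC_add_left: "(a + b) *\<^sub>C x = a *\<^sub>C x + b *\<^sub>C x"
    and scaleC_scaleC: "a *\<^sub>C (b *\<^sub>C x) = (a * b) *\<^sub>C x"
    and scaleC_of_real: "complex_of_real r *\<^sub>C x = r *\<^sub>R x"
    and norm_scaleC: "norm (a *\<^sub>C x) = cmod a * norm x"

instantiation complex :: complex_banach
begin
definition scaleC_complex :: "complex \<Rightarrow> complex \<Rightarrow> complex" where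
  "scaleC_complex a x = a * x"
instance
  by standard (auto simp: scaleC_complex_def algebra_simps norm_mult scaleR_conv_of_real)
end

section \<open>Bochner integration in a possibly non-separable Banach space\<close>

text \<open>
  The library's \<^const>\<open>has_bochner_integral\<close> is confined to second countable range
  spaces. The following is the same definition without that restriction. Approximability by
  simple functions in mean is what forces strong measurability here.
\<close>

definition has_bint :: "real set \<Rightarrow> (real \<Rightarrow> 'a::banach) \<Rightarrow> 'a \<Rightarrow> bool" where
  "has_bint K f x \<longleftrightarrow>
     f \<in> borel_measurable (lebesgue_on K) \<and>
     (\<exists>s. (\<forall>i. Bochner_Integration.simple_bochner_integrable (lebesgue_on K) (s i)) \<and>
          (\<lambda>i. \<integral>\<^sup>+t. norm (f t - s i t) \<partial>lebesgue_on K) \<longlonglongrightarrow> 0 \<and>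
          (\<lambda>i. Bochner_Integration.simple_bochner_integral (lebesgue_on K) (s i)) \<longlonglongrightarrow> x)"

definition bintegrable :: "real set \<Rightarrow> (real \<Rightarrow> 'a::banach) \<Rightarrow> bool" where
  "bintegrable K f \<longleftrightarrow> (\<exists>x. has_bint K f x)"

definition bint :: "real set \<Rightarrow> (real \<Rightarrow> 'a::banach) \<Rightarrow> 'a" where
  "bint K f = (THE x. has_bint K f x)"

section \<open>Function classes on an interval\<close>

text \<open>
  A function on \<open>J\<close> is an element of \<^term>\<open>extensional J\<close>; the restriction of \<open>f\<close> to \<open>J\<close> is
  \<^term>\<open>restrict f J\<close>. Functions are not identified when they agree almost everywhere.
\<close>

definition admissible_interval :: "real set \<Rightarrow> bool" where
  "admissible_interval J \<longleftrightarrow> J = UNIV \<or> (\<exists>\<alpha>. J = {\<alpha><..}) \<or> (\<exists>\<alpha>. J = {\<alpha>..})"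

definition L1loc :: "real set \<Rightarrow> (real \<Rightarrow> 'a::banach) set" where
  "L1loc J = {f \<in> extensional J. \<forall>K. compact K \<and> K \<subseteq> J \<longrightarrow> bintegrable K f}"

definition Linf :: "real set \<Rightarrow> (real \<Rightarrow> 'a::banach) set" where
  "Linf J = {f \<in> L1loc J. \<exists>C. AE t in lebesgue_on J. norm (f t) \<le> C}"

definition Cu :: "real set \<Rightarrow> (real \<Rightarrow> 'a::banach) set" where
  "Cu J = {f \<in> extensional J. uniformly_continuous_on J f}"

definition Cub :: "real set \<Rightarrow> (real \<Rightarrow> 'a::banach) set" where
  "Cub J = {f \<in> Cu J. bounded (f ` J)}"

definition linear_class :: "real set \<Rightarrow> (real \<Rightarrow> 'a::complex_banach) set \<Rightarrow> bool" where
  "linear_class J A \<longleftrightarrow>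
     (\<lambda>t\<in>J. 0) \<in> A \<and>
     (\<forall>f\<in>A. \<forall>g\<in>A. (\<lambda>t\<in>J. f t + g t) \<in> A) \<and>
     (\<forall>c. \<forall>f\<in>A. (\<lambda>t\<in>J. c *\<^sub>C f t) \<in> A)"

definition uniformly_closed :: "real set \<Rightarrow> (real \<Rightarrow> 'a::banach) set \<Rightarrow> bool" where
  "uniformly_closed J A \<longleftrightarrow>
     (\<forall>F f. (\<forall>n::nat. F n \<in> A) \<and> f \<in> extensional J \<and> uniform_limit J F f sequentially
        \<longrightarrow> f \<in> A)"

definition Cub_invariant :: "real set \<Rightarrow> (real \<Rightarrow> 'a::banach) set \<Rightarrow> bool" where
  "Cub_invariant J A \<longleftrightarrow>
     (\<forall>f\<in>Cub UNIV. restrict f J \<in> A \<longrightarrow> (\<forall>a. (\<lambda>t\<in>J. f (t + a)) \<in> A))"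

definition cond_L :: "real set \<Rightarrow> (real \<Rightarrow> 'a::banach) set \<Rightarrow> (real \<Rightarrow> 'a) set \<Rightarrow> bool" where
  "cond_L J U A \<longleftrightarrow>
     (\<forall>\<psi>\<in>U. (\<forall>h>0. (\<lambda>t\<in>J. \<psi> (t + h) - \<psi> t) \<in> A) \<longrightarrow> \<psi> \<in> A)"

definition mean :: "real set \<Rightarrow> real \<Rightarrow> (real \<Rightarrow> 'a::banach) \<Rightarrow> (real \<Rightarrow> 'a)" where
  "mean J h f = (\<lambda>t\<in>J. (1 / h) *\<^sub>R bint {0..h} (\<lambda>s. f (t + s)))"

definition mean_class :: "real set \<Rightarrow> (real \<Rightarrow> 'a::banach) set \<Rightarrow> (real \<Rightarrow> 'a) set" where
  "mean_class J B = {f \<in> L1loc J. \<forall>h>0. mean J h f \<in> B}"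

primrec mean_power :: "real set \<Rightarrow> nat \<Rightarrow> (real \<Rightarrow> 'a::banach) set \<Rightarrow> (real \<Rightarrow> 'a) set" where
  "mean_power J 0 B = B"
| "mean_power J (Suc k) B = mean_class J (mean_power J k B)"

definition char_mult :: "real \<Rightarrow> (real \<Rightarrow> 'a::complex_banach) \<Rightarrow> (real \<Rightarrow> 'a)" where
  "char_mult \<omega> f = (\<lambda>t. cis (\<omega> * t) *\<^sub>C f t)"

definition char_invariant ::
    "real set \<Rightarrow> real \<Rightarrow> (real \<Rightarrow> 'a::complex_banach) set \<Rightarrow> bool" where
  "char_invariant J \<omega> A \<longleftrightarrow> (\<forall>f\<in>A. restrict (char_mult \<omega> f) J \<in> A)"

section \<open>Distributions and spectrum\<close>

definition iter_deriv :: "nat \<Rightarrow> (real \<Rightarrow> complex) \<Rightarrow> (real \<Rightarrow> complex)" where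
  "iter_deriv j = (\<lambda>g t. vector_derivative g (at t)) ^^ j"

definition smooth :: "(real \<Rightarrow> complex) \<Rightarrow> bool" where
  "smooth \<phi> \<longleftrightarrow> (\<forall>j t. iter_deriv j \<phi> differentiable (at t))"

definition DL1 :: "(real \<Rightarrow> complex) set" where
  "DL1 = {\<phi>. smooth \<phi> \<and> (\<forall>j. integrable lborel (iter_deriv j \<phi>))}"

definition test_functions :: "(real \<Rightarrow> complex) set" where
  "test_functions = {\<phi>. smooth \<phi> \<and> compact (closure {t. \<phi> t \<noteq> 0})}"

definition DL1_null :: "(nat \<Rightarrow> real \<Rightarrow> complex) \<Rightarrow> bool" where
  "DL1_null \<Phi> \<longleftrightarrow>
     (\<forall>k. \<Phi> k \<in> DL1) \<and>
     (\<forall>j. (\<lambda>k. LINT t|lborel. cmod (iter_deriv j (\<Phi> k) t)) \<longlonglongrightarrow> 0)"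

text \<open>Elements of the dual are total functions whose values off \<^term>\<open>DL1\<close> are irrelevant.\<close>

definition DL1_dual :: "((real \<Rightarrow> complex) \<Rightarrow> 'a::complex_banach) set" where
  "DL1_dual = {S.
     (\<forall>\<phi>\<in>DL1. \<forall>\<psi>\<in>DL1. S (\<lambda>t. \<phi> t + \<psi> t) = S \<phi> + S \<psi>) \<and>
     (\<forall>c. \<forall>\<phi>\<in>DL1. S (\<lambda>t. c * \<phi> t) = c *\<^sub>C S \<phi>) \<and>
     (\<forall>\<Phi>. DL1_null \<Phi> \<longrightarrow> (\<lambda>k. S (\<Phi> k)) \<longlonglongrightarrow> 0)}"

text \<open>
  The extension of a function, viewed as a distribution, to \<^term>\<open>DL1\<close>. For functions in some
  \<^term>\<open>mean_power UNIV m (Linf UNIV)\<close> it exists, and its values on \<^term>\<open>DL1\<close> are uniquely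
  determined, so that the choice operator only chooses the irrelevant values off \<^term>\<open>DL1\<close>.
\<close>

definition DL1_extension :: "(real \<Rightarrow> 'a::complex_banach) \<Rightarrow> (real \<Rightarrow> complex) \<Rightarrow> 'a" where
  "DL1_extension f =
     (SOME S. S \<in> DL1_dual \<and> (\<forall>\<phi>\<in>test_functions. S \<phi> = bint UNIV (\<lambda>t. \<phi> t *\<^sub>C f t)))"

definition conv :: "((real \<Rightarrow> complex) \<Rightarrow> 'a) \<Rightarrow> (real \<Rightarrow> complex) \<Rightarrow> (real \<Rightarrow> 'a)" where
  "conv S \<phi> = (\<lambda>x. S (\<lambda>y. \<phi> (x - y)))"

definition fourier :: "(real \<Rightarrow> complex) \<Rightarrow> real \<Rightarrow> complex" where
  "fourier \<phi> \<omega> = (LINT t|lborel. cis (- \<omega> * t) * \<phi> t)"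

definition sp_DL1 ::
    "real set \<Rightarrow> (real \<Rightarrow> 'a) set \<Rightarrow> ((real \<Rightarrow> complex) \<Rightarrow> 'a) \<Rightarrow> real set" where
  "sp_DL1 J A S = {\<omega>. \<forall>\<phi>\<in>DL1. restrict (conv S \<phi>) J \<in> A \<longrightarrow> fourier \<phi> \<omega> = 0}"

end

theory Submission
  imports Defs "HOL-Probability.Sinc_Integral"
begin

text \<open>
  Let \<open>S\<close> be the distribution of \<open>\<phi>\<close>, and let \<open>N f\<close> be the uniform distance of \<open>S * f\<close> from the bounded
  uniformly continuous functions whose restriction to \<open>J\<close> is in \<open>A\<close>. This seminorm does not grow under
  translations, so \<open>N (f * k) \<le> \<parallel>k\<parallel>\<^sub>1 N f\<close>, and the spectrum is the hull of its null space. Localising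
  with Fejer and de la Vallee Poussin kernels, a contraction argument replaces Wiener's division lemma
  and gives two facts: if the spectrum is empty then \<open>N = 0\<close>; if \<open>\<omega>\<close> is isolated in it and \<open>f\<close> is
  localised near \<open>\<omega>\<close>, then \<open>f(x + h) - e\<^sup>i\<^sup>\<omega>\<^sup>h f(x)\<close> is in the null space for all \<open>h\<close>. A nonempty countable
  closed set has an isolated point \<open>\<omega>\<close> by Baire's theorem. There all differences of \<open>\<gamma>\<^sub>-\<^sub>\<omega> (S * f)\<close>
  are in \<open>A\<close> while the function itself is in \<open>U\<close>, so \<open>(L\<^sub>U)\<close> puts \<open>S * f\<close> into \<open>A\<close>, although the transform
  of \<open>f\<close> does not vanish at \<open>\<omega>\<close>. Hence the spectrum is empty and all \<open>S * f\<close> are in \<open>A\<close>; mollifying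
  the \<open>m\<close>-fold means of \<open>\<phi>\<close> with kernels supported on the left then shows that these means are in \<open>A\<close>.
\<close>

section \<open>Bochner integrals as gauge integrals\<close>

text \<open>Two obstacles shape the argument. The classes live on \<open>J\<close>, and their
  translation invariance holds only for restrictions of bounded uniformly continuous functions on
  the line. So the work is done with such functions (\<open>lift\<close>), and
  \<open>\<phi>\<close>, which need be neither bounded nor continuous, enters through its
  convolutions with \<open>DL1\<close>.

  The conditions on \<open>\<phi>\<close>, however, concern iterated means. Means look to the right,
  hence respect \<open>J\<close>, and they commute with convolution by test functions, but not with
  multiplication by a character. The defect is an average of windows of all smaller widths; to bound
  it on \<open>J\<close>, Baire's theorem turns bounds for each single width into one bound.

  A seminorm knows translations only. Convolution with an integrable kernel becomes accessible as a
  limit of combinations of translates whose weights add up to at most the norm of the kernel. Fejer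
  kernels fit because a wide one is exactly a finite combination of narrow ones at shifted
  frequencies: this cuts a function into finitely many frequency pieces, and what is known near
  single points of the line adds up by compactness.\<close>

abbreviation simple_integrable where
  "simple_integrable \<equiv> Bochner_Integration.simple_bochner_integrable"

abbreviation simple_integral where
  "simple_integral \<equiv> Bochner_Integration.simple_bochner_integral"

text \<open>With a non-separable range the difference of two measurable functions need not be
  measurable, because the Borel sets of a product need not be generated by rectangles. If one of the
  functions is simple, only its finitely many values matter, and each of them leaves a measurable
  function of the other.\<close>

lemma simple_measurable_compose:
  assumes "simple_function M s" and "\<And>y. g y \<in> measurable M N"
  shows "(\<lambda>x. g (s x) x) \<in> measurable M N"
proof (rule measurable_compose_countable'[where I="s ` space M"])
  show "s \<in> measurable M (count_space (s ` space M))"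
    using assms(1) by (auto simp: simple_function_def measurable_count_space_eq_countable countable_finite intro!: measurable_count_space_eq_countable[THEN iffD2])
  show "countable (s ` space M)"
    using assms(1) by (auto simp: simple_function_def countable_finite)
qed (use assms in auto)

lemma norm_diff_simple_measurable:
  fixes f :: "'b \<Rightarrow> 'a::real_normed_vector"
  assumes "f \<in> borel_measurable M" "simple_function M s"
  shows "(\<lambda>x. norm (f x - s x)) \<in> borel_measurable M"
proof (rule simple_measurable_compose[OF assms(2), where g="\<lambda>y x. norm (f x - y)"])
  fix y
  have "(\<lambda>z::'a. norm (z - y)) \<in> borel_measurable borel"
    by (intro borel_measurable_continuous_onI continuous_intros)
  from measurable_compose[OF assms(1) this] show "(\<lambda>x. norm (f x - y)) \<in> borel_measurable M" .
qed

lemma simple_simple: "simple_integrable M s \<Longrightarrow> simple_function M s"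
  by (auto elim: Bochner_Integration.simple_bochner_integrable.cases)

text \<open>Triangle inequality through \<open>f\<close>. The whole construction rests on it: it
  makes the limit of the integrals unique, and it makes the integrals of approximating simple
  functions a Cauchy sequence.\<close>

lemma simple_norm_diff_bound:
  fixes f :: "'b \<Rightarrow> 'a::real_normed_vector"
  assumes f: "f \<in> borel_measurable M"
    and s: "simple_integrable M s"
    and t: "simple_integrable M t"
  shows "ennreal (norm (simple_integral M s -
            simple_integral M t)) \<le>
    (\<integral>\<^sup>+ x. norm (f x - s x) \<partial>M) + (\<integral>\<^sup>+ x. norm (f x - t x) \<partial>M)"
proof -
  have m: "(\<lambda>x. norm (f x - s x)) \<in> borel_measurable M" "(\<lambda>x. norm (f x - t x)) \<in> borel_measurable M"
    using norm_diff_simple_measurable[OF f] s t simple_simple by blast+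
  have "ennreal (norm (simple_integral M s -
            simple_integral M t)) =
        norm (simple_integral M (\<lambda>x. s x - t x))"
    using s t by (subst simple_bochner_integral_diff) auto
  also have "\<dots> \<le> simple_integral M (\<lambda>x. norm (s x - t x))"
    using simple_bochner_integrable_compose2[of "(-)" M "s" "t"] s t
    by (auto intro!: simple_bochner_integral_norm_bound)
  also have "\<dots> = (\<integral>\<^sup>+x. norm (s x - t x) \<partial>M)"
    using simple_bochner_integrable_compose2[of "\<lambda>x y. norm (x - y)" M "s" "t"] s t
    by (auto intro!: simple_bochner_integral_eq_nn_integral)
  also have "\<dots> \<le> (\<integral>\<^sup>+x. ennreal (norm (f x - s x)) + ennreal (norm (f x - t x)) \<partial>M)"
  proof (rule nn_integral_mono)
    fix x
    have "norm (s x - t x) \<le> norm (f x - s x) + norm (f x - t x)"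
      by (metis add.commute norm_minus_commute norm_triangle_sub diff_add_cancel dist_norm dist_triangle2 dist_commute)
    then show "ennreal (norm (s x - t x)) \<le> ennreal (norm (f x - s x)) + ennreal (norm (f x - t x))"
      by (simp flip: ennreal_plus)
  qed
  also have "\<dots> = (\<integral>\<^sup>+ x. norm (f x - s x) \<partial>M) + (\<integral>\<^sup>+ x. norm (f x - t x) \<partial>M)"
    using m by (intro nn_integral_add) auto
  finally show ?thesis .
qed

lemma has_bint_unique:
  assumes "has_bint K f x" "has_bint K f y"
  shows "x = y"
proof -
  let ?M = "lebesgue_on K"
  let ?I = "simple_integral ?M"
  from assms(1) obtain s where s: "\<And>i. simple_integrable ?M (s i)"
      "(\<lambda>i. \<integral>\<^sup>+t. norm (f t - s i t) \<partial>?M) \<longlonglongrightarrow> 0" "(\<lambda>i. ?I (s i)) \<longlonglongrightarrow> x"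
    unfolding has_bint_def by auto
  from assms(2) obtain r where r: "\<And>i. simple_integrable ?M (r i)"
      "(\<lambda>i. \<integral>\<^sup>+t. norm (f t - r i t) \<partial>?M) \<longlonglongrightarrow> 0" "(\<lambda>i. ?I (r i)) \<longlonglongrightarrow> y"
    unfolding has_bint_def by auto
  have f: "f \<in> borel_measurable ?M" using assms(1) by (simp add: has_bint_def)
  have "(\<lambda>i. ennreal (norm (?I (s i) - ?I (r i)))) \<longlonglongrightarrow> 0"
  proof (rule tendsto_sandwich[OF _ _ tendsto_const])
    show "\<forall>\<^sub>F i in sequentially. ennreal (norm (?I (s i) - ?I (r i)))
        \<le> (\<integral>\<^sup>+t. norm (f t - s i t) \<partial>?M) + (\<integral>\<^sup>+t. norm (f t - r i t) \<partial>?M)"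
      by (intro always_eventually allI simple_norm_diff_bound f s r)
    show "(\<lambda>i. (\<integral>\<^sup>+t. norm (f t - s i t) \<partial>?M) + (\<integral>\<^sup>+t. norm (f t - r i t) \<partial>?M)) \<longlonglongrightarrow> 0"
      using tendsto_add[OF s(2) r(2)] by simp
  qed auto
  moreover have "(\<lambda>i. ennreal (norm (?I (s i) - ?I (r i)))) \<longlonglongrightarrow> ennreal (norm (x - y))"
    by (intro tendsto_ennrealI tendsto_norm tendsto_diff s r)
  ultimately have "ennreal (norm (x - y)) = 0"
    using LIMSEQ_unique by blast
  then show ?thesis by (simp add: ennreal_eq_0_iff)
qed

lemma bint_eq: "has_bint K f x \<Longrightarrow> bint K f = x"
  unfolding bint_def using has_bint_unique by blast

text \<open>Completeness supplies the value of the integral, so approximability in mean is all that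
  has to be checked: the integrals of approximations with errors below \<open>1 / Suc n\<close> form
  a Cauchy sequence.\<close>

lemma bintegrableI:
  assumes f: "f \<in> borel_measurable (lebesgue_on K)"
    and ap: "\<And>e::real. e > 0 \<Longrightarrow> \<exists>s. simple_integrable (lebesgue_on K) s \<and>
        (\<integral>\<^sup>+t. norm (f t - s t) \<partial>lebesgue_on K) < ennreal e"
  shows "bintegrable K (f :: real \<Rightarrow> 'a::banach)"
proof -
  let ?M = "lebesgue_on K"
  let ?I = "simple_integral ?M"
  have "\<exists>s. \<forall>n::nat. simple_integrable ?M (s n) \<and>
        (\<integral>\<^sup>+t. norm (f t - s n t) \<partial>?M) < ennreal (1 / Suc n)"
    by (intro choice allI ap) simp
  then obtain s where s: "\<And>n::nat. simple_integrable ?M (s n)"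
     "\<And>n. (\<integral>\<^sup>+t. norm (f t - s n t) \<partial>?M) < ennreal (1 / Suc n)" by auto
  have d: "norm (?I (s n) - ?I (s m)) < 1 / Suc n + 1 / Suc m" for n m
  proof -
    have "ennreal (norm (?I (s n) - ?I (s m))) \<le>
       (\<integral>\<^sup>+t. norm (f t - s n t) \<partial>?M) + (\<integral>\<^sup>+t. norm (f t - s m t) \<partial>?M)"
      by (intro simple_norm_diff_bound f s)
    also have "\<dots> < ennreal (1 / Suc n) + ennreal (1 / Suc m)"
      by (intro add_strict_mono s)
    also have "\<dots> = ennreal (1 / Suc n + 1 / Suc m)" by simp
    finally show ?thesis by (rule ennreal_less_iff[THEN iffD1, rotated]) simp
  qed
  have "Cauchy (\<lambda>n. ?I (s n))"
  proof (rule metric_CauchyI)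
    fix e :: real assume e: "e > 0"
    then obtain N where N: "inverse (real (Suc N)) < e / 2"
      using reals_Archimedean[of "e/2"] by auto
    show "\<exists>M. \<forall>m\<ge>M. \<forall>n\<ge>M. dist (?I (s m)) (?I (s n)) < e"
    proof (intro exI[of _ N] allI impI)
      fix m n assume "N \<le> m" "N \<le> n"
      then have "1 / Suc m \<le> inverse (real (Suc N))" "1 / Suc n \<le> inverse (real (Suc N))"
        by (auto simp: field_simps)
      with d[of m n] N show "dist (?I (s m)) (?I (s n)) < e" by (simp add: dist_norm)
    qed
  qed
  then obtain x where x: "(\<lambda>n. ?I (s n)) \<longlonglongrightarrow> x"
    using Cauchy_convergent convergent_def by blast
  have "(\<lambda>i. \<integral>\<^sup>+t. norm (f t - s i t) \<partial>?M) \<longlonglongrightarrow> 0"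
  proof (rule tendsto_sandwich[OF _ _ tendsto_const])
    show "\<forall>\<^sub>F n in sequentially. (\<integral>\<^sup>+t. norm (f t - s n t) \<partial>?M) \<le> ennreal (1 / Suc n)"
      using s(2) by (intro always_eventually allI) (simp add: less_imp_le)
    have "(\<lambda>n. ennreal (1 / Suc n)) \<longlonglongrightarrow> ennreal 0"
      by (intro tendsto_ennrealI LIMSEQ_Suc[OF lim_1_over_n])
    then show "(\<lambda>n. ennreal (1 / Suc n)) \<longlonglongrightarrow> 0" by simp
  qed auto
  then show ?thesis unfolding bintegrable_def has_bint_def using f s x by blast
qed

lemma has_bint_approx:
  fixes e :: real
  assumes "has_bint K f x" "e > 0"
  obtains s where "simple_integrable (lebesgue_on K) s"
    "(\<integral>\<^sup>+t. norm (f t - s t) \<partial>lebesgue_on K) < ennreal e"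
    "norm (simple_integral (lebesgue_on K) s - x) < e"
proof -
  let ?M = "lebesgue_on K"
  let ?I = "simple_integral ?M"
  from assms(1) obtain s where s: "\<And>i. simple_integrable ?M (s i)"
      "(\<lambda>i. \<integral>\<^sup>+t. norm (f t - s i t) \<partial>?M) \<longlonglongrightarrow> 0" "(\<lambda>i. ?I (s i)) \<longlonglongrightarrow> x"
    unfolding has_bint_def by auto
  have "\<forall>\<^sub>F i in sequentially. (\<integral>\<^sup>+t. norm (f t - s i t) \<partial>?M) < ennreal e"
    using order_tendstoD(2)[OF s(2), of "ennreal e"] assms(2) by simp
  moreover have "\<forall>\<^sub>F i in sequentially. dist (?I (s i)) x < e"
    using tendstoD[OF s(3) assms(2)] .
  ultimately have "\<forall>\<^sub>F i in sequentially. (\<integral>\<^sup>+t. norm (f t - s i t) \<partial>?M) < ennreal e \<and> dist (?I (s i)) x < e"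
    by (rule eventually_conj)
  then obtain i where "(\<integral>\<^sup>+t. norm (f t - s i t) \<partial>?M) < ennreal e" "dist (?I (s i)) x < e"
    by (metis (mono_tags, lifting) eventually_sequentially order_refl)
  then show ?thesis using that[of "s i"] s(1) by (simp add: dist_norm)
qed

text \<open>On a bounded interval the level sets have finite measure, so their indicators are gauge
  integrable, and a simple function is a finite combination of them.\<close>

lemma simple_has_integral:
  fixes s :: "real \<Rightarrow> 'a::banach"
  assumes s: "simple_integrable (lebesgue_on {a..b}) s"
  shows "(s has_integral simple_integral (lebesgue_on {a..b}) s) {a..b}"
proof -
  let ?M = "lebesgue_on {a..b}"
  have fin: "finite (s ` {a..b})" and meas: "\<And>y. {x\<in>{a..b}. s x = y} \<in> sets ?M"
  proof -
    have sf: "simple_function ?M s" using s by (rule simple_simple)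
    then show "finite (s ` {a..b})" by (simp add: simple_function_def)
    fix y
    have "s -` {y} \<inter> space ?M \<in> sets ?M" using simple_functionD(2)[OF sf] by blast
    moreover have "s -` {y} \<inter> space ?M = {x\<in>{a..b}. s x = y}" by auto
    ultimately show "{x\<in>{a..b}. s x = y} \<in> sets ?M" by simp
  qed
  have "((\<lambda>x. \<Sum>y\<in>s`{a..b}. indicator {x\<in>{a..b}. s x = y} x *\<^sub>R y) has_integral
      (\<Sum>y\<in>s`{a..b}. measure ?M {x\<in>{a..b}. s x = y} *\<^sub>R y)) {a..b}"
  proof (intro has_integral_sum fin)
    fix y
    have lm: "{x\<in>{a..b}. s x = y} \<in> lmeasurable"
      using meas[of y] by (intro bounded_set_imp_lmeasurable)
        (auto simp: sets_restrict_space intro: bounded_subset[OF bounded_closed_interval] intro!: sets.Int)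
    have "((\<lambda>x. indicator {x\<in>{a..b}. s x = y} x :: real) has_integral measure lebesgue {x\<in>{a..b}. s x = y}) {a..b}"
    proof -
      have "(indicator {x\<in>{a..b}. s x = y} has_integral measure lebesgue {x\<in>{a..b}. s x = y}) (UNIV :: real set)"
        using lm lmeasurable_iff_has_integral by blast
      then have "((\<lambda>x. if x \<in> {a..b} then indicator {x\<in>{a..b}. s x = y} x else 0) has_integral measure lebesgue {x\<in>{a..b}. s x = y}) (UNIV :: real set)"
        by (rule has_integral_eq[rotated]) (auto simp: indicator_def)
      then show ?thesis by (simp only: has_integral_restrict_UNIV)
    qed
    then have "((\<lambda>x. indicator {x\<in>{a..b}. s x = y} x :: real) has_integral measure ?M {x\<in>{a..b}. s x = y}) {a..b}"
      by (subst measure_restrict_space) (auto simp: sets_restrict_space)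
    then show "((\<lambda>x. indicator {x\<in>{a..b}. s x = y} x *\<^sub>R y) has_integral
        measure ?M {x\<in>{a..b}. s x = y} *\<^sub>R y) {a..b}"
      by (rule has_integral_scaleR_left)
  qed
  moreover have "(\<Sum>y\<in>s`{a..b}. indicator {x\<in>{a..b}. s x = y} x *\<^sub>R y) = s x" if "x \<in> {a..b}" for x
  proof -
    have "(\<Sum>y\<in>s`{a..b}. indicator {x\<in>{a..b}. s x = y} x *\<^sub>R y) =
        (\<Sum>y\<in>s`{a..b}. if y = s x then y else 0)"
      using that by (intro sum.cong) (auto simp: indicator_def)
    also have "\<dots> = s x" using that fin by (simp add: sum.delta)
    finally show ?thesis .
  qed
  ultimately have "(s has_integral (\<Sum>y\<in>s`{a..b}. measure ?M {x\<in>{a..b}. s x = y} *\<^sub>R y)) {a..b}"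
    by (rule has_integral_eq[rotated])
  moreover have "(\<Sum>y\<in>s`{a..b}. measure ?M {x\<in>{a..b}. s x = y} *\<^sub>R y) =
      simple_integral ?M s"
    unfolding simple_bochner_integral_def by (rule sum.cong) auto
  ultimately show ?thesis by simp
qed

lemma simple_nn_integral_norm:
  fixes s :: "'b \<Rightarrow> 'a::real_normed_vector"
  assumes "simple_integrable M s"
  shows "(\<integral>\<^sup>+t. norm (s t) \<partial>M) < \<infinity>"
proof -
  have "simple_integrable M (\<lambda>x. norm (s x))"
    using simple_bochner_integrable_compose2[of "\<lambda>x y. norm x" M s s] assms by simp
  then have "ennreal (simple_integral M (\<lambda>x. norm (s x))) = (\<integral>\<^sup>+t. norm (s t) \<partial>M)"
    by (rule simple_bochner_integral_eq_nn_integral) auto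
  then show ?thesis by (metis ennreal_less_top infinity_ennreal_def)
qed

lemma bintegrable_norm:
  assumes "bintegrable K f"
  shows "integrable (lebesgue_on K) (\<lambda>t. norm (f t))"
proof -
  from assms obtain x where x: "has_bint K f x" by (auto simp: bintegrable_def)
  obtain s where s: "simple_integrable (lebesgue_on K) s"
    "(\<integral>\<^sup>+t. norm (f t - s t) \<partial>lebesgue_on K) < ennreal 1"
    using has_bint_approx[OF x, of 1] by auto
  have f: "f \<in> borel_measurable (lebesgue_on K)" using x by (simp add: has_bint_def)
  have m: "(\<lambda>x. norm (f x - s x)) \<in> borel_measurable (lebesgue_on K)"
    using norm_diff_simple_measurable[OF f simple_simple[OF s(1)]] .
  have m2: "s \<in> borel_measurable (lebesgue_on K)"
    using borel_measurable_simple_function simple_simple[OF s(1)] by blast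
  have nm: "(norm :: 'a \<Rightarrow> real) \<in> borel_measurable borel"
    by (intro borel_measurable_continuous_onI continuous_intros)
  show ?thesis
  proof (rule integrableI_bounded)
    show "(\<lambda>t. norm (f t)) \<in> borel_measurable (lebesgue_on K)"
      using measurable_compose[OF f nm] .
    have "(\<integral>\<^sup>+t. norm (norm (f t)) \<partial>lebesgue_on K) \<le>
       (\<integral>\<^sup>+t. ennreal (norm (f t - s t)) + ennreal (norm (s t)) \<partial>lebesgue_on K)"
    proof (rule nn_integral_mono)
      fix t
      have "norm (f t) \<le> norm (f t - s t) + norm (s t)"
        by (metis norm_triangle_sub add.commute)
      then show "ennreal (norm (norm (f t))) \<le> ennreal (norm (f t - s t)) + ennreal (norm (s t))"
        by (simp flip: ennreal_plus)
    qed
    also have "\<dots> = (\<integral>\<^sup>+t. norm (f t - s t) \<partial>lebesgue_on K) + (\<integral>\<^sup>+t. norm (s t) \<partial>lebesgue_on K)"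
      using m measurable_compose[OF m2 nm] by (intro nn_integral_add) auto
    also have "\<dots> < \<infinity>"
      using s(2) simple_nn_integral_norm[OF s(1)] by (auto simp: ennreal_add_less_top intro: less_trans)
    finally show "(\<integral>\<^sup>+t. norm (norm (f t)) \<partial>lebesgue_on K) < \<infinity>" .
  qed
qed

lemma has_integral_gaugeE:
  fixes f :: "real \<Rightarrow> 'a::real_normed_vector"
  assumes "(f has_integral y) {a..b}" "e > 0"
  obtains d where "gauge d"
    "\<And>D. D tagged_division_of cbox a b \<Longrightarrow> d fine D \<Longrightarrow>
       norm ((\<Sum>(x,k)\<in>D. Henstock_Kurzweil_Integration.content k *\<^sub>R f x) - y) < e"
proof -
  have "(f has_integral y) (cbox a b)" using assms(1) by simp
  from this[unfolded has_integral, rule_format, OF assms(2)] show ?thesis using that by auto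
qed

text \<open>Riemann sums of \<open>f\<close> are compared with those of a simple function that is close in mean.\<close>

lemma has_bint_has_integral:
  fixes f :: "real \<Rightarrow> 'a::banach"
  assumes "has_bint {a..b} f x"
  shows "(f has_integral x) {a..b}"
proof -
  have f: "f \<in> borel_measurable (lebesgue_on {a..b})" using assms by (simp add: has_bint_def)
  show ?thesis
    unfolding box_real(2)[symmetric] has_integral
  proof (intro allI impI)
    fix e :: real assume e: "e > 0"
    then have e4: "e / 4 > 0" by simp
    obtain s where s: "simple_integrable (lebesgue_on {a..b}) s"
      "(\<integral>\<^sup>+t. norm (f t - s t) \<partial>lebesgue_on {a..b}) < ennreal (e/4)"
      "norm (simple_integral (lebesgue_on {a..b}) s - x) < e/4"
      using has_bint_approx[OF assms e4] by auto
    let ?I = "simple_integral (lebesgue_on {a..b}) s"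
    let ?g = "\<lambda>t. norm (f t - s t)"
    have gm: "?g \<in> borel_measurable (lebesgue_on {a..b})"
      using norm_diff_simple_measurable[OF f simple_simple[OF s(1)]] .
    have gi: "integrable (lebesgue_on {a..b}) ?g"
      using s(2) by (intro integrableI_bounded gm) (auto intro: less_trans)
    \<comment> \<open>Riemann sums of \<open>f - s\<close> are dominated by those of its norm. The
      latter are within \<open>e / 4\<close> of \<open>G\<close> on a fine division, and
      \<open>G < e / 4\<close> because \<open>s\<close> is close to \<open>f\<close> in
      mean.\<close>
    define G where "G = integral\<^sup>L (lebesgue_on {a..b}) ?g"
    have G: "(?g has_integral G) {a..b}"
      unfolding G_def by (intro has_integral_integral_lebesgue_on gi) auto
    have "ennreal G < ennreal (e/4)"
      using s(2) nn_integral_eq_integral[OF gi] by (simp add: G_def)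
    then have Ge: "G < e/4"
      using e4 ennreal_lessI by (metis ennreal_leI leI leD)
    obtain d1 where d1: "gauge d1"
       "\<And>D. D tagged_division_of cbox a b \<Longrightarrow> d1 fine D \<Longrightarrow> norm ((\<Sum>(x,k)\<in>D. Henstock_Kurzweil_Integration.content k *\<^sub>R ?g x) - G) < e/4"
      using has_integral_gaugeE[OF G e4] by metis
    obtain d2 where d2: "gauge d2"
       "\<And>D. D tagged_division_of cbox a b \<Longrightarrow> d2 fine D \<Longrightarrow> norm ((\<Sum>(x,k)\<in>D. Henstock_Kurzweil_Integration.content k *\<^sub>R s x) - ?I) < e/4"
      using has_integral_gaugeE[OF simple_has_integral[OF s(1)] e4] by metis
    show "\<exists>d. gauge d \<and> (\<forall>D. D tagged_division_of cbox a b \<and> d fine D \<longrightarrow>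
            norm ((\<Sum>(x, k)\<in>D. Henstock_Kurzweil_Integration.content k *\<^sub>R f x) - x) < e)"
    proof (intro exI[of _ "\<lambda>x. d1 x \<inter> d2 x"] conjI allI impI gauge_Int d1 d2)
      fix D assume D: "D tagged_division_of cbox a b \<and> (\<lambda>x. d1 x \<inter> d2 x) fine D"
      then have 1: "norm ((\<Sum>(x,k)\<in>D. Henstock_Kurzweil_Integration.content k *\<^sub>R ?g x) - G) < e/4"
        and 2: "norm ((\<Sum>(x,k)\<in>D. Henstock_Kurzweil_Integration.content k *\<^sub>R s x) - ?I) < e/4"
        using d1(2) d2(2) by (auto simp: fine_Int)
      have "norm ((\<Sum>(x,k)\<in>D. Henstock_Kurzweil_Integration.content k *\<^sub>R f x) - (\<Sum>(x,k)\<in>D. Henstock_Kurzweil_Integration.content k *\<^sub>R s x))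
         = norm (\<Sum>(x,k)\<in>D. Henstock_Kurzweil_Integration.content k *\<^sub>R (f x - s x))"
        by (simp add: sum_subtractf[symmetric] scaleR_diff_right case_prod_unfold)
      also have "\<dots> \<le> (\<Sum>(x,k)\<in>D. Henstock_Kurzweil_Integration.content k *\<^sub>R ?g x)"
        by (rule order_trans[OF norm_sum]) (auto simp: case_prod_unfold intro!: sum_mono)
      finally have 3: "norm ((\<Sum>(x,k)\<in>D. Henstock_Kurzweil_Integration.content k *\<^sub>R f x) - (\<Sum>(x,k)\<in>D. Henstock_Kurzweil_Integration.content k *\<^sub>R s x)) < e/2"
        using 1 Ge unfolding real_norm_def by linarith
      have "(\<Sum>(x,k)\<in>D. Henstock_Kurzweil_Integration.content k *\<^sub>R f x) - x =
         ((\<Sum>(x,k)\<in>D. Henstock_Kurzweil_Integration.content k *\<^sub>R f x) - (\<Sum>(x,k)\<in>D. Henstock_Kurzweil_Integration.content k *\<^sub>R s x))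
         + ((\<Sum>(x,k)\<in>D. Henstock_Kurzweil_Integration.content k *\<^sub>R s x) - ?I) + (?I - x)" by simp
      also have "norm \<dots> \<le> norm ((\<Sum>(x,k)\<in>D. Henstock_Kurzweil_Integration.content k *\<^sub>R f x) - (\<Sum>(x,k)\<in>D. Henstock_Kurzweil_Integration.content k *\<^sub>R s x))
         + norm ((\<Sum>(x,k)\<in>D. Henstock_Kurzweil_Integration.content k *\<^sub>R s x) - ?I) + norm (?I - x)"
        by (intro order_trans[OF norm_triangle_ineq] add_right_mono norm_triangle_ineq order_refl)
      also have "\<dots> < e" using 2 3 s(3) by simp
      finally show "norm ((\<Sum>(x,k)\<in>D. Henstock_Kurzweil_Integration.content k *\<^sub>R f x) - x) < e" .
    qed
  qed
qed

lemma bint_eq_integral: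
  fixes f :: "real \<Rightarrow> 'a::banach"
  assumes "bintegrable {a..b} f"
  shows "f integrable_on {a..b}" "bint {a..b} f = integral {a..b} f"
  using assms has_bint_has_integral bint_eq unfolding bintegrable_def
  by (blast intro: has_integral_integrable, metis integral_unique)

lemma bintegrable_norm_has_integral:
  fixes f :: "real \<Rightarrow> 'a::banach"
  assumes "bintegrable {a..b} f"
  shows "((\<lambda>t. norm (f t)) has_integral integral\<^sup>L (lebesgue_on {a..b}) (\<lambda>t. norm (f t))) {a..b}"
  by (intro has_integral_integral_lebesgue_on bintegrable_norm assms) auto

section \<open>Products with continuous functions, translations, integrals over the line\<close>

lemma bounded_bilinear_scaleC: "bounded_bilinear (scaleC :: complex \<Rightarrow> 'a::complex_banach \<Rightarrow> 'a)"
proof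
  fix a b :: complex and x y :: 'a and r :: real
  show "(a + b) *\<^sub>C x = a *\<^sub>C x + b *\<^sub>C x" by (rule scaleC_add_left)
  show "a *\<^sub>C (x + y) = a *\<^sub>C x + a *\<^sub>C y" by (rule scaleC_add_right)
  show "(r *\<^sub>R a) *\<^sub>C x = r *\<^sub>R (a *\<^sub>C x)"
    by (simp add: scaleC_of_real[of r "a *\<^sub>C x", symmetric] scaleC_scaleC scaleR_conv_of_real)
  show "a *\<^sub>C (r *\<^sub>R x) = r *\<^sub>R (a *\<^sub>C x)"
    by (simp add: scaleC_of_real[of r "a *\<^sub>C x", symmetric] scaleC_of_real[of r x, symmetric] scaleC_scaleC mult.commute)
  show "\<exists>K. \<forall>a x. norm (a *\<^sub>C (x::'a)) \<le> norm a * norm x * K"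
    by (intro exI[of _ 1]) (simp add: norm_scaleC)
qed

interpretation scaleC: bounded_bilinear "scaleC :: complex \<Rightarrow> 'a::complex_banach \<Rightarrow> 'a"
  by (rule bounded_bilinear_scaleC)

lemmas continuous_on_scaleC [continuous_intros] = scaleC.continuous_on

text \<open>Composing any function with this rounding map makes it simple on a bounded interval, as
  only finitely many grid points are hit. Rounding down on a grid that starts at \<open>a\<close>
  keeps the sample points inside \<open>{a..b}\<close>.\<close>

definition grid :: "real \<Rightarrow> nat \<Rightarrow> real \<Rightarrow> real" where
  "grid a n t = a + real_of_int \<lfloor>real (Suc n) * (t - a)\<rfloor> / real (Suc n)"

lemma grid_bounds: fixes a t :: real and n :: nat shows "grid a n t \<le> t" "t < grid a n t + 1 / Suc n"
proof -
  have "real_of_int \<lfloor>real (Suc n) * (t - a)\<rfloor> \<le> real (Suc n) * (t - a)"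
    "real (Suc n) * (t - a) < real_of_int \<lfloor>real (Suc n) * (t - a)\<rfloor> + 1" by linarith+
  then have "real_of_int \<lfloor>real (Suc n) * (t - a)\<rfloor> / Suc n \<le> t - a"
    "t - a < (real_of_int \<lfloor>real (Suc n) * (t - a)\<rfloor> + 1) / Suc n"
    by (simp_all add: divide_simps mult.commute)
  then show "grid a n t \<le> t" "t < grid a n t + 1 / Suc n"
    by (simp_all add: grid_def add_divide_distrib)
qed

lemma grid_ge: "a \<le> t \<Longrightarrow> a \<le> grid a n t"
  by (simp add: grid_def)

lemma grid_simple: "simple_function (lebesgue_on {a..b}) (grid a n)"
proof (rule simple_function_borel_measurable)
  have "grid a n \<in> borel_measurable borel" unfolding grid_def by measurable
  then have "grid a n \<in> borel_measurable lebesgue" by (rule borel_measurable_subalgebra[OF _ _ , rotated 2]) auto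
  then show "grid a n \<in> borel_measurable (lebesgue_on {a..b})"
    by (rule measurable_restrict_space1)
  have "grid a n ` {a..b} \<subseteq> (\<lambda>k::int. a + k / Suc n) ` {0..\<lfloor>real (Suc n) * (b - a)\<rfloor>}"
    unfolding grid_def
    by (auto intro!: imageI floor_mono mult_left_mono)
  from finite_subset[OF this] show "finite (grid a n ` space (lebesgue_on {a..b}))"
    by simp
qed

lemma grid_tendsto: "(\<lambda>n. grid a n t) \<longlonglongrightarrow> t"
proof (rule tendsto_sandwich[OF _ _ _ tendsto_const])
  show "\<forall>\<^sub>F n in sequentially. t - 1 / Suc n \<le> grid a n t"
    by (rule always_eventually) (smt (verit) grid_bounds)
  have "(\<lambda>n. t - 1 / Suc n) \<longlonglongrightarrow> t - 0"
    by (intro tendsto_intros LIMSEQ_Suc[OF lim_1_over_n])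
  then show "(\<lambda>n. t - 1 / Suc n) \<longlonglongrightarrow> t" by simp
qed (simp add: grid_bounds)

text \<open>If \<open>s\<close> approximates \<open>f\<close>, then \<open>s\<close> times
  \<open>g\<close> sampled on a fine grid is simple. The error splits into \<open>g (f - s)\<close>,
  controlled by the bound \<open>B\<close> of \<open>g\<close>, and the sampling error of
  \<open>g\<close> times \<open>s\<close>, controlled by the norm \<open>C\<close> of
  \<open>s\<close>. This explains the two tolerances \<open>e / (2 * B)\<close> and
  \<open>e / (2 * (C + 1))\<close>.\<close>

lemma bintegrable_scaleC:
  fixes f :: "real \<Rightarrow> 'a::complex_banach"
  assumes f: "bintegrable {a..b} f" and g: "continuous_on {a..b} g"
  shows "bintegrable {a..b} (\<lambda>t. g t *\<^sub>C f t)"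
proof (rule bintegrableI)
  let ?M = "lebesgue_on {a..b}"
  from f obtain x where x: "has_bint {a..b} f x" by (auto simp: bintegrable_def)
  have fm: "f \<in> borel_measurable ?M" using x by (simp add: has_bint_def)
  have gs: "simple_function ?M (\<lambda>t. g (grid a n t))" for n
    using simple_function_compose1[OF grid_simple] .
  have gr: "grid a n t \<in> {a..b}" if "t \<in> {a..b}" for n t
    using that grid_bounds[where a=a and n=n and t=t] grid_ge[where a=a and n=n and t=t] by auto
  show "(\<lambda>t. g t *\<^sub>C f t) \<in> borel_measurable ?M"
  proof (rule borel_measurable_LIMSEQ_metric)
    show "(\<lambda>t. g (grid a n t) *\<^sub>C f t) \<in> borel_measurable ?M" for n
    proof (rule simple_measurable_compose[OF gs, where g="\<lambda>y t. y *\<^sub>C f t"])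
      fix y
      have "(\<lambda>z::'a. y *\<^sub>C z) \<in> borel_measurable borel"
        by (intro borel_measurable_continuous_onI continuous_intros)
      from measurable_compose[OF fm this] show "(\<lambda>t. y *\<^sub>C f t) \<in> borel_measurable ?M" .
    qed
    fix t assume "t \<in> space ?M"
    then have t: "t \<in> {a..b}" by simp
    have "(\<lambda>n. g (grid a n t)) \<longlonglongrightarrow> g t"
      using g t gr by (auto intro!: continuous_on_tendsto_compose[OF g grid_tendsto] always_eventually)
    then show "(\<lambda>n. g (grid a n t) *\<^sub>C f t) \<longlonglongrightarrow> g t *\<^sub>C f t"
      by (intro scaleC.tendsto tendsto_const)
  qed
  fix e :: real assume e: "e > 0"
  have "bounded (g ` {a..b})" using g compact_Icc compact_continuous_image compact_imp_bounded by blast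
  then obtain B where B: "B > 0" "\<And>t. t \<in> {a..b} \<Longrightarrow> norm (g t) \<le> B"
    by (auto simp: bounded_pos)
  have "e / (2 * B) > 0" using e B by simp
  then obtain s where s: "simple_integrable ?M s"
    "(\<integral>\<^sup>+t. norm (f t - s t) \<partial>?M) < ennreal (e / (2 * B))"
    using has_bint_approx[OF x] by metis
  obtain C where C: "C \<ge> 0" "(\<integral>\<^sup>+t. norm (s t) \<partial>?M) = ennreal C"
    using simple_nn_integral_norm[OF s(1)] by (metis ennreal_cases infinity_ennreal_def less_irrefl)
  define d where "d = e / (2 * (C + 1))"
  have d: "d > 0" using e C by (simp add: d_def)
  have "uniformly_continuous_on {a..b} g"
    using g compact_uniformly_continuous by blast
  then obtain r where r: "r > 0" "\<And>t u. t \<in> {a..b} \<Longrightarrow> u \<in> {a..b} \<Longrightarrow> dist u t < r \<Longrightarrow> dist (g u) (g t) < d"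
    unfolding uniformly_continuous_on_def using d by metis
  obtain n where n: "inverse (real (Suc n)) < r" using reals_Archimedean[OF r(1)] by auto
  have gd: "norm (g t - g (grid a n t)) \<le> d" if t: "t \<in> {a..b}" for t
  proof -
    have "dist (grid a n t) t < r"
      using grid_bounds[where a=a and n=n and t=t] n by (simp add: dist_real_def inverse_eq_divide)
    from r(2)[OF t gr[OF t] this] show ?thesis by (simp add: dist_norm norm_minus_commute)
  qed
  have gsb: "simple_integrable ?M (\<lambda>t. g (grid a n t))"
  proof (rule Bochner_Integration.simple_bochner_integrable.intros[OF gs])
    have "emeasure ?M {y \<in> space ?M. g (grid a n y) \<noteq> 0} \<le> emeasure ?M (space ?M)"
      by (rule emeasure_space)
    also have "\<dots> < \<infinity>" by (simp add: emeasure_restrict_space emeasure_lborel_Icc_eq)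
    finally show "emeasure ?M {y \<in> space ?M. g (grid a n y) \<noteq> 0} \<noteq> \<infinity>" by simp
  qed
  have "simple_integrable ?M (\<lambda>t. g (grid a n t) *\<^sub>C s t)"
    by (rule simple_bochner_integrable_compose2[OF _ gsb s(1)]) (simp add: scaleC.zero_left)
  moreover have "(\<integral>\<^sup>+t. norm (g t *\<^sub>C f t - g (grid a n t) *\<^sub>C s t) \<partial>?M) < ennreal e"
  proof -
    have m1: "(\<lambda>x. norm (f x - s x)) \<in> borel_measurable ?M"
      using norm_diff_simple_measurable[OF fm simple_simple[OF s(1)]] .
    have "(\<lambda>x. norm (0 - s x)) \<in> borel_measurable ?M"
      using norm_diff_simple_measurable[OF _ simple_simple[OF s(1)], of "\<lambda>x. 0"] by simp
    then have m2: "(\<lambda>x. norm (s x)) \<in> borel_measurable ?M" by simp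
    have "(\<integral>\<^sup>+t. norm (g t *\<^sub>C f t - g (grid a n t) *\<^sub>C s t) \<partial>?M) \<le>
        (\<integral>\<^sup>+t. ennreal B * ennreal (norm (f t - s t)) + ennreal d * ennreal (norm (s t)) \<partial>?M)"
    proof (rule nn_integral_mono)
      fix t assume "t \<in> space ?M"
      then have t: "t \<in> {a..b}" by simp
      have "g t *\<^sub>C f t - g (grid a n t) *\<^sub>C s t = g t *\<^sub>C (f t - s t) + (g t - g (grid a n t)) *\<^sub>C s t"
        by (simp add: scaleC.diff_left scaleC.diff_right)
      also have "norm \<dots> \<le> B * norm (f t - s t) + d * norm (s t)"
        by (intro norm_triangle_le add_mono) (auto simp: norm_scaleC intro!: mult_right_mono B(2)[OF t] gd[OF t])
      finally show "ennreal (norm (g t *\<^sub>C f t - g (grid a n t) *\<^sub>C s t)) \<le>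
         ennreal B * ennreal (norm (f t - s t)) + ennreal d * ennreal (norm (s t))"
        using B(1) d by (simp add: ennreal_mult[symmetric] ennreal_plus[symmetric] del: ennreal_plus)
    qed
    also have "\<dots> = ennreal B * (\<integral>\<^sup>+t. norm (f t - s t) \<partial>?M) + ennreal d * (\<integral>\<^sup>+t. norm (s t) \<partial>?M)"
      using m1 m2 by (simp add: nn_integral_add nn_integral_cmult)
    also have "\<dots> \<le> ennreal B * ennreal (e / (2 * B)) + ennreal d * ennreal C"
      using s(2) C by (intro add_mono mult_left_mono) auto
    also have "\<dots> = ennreal (e / 2 + d * C)"
      using B(1) d C e by (simp add: ennreal_mult[symmetric] ennreal_plus[symmetric] del: ennreal_plus)
    also have "\<dots> < ennreal e"
    proof (rule ennreal_lessI[OF e])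
      have "d * C < d * (C + 1)" using d by simp
      also have "\<dots> = e / 2" using C by (simp add: d_def divide_simps)
      finally show "e / 2 + d * C < e" by simp
    qed
    finally show ?thesis .
  qed
  ultimately show "\<exists>s. simple_integrable ?M s \<and>
        (\<integral>\<^sup>+t. norm (g t *\<^sub>C f t - s t) \<partial>?M) < ennreal e" by blast
qed

lemma nn_integral_lebesgue_on_shift:
  fixes u :: "real \<Rightarrow> ennreal"
  assumes u: "u \<in> borel_measurable (lebesgue_on {t..t+h})"
  shows "(\<integral>\<^sup>+s. u (t + s) \<partial>lebesgue_on {0..h}) = (\<integral>\<^sup>+s. u s \<partial>lebesgue_on {t..t+h})"
proof -
  have m: "(\<lambda>x. u x * indicator {t..t+h} x) \<in> borel_measurable lebesgue"
    using u borel_measurable_restrict_space_iff_ennreal[of "{t..t+h}" lebesgue u]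
    by (simp add: mult.commute)
  have "(\<integral>\<^sup>+s. u s \<partial>lebesgue_on {t..t+h}) = (\<integral>\<^sup>+s. u s * indicator {t..t+h} s \<partial>lebesgue)"
    by (subst nn_integral_restrict_space) auto
  also have "\<dots> = (\<integral>\<^sup>+s. u (t + s) * indicator {t..t+h} (t + s) \<partial>lebesgue)"
    using nn_integral_real_affine_lebesgue[OF m, of 1 t] by simp
  also have "\<dots> = (\<integral>\<^sup>+s. u (t + s) * indicator {0..h} s \<partial>lebesgue)"
    by (rule nn_integral_cong) (auto simp: indicator_def)
  also have "\<dots> = (\<integral>\<^sup>+s. u (t + s) \<partial>lebesgue_on {0..h})"
    by (subst nn_integral_restrict_space) auto
  finally show ?thesis by simp
qed

lemma measurable_lebesgue_on_shift:
  "(\<lambda>s. t + s) \<in> measurable (lebesgue_on {0..h}) (lebesgue_on {t..t+h::real})"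
proof (rule measurable_restrict_space3)
  show "(\<lambda>s. t + s) \<in> measurable lebesgue lebesgue"
    using lebesgue_affine_measurable[of "\<lambda>_. 1" t] by simp
qed auto

lemma bintegrable_shift:
  fixes f :: "real \<Rightarrow> 'a::banach"
  assumes "bintegrable {t..t+h} f"
  shows "bintegrable {0..h} (\<lambda>s. f (t + s))"
proof (rule bintegrableI)
  from assms obtain x where x: "has_bint {t..t+h} f x" by (auto simp: bintegrable_def)
  have f: "f \<in> borel_measurable (lebesgue_on {t..t+h})" using x by (simp add: has_bint_def)
  show "(\<lambda>s. f (t + s)) \<in> borel_measurable (lebesgue_on {0..h})"
    using measurable_compose[OF measurable_lebesgue_on_shift f] .
  fix e :: real assume "e > 0"
  then obtain s where s: "simple_integrable (lebesgue_on {t..t+h}) s"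
    "(\<integral>\<^sup>+t. norm (f t - s t) \<partial>lebesgue_on {t..t+h}) < ennreal e"
    using has_bint_approx[OF x] by metis
  have sf: "simple_function (lebesgue_on {0..h}) (\<lambda>u. s (t + u))"
    using simple_function_comp[OF measurable_lebesgue_on_shift simple_simple[OF s(1)]] by (simp add: comp_def)
  have "norm \<in> borel_measurable (borel :: 'a measure)"
    by (intro borel_measurable_continuous_onI continuous_intros)
  from measurable_compose[OF borel_measurable_simple_function[OF simple_simple[OF s(1)]] this]
  have sm: "(\<lambda>u. ennreal (norm (s u))) \<in> borel_measurable (lebesgue_on {t..t+h})" by measurable
  have 1: "simple_integrable (lebesgue_on {0..h}) (\<lambda>u. s (t + u))"
  proof (rule simple_bochner_integrableI_bounded[OF sf])
    show "(\<integral>\<^sup>+u. norm (s (t + u)) \<partial>lebesgue_on {0..h}) < \<infinity>"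
      using nn_integral_lebesgue_on_shift[OF sm] simple_nn_integral_norm[OF s(1)] by simp
  qed
  have m: "(\<lambda>u. ennreal (norm (f u - s u))) \<in> borel_measurable (lebesgue_on {t..t+h})"
    using norm_diff_simple_measurable[OF f simple_simple[OF s(1)]] by measurable
  have "(\<integral>\<^sup>+u. norm (f (t + u) - s (t + u)) \<partial>lebesgue_on {0..h}) < ennreal e"
    using nn_integral_lebesgue_on_shift[OF m] s(2) by simp
  with 1 show "\<exists>s. simple_integrable (lebesgue_on {0..h}) s \<and>
        (\<integral>\<^sup>+u. norm (f (t + u) - s u) \<partial>lebesgue_on {0..h}) < ennreal e" by blast
qed

lemma integral_shift_Icc:
  fixes f :: "real \<Rightarrow> 'a::banach"
  shows "integral {0..h} (\<lambda>s. f (t + s)) = integral {t..t+h} f"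
  using integral_shift_Icc_real[where f=f and c=t and a=0 and b=h] by (simp add: add.commute comp_def)

lemma bint_shift:
  fixes f :: "real \<Rightarrow> 'a::banach"
  assumes "bintegrable {t..t+h} f"
  shows "bint {0..h} (\<lambda>s. f (t + s)) = integral {t..t+h} f"
  using bint_eq_integral(2)[OF bintegrable_shift[OF assms]] integral_shift_Icc[of h f t] by simp

text \<open>The definition of \<open>DL1_extension\<close> integrates over the whole line, while all
  computations use gauge integrals over intervals. For functions that vanish outside the interval
  the two agree, since the approximating simple functions can be continued by zero.\<close>

lemma bint_UNIV:
  fixes f :: "real \<Rightarrow> 'a::banach"
  assumes f: "bintegrable {a..b} f" and z: "\<And>t. t \<notin> {a..b} \<Longrightarrow> f t = 0"
  shows "bint UNIV f = integral {a..b} f"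
proof -
  let ?M = "lebesgue_on {a..b}"
  from f obtain x where x: "has_bint {a..b} f x" by (auto simp: bintegrable_def)
  then obtain s where fm: "f \<in> borel_measurable ?M"
    and s: "\<And>i. simple_integrable ?M (s i)"
      "(\<lambda>i. \<integral>\<^sup>+t. norm (f t - s i t) \<partial>?M) \<longlonglongrightarrow> 0"
      "(\<lambda>i. simple_integral ?M (s i)) \<longlonglongrightarrow> x"
    unfolding has_bint_def by auto
  define r where "r i t = (indicator {a..b} t :: real) *\<^sub>R s i t" for i t
  have "has_bint UNIV f x"
    unfolding has_bint_def
  proof (intro conjI exI[of _ r] allI)
    have "(\<lambda>t. if t \<in> {a..b} then f t else 0) \<in> borel_measurable lebesgue"
      using fm by (subst measurable_If_restrict_space_iff) (auto simp: atLeastAtMost_def atLeast_def atMost_def Collect_conj_eq)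
    moreover have "(\<lambda>t. if t \<in> {a..b} then f t else 0) = f" using z by auto
    ultimately show "f \<in> borel_measurable (lebesgue_on UNIV)" by (simp add: lebesgue_on_UNIV_eq)
    show "simple_integrable (lebesgue_on UNIV) (r i)" for i
      using simple_bochner_integrable_restrict_space[of "{a..b}" lebesgue "s i"] s(1)[of i]
      by (simp add: r_def[abs_def] lebesgue_on_UNIV_eq)
    have "simple_integral (lebesgue_on UNIV) (r i) =
          simple_integral ?M (s i)" for i
      using simple_bochner_integral_restrict_space[of "{a..b}" lebesgue "s i"] s(1)[of i]
      by (simp add: r_def[abs_def] lebesgue_on_UNIV_eq)
    then show "(\<lambda>i. simple_integral (lebesgue_on UNIV) (r i)) \<longlonglongrightarrow> x"
      using s(3) by simp
    have "(\<integral>\<^sup>+t. norm (f t - r i t) \<partial>lebesgue_on UNIV) = (\<integral>\<^sup>+t. norm (f t - s i t) \<partial>?M)" for i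
      unfolding lebesgue_on_UNIV_eq
      by (subst nn_integral_restrict_space) (auto simp: r_def z indicator_def intro!: nn_integral_cong)
    then show "(\<lambda>i. \<integral>\<^sup>+t. norm (f t - r i t) \<partial>lebesgue_on UNIV) \<longlonglongrightarrow> 0"
      using s(2) by simp
  qed
  then show ?thesis using bint_eq has_bint_has_integral[OF x] integral_unique by metis
qed

section \<open>Window integrals\<close>

text \<open>Uniform continuity makes the samples on a fine grid uniformly close, and on a bounded
  interval this implies closeness in mean.\<close>

lemma bintegrable_continuous:
  fixes f :: "real \<Rightarrow> 'a::banach"
  assumes f: "continuous_on {a..b} f"
  shows "bintegrable {a..b} f"
proof (rule bintegrableI)
  let ?M = "lebesgue_on {a..b}"
  show fm: "f \<in> borel_measurable ?M"
    using f by (rule continuous_imp_measurable_on_sets_lebesgue) auto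
  fix e :: real assume e: "e > 0"
  have gr: "grid a n t \<in> {a..b}" if "t \<in> {a..b}" for n t
    using that grid_bounds[where a=a and n=n and t=t] grid_ge[where a=a and n=n and t=t] by auto
  define d where "d = e / (2 * (\<bar>b - a\<bar> + 1))"
  have d: "d > 0" unfolding d_def by (intro divide_pos_pos e) (simp add: add_nonneg_pos)
  have "uniformly_continuous_on {a..b} f"
    using f compact_uniformly_continuous by blast
  then obtain r where r: "r > 0" "\<And>t u. t \<in> {a..b} \<Longrightarrow> u \<in> {a..b} \<Longrightarrow> dist u t < r \<Longrightarrow> dist (f u) (f t) < d"
    unfolding uniformly_continuous_on_def using d by metis
  obtain n where n: "inverse (real (Suc n)) < r" using reals_Archimedean[OF r(1)] by auto
  have gd: "norm (f t - f (grid a n t)) \<le> d" if t: "t \<in> {a..b}" for t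
  proof -
    have "dist (grid a n t) t < r"
      using grid_bounds[where a=a and n=n and t=t] n by (simp add: dist_real_def inverse_eq_divide)
    from r(2)[OF t gr[OF t] this] show ?thesis by (simp add: dist_norm norm_minus_commute)
  qed
  have "simple_integrable ?M (\<lambda>t. f (grid a n t))"
  proof (rule Bochner_Integration.simple_bochner_integrable.intros)
    show "simple_function ?M (\<lambda>t. f (grid a n t))"
      using simple_function_compose1[OF grid_simple] .
    have "emeasure ?M {y \<in> space ?M. f (grid a n y) \<noteq> 0} \<le> emeasure ?M (space ?M)"
      by (rule emeasure_space)
    also have "\<dots> < \<infinity>" by (simp add: emeasure_restrict_space emeasure_lborel_Icc_eq)
    finally show "emeasure ?M {y \<in> space ?M. f (grid a n y) \<noteq> 0} \<noteq> \<infinity>" by simp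
  qed
  moreover have "(\<integral>\<^sup>+t. norm (f t - f (grid a n t)) \<partial>?M) < ennreal e"
  proof -
    have "(\<integral>\<^sup>+t. norm (f t - f (grid a n t)) \<partial>?M) \<le> (\<integral>\<^sup>+t. ennreal d \<partial>?M)"
      using gd d by (intro nn_integral_mono) (auto intro!: ennreal_leI)
    also have "\<dots> \<le> ennreal (d * \<bar>b - a\<bar>)"
      using d by (auto simp: emeasure_restrict_space emeasure_lborel_Icc_eq ennreal_mult[symmetric])
    also have "\<dots> < ennreal e"
    proof (rule ennreal_lessI[OF e])
      have "d * \<bar>b - a\<bar> < d * (2 * (\<bar>b - a\<bar> + 1))" using d by (intro mult_strict_left_mono) auto
      moreover have "0 < 2 * (\<bar>b - a\<bar> + 1)" by (simp add: add_nonneg_pos)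
      then have "d * (2 * (\<bar>b - a\<bar> + 1)) = e" unfolding d_def by (metis less_irrefl nonzero_eq_divide_eq)
      ultimately show "d * \<bar>b - a\<bar> < e" by linarith
    qed
    finally show ?thesis .
  qed
  ultimately show "\<exists>s. simple_integrable ?M s \<and>
        (\<integral>\<^sup>+t. norm (f t - s t) \<partial>?M) < ennreal e" by blast
qed

definition loc_int :: "(real \<Rightarrow> 'a::banach) \<Rightarrow> bool" where
  "loc_int f \<longleftrightarrow> (\<forall>a b. bintegrable {a..b} f)"

text \<open>\<open>window h f\<close> is \<open>h M\<^sub>h f\<close>; dropping the factor makes it additive in \<open>h\<close> up to translation.\<close>

definition window :: "real \<Rightarrow> (real \<Rightarrow> 'a::banach) \<Rightarrow> real \<Rightarrow> 'a" where
  "window h f t = integral {t..t+h} f"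

text \<open>The antiderivative based at 0, with the sign that makes it additive to the left of 0 as
  well. Every window is then an increment of one continuous function, so identities between windows
  become algebra.\<close>

definition primitive :: "(real \<Rightarrow> 'a::banach) \<Rightarrow> real \<Rightarrow> 'a" where
  "primitive f s = (if 0 \<le> s then integral {0..s} f else - integral {s..0} f)"

lemma loc_int_continuous: "continuous_on UNIV f \<Longrightarrow> loc_int f"
  unfolding loc_int_def using bintegrable_continuous continuous_on_subset by blast

lemma loc_int_scaleC:
  fixes f :: "real \<Rightarrow> 'a::complex_banach"
  shows "loc_int f \<Longrightarrow> continuous_on UNIV g \<Longrightarrow> loc_int (\<lambda>t. g t *\<^sub>C f t)"
  unfolding loc_int_def using bintegrable_scaleC continuous_on_subset by blast

lemma loc_int_integrable: "loc_int f \<Longrightarrow> f integrable_on {a..b}"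
  unfolding loc_int_def using bint_eq_integral(1) by blast

lemma loc_int_norm_integrable: "loc_int f \<Longrightarrow> (\<lambda>t. norm (f t)) integrable_on {a..b}"
  unfolding loc_int_def using bintegrable_norm_has_integral by blast

lemma loc_int_norm_integral: "loc_int f \<Longrightarrow> norm (integral {a..b} f) \<le> integral {a..b} (\<lambda>t. norm (f t))"
  by (intro integral_norm_bound_integral loc_int_integrable loc_int_norm_integrable) auto

lemma loc_int_combine: "loc_int f \<Longrightarrow> a \<le> c \<Longrightarrow> c \<le> b \<Longrightarrow> integral {a..c} f + integral {c..b} f = integral {a..b} f"
  by (intro Henstock_Kurzweil_Integration.integral_combine loc_int_integrable)

lemma primitive_diff:
  assumes "loc_int f" "s \<le> t"
  shows "primitive f t - primitive f s = integral {s..t} f"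
  using loc_int_combine[OF assms(1), of s 0 t] loc_int_combine[OF assms(1), of 0 s t] loc_int_combine[OF assms(1), of s t 0] assms(2)
  by (auto simp: primitive_def algebra_simps)

lemma window_primitive: "loc_int f \<Longrightarrow> 0 \<le> h \<Longrightarrow> window h f t = primitive f (t + h) - primitive f t"
  by (simp add: window_def primitive_diff)

lemma primitive_continuous:
  assumes "loc_int f"
  shows "continuous_on UNIV (primitive f)"
proof -
  have "isCont (primitive f) x" for x
  proof -
    let ?N = "\<bar>x\<bar> + 1"
    have "continuous_on {-?N..?N} (\<lambda>s. integral {-?N..s} f)"
      by (intro indefinite_integral_continuous_1 loc_int_integrable assms)
    then have "continuous_on {-?N..?N} (\<lambda>s. primitive f (-?N) + integral {-?N..s} f)"
      by (intro continuous_intros)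
    then have "continuous_on {-?N..?N} (primitive f)"
    proof (rule continuous_on_eq)
      fix s assume "s \<in> {-?N..?N}"
      then show "primitive f (-?N) + integral {-?N..s} f = primitive f s"
        using primitive_diff[OF assms, of "-?N" s] by (metis atLeastAtMost_iff add.commute diff_add_cancel)
    qed
    then have "continuous_on {-?N<..<?N} (primitive f)"
      by (rule continuous_on_subset) auto
    then show ?thesis
      using continuous_on_eq_continuous_at[OF open_greaterThanLessThan, of "-?N" ?N "primitive f"]
      by (metis abs_ge_self abs_ge_minus_self add_strict_increasing2 greaterThanLessThan_iff minus_less_iff less_add_one le_less_trans)
  qed
  then show ?thesis by (simp add: continuous_on_eq_continuous_at)
qed

lemma continuous_primitive_compose [continuous_intros]:
  "loc_int f \<Longrightarrow> continuous_on S g \<Longrightarrow> continuous_on S (\<lambda>x. primitive f (g x))"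
  using continuous_on_compose2[OF primitive_continuous] by blast

lemma window_continuous: "loc_int f \<Longrightarrow> 0 \<le> h \<Longrightarrow> continuous_on UNIV (window h f)"
  by (rule continuous_on_eq[of _ "\<lambda>t. primitive f (t + h) - primitive f t"])
    (auto intro!: continuous_intros simp: window_primitive)

lemma window_loc_int: "loc_int f \<Longrightarrow> 0 \<le> h \<Longrightarrow> loc_int (window h f)"
  by (rule loc_int_continuous) (rule window_continuous)

lemma window_0: "window 0 f t = 0" by (simp add: window_def)

lemma window_diff: "loc_int f \<Longrightarrow> loc_int g \<Longrightarrow> window h (\<lambda>t. f t - g t) = (\<lambda>t. window h f t - window h g t)"
  by (auto simp: window_def fun_eq_iff intro!: Henstock_Kurzweil_Integration.integral_diff loc_int_integrable)

lemma integral_scaleC_right: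
  fixes f :: "real \<Rightarrow> 'a::complex_banach"
  assumes "f integrable_on S"
  shows "integral S (\<lambda>t. c *\<^sub>C f t) = c *\<^sub>C integral S f"
  using integral_linear[OF assms scaleC.bounded_linear_right, of c] by (simp add: comp_def)

lemma window_scaleC:
  fixes f :: "real \<Rightarrow> 'a::complex_banach"
  assumes "loc_int f"
  shows "window h (\<lambda>t. c *\<^sub>C f t) = (\<lambda>t. c *\<^sub>C window h f t)"
proof
  show "window h (\<lambda>t. c *\<^sub>C f t) t = c *\<^sub>C window h f t" for t
    unfolding window_def by (rule integral_scaleC_right[OF loc_int_integrable[OF assms]])
qed

lemma window_scaleR: "window h (\<lambda>t. c *\<^sub>R f t) = (\<lambda>t. c *\<^sub>R window h f t)"
  by (simp add: window_def fun_eq_iff)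

lemma window_translate: "window h (\<lambda>t. f (t + a)) t = window h f (t + a)"
  using integral_shift_Icc_real[where f=f and c=a and a=t and b="t+h"]
  by (simp add: window_def comp_def add.commute add.left_commute)

lemma window_split: "loc_int f \<Longrightarrow> 0 \<le> u \<Longrightarrow> 0 \<le> v \<Longrightarrow> window (u + v) f t = window u f t + window v f (t + u)"
  by (simp add: window_primitive algebra_simps)

lemma window_window:
  assumes "loc_int f" "0 \<le> s" "0 \<le> u"
  shows "window s (window u f) t = window s (primitive f) (t + u) - window s (primitive f) t"
proof -
  have "loc_int (\<lambda>v. primitive f (v + u))" "loc_int (primitive f)"
    by (intro loc_int_continuous continuous_intros primitive_continuous assms)+
  then have "window s (\<lambda>v. primitive f (v + u) - primitive f v) t = window s (\<lambda>v. primitive f (v + u)) t - window s (primitive f) t"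
    by (simp add: window_diff)
  moreover have "window u f = (\<lambda>v. primitive f (v + u) - primitive f v)" using assms by (auto simp: window_primitive)
  ultimately show ?thesis by (simp add: window_translate)
qed

text \<open>Both sides are the same mixed second difference of an antiderivative of
  \<open>primitive f\<close>, an expression symmetric in \<open>s\<close> and
  \<open>u\<close>.\<close>

lemma window_commute:
  assumes "loc_int f" "0 \<le> s" "0 \<le> u"
  shows "window s (window u f) = window u (window s f)"
proof
  fix t
  have "loc_int (primitive f)" by (intro loc_int_continuous primitive_continuous assms)
  then show "window s (window u f) t = window u (window s f) t"
    using assms by (simp add: window_window window_primitive algebra_simps)
qed

text \<open>\<open>Q\<close> has vanishing derivative in the mean: subdivide \<open>[a, b]\<close> into equal parts.\<close>

lemma eq_if_small_increments:
  fixes Q :: "real \<Rightarrow> 'a::real_normed_vector" and W :: "real \<Rightarrow> real"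
  assumes "a \<le> b"
    and inc: "\<And>s t. a \<le> s \<Longrightarrow> s \<le> t \<Longrightarrow> t \<le> b \<Longrightarrow> norm (Q t - Q s) \<le> K * (t - s) * (W t - W s)"
  shows "Q b = Q a"
proof -
  have bnd: "norm (Q b - Q a) \<le> (K * (b - a) * (W b - W a)) / real (Suc n)" for n
  proof -
    define \<delta> where "\<delta> = (b - a) / real (Suc n)"
    have \<delta>: "real (Suc n) * \<delta> = b - a" by (simp add: \<delta>_def)
    define p where "p i = a + real i * \<delta>" for i
    have p0: "p 0 = a" and pn: "p (Suc n) = b" using \<delta> by (simp_all add: p_def del: of_nat_Suc)
    have pd: "p (Suc i) - p i = \<delta>" for i by (simp add: p_def algebra_simps)
    have pm: "p i \<le> p (Suc i)" for i using pd[of i] assms(1) by (smt (verit) \<delta>_def divide_nonneg_nonneg of_nat_0_le_iff)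
    have pa: "a \<le> p i" for i using assms(1) by (simp add: p_def \<delta>_def)
    have "mono p" using pm by (simp add: mono_iff_le_Suc)
    then have pb: "p i \<le> b" if "i \<le> Suc n" for i using that pn by (metis monoD)
    \<comment> \<open>Every part contributes a factor \<open>\<delta>\<close>, and the increments of
      \<open>W\<close> telescope, so the sum is of order \<open>1 / n\<close>.\<close>
    have "Q b - Q a = (\<Sum>i<Suc n. Q (p (Suc i)) - Q (p i))"
      using sum_lessThan_telescope[of "\<lambda>i. Q (p i)" "Suc n"] by (simp only: p0 pn)
    also have "norm \<dots> \<le> (\<Sum>i<Suc n. (K * \<delta>) * (W (p (Suc i)) - W (p i)))"
    proof (rule sum_norm_le)
      fix i assume "i \<in> {..<Suc n}"
      then show "norm (Q (p (Suc i)) - Q (p i)) \<le> (K * \<delta>) * (W (p (Suc i)) - W (p i))"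
        using inc[OF pa[of i] pm[of i] pb[of "Suc i"]] by (simp only: pd) auto
    qed
    also have "\<dots> = (K * \<delta>) * (W b - W a)"
      unfolding sum_distrib_left[symmetric]
      using sum_lessThan_telescope[of "\<lambda>i. W (p i)" "Suc n"] by (simp only: p0 pn)
    finally show ?thesis by (simp add: \<delta>_def)
  qed
  have "(\<lambda>n. (K * (b - a) * (W b - W a)) / real (Suc n)) \<longlonglongrightarrow> 0"
    by (intro LIMSEQ_Suc lim_const_over_n)
  then have "norm (Q b - Q a) \<le> 0"
    using LIMSEQ_le_const[of _ 0 "norm (Q b - Q a)"] bnd by blast
  then show ?thesis by simp
qed

text \<open>As \<open>f\<close> is merely locally integrable, its antiderivative \<open>F\<close>
  may fail to be differentiable at given points, so the product rule is replaced by an increment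
  estimate. With \<open>W\<close> the integral of the norm of \<open>f\<close>, the defect
  \<open>Q\<close> of the formula has increments of size
  \<open>2 * M * (t - s) * (W t - W s)\<close> and is therefore constant.\<close>

lemma integral_by_parts_loc_int:
  fixes f :: "real \<Rightarrow> 'a::complex_banach"
  assumes f: "loc_int f" and ab: "a \<le> b"
    and d: "\<And>t. (k has_vector_derivative k' t) (at t)" and c: "continuous_on UNIV k'"
  shows "integral {a..b} (\<lambda>t. k t *\<^sub>C f t) =
     k b *\<^sub>C integral {a..b} f - integral {a..b} (\<lambda>t. k' t *\<^sub>C integral {a..t} f)"
proof -
  define F where "F t = integral {a..t} f" for t
  have Fp: "F t = primitive f t - primitive f a" if "a \<le> t" for t using primitive_diff[OF f that] by (simp add: F_def)
  have Fc: "continuous_on {a..b} F"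
    unfolding F_def by (intro indefinite_integral_continuous_1 loc_int_integrable f)
  have kc: "continuous_on UNIV k"
    by (simp add: continuous_on_eq_continuous_at differentiable_imp_continuous_within differentiableI_vector[OF d])
  have kf: "loc_int (\<lambda>t. k t *\<^sub>C f t)" by (intro loc_int_scaleC f kc)
  have k'F: "(\<lambda>t. k' t *\<^sub>C F t) integrable_on {s..t}" if "a \<le> s" "t \<le> b" for s t
    using that by (intro integrable_continuous_real continuous_intros continuous_on_subset[OF c] continuous_on_subset[OF Fc]) auto
  have "bounded (k' ` {a..b})"
    using c by (meson compact_Icc compact_continuous_image compact_imp_bounded continuous_on_subset top_greatest)
  then obtain M where M: "M > 0" "\<And>t. t \<in> {a..b} \<Longrightarrow> norm (k' t) \<le> M" by (auto simp: bounded_pos)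
  define W where "W t = integral {a..t} (\<lambda>t. norm (f t))" for t
  define Q where "Q t = integral {a..t} (\<lambda>t. k t *\<^sub>C f t) + integral {a..t} (\<lambda>t. k' t *\<^sub>C F t) - k t *\<^sub>C F t" for t
  have "Q b = Q a"
  proof (rule eq_if_small_increments[OF ab, where W=W and K="2*M"])
    fix s t assume st: "a \<le> s" "s \<le> t" "t \<le> b"
    have Wd: "W t' - W s = integral {s..t'} (\<lambda>t. norm (f t))" if "s \<le> t'" for t'
      using Henstock_Kurzweil_Integration.integral_combine[of a s t' "\<lambda>t. norm (f t)"] st that loc_int_norm_integrable[OF f] unfolding W_def by simp
    have Fd: "F u - F s = integral {s..u} f" if "s \<le> u" for u
      using primitive_diff[OF f that] st that by (simp add: Fp)
    have Fb: "norm (F u - F s) \<le> W t - W s" if "s \<le> u" "u \<le> t" for u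
    proof -
      have "norm (F u - F s) \<le> integral {s..u} (\<lambda>t. norm (f t))"
        using Fd that loc_int_norm_integral[OF f] by simp
      also have "\<dots> \<le> integral {s..t} (\<lambda>t. norm (f t))"
        using that by (intro integral_subset_le loc_int_norm_integrable f) auto
      finally show ?thesis using Wd st by simp
    qed
    have kd: "norm (k u - k v) \<le> M * \<bar>u - v\<bar>" if "u \<in> {s..t}" "v \<in> {s..t}" for u v
    proof -
      have "norm (k u - k v) \<le> M * norm (u - v)"
      proof (rule differentiable_bound[of "{s..t}" k "\<lambda>t x. x *\<^sub>R k' t" M])
        fix x assume "x \<in> {s..t}"
        then show "(k has_derivative (\<lambda>y. y *\<^sub>R k' x)) (at x within {s..t})"
          using d[of x] by (auto simp: has_vector_derivative_def intro: has_derivative_at_withinI)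
        show "onorm (\<lambda>y. y *\<^sub>R k' x) \<le> M"
        proof (rule onorm_le)
          fix y :: real
          show "norm (y *\<^sub>R k' x) \<le> M * norm y"
            using mult_right_mono[OF M(2)[of x], of "norm y"] \<open>x \<in> {s..t}\<close> st by (simp add: mult.commute)
        qed
      qed (use that in auto)
      then show ?thesis by simp
    qed
    have e1: "integral {a..t} (\<lambda>t. k t *\<^sub>C f t) - integral {a..s} (\<lambda>t. k t *\<^sub>C f t) = integral {s..t} (\<lambda>t. k t *\<^sub>C f t)"
      using loc_int_combine[OF kf st(1,2)] by (metis add_diff_cancel_left')
    have e2: "integral {a..t} (\<lambda>t. k' t *\<^sub>C F t) - integral {a..s} (\<lambda>t. k' t *\<^sub>C F t) = integral {s..t} (\<lambda>t. k' t *\<^sub>C F t)"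
      using Henstock_Kurzweil_Integration.integral_combine[OF st(1,2) k'F] st by (metis add_diff_cancel_left' order_refl)
    have kder: "(k' has_integral (k t - k s)) {s..t}"
      using st d by (intro fundamental_theorem_of_calculus) (auto intro: has_vector_derivative_at_within)
    have e3: "integral {s..t} (\<lambda>u. k' u *\<^sub>C F s) = (k t - k s) *\<^sub>C F s"
      using has_integral_linear[OF kder scaleC.bounded_linear_left, of "F s"]
      by (simp add: comp_def integral_unique)
    have i1: "integral {s..t} (\<lambda>u. (k u - k t) *\<^sub>C f u) = integral {s..t} (\<lambda>t. k t *\<^sub>C f t) - k t *\<^sub>C (F t - F s)"
      using st loc_int_integrable[OF kf] loc_int_integrable[OF f]
      by (simp add: scaleC.diff_left Henstock_Kurzweil_Integration.integral_diff loc_int_integrable[OF loc_int_scaleC[OF f continuous_on_const]]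
          integral_scaleC_right Fd)
    have i2: "integral {s..t} (\<lambda>u. k' u *\<^sub>C (F u - F s)) = integral {s..t} (\<lambda>t. k' t *\<^sub>C F t) - (k t - k s) *\<^sub>C F s"
      using st k'F has_integral_linear[OF kder scaleC.bounded_linear_left, of "F s"]
      by (simp add: scaleC.diff_right Henstock_Kurzweil_Integration.integral_diff e3 comp_def has_integral_integrable)
    \<comment> \<open>What is left are two deviations over the short interval:
      \<open>k u - k t\<close>, at most \<open>M * (t - s)\<close>, integrated against
      \<open>f\<close>, and \<open>F u - F s\<close>, at most \<open>W t - W s\<close>, integrated
      against \<open>k'\<close>. Each product is small of second order.\<close>
    have "Q t - Q s = integral {s..t} (\<lambda>u. (k u - k t) *\<^sub>C f u) + integral {s..t} (\<lambda>u. k' u *\<^sub>C (F u - F s))"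
      unfolding i1 i2 Q_def e1[symmetric] e2[symmetric] by (simp add: scaleC.diff_left scaleC.diff_right)
    also have "norm \<dots> \<le> M * (t - s) * (W t - W s) + M * (t - s) * (W t - W s)"
    proof (rule norm_triangle_le[OF add_mono])
      have "norm (integral {s..t} (\<lambda>u. (k u - k t) *\<^sub>C f u)) \<le> integral {s..t} (\<lambda>u. (M * (t - s)) * norm (f u))"
      proof (rule integral_norm_bound_integral)
        show "(\<lambda>u. (k u - k t) *\<^sub>C f u) integrable_on {s..t}"
          by (intro loc_int_integrable loc_int_scaleC f continuous_intros kc)
        show "(\<lambda>u. (M * (t - s)) * norm (f u)) integrable_on {s..t}"
          using integrable_on_cmult_left[OF loc_int_norm_integrable[OF f], of "M * (t - s)"] by simp
        fix u assume u: "u \<in> {s..t}"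
        have "norm (k u - k t) \<le> M * (t - s)"
          using order_trans[OF kd[OF u, of t] mult_left_mono[of "\<bar>u - t\<bar>" "t - s" M]] u st M(1) by simp
        then show "norm ((k u - k t) *\<^sub>C f u) \<le> M * (t - s) * norm (f u)"
          by (simp add: norm_scaleC mult_right_mono)
      qed
      also have "\<dots> = M * (t - s) * (W t - W s)" using Wd st by simp
      finally show "norm (integral {s..t} (\<lambda>u. (k u - k t) *\<^sub>C f u)) \<le> M * (t - s) * (W t - W s)" .
      have "norm (integral {s..t} (\<lambda>u. k' u *\<^sub>C (F u - F s))) \<le> integral {s..t} (\<lambda>u. M * (W t - W s))"
      proof (rule integral_norm_bound_integral)
        show "(\<lambda>u. k' u *\<^sub>C (F u - F s)) integrable_on {s..t}"
          using st by (intro integrable_continuous_real continuous_intros continuous_on_subset[OF c] continuous_on_subset[OF Fc]) auto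
        fix u assume u: "u \<in> {s..t}"
        then show "norm (k' u *\<^sub>C (F u - F s)) \<le> M * (W t - W s)"
          using st M(1) unfolding norm_scaleC by (intro mult_mono M(2) Fb) auto
      qed auto
      also have "\<dots> = M * (t - s) * (W t - W s)" using st by simp
      finally show "norm (integral {s..t} (\<lambda>u. k' u *\<^sub>C (F u - F s))) \<le> M * (t - s) * (W t - W s)" .
    qed
    finally show "norm (Q t - Q s) \<le> 2 * M * (t - s) * (W t - W s)" by simp
  qed
  then show ?thesis by (simp add: Q_def F_def scaleC.zero_right algebra_simps)
qed

text \<open>The remainder of an integration by parts: when a smooth kernel acts on a stretch of
  \<open>f\<close>, the result is expressed by windows of \<open>f\<close> of all widths up to
  \<open>h\<close>, weighted with the derivative of the kernel. This is how a kernel acts on a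
  function of which only the windows are controlled.\<close>

definition window_avg :: "real \<Rightarrow> (real \<Rightarrow> complex) \<Rightarrow> (real \<Rightarrow> 'a::complex_banach) \<Rightarrow> real \<Rightarrow> 'a" where
  "window_avg h c f t = integral {0..h} (\<lambda>u. c u *\<^sub>C window u f t)"

lemma kernel_by_parts:
  fixes f :: "real \<Rightarrow> 'a::complex_banach"
  assumes f: "loc_int f" and h: "0 \<le> h"
    and d: "\<And>t. (k has_vector_derivative k' t) (at t)" and c: "continuous_on UNIV k'"
  shows "integral {t..t+h} (\<lambda>v. k (v - t) *\<^sub>C f v) = k h *\<^sub>C window h f t - window_avg h k' f t"
proof -
  have d': "((\<lambda>v. k (v - t)) has_vector_derivative k' (v - t)) (at v)" for v
  proof -
    have "((\<lambda>v. v - t) has_real_derivative 1) (at v)" by (auto intro!: derivative_eq_intros)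
    from vector_diff_chain_at[OF this[unfolded has_real_derivative_iff_has_vector_derivative] d]
    show ?thesis by (simp add: comp_def)
  qed
  have c': "continuous_on UNIV (\<lambda>v. k' (v - t))"
    by (intro continuous_on_compose2[OF c] continuous_intros) auto
  have "integral {0..h} (\<lambda>u. k' u *\<^sub>C integral {t..t+u} f) = integral {t..t+h} (\<lambda>v. k' (v - t) *\<^sub>C integral {t..v} f)"
    using integral_shift_Icc[of h "\<lambda>v. k' (v - t) *\<^sub>C integral {t..v} f" t] by simp
  then show ?thesis
    using integral_by_parts_loc_int[OF f _ d' c', of t "t+h"] h by (simp add: window_def window_avg_def)
qed

lemma window_continuous_width: "loc_int f \<Longrightarrow> continuous_on {0..h} (\<lambda>u. window u f t)"
  by (rule continuous_on_eq[of _ "\<lambda>u. primitive f (t + u) - primitive f t"])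
    (auto intro!: continuous_intros simp: window_primitive)

text \<open>Written with the primitive, the integrand is jointly continuous in position and width,
  so the two integrals may be exchanged; after that only \<open>window_commute\<close> is
  left.\<close>

lemma window_avg_swap:
  assumes f: "loc_int f" and h: "0 \<le> h" "0 \<le> s" and c: "continuous_on UNIV c"
  shows "window s (window_avg h c f) t = window_avg h c (window s f) t"
proof -
  have "continuous_on (cbox (t, 0) (t+s, h)) (\<lambda>(v, u). c u *\<^sub>C window u f v)"
  proof (rule continuous_on_eq)
    show "continuous_on (cbox (t, 0) (t+s, h)) (\<lambda>p. c (snd p) *\<^sub>C (primitive f (fst p + snd p) - primitive f (fst p)))"
      by (intro continuous_intros continuous_on_compose2[OF c] f) auto
  qed (auto simp: window_primitive[OF f] cbox_Pair_eq)
  from integral_swap_continuous[OF this]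
  have "window s (window_avg h c f) t = integral {0..h} (\<lambda>u. integral {t..t+s} (\<lambda>v. c u *\<^sub>C window u f v))"
    by (simp add: window_def window_avg_def[abs_def])
  also have "\<dots> = integral {0..h} (\<lambda>u. c u *\<^sub>C window s (window u f) t)"
    by (rule integral_cong) (auto simp: window_def[of s] integral_scaleC_right loc_int_integrable window_loc_int[OF f])
  also have "\<dots> = window_avg h c (window s f) t"
    unfolding window_avg_def using f h by (intro integral_cong) (auto simp: window_commute)
  finally show ?thesis .
qed

lemma window_avg_continuous:
  assumes f: "loc_int f" and c: "continuous_on UNIV c"
  shows "continuous_on UNIV (window_avg h c f)"
proof -
  have "continuous_on U (\<lambda>t. integral (cbox 0 h) (\<lambda>u. c u *\<^sub>C window u f t))" for U
  proof (rule integral_continuous_on_param, rule continuous_on_eq)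
    show "continuous_on (U \<times> cbox 0 h) (\<lambda>p. c (snd p) *\<^sub>C (primitive f (fst p + snd p) - primitive f (fst p)))"
      by (intro continuous_intros continuous_on_compose2[OF c] f) auto
  qed (auto simp: window_primitive[OF f])
  then show ?thesis by (simp add: window_avg_def[abs_def])
qed

section \<open>Bounds for windows on sets closed under moving to the right\<close>

definition forward_closed :: "real set \<Rightarrow> bool" where
  "forward_closed J \<longleftrightarrow> (\<forall>t\<in>J. \<forall>u\<ge>0. t + u \<in> J)"

text \<open>Baire's theorem makes the bound on \<open>window u f\<close> uniform for \<open>u\<close> in some interval; differences
  of window lengths move this interval to the origin.\<close>

lemma window_uniform_bound:
  fixes f :: "real \<Rightarrow> 'a::banach"
  assumes J: "forward_closed J" and f: "loc_int f"
    and b: "\<And>u. u > 0 \<Longrightarrow> bounded (window u f ` J)"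
  shows "\<exists>C. \<forall>u\<in>{0..h}. \<forall>t\<in>J. norm (window u f t) \<le> C"
proof -
  \<comment> \<open>Closed, because a window depends continuously on its width; exhausting
    \<open>{0..1}\<close>, because each single window is bounded on \<open>J\<close>.\<close>
  define E where "E n = {u\<in>{0..1}. \<forall>t\<in>J. norm (window u f t) \<le> real n}" for n
  have Ecl: "closed (E n)" for n
  proof -
    have "E n = {0..1} \<inter> (\<Inter>t\<in>J. {u\<in>{0..1}. norm (window u f t) \<le> real n})" by (auto simp: E_def)
    moreover have "closed {u\<in>{0..1}. norm (window u f t) \<le> real n}" for t
      by (intro continuous_closed_preimage_constant continuous_on_closed_Collect_le continuous_intros window_continuous_width f)
    ultimately show ?thesis
      by (simp only:) (intro closed_Int closed_INT ballI closed_atLeastAtMost)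
  qed
  have Eall: "\<exists>n. u \<in> E n" if u: "u \<in> {0..1}" for u
  proof (cases "u = 0")
    case True then show ?thesis by (auto simp: E_def window_0)
  next
    case False
    with b[of u] u obtain B where "\<And>t. t \<in> J \<Longrightarrow> norm (window u f t) \<le> B" by (auto simp: bounded_iff)
    moreover obtain n where "B \<le> real n" using real_arch_simple by blast
    ultimately have "u \<in> E n" using u by (force simp: E_def)
    then show ?thesis by blast
  qed
  have "\<exists>n. \<not> {0..1} \<subseteq> closure ({0..1} - E n)"
  proof (rule ccontr)
    assume nd: "\<not> ?thesis"
    have "{0..1} \<subseteq> closure (\<Inter>(range (\<lambda>n. {0..1} - E n)))"
    proof (intro Baire)
      fix T assume "T \<in> range (\<lambda>n. {0..1} - E n)"
      then obtain n where T: "T = {0..1} - E n" by auto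
      have "openin (top_of_set {0..1}) ({0..1} \<inter> - E n)" using Ecl[of n] by (intro openin_open_Int) auto
      moreover have "{0..1} \<inter> - E n = T" using T by auto
      moreover have "{0..1} \<subseteq> closure T" using nd T by auto
      ultimately show "openin (top_of_set {0..1}) T \<and> {0..1} \<subseteq> closure T" by auto
    qed auto
    moreover have "\<Inter>(range (\<lambda>n. {0..1} - E n)) = {}" using Eall by auto
    ultimately show False by (metis atLeastAtMost_iff closure_empty empty_iff order_refl subsetD zero_le_one)
  qed
  then obtain n u0 where u0: "u0 \<in> {0..1}" "u0 \<notin> closure ({0..1} - E n)" by blast
  then obtain e where e: "e > 0" "\<And>u. u \<in> {0..1} \<Longrightarrow> dist u u0 < e \<Longrightarrow> u \<in> E n"
    unfolding closure_approachable by (metis DiffI)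
  \<comment> \<open>A relative neighbourhood of \<open>u0\<close> in \<open>{0..1}\<close> contains
    an interval of positive length. It is taken to the right of \<open>u0\<close>, or to its left if
    \<open>u0 = 1\<close>.\<close>
  obtain a d where ad: "0 \<le> a" "d > 0" "\<And>u. u \<in> {a..a+d} \<Longrightarrow> u \<in> E n"
  proof (cases "u0 < 1")
    case True
    show ?thesis
      by (rule that[of u0 "min (e/2) (1 - u0)"]) (use True u0 e in \<open>auto simp: dist_real_def\<close>)
  next
    case False
    show ?thesis
      by (rule that[of "1 - min 1 (e/2)" "min 1 (e/2)"]) (use False u0 e in \<open>auto simp: dist_real_def\<close>)
  qed
  have d1: "norm (window u f t) \<le> 2 * real n" if "u \<in> {0..d}" "t \<in> J" for u t
  proof -
    have 1: "window u f t = window (a + u) f t - window a f (t + u)"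
      using window_split[OF f, of u a t] that ad by (simp add: add.commute)
    have "t + u \<in> J" using J that by (auto simp: forward_closed_def)
    then have "norm (window (a + u) f t) \<le> n" "norm (window a f (t + u)) \<le> n"
      using ad(3)[of "a + u"] ad(3)[of a] ad that by (auto simp: E_def)
    then show ?thesis unfolding 1 using norm_triangle_ineq4[of "window (a+u) f t" "window a f (t+u)"] by linarith
  qed
  \<comment> \<open>A window of width at most \<open>k * d\<close> is chained from \<open>k\<close>
    windows of width at most \<open>d\<close>, whose starting points all stay in
    \<open>J\<close>.\<close>
  have dk: "norm (window u f t) \<le> 2 * real n * real k" if "u \<in> {0..real k * d}" "t \<in> J" for u t k
    using that
  proof (induction k arbitrary: u t)
    case 0 then show ?case by (simp add: window_0)
  next
    case (Suc k)
    define v where "v = min u d"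
    have v: "v \<in> {0..d}" "u - v \<in> {0..real k * d}" using Suc.prems ad(2) by (auto simp: v_def algebra_simps min_def)
    have "t + v \<in> J" using J v Suc.prems by (auto simp: forward_closed_def)
    then have "norm (window (u - v) f (t + v)) \<le> 2 * real n * real k" using Suc.IH v by blast
    moreover have "norm (window v f t) \<le> 2 * real n" using d1 v Suc.prems by blast
    moreover have "window u f t = window v f t + window (u - v) f (t + v)" using window_split[OF f, of v "u - v" t] v by auto
    ultimately show ?case using norm_triangle_ineq[of "window v f t" "window (u - v) f (t + v)"] by (simp add: algebra_simps)
  qed
  obtain k :: nat where "h / d \<le> real k" using real_arch_simple by blast
  then have "h \<le> real k * d" using ad(2) by (simp add: pos_divide_le_eq)
  then have "\<forall>u\<in>{0..h}. \<forall>t\<in>J. norm (window u f t) \<le> 2 * real n * real k" using dk by auto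
  then show ?thesis by blast
qed

text \<open>The windows are uniformly continuous for each width separately, without a common
  modulus. The common bound from \<open>window_uniform_bound\<close> is the majorant that lets
  dominated convergence act along pairs of sequences whose distance tends to 0.\<close>

lemma window_avg_bounded_uc:
  fixes f :: "real \<Rightarrow> 'a::complex_banach"
  assumes J: "forward_closed J" and f: "loc_int f" and c: "continuous_on UNIV c"
    and b: "\<And>u. u > 0 \<Longrightarrow> bounded (window u f ` J)"
  shows "bounded (window_avg h c f ` J)"
    and "(\<And>u. u > 0 \<Longrightarrow> uniformly_continuous_on J (window u f)) \<Longrightarrow> uniformly_continuous_on J (window_avg h c f)"
proof -
  obtain C where C: "\<And>u t. u \<in> {0..h} \<Longrightarrow> t \<in> J \<Longrightarrow> norm (window u f t) \<le> C"
    using window_uniform_bound[OF J f b] by blast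
  have int: "(\<lambda>u. c u *\<^sub>C window u f t) integrable_on {0..h}" for t
    by (intro integrable_continuous_real continuous_intros window_continuous_width f continuous_on_subset[OF c]) auto
  have cint: "(\<lambda>u. norm (c u) * K) integrable_on {0..h}" for K
    by (intro integrable_continuous_real continuous_intros continuous_on_subset[OF c]) auto
  show "bounded (window_avg h c f ` J)"
    unfolding bounded_iff
  proof (intro exI ballI)
    fix y assume "y \<in> window_avg h c f ` J"
    then obtain t where t: "t \<in> J" "y = window_avg h c f t" by auto
    show "norm y \<le> integral {0..h} (\<lambda>u. norm (c u) * C)"
      unfolding t(2) window_avg_def
      by (rule integral_norm_bound_integral[OF int cint])
        (auto simp: norm_scaleC intro!: mult_left_mono C t)
  qed
  assume uc: "\<And>u. u > 0 \<Longrightarrow> uniformly_continuous_on J (window u f)"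
  show "uniformly_continuous_on J (window_avg h c f)"
    unfolding uniformly_continuous_on_sequentially
  proof (intro allI impI, elim conjE)
    fix x y :: "nat \<Rightarrow> real"
    assume x: "\<forall>n. x n \<in> J" and y: "\<forall>n. y n \<in> J" and xy: "(\<lambda>n. dist (x n) (y n)) \<longlonglongrightarrow> 0"
    let ?g = "\<lambda>n u. norm (c u) * dist (window u f (x n)) (window u f (y n))"
    have gi: "?g n integrable_on {0..h}" for n
      by (intro integrable_continuous_real continuous_intros window_continuous_width f continuous_on_subset[OF c]) auto
    have "(\<lambda>n. integral {0..h} (?g n)) \<longlonglongrightarrow> integral {0..h} (\<lambda>u. 0::real)"
    proof (rule dominated_convergence(2)[OF gi cint[of "2*C"]])
      fix n u assume "u \<in> {0..h}"
      then have "norm (window u f (x n)) \<le> C" "norm (window u f (y n)) \<le> C" using x y C by auto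
      then have "dist (window u f (x n)) (window u f (y n)) \<le> 2 * C"
        unfolding dist_norm using norm_triangle_ineq4[of "window u f (x n)" "window u f (y n)"] by linarith
      then show "norm (?g n u) \<le> norm (c u) * (2 * C)"
        by (simp add: abs_mult mult_left_mono)
    next
      fix u assume u: "u \<in> {0..h}"
      have "(\<lambda>n. dist (window u f (x n)) (window u f (y n))) \<longlonglongrightarrow> 0"
      proof (cases "u = 0")
        case False
        then have "uniformly_continuous_on J (window u f)" using uc u by simp
        then show ?thesis
          unfolding uniformly_continuous_on_sequentially using x y xy by blast
      qed (simp add: window_0)
      then show "(\<lambda>n. ?g n u) \<longlonglongrightarrow> 0"
        using tendsto_mult_right_zero by blast
    qed
    then have lim: "(\<lambda>n. integral {0..h} (?g n)) \<longlonglongrightarrow> 0" by simp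
    show "(\<lambda>n. dist (window_avg h c f (x n)) (window_avg h c f (y n))) \<longlonglongrightarrow> 0"
    proof (rule tendsto_sandwich[OF _ _ tendsto_const lim])
      show "\<forall>\<^sub>F n in sequentially. dist (window_avg h c f (x n)) (window_avg h c f (y n)) \<le> integral {0..h} (?g n)"
      proof (intro always_eventually allI)
        fix n
        have "window_avg h c f (x n) - window_avg h c f (y n) = integral {0..h} (\<lambda>u. c u *\<^sub>C window u f (x n) - c u *\<^sub>C window u f (y n))"
          unfolding window_avg_def by (rule Henstock_Kurzweil_Integration.integral_diff[symmetric]) (rule int)+
        also have "norm \<dots> \<le> integral {0..h} (?g n)"
          by (rule integral_norm_bound_integral[OF Henstock_Kurzweil_Integration.integrable_diff[OF int int] gi])
            (simp add: scaleC.diff_right[symmetric] norm_scaleC dist_norm)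
        finally show "dist (window_avg h c f (x n)) (window_avg h c f (y n)) \<le> integral {0..h} (?g n)" by (simp add: dist_norm)
      qed
    qed auto
  qed
qed

section \<open>Iterated windows and multiplication by characters\<close>

definition iter_window :: "((real \<Rightarrow> 'a) \<Rightarrow> bool) \<Rightarrow> nat \<Rightarrow> (real \<Rightarrow> 'a::banach) \<Rightarrow> bool" where
  "iter_window P m f \<longleftrightarrow> (\<forall>hs::real list. length hs = m \<longrightarrow> (\<forall>h\<in>set hs. 0 < h) \<longrightarrow> P (fold window hs f))"

lemma iter_window_0 [simp]: "iter_window P 0 f \<longleftrightarrow> P f"
  by (simp add: iter_window_def)

lemma iter_window_Suc: "iter_window P (Suc m) f \<longleftrightarrow> (\<forall>h>0. iter_window P m (window h f))"
proof
  assume a: "iter_window P (Suc m) f"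
  show "\<forall>h>0. iter_window P m (window h f)"
    unfolding iter_window_def
  proof (intro allI impI)
    fix h :: real and hs :: "real list" assume "0 < h" "length hs = m" "\<forall>h\<in>set hs. 0 < h"
    then show "P (fold window hs (window h f))" using a[unfolded iter_window_def, rule_format, of "h # hs"] by auto
  qed
next
  assume a: "\<forall>h>0. iter_window P m (window h f)"
  show "iter_window P (Suc m) f"
    unfolding iter_window_def
  proof (intro allI impI)
    fix hs :: "real list" assume "length hs = Suc m" "\<forall>h\<in>set hs. 0 < h"
    then show "P (fold window hs f)" using a by (cases hs) (auto simp: iter_window_def)
  qed
qed

text \<open>Averaging over the width consumes one of the \<open>Suc m\<close> windows; it commutes
  with the other \<open>m\<close>, which are therefore still available.\<close>

lemma iter_window_window_avg:
  fixes f :: "real \<Rightarrow> 'a::complex_banach"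
  assumes P: "\<And>L. loc_int L \<Longrightarrow> (\<And>u. u > 0 \<Longrightarrow> P (window u L)) \<Longrightarrow> P (window_avg h c L)"
    and c: "continuous_on UNIV c" and h: "0 \<le> h"
  shows "loc_int f \<Longrightarrow> iter_window P (Suc m) f \<Longrightarrow> iter_window P m (window_avg h c f)"
proof (induction m arbitrary: f)
  case 0
  then show ?case using P by (simp add: iter_window_Suc)
next
  case (Suc m)
  show ?case
    unfolding iter_window_Suc
  proof (intro allI impI)
    fix s :: real assume s: "s > 0"
    then have "window s (window_avg h c f) = window_avg h c (window s f)" using window_avg_swap[OF Suc.prems(1) h _ c] by auto
    moreover have "iter_window P (Suc m) (window s f)" using Suc.prems(2) s unfolding iter_window_Suc[of P "Suc m"] by blast
    ultimately show "iter_window P m (window s (window_avg h c f))" using Suc.IH[of "window s f"] Suc.prems s by (simp add: window_loc_int)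
  qed
qed

lemma iter_window_lincomb:
  fixes f :: "real \<Rightarrow> 'a::complex_banach"
  assumes P: "\<And>f g a. P f \<Longrightarrow> P g \<Longrightarrow> P (\<lambda>t. a *\<^sub>C f t - g t)"
  shows "loc_int f \<Longrightarrow> loc_int g \<Longrightarrow> iter_window P m f \<Longrightarrow> iter_window P m g \<Longrightarrow> iter_window P m (\<lambda>t. a *\<^sub>C f t - g t)"
proof (induction m arbitrary: f g)
  case (Suc m)
  have "window h (\<lambda>t. a *\<^sub>C f t - g t) = (\<lambda>t. a *\<^sub>C window h f t - window h g t)" for h
    using Suc.prems by (simp add: window_diff window_scaleC loc_int_scaleC)
  then show ?case using Suc by (auto simp: iter_window_Suc window_loc_int)
qed (simp add: P)

definition bdd_uc :: "real set \<Rightarrow> (real \<Rightarrow> 'a::complex_banach) \<Rightarrow> bool" where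
  "bdd_uc J f \<longleftrightarrow> bounded (f ` J) \<and> uniformly_continuous_on J f"

lemma bdd_uc_scaleC:
  assumes "bounded (g ` J)" "uniformly_continuous_on J g" "bdd_uc J f"
  shows "bdd_uc J (\<lambda>t. g t *\<^sub>C f t)"
proof -
  obtain B where B: "B > 0" "\<And>t. t \<in> J \<Longrightarrow> norm (g t) \<le> B" using assms(1) by (auto simp: bounded_pos)
  obtain C where C: "C > 0" "\<And>t. t \<in> J \<Longrightarrow> norm (f t) \<le> C" using assms(3) by (auto simp: bdd_uc_def bounded_pos)
  have "bounded ((\<lambda>t. g t *\<^sub>C f t) ` J)"
    unfolding bounded_iff using B C by (intro exI[of _ "B * C"]) (auto simp: norm_scaleC intro!: mult_mono)
  moreover have "uniformly_continuous_on J (\<lambda>t. g t *\<^sub>C f t)"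
    unfolding uniformly_continuous_on_sequentially
  proof (intro allI impI, elim conjE)
    fix x y :: "nat \<Rightarrow> real"
    assume x: "\<forall>n. x n \<in> J" and y: "\<forall>n. y n \<in> J" and xy: "(\<lambda>n. dist (x n) (y n)) \<longlonglongrightarrow> 0"
    have 1: "(\<lambda>n. dist (g (x n)) (g (y n))) \<longlonglongrightarrow> 0" "(\<lambda>n. dist (f (x n)) (f (y n))) \<longlonglongrightarrow> 0"
      using assms(2,3) x y xy unfolding bdd_uc_def uniformly_continuous_on_sequentially by blast+
    have lim: "(\<lambda>n. B * dist (f (x n)) (f (y n)) + dist (g (x n)) (g (y n)) * C) \<longlonglongrightarrow> 0"
      using tendsto_add[OF tendsto_mult_right_zero[OF 1(2), of B] tendsto_mult_left_zero[OF 1(1), of C]] by simp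
    show "(\<lambda>n. dist (g (x n) *\<^sub>C f (x n)) (g (y n) *\<^sub>C f (y n))) \<longlonglongrightarrow> 0"
    proof (rule tendsto_sandwich[OF _ _ tendsto_const lim])
      show "\<forall>\<^sub>F n in sequentially. dist (g (x n) *\<^sub>C f (x n)) (g (y n) *\<^sub>C f (y n)) \<le>
          B * dist (f (x n)) (f (y n)) + dist (g (x n)) (g (y n)) * C"
      proof (intro always_eventually allI)
        fix n
        have "g (x n) *\<^sub>C f (x n) - g (y n) *\<^sub>C f (y n) =
          g (x n) *\<^sub>C (f (x n) - f (y n)) + (g (x n) - g (y n)) *\<^sub>C f (y n)"
          by (simp add: scaleC.diff_left scaleC.diff_right)
        then show "dist (g (x n) *\<^sub>C f (x n)) (g (y n) *\<^sub>C f (y n)) \<le>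
          B * dist (f (x n)) (f (y n)) + dist (g (x n)) (g (y n)) * C"
          unfolding dist_norm using x y
          by (simp add: order_trans[OF norm_triangle_ineq] add_mono norm_scaleC B C mult_left_mono mult_right_mono)
      qed
    qed auto
  qed
  ultimately show ?thesis by (simp add: bdd_uc_def)
qed

lemma bdd_uc_diff:
  assumes "bdd_uc J f" "bdd_uc J g"
  shows "bdd_uc J (\<lambda>t. f t - g t)"
  using assms by (auto simp: bdd_uc_def intro!: bounded_minus_comp uniformly_continuous_on_diff)

lemma cis_uniformly_continuous: "uniformly_continuous_on S (\<lambda>t::real. cis (w * t))"
proof -
  have "norm (cis (w * s) - cis (w * t)) \<le> \<bar>w\<bar> * norm (s - t)" for s t
  proof (rule differentiable_bound[of UNIV "\<lambda>t. cis (w * t)" "\<lambda>t x. x *\<^sub>R (\<i> * w * cis (w * t))"])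
    fix x :: real
    show "((\<lambda>t. cis (w * t)) has_derivative (\<lambda>y. y *\<^sub>R (\<i> * w * cis (w * x)))) (at x within UNIV)"
      by (auto intro!: derivative_eq_intros simp: scaleR_conv_of_real algebra_simps)
    show "onorm (\<lambda>y. y *\<^sub>R (\<i> * w * cis (w * x))) \<le> \<bar>w\<bar>"
      by (rule onorm_le) (simp add: norm_mult)
  qed auto
  then have l: "dist (cis (w * s)) (cis (w * t)) \<le> \<bar>w\<bar> * dist s t" for s t by (simp add: dist_norm)
  show ?thesis
    unfolding uniformly_continuous_on_def
  proof (intro allI impI)
    fix e :: real assume e: "e > 0"
    show "\<exists>d>0. \<forall>x\<in>S. \<forall>x'\<in>S. dist x' x < d \<longrightarrow> dist (cis (w * x')) (cis (w * x)) < e"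
    proof (intro exI[of _ "e / (\<bar>w\<bar> + 1)"] conjI ballI impI)
      fix x x' :: real assume "dist x' x < e / (\<bar>w\<bar> + 1)"
      then have "(\<bar>w\<bar> + 1) * dist x' x < e" by (simp add: pos_less_divide_eq add_nonneg_pos mult.commute)
      then show "dist (cis (w * x')) (cis (w * x)) < e"
        using l[of x' x] zero_le_dist[of x' x] unfolding distrib_right mult_1 by linarith
    qed (use e in \<open>auto simp: add_nonneg_pos\<close>)
  qed
qed

lemma bdd_uc_cis: "bdd_uc J f \<Longrightarrow> bdd_uc J (\<lambda>t. cis (w * t) *\<^sub>C f t)"
  by (rule bdd_uc_scaleC[OF _ cis_uniformly_continuous]) (auto simp: bounded_iff intro!: exI[of _ 1])

lemma bdd_uc_const_scaleC: "bdd_uc J f \<Longrightarrow> bdd_uc J (\<lambda>t. a *\<^sub>C f t)"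
  by (rule bdd_uc_scaleC) (auto simp: bounded_iff uniformly_continuous_on_const)

text \<open>The value of the character at the left end is pulled out; the remaining factor is a
  smooth kernel on the window, and integration by parts applies. Modulation and windowing thus
  commute up to an average of windows.\<close>

lemma window_char_mult:
  fixes f :: "real \<Rightarrow> 'a::complex_banach"
  assumes f: "loc_int f" and h: "0 \<le> h"
  shows "window h (char_mult w f) =
    char_mult w (\<lambda>t. cis (w * h) *\<^sub>C window h f t - window_avg h (\<lambda>u. \<i> * w * cis (w * u)) f t)"
proof
  fix t
  have d: "((\<lambda>u. cis (w * u)) has_vector_derivative \<i> * w * cis (w * u)) (at u)" for u
    unfolding has_vector_derivative_def
    by (auto intro!: derivative_eq_intros simp: scaleR_conv_of_real algebra_simps)
  have "window h (char_mult w f) t = integral {t..t+h} (\<lambda>v. cis (w * t) *\<^sub>C (cis (w * (v - t)) *\<^sub>C f v))"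
    unfolding window_def char_mult_def scaleC_scaleC by (simp add: cis_mult algebra_simps)
  also have "\<dots> = cis (w * t) *\<^sub>C integral {t..t+h} (\<lambda>v. cis (w * (v - t)) *\<^sub>C f v)"
    by (intro integral_scaleC_right loc_int_integrable loc_int_scaleC f continuous_intros)
  also have "integral {t..t+h} (\<lambda>v. cis (w * (v - t)) *\<^sub>C f v) =
      cis (w * h) *\<^sub>C window h f t - window_avg h (\<lambda>u. \<i> * w * cis (w * u)) f t"
    by (rule kernel_by_parts[OF f h d]) (intro continuous_intros)
  finally show "window h (char_mult w f) t =
    char_mult w (\<lambda>t. cis (w * h) *\<^sub>C window h f t - window_avg h (\<lambda>u. \<i> * w * cis (w * u)) f t) t"
    by (simp add: char_mult_def)
qed

text \<open>Needed because the condition on \<open>U\<close> concerns the modulated function,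
  whereas uniform continuity of the means is given for the unmodulated one. Each of the two terms of
  \<open>window_char_mult\<close> has one window less to go, so induction works.\<close>

lemma iter_window_bdd_uc_char_mult:
  fixes f :: "real \<Rightarrow> 'a::complex_banach"
  assumes J: "forward_closed J"
  shows "loc_int f \<Longrightarrow> iter_window (bdd_uc J) m f \<Longrightarrow> iter_window (bdd_uc J) m (char_mult w f)"
proof (induction m arbitrary: f)
  case 0
  then show ?case by (simp add: char_mult_def[abs_def] bdd_uc_cis)
next
  case (Suc m)
  have c: "continuous_on UNIV (\<lambda>u. \<i> * w * cis (w * u))" by (intro continuous_intros)
  show ?case
    unfolding iter_window_Suc
  proof (intro allI impI)
    fix h :: real assume h: "h > 0"
    let ?E = "window_avg h (\<lambda>u. \<i> * w * cis (w * u)) f"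
    have "iter_window (bdd_uc J) m ?E"
    proof (rule iter_window_window_avg[OF _ c _ Suc.prems])
      show "bdd_uc J (window_avg h (\<lambda>u. \<i> * w * cis (w * u)) L)" if "loc_int L" "\<And>u. u > 0 \<Longrightarrow> bdd_uc J (window u L)" for L :: "real \<Rightarrow> 'a"
        using that window_avg_bounded_uc[OF J that(1) c] by (simp add: bdd_uc_def)
    qed (use h in simp)
    moreover have "iter_window (bdd_uc J) m (window h f)" using Suc.prems(2) h by (simp add: iter_window_Suc)
    moreover have l: "loc_int ?E" "loc_int (window h f)"
      using Suc.prems(1) h by (auto intro!: loc_int_continuous window_avg_continuous window_continuous c)
    ultimately have "iter_window (bdd_uc J) m (\<lambda>t. cis (w * h) *\<^sub>C window h f t - ?E t)"
      by (intro iter_window_lincomb) (auto intro!: bdd_uc_diff bdd_uc_const_scaleC)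
    moreover have "loc_int (\<lambda>t. cis (w * h) *\<^sub>C window h f t - ?E t)"
      using Suc.prems(1) h by (auto intro!: loc_int_continuous continuous_intros window_avg_continuous window_continuous c)
    ultimately show "iter_window (bdd_uc J) m (window h (char_mult w f))"
      using Suc.IH window_char_mult[OF Suc.prems(1), of h w] h by simp
  qed
qed

lemma bdd_uc_window:
  fixes f :: "real \<Rightarrow> 'a::complex_banach"
  assumes J: "forward_closed J" and f: "loc_int f" and b: "bdd_uc J f" and h: "0 < h"
  shows "bdd_uc J (window h f)"
  unfolding bdd_uc_def
proof
  have int: "(\<lambda>u. f (t + u)) integrable_on {0..h}" for t
    by (rule bint_eq_integral(1)[OF bintegrable_shift]) (use f in \<open>simp add: loc_int_def\<close>)
  have D: "window h f t = integral {0..h} (\<lambda>u. f (t + u))" for t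
    by (simp add: window_def integral_shift_Icc)
  obtain C where C: "\<And>t. t \<in> J \<Longrightarrow> norm (f t) \<le> C" using b by (auto simp: bdd_uc_def bounded_iff)
  show "bounded (window h f ` J)"
    unfolding bounded_iff
  proof (intro exI ballI)
    fix y assume "y \<in> window h f ` J"
    then obtain t where t: "t \<in> J" "y = window h f t" by auto
    show "norm y \<le> integral {0..h} (\<lambda>u. C)"
      unfolding t(2) D
      by (rule integral_norm_bound_integral[OF int]) (use J t C in \<open>auto simp: forward_closed_def\<close>)
  qed
  show "uniformly_continuous_on J (window h f)"
    unfolding uniformly_continuous_on_def
  proof (intro allI impI)
    fix e :: real assume e: "e > 0"
    then have "e / (2 * h) > 0" using h by simp
    then obtain d where d: "d > 0" "\<And>x y. x \<in> J \<Longrightarrow> y \<in> J \<Longrightarrow> dist y x < d \<Longrightarrow> dist (f y) (f x) < e / (2 * h)"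
      using b unfolding bdd_uc_def uniformly_continuous_on_def by metis
    show "\<exists>d>0. \<forall>x\<in>J. \<forall>x'\<in>J. dist x' x < d \<longrightarrow> dist (window h f x') (window h f x) < e"
    proof (intro exI[of _ d] conjI d(1) ballI impI)
      fix x x' assume x: "x \<in> J" "x' \<in> J" "dist x' x < d"
      have "window h f x' - window h f x = integral {0..h} (\<lambda>u. f (x' + u) - f (x + u))"
        unfolding D by (rule Henstock_Kurzweil_Integration.integral_diff[symmetric]) (rule int)+
      also have "norm \<dots> \<le> integral {0..h} (\<lambda>u. e / (2 * h))"
      proof (rule integral_norm_bound_integral[OF Henstock_Kurzweil_Integration.integrable_diff[OF int int]])
        fix u assume "u \<in> {0..h}"
        then have "dist (f (x' + u)) (f (x + u)) < e / (2 * h)"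
          using J x by (intro d(2)) (auto simp: forward_closed_def dist_real_def)
        then show "norm (f (x' + u) - f (x + u)) \<le> e / (2 * h)" by (simp add: dist_norm)
      qed auto
      also have "\<dots> < e" using h e by simp
      finally show "dist (window h f x') (window h f x) < e" by (simp add: dist_norm)
    qed
  qed
qed

text \<open>Bounded uniform continuity is known after \<open>m\<close> windows, membership in
  \<open>U\<close> after \<open>q\<close>; this lemma brings both to level \<open>q\<close> and is
  the place where \<open>m \<le> q\<close> enters. A further window preserves bounded uniform
  continuity on \<open>J\<close>.\<close>

lemma iter_window_bdd_uc_mono:
  fixes f :: "real \<Rightarrow> 'a::complex_banach"
  assumes J: "forward_closed J" and f: "loc_int f" and m: "iter_window (bdd_uc J) m f" and mq: "m \<le> q"
  shows "iter_window (bdd_uc J) q f"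
proof -
  have step: "loc_int g \<Longrightarrow> iter_window (bdd_uc J) k g \<Longrightarrow> iter_window (bdd_uc J) (Suc k) g" for k and g :: "real \<Rightarrow> 'a"
  proof (induction k arbitrary: g)
    case 0
    then show ?case by (simp add: iter_window_Suc bdd_uc_window[OF J])
  next
    case (Suc k)
    show ?case
      unfolding iter_window_Suc[of _ "Suc k"]
    proof (intro allI impI)
      fix h :: real assume "0 < h"
      then show "iter_window (bdd_uc J) (Suc k) (window h g)"
        using Suc.prems Suc.IH[of "window h g"] by (simp add: window_loc_int iter_window_Suc[of _ k g])
    qed
  qed
  show ?thesis
    using mq by (induction q rule: dec_induct) (auto intro: m step f)
qed

section \<open>Convolution with compactly supported kernels\<close>

definition trunc_conv :: "real \<Rightarrow> (real \<Rightarrow> 'a::complex_banach) \<Rightarrow> (real \<Rightarrow> complex) \<Rightarrow> real \<Rightarrow> 'a" where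
  "trunc_conv B f r x = integral {-B..B} (\<lambda>z. r z *\<^sub>C f (x - z))"

lemma integral_reflect_translate:
  fixes G :: "real \<Rightarrow> 'a::banach"
  shows "integral {-B..B} (\<lambda>z. G (x - z)) = integral {x-B..x+B} G"
proof -
  have "integral {-B..B} (\<lambda>z. G (x - z)) = integral {-B..B} (\<lambda>z. G (x + z))"
    using Henstock_Kurzweil_Integration.integral_reflect_real[of B "-B" "\<lambda>z. G (x + z)"] by simp
  also have "\<dots> = integral {x-B..x+B} G"
    using integral_shift_Icc_real[where f=G and c=x and a="-B" and b=B] by (simp add: comp_def add.commute)
  finally show ?thesis .
qed

lemma integral_scaleC_left:
  fixes y :: "'a::complex_banach"
  assumes "r integrable_on S"
  shows "integral S (\<lambda>t. r t *\<^sub>C y) = integral S r *\<^sub>C y"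
  using integral_linear[OF assms scaleC.bounded_linear_left, of y] by (simp add: comp_def)

text \<open>Moving a derivative to \<open>r\<close> replaces \<open>f\<close> by its continuous
  primitive. The constant \<open>y\<close> is free because the integral of \<open>r'\<close>
  vanishes; it absorbs the difference between \<open>primitive (window h f)\<close> and
  \<open>window h (primitive f)\<close>.\<close>

lemma trunc_conv_by_parts:
  fixes f :: "real \<Rightarrow> 'a::complex_banach"
  assumes f: "loc_int f" and B: "0 \<le> B"
    and d: "\<And>t. (r has_vector_derivative r' t) (at t)" and c: "continuous_on UNIV r'"
    and z: "r B = 0" "r (-B) = 0"
  shows "trunc_conv B f r x = integral {-B..B} (\<lambda>z. r' z *\<^sub>C (primitive f (x - z) + y))"
proof -
  have d': "((\<lambda>v. r (x - v)) has_vector_derivative - r' (x - v)) (at v)" for v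
  proof -
    have "((\<lambda>v. x - v) has_real_derivative -1) (at v)" by (auto intro!: derivative_eq_intros)
    from vector_diff_chain_at[OF this[unfolded has_real_derivative_iff_has_vector_derivative] d]
    show ?thesis by (simp add: comp_def)
  qed
  have c': "continuous_on UNIV (\<lambda>v. - r' (x - v))"
    by (intro continuous_intros continuous_on_compose2[OF c]) auto
  have ri: "r' integrable_on {-B..B}"
    by (intro integrable_continuous_real continuous_on_subset[OF c]) auto
  have "(r' has_integral (r B - r (-B))) {-B..B}"
    using B d by (intro fundamental_theorem_of_calculus) (auto intro: has_vector_derivative_at_within)
  then have r0: "integral {-B..B} r' = 0" using z by (simp add: integral_unique)
  have Pi: "(\<lambda>z. r' z *\<^sub>C primitive f (x - z)) integrable_on {-B..B}"
    by (intro integrable_continuous_real continuous_intros f continuous_on_subset[OF c]) auto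
  have ci: "(\<lambda>z. r' z *\<^sub>C v) integrable_on {-B..B}" for v :: 'a
    by (intro integrable_continuous_real continuous_intros continuous_on_subset[OF c]) auto
  have "trunc_conv B f r x = integral {x-B..x+B} (\<lambda>y. r (x - y) *\<^sub>C f y)"
    using integral_reflect_translate[of B "\<lambda>y. r (x - y) *\<^sub>C f y" x] by (simp add: trunc_conv_def)
  also have "\<dots> = integral {x-B..x+B} (\<lambda>y. r' (x - y) *\<^sub>C integral {x-B..y} f)"
    using integral_by_parts_loc_int[OF f _ d' c', of "x-B" "x+B"] B z
    by (simp add: scaleC.zero_left scaleC.minus_left)
  also have "\<dots> = integral {x-B..x+B} (\<lambda>y. r' (x - y) *\<^sub>C (primitive f y - primitive f (x - B)))"
    by (rule integral_cong) (simp add: primitive_diff[OF f])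
  also have "\<dots> = integral {-B..B} (\<lambda>z. r' z *\<^sub>C (primitive f (x - z) - primitive f (x - B)))"
    using integral_reflect_translate[of B "\<lambda>y. r' (x - y) *\<^sub>C (primitive f y - primitive f (x - B))" x] by simp
  also have "\<dots> = integral {-B..B} (\<lambda>z. r' z *\<^sub>C primitive f (x - z))"
    using Pi ci r0 by (simp add: scaleC.diff_right Henstock_Kurzweil_Integration.integral_diff integral_scaleC_left[OF ri] scaleC.zero_left)
  also have "\<dots> = integral {-B..B} (\<lambda>z. r' z *\<^sub>C (primitive f (x - z) + y))"
    using Pi ci r0 by (simp add: scaleC.add_right Henstock_Kurzweil_Integration.integral_add integral_scaleC_left[OF ri] scaleC.zero_left)
  finally show ?thesis .
qed

lemma primitive_window:
  fixes f :: "real \<Rightarrow> 'a::banach"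
  assumes f: "loc_int f" and h: "0 \<le> h"
  shows "primitive (window h f) s = window h (primitive f) s - window h (primitive f) 0"
proof (cases "0 \<le> s")
  case True
  have "window s (window h f) 0 = window h (primitive f) s - window h (primitive f) 0"
    using window_window[OF f h True] window_commute[OF f True h] by simp
  then show ?thesis using True by (simp add: primitive_def[of "window h f"] window_def[of s])
next
  case False
  then have s: "0 \<le> - s" by simp
  have "window (-s) (window h f) s = window h (primitive f) 0 - window h (primitive f) s"
    using window_window[OF f h s] window_commute[OF f s h] by simp
  then show ?thesis using False by (simp add: primitive_def[of "window h f"] window_def[of "-s"])
qed

text \<open>After integration by parts the integrand is continuous in both variables, so the
  integrals may be exchanged; a second integration by parts, now for \<open>window h f\<close>,
  leads back.\<close>

lemma window_trunc_conv:
  fixes f :: "real \<Rightarrow> 'a::complex_banach"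
  assumes f: "loc_int f" and B: "0 \<le> B" and h: "0 \<le> h"
    and d: "\<And>t. (r has_vector_derivative r' t) (at t)" and c: "continuous_on UNIV r'"
    and z: "r B = 0" "r (-B) = 0"
  shows "window h (trunc_conv B f r) = trunc_conv B (window h f) r"
proof
  fix x
  have lP: "loc_int (primitive f)" by (intro loc_int_continuous primitive_continuous f)
  have "continuous_on (cbox (x, -B) (x+h, B)) (\<lambda>p. r' (snd p) *\<^sub>C (primitive f (fst p - snd p)))"
    by (intro continuous_intros continuous_on_compose2[OF c] f) auto
  then have "continuous_on (cbox (x, -B) (x+h, B)) (\<lambda>(v, u). r' u *\<^sub>C (primitive f (v - u)))"
    by (simp add: case_prod_unfold)
  moreover have "trunc_conv B f r = (\<lambda>v. integral {-B..B} (\<lambda>u. r' u *\<^sub>C primitive f (v - u)))"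
    using trunc_conv_by_parts[OF f B d c z, where y=0] by (intro ext) simp
  ultimately have "window h (trunc_conv B f r) x = integral {-B..B} (\<lambda>u. integral {x..x+h} (\<lambda>v. r' u *\<^sub>C primitive f (v - u)))"
    using integral_swap_continuous[of x "-B" "x+h" B "\<lambda>v u. r' u *\<^sub>C primitive f (v - u)"] by (simp add: window_def)
  also have "\<dots> = integral {-B..B} (\<lambda>u. r' u *\<^sub>C (primitive (window h f) (x - u) + window h (primitive f) 0))"
  proof (rule integral_cong)
    fix u
    have "loc_int (\<lambda>v. primitive f (v - u))" by (intro loc_int_continuous continuous_intros f)
    then have "integral {x..x+h} (\<lambda>v. r' u *\<^sub>C primitive f (v - u)) = r' u *\<^sub>C window h (\<lambda>v. primitive f (v - u)) x"
      by (simp add: integral_scaleC_right loc_int_integrable window_def)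
    also have "window h (\<lambda>v. primitive f (v - u)) x = primitive (window h f) (x - u) + window h (primitive f) 0"
      using window_translate[of h "primitive f" "-u" x] primitive_window[OF f h, of "x - u"] by simp
    finally show "integral {x..x+h} (\<lambda>v. r' u *\<^sub>C primitive f (v - u)) =
        r' u *\<^sub>C (primitive (window h f) (x - u) + window h (primitive f) 0)" .
  qed
  also have "\<dots> = trunc_conv B (window h f) r x"
    using trunc_conv_by_parts[OF window_loc_int[OF f h] B d c z] by simp
  finally show "window h (trunc_conv B f r) x = trunc_conv B (window h f) r x" .
qed

lemma loc_int_fold_window: "loc_int f \<Longrightarrow> \<forall>h\<in>set hs. 0 < h \<Longrightarrow> loc_int (fold window hs f)"
  by (induction hs arbitrary: f) (auto simp: window_loc_int)

lemma fold_window_trunc_conv: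
  fixes f :: "real \<Rightarrow> 'a::complex_banach"
  assumes B: "0 \<le> B" and d: "\<And>t. (r has_vector_derivative r' t) (at t)" and c: "continuous_on UNIV r'"
    and z: "r B = 0" "r (-B) = 0"
  shows "loc_int f \<Longrightarrow> \<forall>h\<in>set hs. 0 < h \<Longrightarrow> fold window hs (trunc_conv B f r) = trunc_conv B (fold window hs f) r"
  by (induction hs arbitrary: f) (auto simp: window_trunc_conv[OF _ B _ d c z] window_loc_int)

lemma fold_window_scaleR: "fold window hs (\<lambda>t. c *\<^sub>R f t) = (\<lambda>t. c *\<^sub>R fold window hs f t)"
  by (induction hs arbitrary: f) (auto simp: window_scaleR)

section \<open>Convolution on the real line\<close>

definition L1norm :: "(real \<Rightarrow> complex) \<Rightarrow> real" where
  "L1norm f = (LINT x|lborel. cmod (f x))"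

definition convol :: "(real \<Rightarrow> complex) \<Rightarrow> (real \<Rightarrow> complex) \<Rightarrow> real \<Rightarrow> complex" where
  "convol f k x = (LINT y|lborel. f (x - y) * k y)"

lemma L1norm_nonneg [simp]: "0 \<le> L1norm f"
  by (simp add: L1norm_def)

lemma integrable_translate: "integrable lborel f \<Longrightarrow> integrable lborel (\<lambda>x::real. f (x + a) :: complex)"
  using lborel_integrable_real_affine[of f 1 a] by (simp add: add.commute)

lemma integrable_reflect: "integrable lborel f \<Longrightarrow> integrable lborel (\<lambda>x::real. f (a - x) :: complex)"
  using lborel_integrable_real_affine[of f "-1" a] by simp

lemma L1norm_translate: "L1norm (\<lambda>x. f (x + a)) = L1norm f"
  using lborel_integral_real_affine[of 1 "\<lambda>x. cmod (f x)" a] by (simp add: L1norm_def add.commute)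

lemma L1norm_translate': "L1norm (\<lambda>x. f (x - a)) = L1norm f"
  using L1norm_translate[of f "-a"] by simp

lemma L1norm_reflect: "L1norm (\<lambda>x. f (a - x)) = L1norm f"
  using lborel_integral_real_affine[of "-1" "\<lambda>x. cmod (f x)" a] by (simp add: L1norm_def)

lemma L1norm_scale: "a \<noteq> 0 \<Longrightarrow> L1norm (\<lambda>x. a * f (\<bar>a\<bar> * x)) = L1norm f"
  using lborel_integral_real_affine[of "\<bar>a\<bar>" "\<lambda>x. cmod (f x)" 0] by (simp add: L1norm_def norm_mult)

lemma L1norm_mult: "L1norm (\<lambda>x. c * f x) = cmod c * L1norm f"
  by (simp add: L1norm_def norm_mult)

lemma L1norm_add: "integrable lborel f \<Longrightarrow> integrable lborel g \<Longrightarrow> L1norm (\<lambda>x. f x + g x) \<le> L1norm f + L1norm g"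
  using integral_mono[of lborel "\<lambda>x. cmod (f x + g x)" "\<lambda>x. cmod (f x) + cmod (g x)"]
  by (simp add: L1norm_def norm_triangle_ineq)

lemma L1norm_diff: "integrable lborel f \<Longrightarrow> integrable lborel g \<Longrightarrow> L1norm (\<lambda>x. f x - g x) \<le> L1norm f + L1norm g"
  using integral_mono[of lborel "\<lambda>x. cmod (f x - g x)" "\<lambda>x. cmod (f x) + cmod (g x)"]
  by (simp add: L1norm_def norm_triangle_ineq4)

lemma L1norm_cis: "L1norm (\<lambda>x. cis (g x) * f x) = L1norm f"
  by (simp add: L1norm_def norm_mult)

lemma cis_measurable [measurable]: "cis \<in> borel_measurable borel"
  by (intro borel_measurable_continuous_onI continuous_intros)

lemma convol_integrable_prod:
  fixes f k :: "real \<Rightarrow> complex"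
  assumes f: "integrable lborel f" and k: "integrable lborel k"
  shows "integrable (lborel \<Otimes>\<^sub>M lborel) (\<lambda>(y, x). f (x - y) * k y :: complex)"
proof (rule lborel_pair.Fubini_integrable)
  have [measurable]: "f \<in> borel_measurable borel" "k \<in> borel_measurable borel"
    using f k by (auto dest: borel_measurable_integrable)
  show "(\<lambda>(y, x). f (x - y) * k y) \<in> borel_measurable (lborel \<Otimes>\<^sub>M lborel)" by measurable
  have "(\<lambda>y. LINT x|lborel. norm (case (y, x) of (y, x) \<Rightarrow> f (x - y) * k y)) = (\<lambda>y. L1norm f * cmod (k y))"
    using L1norm_translate'[of f] by (simp add: L1norm_def norm_mult)
  then show "integrable lborel (\<lambda>y. LINT x|lborel. norm (case (y, x) of (y, x) \<Rightarrow> f (x - y) * k y))"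
    using k by simp
  have "integrable lborel (\<lambda>x. f (x - y) * k y)" for y
    using integrable_translate[OF f, of "-y"] by simp
  then show "AE y in lborel. integrable lborel (\<lambda>x. case (y, x) of (y, x) \<Rightarrow> f (x - y) * k y)"
    by simp
qed

lemma convol_integrable: "integrable lborel f \<Longrightarrow> integrable lborel k \<Longrightarrow> integrable lborel (convol f k)"
  using lborel_pair.integrable_fst'[OF lborel_pair.integrable_product_swap[OF convol_integrable_prod]]
  by (simp add: convol_def[abs_def])

lemma convol_commute: "convol f k x = convol k f x"
  using lborel_integral_real_affine[of "-1" "\<lambda>y. f (x - y) * k y" x] by (simp add: convol_def mult.commute)

lemma bounded_mult_integrable:
  fixes g f :: "real \<Rightarrow> complex"
  assumes "g \<in> borel_measurable borel" "\<And>x. cmod (g x) \<le> B" "integrable lborel f"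
  shows "integrable lborel (\<lambda>y. g y * f y)"
proof (rule Bochner_Integration.integrable_bound[of _ "\<lambda>y. B * cmod (f y)"])
  show "integrable lborel (\<lambda>y. B * cmod (f y))" using assms(3) by simp
  have [measurable]: "g \<in> borel_measurable borel" "f \<in> borel_measurable borel"
    using assms by (auto dest: borel_measurable_integrable)
  show "(\<lambda>y. g y * f y) \<in> borel_measurable lborel" by measurable
  have "0 \<le> B" using assms(2)[of 0] norm_ge_zero order_trans by blast
  then show "AE y in lborel. norm (g y * f y) \<le> norm (B * cmod (f y))"
    using assms(2) by (auto simp: norm_mult intro!: mult_right_mono always_eventually)
qed

text \<open>Stated for bounded \<open>g\<close>, so that it holds at every point.\<close>

lemma convol_assoc:
  assumes gm: "g \<in> borel_measurable borel" and gb: "\<And>x. cmod (g x) \<le> B"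
    and k: "integrable lborel k" and l: "integrable lborel l"
  shows "convol (convol g k) l x = convol g (convol k l) x"
proof -
  have [measurable]: "g \<in> borel_measurable borel" "k \<in> borel_measurable borel" "l \<in> borel_measurable borel"
    using gm k l by (auto dest: borel_measurable_integrable)
  have B: "0 \<le> B" using gb[of 0] norm_ge_zero order_trans by blast
  have i: "integrable (lborel \<Otimes>\<^sub>M lborel) (\<lambda>(z, y). g (x - y) * (k (y - z) * l z))"
  proof (rule Bochner_Integration.integrable_bound)
    show "integrable (lborel \<Otimes>\<^sub>M lborel) (\<lambda>p. B * cmod (case p of (z, y) \<Rightarrow> k (y - z) * l z))"
      using integrable_norm[OF convol_integrable_prod[OF k l]] by (rule integrable_mult_right)
    show "(\<lambda>(z, y). g (x - y) * (k (y - z) * l z)) \<in> borel_measurable (lborel \<Otimes>\<^sub>M lborel)"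
      by measurable
    show "AE p in lborel \<Otimes>\<^sub>M lborel. norm (case p of (z, y) \<Rightarrow> g (x - y) * (k (y - z) * l z))
        \<le> norm (B * cmod (case p of (z, y) \<Rightarrow> k (y - z) * l z))"
      using gb B by (auto simp: norm_mult abs_mult intro!: always_eventually mult_right_mono)
  qed
  have "convol (convol g k) l x = (LINT z|lborel. (LINT y|lborel. g (x - z - y) * k y) * l z)"
    by (simp add: convol_def)
  also have "\<dots> = (LINT z|lborel. LINT y|lborel. g (x - y) * (k (y - z) * l z))"
  proof (rule Bochner_Integration.integral_cong[OF refl])
    fix z
    have "(LINT y|lborel. g (x - z - y) * k y) = (LINT y|lborel. g (x - y) * k (y - z))"
      using lborel_integral_real_affine[of 1 "\<lambda>y. g (x - z - y) * k y" "-z"] by (simp add: algebra_simps)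
    then show "(LINT y|lborel. g (x - z - y) * k y) * l z = (LINT y|lborel. g (x - y) * (k (y - z) * l z))"
      by (simp flip: integral_mult_left_zero add: mult.assoc)
  qed
  also have "\<dots> = (LINT y|lborel. LINT z|lborel. g (x - y) * (k (y - z) * l z))"
    using lborel_pair.Fubini_integral[OF i] by simp
  also have "\<dots> = convol g (convol k l) x"
    by (simp add: convol_def)
  finally show ?thesis .
qed

lemma fourier_convol:
  assumes f: "integrable lborel f" and k: "integrable lborel k"
  shows "fourier (convol f k) w = fourier f w * fourier k w"
proof -
  have [measurable]: "f \<in> borel_measurable borel" "k \<in> borel_measurable borel"
    using k f by (auto dest: borel_measurable_integrable)
  have i: "integrable (lborel \<Otimes>\<^sub>M lborel) (\<lambda>(y, x). cis (- w * x) * (f (x - y) * k y))"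
  proof (rule Bochner_Integration.integrable_bound[OF convol_integrable_prod[OF f k]])
    show "(\<lambda>(y, x). cis (- w * x) * (f (x - y) * k y)) \<in> borel_measurable (lborel \<Otimes>\<^sub>M lborel)"
      by measurable
  qed (auto simp: norm_mult)
  have "fourier (convol f k) w = (LINT x|lborel. LINT y|lborel. cis (- w * x) * (f (x - y) * k y))"
    by (simp add: fourier_def convol_def)
  also have "\<dots> = (LINT y|lborel. LINT x|lborel. cis (- w * x) * (f (x - y) * k y))"
    using lborel_pair.Fubini_integral[OF i] by simp
  also have "\<dots> = (LINT y|lborel. fourier f w * (cis (- w * y) * k y))"
  proof (rule Bochner_Integration.integral_cong[OF refl])
    fix y
    have "(LINT x|lborel. cis (- w * x) * (f (x - y) * k y)) = (LINT x|lborel. cis (- w * (y + x)) * (f x * k y))"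
      using lborel_integral_real_affine[of 1 "\<lambda>x. cis (- w * x) * (f (x - y) * k y)" y] by simp
    also have "\<dots> = (LINT x|lborel. (cis (- w * x) * f x) * (cis (- w * y) * k y))"
    proof (intro Bochner_Integration.integral_cong refl)
      fix x
      have "cis (- w * (y + x)) = cis (- w * x) * cis (- w * y)" by (simp add: cis_mult algebra_simps)
      then show "cis (- w * (y + x)) * (f x * k y) = (cis (- w * x) * f x) * (cis (- w * y) * k y)" by simp
    qed
    also have "\<dots> = fourier f w * (cis (- w * y) * k y)"
      by (simp add: fourier_def)
    finally show "(LINT x|lborel. cis (- w * x) * (f (x - y) * k y)) = fourier f w * (cis (- w * y) * k y)" .
  qed
  also have "\<dots> = fourier f w * fourier k w" by (simp add: fourier_def)
  finally show ?thesis .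
qed

section \<open>Iterated derivatives and operations on \<open>DL1\<close>\<close>

lemma iter_deriv_0 [simp]: "iter_deriv 0 g = g"
  by (simp add: iter_deriv_def)

lemma iter_deriv_Suc: "iter_deriv (Suc j) g t = vector_derivative (iter_deriv j g) (at t)"
  by (simp add: iter_deriv_def)

text \<open>A whole sequence of candidate derivatives is exhibited at once. This identifies
  \<open>iter_deriv\<close> and, through \<open>smoothI\<close> and \<open>DL1_I\<close>, gives
  smoothness and membership in \<open>DL1\<close> from the same two facts.\<close>

lemma iter_deriv_eqI:
  assumes "G 0 = g" "\<And>j t. (G j has_vector_derivative G (Suc j) t) (at t)"
  shows "iter_deriv j g = G j"
proof (induction j)
  case (Suc j)
  then show ?case using vector_derivative_at[OF assms(2)] by (auto simp: iter_deriv_Suc)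
qed (simp add: assms)

lemma smoothI:
  assumes "G 0 = g" "\<And>j t. (G j has_vector_derivative G (Suc j) t) (at t)"
  shows "smooth g"
  unfolding smooth_def iter_deriv_eqI[of G, OF assms] using assms(2) differentiableI_vector by blast

lemma smooth_iter_deriv:
  "smooth g \<Longrightarrow> (iter_deriv j g has_vector_derivative iter_deriv (Suc j) g t) (at t)"
  unfolding iter_deriv_Suc smooth_def using vector_derivative_works by blast

lemma smooth_continuous: "smooth g \<Longrightarrow> continuous_on S (iter_deriv j g)"
  unfolding smooth_def
  by (auto intro!: continuous_at_imp_continuous_on differentiable_imp_continuous_within)

lemma smooth_measurable: "smooth g \<Longrightarrow> iter_deriv j g \<in> borel_measurable borel"
  by (intro borel_measurable_continuous_onI smooth_continuous)

lemma DL1_I: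
  assumes "G 0 = g" "\<And>j t. (G j has_vector_derivative G (Suc j) t) (at t)" "\<And>j. integrable lborel (G j)"
  shows "g \<in> DL1"
  unfolding DL1_def using smoothI[of G, OF assms(1,2)] iter_deriv_eqI[of G, OF assms(1,2)] assms(3) by auto

lemma DL1_D:
  assumes "g \<in> DL1"
  shows "smooth g" "integrable lborel (iter_deriv j g)"
    "(iter_deriv j g has_vector_derivative iter_deriv (Suc j) g t) (at t)"
    "iter_deriv j g \<in> borel_measurable borel"
  using assms smooth_iter_deriv smooth_measurable by (auto simp: DL1_def)

lemma DL1_integrable: "g \<in> DL1 \<Longrightarrow> integrable lborel g"
  using DL1_D(2)[of g 0] by simp

lemma
  assumes f: "f \<in> DL1" and g: "g \<in> DL1"
  shows DL1_add: "(\<lambda>t. f t + g t) \<in> DL1"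
    and iter_deriv_add: "iter_deriv j (\<lambda>t. f t + g t) = (\<lambda>t. iter_deriv j f t + iter_deriv j g t)"
proof -
  let ?G = "\<lambda>j t. iter_deriv j f t + iter_deriv j g t"
  have d: "(?G j has_vector_derivative ?G (Suc j) t) (at t)" for j t
    by (intro has_vector_derivative_add DL1_D f g)
  show "(\<lambda>t. f t + g t) \<in> DL1" by (rule DL1_I[of ?G, OF _ d]) (auto intro: DL1_D(2) f g)
  show "iter_deriv j (\<lambda>t. f t + g t) = ?G j" by (rule iter_deriv_eqI[where G="?G", OF _ d]) simp
qed

lemma
  assumes f: "f \<in> DL1"
  shows DL1_mult: "(\<lambda>t. c * f t) \<in> DL1"
    and iter_deriv_mult: "iter_deriv j (\<lambda>t. c * f t) = (\<lambda>t. c * iter_deriv j f t)"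
proof -
  let ?G = "\<lambda>j t. c * iter_deriv j f t"
  have d: "(?G j has_vector_derivative ?G (Suc j) t) (at t)" for j t
    by (intro has_vector_derivative_mult_right DL1_D f)
  show "(\<lambda>t. c * f t) \<in> DL1" by (rule DL1_I[of ?G, OF _ d]) (auto intro: DL1_D(2) f)
  show "iter_deriv j (\<lambda>t. c * f t) = ?G j" by (rule iter_deriv_eqI[where G="?G", OF _ d]) simp
qed

lemma
  assumes f: "f \<in> DL1"
  shows DL1_translate: "(\<lambda>t. f (t + a)) \<in> DL1"
    and iter_deriv_translate: "iter_deriv j (\<lambda>t. f (t + a)) = (\<lambda>t. iter_deriv j f (t + a))"
proof -
  let ?G = "\<lambda>j t. iter_deriv j f (t + a)"
  have d: "(?G j has_vector_derivative ?G (Suc j) t) (at t)" for j t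
  proof -
    have "((\<lambda>v. v + a) has_real_derivative 1) (at t)" by (auto intro!: derivative_eq_intros)
    from vector_diff_chain_at[OF this[unfolded has_real_derivative_iff_has_vector_derivative] DL1_D(3)[OF f]]
    show ?thesis by (simp add: comp_def)
  qed
  show "(\<lambda>t. f (t + a)) \<in> DL1" by (rule DL1_I[of ?G, OF _ d]) (auto intro!: DL1_D(2) f integrable_translate)
  show "iter_deriv j (\<lambda>t. f (t + a)) = ?G j" by (rule iter_deriv_eqI[where G="?G", OF _ d]) simp
qed

lemma
  assumes f: "f \<in> DL1"
  shows DL1_reflect: "(\<lambda>t. f (a - t)) \<in> DL1"
    and iter_deriv_reflect: "iter_deriv j (\<lambda>t. f (a - t)) = (\<lambda>t. (-1)^j * iter_deriv j f (a - t))"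
proof -
  let ?G = "\<lambda>j t. (-1)^j * iter_deriv j f (a - t)"
  have d: "(?G j has_vector_derivative ?G (Suc j) t) (at t)" for j t
  proof -
    have "((\<lambda>v. a - v) has_real_derivative -1) (at t)" by (auto intro!: derivative_eq_intros)
    from vector_diff_chain_at[OF this[unfolded has_real_derivative_iff_has_vector_derivative] DL1_D(3)[OF f, of j]]
    have "((\<lambda>t. iter_deriv j f (a - t)) has_vector_derivative - iter_deriv (Suc j) f (a - t)) (at t)" by (simp add: comp_def)
    from has_vector_derivative_mult_right[OF this, of "(-1)^j"] show ?thesis by simp
  qed
  show "(\<lambda>t. f (a - t)) \<in> DL1" by (rule DL1_I[of ?G, OF _ d]) (auto intro!: DL1_D(2) f integrable_reflect)
  show "iter_deriv j (\<lambda>t. f (a - t)) = ?G j" by (rule iter_deriv_eqI[where G="?G", OF _ d]) simp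
qed

lemma
  assumes f: "f \<in> DL1"
  shows DL1_deriv: "iter_deriv 1 f \<in> DL1"
    and iter_deriv_deriv: "iter_deriv j (iter_deriv 1 f) = iter_deriv (Suc j) f"
proof -
  have d: "(iter_deriv (Suc j) f has_vector_derivative iter_deriv (Suc (Suc j)) f t) (at t)" for j t
    by (intro DL1_D f)
  show "iter_deriv 1 f \<in> DL1" by (rule DL1_I[of "\<lambda>j. iter_deriv (Suc j) f", OF _ d]) (auto intro!: DL1_D(2) f)
  show "iter_deriv j (iter_deriv 1 f) = iter_deriv (Suc j) f"
    by (rule iter_deriv_eqI[where G="\<lambda>j. iter_deriv (Suc j) f", OF _ d]) simp
qed

lemma
  assumes "finite I" and f: "\<And>i. i \<in> I \<Longrightarrow> f i \<in> DL1"
  shows DL1_sum: "(\<lambda>t. \<Sum>i\<in>I. f i t) \<in> DL1"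
    and iter_deriv_sum: "iter_deriv j (\<lambda>t. \<Sum>i\<in>I. f i t) = (\<lambda>t. \<Sum>i\<in>I. iter_deriv j (f i) t)"
proof -
  let ?G = "\<lambda>j t. \<Sum>i\<in>I. iter_deriv j (f i) t"
  have d: "(?G j has_vector_derivative ?G (Suc j) t) (at t)" for j t
    by (intro has_vector_derivative_sum DL1_D f)
  have "integrable lborel (?G j)" for j
    by (intro Bochner_Integration.integrable_sum DL1_D(2) f)
  then show "(\<lambda>t. \<Sum>i\<in>I. f i t) \<in> DL1" by (intro DL1_I[of ?G, OF _ d]) auto
  show "iter_deriv j (\<lambda>t. \<Sum>i\<in>I. f i t) = ?G j" by (rule iter_deriv_eqI[where G="?G", OF _ d]) simp
qed

text \<open>The bound is a nonnegative integral over a fixed window with the translation moved into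
  the integrand. In this form it can be integrated over \<open>x\<close> and the order exchanged,
  which is the proof of \<open>L1norm_increment\<close>.\<close>

lemma increment_bound_integral:
  fixes g :: "real \<Rightarrow> complex"
  assumes d: "\<And>t. (g has_vector_derivative g' t) (at t)" and i: "integrable lborel g'" and h: "0 \<le> h"
  shows "ennreal (cmod (g (x + h) - g x)) \<le> (\<integral>\<^sup>+u. indicator {0..h} u * ennreal (cmod (g' (x + u))) \<partial>lborel)"
proof -
  have [measurable]: "g' \<in> borel_measurable borel" using i by (auto dest: borel_measurable_integrable)
  have si: "set_integrable lborel {x..x+h} g'"
    using i unfolding set_integrable_def by (intro integrable_mult_indicator) auto
  have "(g' has_integral (g (x + h) - g x)) {x..x+h}"
    using h d by (intro fundamental_theorem_of_calculus) (auto intro: has_vector_derivative_at_within)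
  then have "g (x + h) - g x = (LINT u:{x..x+h}|lborel. g' u)"
    using set_borel_integral_eq_integral(2)[OF si] by (simp add: integral_unique)
  then have "cmod (g (x + h) - g x) \<le> (LINT u|lborel. norm (indicator {x..x+h} u *\<^sub>R g' u))"
    unfolding set_lebesgue_integral_def by (metis integral_norm_bound)
  also have "ennreal \<dots> = (\<integral>\<^sup>+u. ennreal (norm (indicator {x..x+h} u *\<^sub>R g' u)) \<partial>lborel)"
    using integrable_norm[OF si[unfolded set_integrable_def]] by (intro nn_integral_eq_integral[symmetric]) auto
  also have "\<dots> = (\<integral>\<^sup>+u. indicator {x..x+h} u * ennreal (cmod (g' u)) \<partial>lborel)"
    by (intro nn_integral_cong) (auto simp: indicator_def)
  also have "\<dots> = (\<integral>\<^sup>+u. indicator {x..x+h} (x + u) * ennreal (cmod (g' (x + u))) \<partial>lborel)"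
    using nn_integral_real_affine[of "\<lambda>u. indicator {x..x+h} u * ennreal (cmod (g' u))" 1 x] by simp
  also have "\<dots> = (\<integral>\<^sup>+u. indicator {0..h} u * ennreal (cmod (g' (x + u))) \<partial>lborel)"
    by (intro nn_integral_cong) (auto simp: indicator_def)
  finally show ?thesis using ennreal_leI by (metis order_trans)
qed

lemma L1norm_ennreal: "integrable lborel f \<Longrightarrow> ennreal (L1norm f) = (\<integral>\<^sup>+x. ennreal (cmod (f x)) \<partial>lborel)"
  unfolding L1norm_def by (intro nn_integral_eq_integral[symmetric]) auto

lemma increment_bound:
  fixes g :: "real \<Rightarrow> complex"
  assumes d: "\<And>t. (g has_vector_derivative g' t) (at t)" and i: "integrable lborel g'"
  shows "cmod (g y - g x) \<le> L1norm g'"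
proof -
  have *: "cmod (g (x + h) - g x) \<le> L1norm g'" if h: "0 \<le> h" for x h
  proof -
    have "ennreal (cmod (g (x + h) - g x)) \<le> (\<integral>\<^sup>+u. indicator {0..h} u * ennreal (cmod (g' (x + u))) \<partial>lborel)"
      by (rule increment_bound_integral[OF d i h])
    also have "\<dots> \<le> (\<integral>\<^sup>+u. ennreal (cmod (g' (u + x))) \<partial>lborel)"
      by (intro nn_integral_mono) (auto simp: indicator_def add.commute)
    also have "\<dots> = ennreal (L1norm g')"
      using L1norm_ennreal[OF integrable_translate[OF i, of x]] L1norm_translate[of g' x] by simp
    finally show ?thesis by simp
  qed
  show ?thesis
    using *[of "y - x" x] *[of "x - y" y] by (cases "x \<le> y") (auto simp: norm_minus_commute)
qed

text \<open>Integrate the pointwise bound over \<open>x\<close> and exchange the integrals: for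
  every \<open>u\<close> in a window of length \<open>h\<close> the inner integral is the norm of a
  translate of \<open>g'\<close>. So translation is Lipschitz in mean, at the cost of one
  derivative.\<close>

lemma L1norm_increment:
  fixes g :: "real \<Rightarrow> complex"
  assumes d: "\<And>t. (g has_vector_derivative g' t) (at t)" and i: "integrable lborel g'" and g: "integrable lborel g"
  shows "L1norm (\<lambda>x. g (x + a) - g (x + b)) \<le> \<bar>a - b\<bar> * L1norm g'"
proof -
  have [measurable]: "g' \<in> borel_measurable borel" using i by (auto dest: borel_measurable_integrable)
  have *: "L1norm (\<lambda>x. g (x + h) - g x) \<le> h * L1norm g'" if h: "0 \<le> h" for h
  proof -
    have "ennreal (L1norm (\<lambda>x. g (x + h) - g x)) = (\<integral>\<^sup>+x. ennreal (cmod (g (x + h) - g x)) \<partial>lborel)"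
      by (intro L1norm_ennreal Bochner_Integration.integrable_diff g integrable_translate)
    also have "\<dots> \<le> (\<integral>\<^sup>+x. (\<integral>\<^sup>+u. indicator {0..h} u * ennreal (cmod (g' (x + u))) \<partial>lborel) \<partial>lborel)"
      by (intro nn_integral_mono increment_bound_integral[OF d i h])
    also have "\<dots> = (\<integral>\<^sup>+u. (\<integral>\<^sup>+x. indicator {0..h} u * ennreal (cmod (g' (x + u))) \<partial>lborel) \<partial>lborel)"
      by (rule lborel_pair.Fubini') measurable
    also have "\<dots> = (\<integral>\<^sup>+u. ennreal (L1norm g') * indicator {0..h} u \<partial>lborel)"
      using L1norm_ennreal[OF integrable_translate[OF i]] L1norm_translate[of g']
      by (intro nn_integral_cong) (simp add: nn_integral_cmult mult.commute)
    also have "\<dots> = ennreal (h * L1norm g')"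
      using h by (simp add: nn_integral_cmult ennreal_mult'[symmetric] mult.commute)
    finally show ?thesis using h by simp
  qed
  have **: "L1norm (\<lambda>x. g (x + a) - g (x + b)) \<le> (a - b) * L1norm g'" if "b \<le> a" for a b
    using *[of "a - b"] L1norm_translate[of "\<lambda>x. g (x + (a - b)) - g x" b] that by (simp add: algebra_simps)
  have "L1norm (\<lambda>x. g (x + a) - g (x + b)) = L1norm (\<lambda>x. g (x + b) - g (x + a))"
    by (simp add: L1norm_def norm_minus_commute)
  then show ?thesis using **[of a b] **[of b a] by (cases "b \<le> a") auto
qed

lemma DL1_bounded: "f \<in> DL1 \<Longrightarrow> \<exists>B. \<forall>x. cmod (iter_deriv j f x) \<le> B"
proof (intro exI allI)
  fix x assume f: "f \<in> DL1"
  show "cmod (iter_deriv j f x) \<le> cmod (iter_deriv j f 0) + L1norm (iter_deriv (Suc j) f)"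
    using increment_bound[OF DL1_D(3)[OF f] DL1_D(2)[OF f], of j x 0]
      norm_triangle_sub[of "iter_deriv j f x" "iter_deriv j f 0"] by linarith
qed

text \<open>The bound on the second derivative makes the Taylor remainder of \<open>g\<close> at
  most \<open>B * h\<^sup>2\<close> at every point, so it stays quadratically small after
  integration against \<open>k\<close>.\<close>

lemma convol_has_vector_derivative:
  assumes d: "\<And>t. (g has_vector_derivative g' t) (at t)" and d2: "\<And>t. (g' has_vector_derivative g'' t) (at t)"
    and b0: "\<And>t. cmod (g t) \<le> B0" and b1: "\<And>t. cmod (g' t) \<le> B1" and b2: "\<And>t. cmod (g'' t) \<le> B"
    and k: "integrable lborel k"
  shows "(convol g k has_vector_derivative convol g' k x) (at x)"
proof -
  have gm [measurable]: "g \<in> borel_measurable borel" "g' \<in> borel_measurable borel"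
    using d d2 by (auto intro!: borel_measurable_continuous_onI continuous_at_imp_continuous_on
       differentiable_imp_continuous_within differentiableI_vector)
  have B: "0 \<le> B" using b2[of 0] norm_ge_zero order_trans by blast
  have int: "integrable lborel (\<lambda>y. g (u - y) * k y)" "integrable lborel (\<lambda>y. g' (u - y) * k y)" for u
    using b0 b1 by (auto intro!: bounded_mult_integrable[OF _ _ k])
  have tay: "cmod (g (u + h) - g u - h *\<^sub>R g' u) \<le> B * h\<^sup>2" for u h
  proof -
    have on: "onorm (\<lambda>x. x *\<^sub>R g'' t) \<le> B" for t
    proof (rule onorm_le)
      show "norm (y *\<^sub>R g'' t) \<le> B * norm y" for y :: real
        using mult_right_mono[OF b2[of t], of "norm y"] by (simp add: mult.commute)
    qed
    have lip: "cmod (g' s - g' u) \<le> B * \<bar>s - u\<bar>" for s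
      using differentiable_bound[of UNIV g' "\<lambda>t x. x *\<^sub>R g'' t" B s u] d2 on
      by (auto simp: has_vector_derivative_def)
    \<comment> \<open>Mean value inequality for \<open>g\<close> minus its linear part at
      \<open>u\<close>; the derivative of this difference is at most
      \<open>B * \<bar>h\<bar>\<close> on the segment.\<close>
    have "cmod ((g (u + h) - (u + h) *\<^sub>R g' u) - (g u - u *\<^sub>R g' u)) \<le> (B * \<bar>h\<bar>) * norm ((u + h) - u)"
    proof (rule differentiable_bound[of "closed_segment u (u + h)" "\<lambda>s. g s - s *\<^sub>R g' u" "\<lambda>s x. x *\<^sub>R (g' s - g' u)"])
      fix s assume s: "s \<in> closed_segment u (u + h)"
      have "((\<lambda>s. g s - s *\<^sub>R g' u) has_vector_derivative (g' s - 1 *\<^sub>R g' u)) (at s within closed_segment u (u + h))"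
        by (intro has_vector_derivative_diff has_vector_derivative_at_within[OF d] has_vector_derivative_scaleR
             derivative_eq_intros has_vector_derivative_const | simp)+
      then show "((\<lambda>s. g s - s *\<^sub>R g' u) has_derivative (\<lambda>x. x *\<^sub>R (g' s - g' u))) (at s within closed_segment u (u + h))"
        by (simp add: has_vector_derivative_def)
      have "\<bar>s - u\<bar> \<le> \<bar>h\<bar>" using s by (auto simp: closed_segment_eq_real_ivl split: if_splits)
      then have "cmod (g' s - g' u) \<le> B * \<bar>h\<bar>" using lip[of s] B by (meson mult_left_mono order_trans)
      then show "onorm (\<lambda>x. x *\<^sub>R (g' s - g' u)) \<le> B * \<bar>h\<bar>"
        by (intro onorm_le) (simp add: mult.commute[of "\<bar>_\<bar>"] mult_right_mono)
    qed auto
    then show ?thesis by (simp add: algebra_simps power2_eq_square)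
  qed
  have est: "cmod (convol g k (x + h) - convol g k x - h *\<^sub>R convol g' k x) \<le> (B * L1norm k) * h\<^sup>2" for h
  proof -
    have "convol g k (x + h) - convol g k x - h *\<^sub>R convol g' k x =
       (LINT y|lborel. (g (x - y + h) - g (x - y) - h *\<^sub>R g' (x - y)) * k y)"
      unfolding convol_def using int by (simp add: left_diff_distrib diff_add_eq add_diff_eq)
    also have "cmod \<dots> \<le> (LINT y|lborel. (B * h\<^sup>2) * cmod (k y))"
    proof (rule order_trans[OF integral_norm_bound integral_mono])
      show "integrable lborel (\<lambda>y. norm ((g (x - y + h) - g (x - y) - h *\<^sub>R g' (x - y)) * k y))"
        using int[of "x + h"] int[of x] by (intro integrable_norm) (simp add: left_diff_distrib diff_add_eq)
      show "integrable lborel (\<lambda>y. (B * h\<^sup>2) * cmod (k y))" using k by simp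
      show "norm ((g (x - y + h) - g (x - y) - h *\<^sub>R g' (x - y)) * k y) \<le> (B * h\<^sup>2) * cmod (k y)" for y
        unfolding norm_mult by (rule mult_right_mono[OF tay]) simp
    qed
    finally show ?thesis by (simp add: L1norm_def mult_ac)
  qed
  show ?thesis
    unfolding has_vector_derivative_def has_derivative_at
  proof (intro conjI bounded_linear_scaleR_left)
    show "(\<lambda>h. norm (convol g k (x + h) - convol g k x - h *\<^sub>R convol g' k x) / norm h) \<midarrow>0\<rightarrow> 0"
    proof (rule Lim_null_comparison[where g="\<lambda>h. (B * L1norm k) * \<bar>h\<bar>"])
      show "\<forall>\<^sub>F h in at 0. norm (norm (convol g k (x + h) - convol g k x - h *\<^sub>R convol g' k x) / norm h) \<le> B * L1norm k * \<bar>h\<bar>"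
        unfolding eventually_at_filter
        using est by (intro always_eventually) (auto simp: divide_le_eq power2_eq_square mult.assoc abs_mult_self_eq)
      show "(\<lambda>h. B * L1norm k * \<bar>h\<bar>) \<midarrow>0\<rightarrow> 0"
        by (auto intro!: tendsto_eq_intros)
    qed
  qed
qed

lemma
  assumes f: "f \<in> DL1" and k: "integrable lborel k"
  shows DL1_convol: "convol f k \<in> DL1"
    and iter_deriv_convol: "iter_deriv j (convol f k) = convol (iter_deriv j f) k"
proof -
  let ?G = "\<lambda>j. convol (iter_deriv j f) k"
  have d: "(?G j has_vector_derivative ?G (Suc j) t) (at t)" for j t
  proof -
    obtain B0 where B0: "\<And>x. cmod (iter_deriv j f x) \<le> B0" using DL1_bounded[OF f] by blast
    obtain B1 where B1: "\<And>x. cmod (iter_deriv (Suc j) f x) \<le> B1" using DL1_bounded[OF f] by blast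
    obtain B2 where B2: "\<And>x. cmod (iter_deriv (Suc (Suc j)) f x) \<le> B2" using DL1_bounded[OF f] by blast
    show ?thesis by (rule convol_has_vector_derivative[OF DL1_D(3)[OF f] DL1_D(3)[OF f] B0 B1 B2 k])
  qed
  show "convol f k \<in> DL1" by (rule DL1_I[of ?G, OF _ d]) (auto intro!: convol_integrable DL1_D(2) f k)
  show "iter_deriv j (convol f k) = ?G j" by (rule iter_deriv_eqI[where G="?G", OF _ d]) simp
qed

section \<open>The norms of W^{p,1}, which generate the topology of \<open>DL1\<close>, and
  convolution as a limit of translates\<close>

definition sobolev :: "nat \<Rightarrow> (real \<Rightarrow> complex) \<Rightarrow> real" where
  "sobolev p f = (\<Sum>j\<le>p. L1norm (iter_deriv j f))"

lemma sobolev_nonneg [simp]: "0 \<le> sobolev p f"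
  by (simp add: sobolev_def sum_nonneg)

lemma sobolev_reflect: "f \<in> DL1 \<Longrightarrow> sobolev p (\<lambda>t. f (a - t)) = sobolev p f"
  by (simp add: sobolev_def iter_deriv_reflect L1norm_mult L1norm_reflect norm_power)

lemma sobolev_mult: "f \<in> DL1 \<Longrightarrow> sobolev p (\<lambda>t. c * f t) = cmod c * sobolev p f"
  by (simp add: sobolev_def iter_deriv_mult L1norm_mult sum_distrib_left)

lemma DL1_diff:
  assumes f: "f \<in> DL1" and g: "g \<in> DL1"
  shows "(\<lambda>t. f t - g t) \<in> DL1"
  using DL1_add[OF f DL1_mult[OF g, of "-1"]] by simp

lemma iter_deriv_diff:
  assumes f: "f \<in> DL1" and g: "g \<in> DL1"
  shows "iter_deriv j (\<lambda>t. f t - g t) = (\<lambda>t. iter_deriv j f t - iter_deriv j g t)"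
  using iter_deriv_add[OF f DL1_mult[OF g, of "-1"], of j] iter_deriv_mult[OF g, of j "-1"] by simp

text \<open>Riemann sums with the integrals of \<open>k\<close> over small cells as weights: taking
  exact integrals keeps the sum of the absolute weights below \<open>L1norm k\<close> for a merely
  integrable \<open>k\<close>. In the norm of each derivative the error is the cell length times the
  norm of the next derivative, plus a share for the mass of \<open>k\<close> outside the retained
  cells.\<close>

lemma convol_approx:
  assumes f: "f \<in> DL1" and k: "integrable lborel k" and e: "e > 0"
  shows "\<exists>(I::int set) w y. finite I \<and> (\<Sum>i\<in>I. cmod (w i)) \<le> L1norm k \<and>
    sobolev p (\<lambda>x. convol f k x - (\<Sum>i\<in>I. w i * f (x - y i))) < e"
proof -
  have [measurable]: "k \<in> borel_measurable borel" using k by (auto dest: borel_measurable_integrable)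
  have fm [measurable]: "iter_deriv j f \<in> borel_measurable borel" for j by (rule DL1_D(4)[OF f])
  \<comment> \<open>\<open>c n y\<close> is the index of the cell of length \<open>1 / Suc n\<close>
    that contains \<open>y\<close>; the index set \<open>I n\<close> below retains the cells that
    cover \<open>[- Suc n, Suc n]\<close>.\<close>
  define c where "c n y = \<lfloor>real (Suc n) * y\<rfloor>" for n y
  have [measurable]: "c n \<in> measurable borel (count_space UNIV)" for n unfolding c_def by measurable
  define I where "I n = {- int (Suc n * Suc n)..int (Suc n * Suc n)}" for n
  have fin: "finite (I n)" for n by (simp add: I_def)
  define w where "w n i = (LINT y|lborel. of_bool (c n y = i) * k y)" for n i
  define y where "y n i = real_of_int i / real (Suc n)" for n i
  have wi: "integrable lborel (\<lambda>y. of_bool (c n y = i) * k y)" for n i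
    by (rule bounded_mult_integrable[OF _ _ k, of _ 1]) auto
  have w1: "(\<Sum>i\<in>I n. cmod (w n i)) \<le> L1norm k" for n
  proof -
    have "(\<Sum>i\<in>I n. cmod (w n i)) \<le> (\<Sum>i\<in>I n. (LINT y|lborel. cmod (of_bool (c n y = i) * k y)))"
      unfolding w_def by (intro sum_mono integral_norm_bound)
    also have "\<dots> = (LINT y|lborel. (\<Sum>i\<in>I n. cmod (of_bool (c n y = i) * k y)))"
      by (intro Bochner_Integration.integral_sum[symmetric] integrable_norm wi)
    also have "\<dots> \<le> (LINT y|lborel. cmod (k y))"
    proof (rule integral_mono)
      show "(\<Sum>i\<in>I n. cmod (of_bool (c n y = i) * k y)) \<le> cmod (k y)" for y
      proof -
        have "(\<Sum>i\<in>I n. cmod (of_bool (c n y = i) * k y)) = (\<Sum>i\<in>I n. if c n y = i then cmod (k y) else 0)"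
          by (intro sum.cong) (auto simp: norm_mult)
        then show ?thesis using fin by simp
      qed
    qed (use k in \<open>auto intro!: Bochner_Integration.integrable_sum integrable_norm wi\<close>)
    finally show ?thesis by (simp add: L1norm_def)
  qed
  define T where "T n = (LINT y|lborel. of_bool (c n y \<notin> I n) * cmod (k y))" for n
  have Ti: "integrable lborel (\<lambda>y. of_bool (c n y \<notin> I n) * cmod (k y))" for n
  proof -
    have "integrable lborel (\<lambda>y. of_bool (c n y \<notin> I n) * k y)"
      by (rule bounded_mult_integrable[OF _ _ k, of _ 1]) auto
    moreover have "cmod (of_bool (c n y \<notin> I n) * k y) = of_bool (c n y \<notin> I n) * cmod (k y)" for y
      by (simp add: norm_mult)
    ultimately show ?thesis using integrable_norm by fastforce
  qed
  have T0: "T \<longlonglongrightarrow> 0"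
  proof -
    have "T \<longlonglongrightarrow> integral\<^sup>L lborel (\<lambda>y::real. 0::real)"
      unfolding T_def
    proof (rule integral_dominated_convergence[where M=lborel and f="\<lambda>y. 0::real" and s="\<lambda>n y. of_bool (c n y \<notin> I n) * cmod (k y)" and w="\<lambda>y. cmod (k y)"])
      show "AE y in lborel. (\<lambda>n. of_bool (c n y \<notin> I n) * cmod (k y)) \<longlonglongrightarrow> 0"
      proof (intro always_eventually allI)
        fix y :: real
        obtain N :: nat where N: "\<bar>y\<bar> \<le> real N" using real_arch_simple by blast
        have "c n y \<in> I n" if n: "n \<ge> N" for n
        proof -
          have "\<bar>real (Suc n) * y\<bar> \<le> real (Suc n) * real n"
            using N n by (simp add: abs_mult mult_left_mono)
          then have "real (Suc n) * y \<le> real (Suc n * n)" "- real (Suc n * n) \<le> real (Suc n) * y"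
            unfolding of_nat_mult by linarith+
          then have "c n y \<le> int (Suc n * n)" "- int (Suc n * n) \<le> c n y"
            unfolding c_def by (simp_all only: floor_le_iff le_floor_iff)
          moreover have "int (Suc n * n) \<le> int (Suc n * Suc n)" by simp
          ultimately show ?thesis unfolding I_def by simp
        qed
        then have "\<forall>\<^sub>F n in sequentially. of_bool (c n y \<notin> I n) * cmod (k y) = 0"
          unfolding eventually_sequentially by auto
        then show "(\<lambda>n. of_bool (c n y \<notin> I n) * cmod (k y)) \<longlonglongrightarrow> 0"
          by (rule tendsto_eventually)
      qed
      show "integrable lborel (\<lambda>y. cmod (k y))" using k by simp
    qed auto
    then show ?thesis by simp
  qed
  let ?d = "\<lambda>n x. convol f k x - (\<Sum>i\<in>I n. w n i * f (x - y n i))"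
  have tr: "(\<lambda>x. f (x - a)) \<in> DL1" for a using DL1_translate[OF f, of "-a"] by simp
  have itr: "iter_deriv j (\<lambda>x. f (x - a)) = (\<lambda>x. iter_deriv j f (x - a))" for j a
    using iter_deriv_translate[OF f, of j "-a"] by simp
  have bnd: "L1norm (iter_deriv j (?d n)) \<le> L1norm (iter_deriv (Suc j) f) * L1norm k / real (Suc n) + L1norm (iter_deriv j f) * T n" for j n
  proof -
    let ?g = "iter_deriv j f"
    \<comment> \<open>In a retained cell this is the change from the translate by \<open>y\<close>
      to the translate by the left end of the cell; in a discarded cell it is the whole
      translate.\<close>
    define D where "D x y = ?g (x - y) - (if c n y \<in> I n then ?g (x - real_of_int (c n y) / real (Suc n)) else 0)" for x y
    have [measurable]: "(\<lambda>(x, y). D x y) \<in> borel_measurable (borel \<Otimes>\<^sub>M borel)" unfolding D_def by measurable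
    obtain B where B: "\<And>x. cmod (?g x) \<le> B" using DL1_bounded[OF f] by blast
    have B0: "0 \<le> B" using B[of 0] norm_ge_zero order_trans by blast
    have gi: "integrable lborel (\<lambda>y. ?g (x - y) * k y)" for x
      using B by (intro bounded_mult_integrable[OF _ _ k]) auto
    have ii: "integrable lborel (\<lambda>y. (if c n y \<in> I n then ?g (x - real_of_int (c n y) / real (Suc n)) else 0) * k y)" for x
      using B B0 by (intro bounded_mult_integrable[OF _ _ k, of _ B]) auto
    have "(\<Sum>i\<in>I n. w n i * ?g (x - y n i)) = (LINT y|lborel. (if c n y \<in> I n then ?g (x - real_of_int (c n y) / real (Suc n)) else 0) * k y)" for x
    proof -
      have "(\<Sum>i\<in>I n. w n i * ?g (x - y n i)) = (\<Sum>i\<in>I n. (LINT y|lborel. (of_bool (c n y = i) * k y) * ?g (x - real_of_int i / real (Suc n))))"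
        unfolding w_def y_def by (simp only: integral_mult_left_zero)
      also have "\<dots> = (LINT y|lborel. (\<Sum>i\<in>I n. (of_bool (c n y = i) * k y) * ?g (x - real_of_int i / real (Suc n))))"
        by (intro Bochner_Integration.integral_sum[symmetric] integrable_mult_left wi)
      also have "\<dots> = (LINT y|lborel. (if c n y \<in> I n then ?g (x - real_of_int (c n y) / real (Suc n)) else 0) * k y)"
      proof (rule Bochner_Integration.integral_cong[OF refl])
        fix y
        have "(\<Sum>i\<in>I n. (of_bool (c n y = i) * k y) * ?g (x - real_of_int i / real (Suc n))) =
          (\<Sum>i\<in>I n. if c n y = i then k y * ?g (x - real_of_int i / real (Suc n)) else 0)"
          by (intro sum.cong) auto
        then show "(\<Sum>i\<in>I n. (of_bool (c n y = i) * k y) * ?g (x - real_of_int i / real (Suc n))) =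
          (if c n y \<in> I n then ?g (x - real_of_int (c n y) / real (Suc n)) else 0) * k y"
          using fin by simp
      qed
      finally show ?thesis .
    qed
    moreover have "iter_deriv j (?d n) x = convol ?g k x - (\<Sum>i\<in>I n. w n i * ?g (x - y n i))" for x
      by (simp add: iter_deriv_diff DL1_convol[OF f k] DL1_sum[OF fin] DL1_mult tr iter_deriv_convol[OF f k]
          iter_deriv_sum[OF fin] iter_deriv_mult itr)
    ultimately have eq: "iter_deriv j (?d n) x = (LINT y|lborel. D x y * k y)" for x
      using gi[of x] ii[of x]
      by (simp add: convol_def D_def left_diff_distrib)
    have dDL: "?d n \<in> DL1" by (intro DL1_diff DL1_convol f k DL1_sum fin DL1_mult tr)
    have Dy: "(\<integral>\<^sup>+x. ennreal (cmod (D x y)) \<partial>lborel) \<le> ennreal (L1norm (iter_deriv (Suc j) f) / real (Suc n) + L1norm ?g * of_bool (c n y \<notin> I n))" for y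
    proof (cases "c n y \<in> I n")
      case True
      have "integrable lborel (\<lambda>x. D x y)"
        unfolding D_def using True integrable_translate[OF DL1_D(2)[OF f, of j], of "-y"]
          integrable_translate[OF DL1_D(2)[OF f, of j], of "- (real_of_int (c n y) / real (Suc n))"] by simp
      then have "(\<integral>\<^sup>+x. ennreal (cmod (D x y)) \<partial>lborel) = ennreal (L1norm (\<lambda>x. D x y))" by (rule L1norm_ennreal[symmetric])
      also have "L1norm (\<lambda>x. D x y) \<le> \<bar>- y - - (real_of_int (c n y) / real (Suc n))\<bar> * L1norm (iter_deriv (Suc j) f)"
        using L1norm_increment[OF DL1_D(3)[OF f] DL1_D(2)[OF f] DL1_D(2)[OF f], of j "-y" "- (real_of_int (c n y) / real (Suc n))"] True
        by (simp add: D_def)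
      also have "\<dots> \<le> (1 / real (Suc n)) * L1norm (iter_deriv (Suc j) f)"
      proof (rule mult_right_mono)
        have "real_of_int (c n y) \<le> real (Suc n) * y" "real (Suc n) * y \<le> real_of_int (c n y) + 1"
          unfolding c_def by linarith+
        then have "real_of_int (c n y) / real (Suc n) \<le> y" "y \<le> (real_of_int (c n y) + 1) / real (Suc n)"
          by (simp_all add: divide_le_eq le_divide_eq mult.commute del: of_nat_Suc)
        then show "\<bar>- y - - (real_of_int (c n y) / real (Suc n))\<bar> \<le> 1 / real (Suc n)"
          unfolding add_divide_distrib by linarith
      qed simp
      finally show ?thesis using True by (simp add: ennreal_leI)
    next
      case False
      then have "(\<integral>\<^sup>+x. ennreal (cmod (D x y)) \<partial>lborel) = ennreal (L1norm (\<lambda>x. ?g (x - y)))"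
        unfolding D_def using integrable_translate[OF DL1_D(2)[OF f, of j], of "-y"] by (simp add: L1norm_ennreal)
      also have "L1norm (\<lambda>x. ?g (x - y)) = L1norm ?g" by (rule L1norm_translate')
      finally show ?thesis using False by (simp add: ennreal_leI)
    qed
    have "ennreal (L1norm (iter_deriv j (?d n))) = (\<integral>\<^sup>+x. ennreal (cmod (LINT y|lborel. D x y * k y)) \<partial>lborel)"
      using L1norm_ennreal[OF DL1_D(2)[OF dDL, of j]] by (simp add: eq)
    also have "\<dots> \<le> (\<integral>\<^sup>+x. (\<integral>\<^sup>+y. ennreal (cmod (D x y)) * ennreal (cmod (k y)) \<partial>lborel) \<partial>lborel)"
    proof (rule nn_integral_mono)
      fix x
      have "integrable lborel (\<lambda>y. D x y * k y)"
        unfolding D_def left_diff_distrib using gi ii by (intro Bochner_Integration.integrable_diff)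
      then have "ennreal (cmod (LINT y|lborel. D x y * k y)) \<le> (\<integral>\<^sup>+y. ennreal (cmod (D x y * k y)) \<partial>lborel)"
        by (rule integral_norm_bound_ennreal)
      then show "ennreal (cmod (LINT y|lborel. D x y * k y)) \<le> (\<integral>\<^sup>+y. ennreal (cmod (D x y)) * ennreal (cmod (k y)) \<partial>lborel)"
        by (simp add: norm_mult ennreal_mult)
    qed
    also have "\<dots> = (\<integral>\<^sup>+y. (\<integral>\<^sup>+x. ennreal (cmod (D x y)) * ennreal (cmod (k y)) \<partial>lborel) \<partial>lborel)"
      by (rule lborel_pair.Fubini') measurable
    also have "\<dots> = (\<integral>\<^sup>+y. (\<integral>\<^sup>+x. ennreal (cmod (D x y)) \<partial>lborel) * ennreal (cmod (k y)) \<partial>lborel)"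
      by (intro nn_integral_cong nn_integral_multc) measurable
    also have "\<dots> \<le> (\<integral>\<^sup>+y. ennreal (L1norm (iter_deriv (Suc j) f) / real (Suc n) + L1norm ?g * of_bool (c n y \<notin> I n)) * ennreal (cmod (k y)) \<partial>lborel)"
      by (intro nn_integral_mono mult_right_mono Dy) simp
    also have "\<dots> = (\<integral>\<^sup>+y. ennreal (L1norm (iter_deriv (Suc j) f) / real (Suc n) * cmod (k y) + L1norm ?g * (of_bool (c n y \<notin> I n) * cmod (k y))) \<partial>lborel)"
      by (intro nn_integral_cong) (simp add: ennreal_mult[symmetric] distrib_right mult.assoc)
    also have "\<dots> = ennreal (LINT y|lborel. L1norm (iter_deriv (Suc j) f) / real (Suc n) * cmod (k y) + L1norm ?g * (of_bool (c n y \<notin> I n) * cmod (k y)))"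
      using k Ti by (intro nn_integral_eq_integral) auto
    also have "(LINT y|lborel. L1norm (iter_deriv (Suc j) f) / real (Suc n) * cmod (k y) + L1norm ?g * (of_bool (c n y \<notin> I n) * cmod (k y))) =
       L1norm (iter_deriv (Suc j) f) * L1norm k / real (Suc n) + L1norm ?g * T n"
      using k Ti[of n] unfolding T_def L1norm_def[of k]
      by (subst Bochner_Integration.integral_add) (simp_all del: of_nat_Suc)
    finally show ?thesis
    proof (subst (asm) ennreal_le_iff)
      have "0 \<le> T n" unfolding T_def by (intro Bochner_Integration.integral_nonneg) auto
      then show "0 \<le> L1norm (iter_deriv (Suc j) f) * L1norm k / real (Suc n) + L1norm ?g * T n" by simp
    qed
  qed
  have "(\<lambda>n. \<Sum>j\<le>p. L1norm (iter_deriv (Suc j) f) * L1norm k / real (Suc n) + L1norm (iter_deriv j f) * T n) \<longlonglongrightarrow> (\<Sum>j\<le>p. 0 + L1norm (iter_deriv j f) * 0)"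
    by (intro tendsto_sum tendsto_add tendsto_mult tendsto_const T0 LIMSEQ_Suc[OF lim_const_over_n])
  then have "(\<lambda>n. \<Sum>j\<le>p. L1norm (iter_deriv (Suc j) f) * L1norm k / real (Suc n) + L1norm (iter_deriv j f) * T n) \<longlonglongrightarrow> 0" by simp
  from order_tendstoD(2)[OF this e] obtain n where
    n: "(\<Sum>j\<le>p. L1norm (iter_deriv (Suc j) f) * L1norm k / real (Suc n) + L1norm (iter_deriv j f) * T n) < e"
    unfolding eventually_sequentially by blast
  have "sobolev p (?d n) < e"
    unfolding sobolev_def by (rule le_less_trans[OF sum_mono[OF bnd] n])
  then show ?thesis using fin[of n] w1[of n] by (intro exI[of _ "I n"] exI[of _ "w n"] exI[of _ "y n"]) simp
qed

text \<open>Continuity is given along null sequences only. If no single Sobolev norm bounded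
  \<open>S\<close>, there would be functions violating the bound with constant and order both
  \<open>n\<close>; scaled so that \<open>S\<close> has norm 1 on them, they form a null
  sequence.\<close>

lemma DL1_dual_bound:
  assumes S: "S \<in> DL1_dual"
  obtains C p where "0 \<le> C" "\<And>f. f \<in> DL1 \<Longrightarrow> norm (S f) \<le> C * sobolev p f"
proof (rule ccontr)
  assume no: "\<not> thesis"
  have "\<exists>f. f \<in> DL1 \<and> norm (S f) > real n * sobolev n f" for n
    using that[of "real n" n] no by (meson not_le of_nat_0_le_iff)
  then obtain F where F: "\<And>n. F n \<in> DL1" "\<And>n. norm (S (F n)) > real n * sobolev n (F n)" by metis
  have pos: "norm (S (F n)) > 0" for n
    using F(2)[of n] sobolev_nonneg[of n "F n"] by (smt (verit) mult_nonneg_nonneg of_nat_0_le_iff)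
  define c where "c n = complex_of_real (1 / norm (S (F n)))" for n
  define G where "G n = (\<lambda>t. c n * F n t)" for n
  have cn: "cmod (c n) = 1 / norm (S (F n))" for n using pos[of n] by (simp add: c_def norm_divide)
  have GD: "G n \<in> DL1" for n unfolding G_def by (intro DL1_mult F)
  have "S (G n) = c n *\<^sub>C S (F n)" for n using S F(1) by (simp add: DL1_dual_def G_def)
  then have SG: "norm (S (G n)) = 1" for n using pos[of n] by (simp add: norm_scaleC cn)
  have nG: "real n * sobolev n (G n) \<le> 1" for n
  proof -
    have "real n * sobolev n (G n) = (real n * sobolev n (F n)) / norm (S (F n))"
      by (simp add: G_def sobolev_mult F cn)
    also have "\<dots> \<le> 1" using F(2)[of n] pos[of n] by (simp add: divide_le_eq)
    finally show ?thesis .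
  qed
  have "DL1_null G"
    unfolding DL1_null_def
  proof (intro conjI allI GD)
    fix j
    have lim: "(\<lambda>n. 1 / real n) \<longlonglongrightarrow> 0" by (rule lim_1_over_n)
    show "(\<lambda>n. LINT t|lborel. cmod (iter_deriv j (G n) t)) \<longlonglongrightarrow> 0"
    proof (rule tendsto_sandwich[OF _ _ tendsto_const lim])
      show "\<forall>\<^sub>F n in sequentially. (LINT t|lborel. cmod (iter_deriv j (G n) t)) \<le> 1 / real n"
        \<comment> \<open>From \<open>Suc j\<close> on, the seminorm of order \<open>j\<close> is a
          summand of \<open>sobolev n\<close>, and \<open>n\<close> is positive.\<close>
        using eventually_ge_at_top[of "Suc j"]
      proof eventually_elim
        case (elim n)
        have "L1norm (iter_deriv j (G n)) \<le> sobolev n (G n)"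
          unfolding sobolev_def using elim by (intro member_le_sum) auto
        also have "\<dots> \<le> 1 / real n" using nG[of n] elim by (simp add: le_divide_eq mult.commute)
        finally show ?case by (simp add: L1norm_def)
      qed
    qed (auto intro!: always_eventually Bochner_Integration.integral_nonneg)
  qed
  then have "(\<lambda>n. S (G n)) \<longlonglongrightarrow> 0" using S by (simp add: DL1_dual_def)
  then have "(\<lambda>n. norm (S (G n))) \<longlonglongrightarrow> 0" by (simp add: tendsto_norm_zero)
  then show False unfolding SG by (simp add: LIMSEQ_const_iff)
qed

section \<open>Test functions and extensions of distributions\<close>

definition test_within :: "real \<Rightarrow> (real \<Rightarrow> complex) \<Rightarrow> bool" where
  "test_within B f \<longleftrightarrow> smooth f \<and> 0 < B \<and> (\<forall>t. B < \<bar>t\<bar> \<longrightarrow> f t = 0)"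

lemma test_functions_iff: "f \<in> test_functions \<longleftrightarrow> (\<exists>B. test_within B f)"
proof
  assume f: "f \<in> test_functions"
  then have "bounded (closure {t. f t \<noteq> 0})" by (simp add: test_functions_def compact_imp_bounded)
  then obtain B where B: "\<And>t. t \<in> closure {t. f t \<noteq> 0} \<Longrightarrow> norm t \<le> B" by (auto simp: bounded_iff)
  have "f t = 0" if "max 1 B < \<bar>t\<bar>" for t
    using B[of t] that closure_subset[of "{t. f t \<noteq> 0}"] by force
  then have "test_within (max 1 B) f" using f by (auto simp: test_within_def test_functions_def)
  then show "\<exists>B. test_within B f" by blast
next
  assume "\<exists>B. test_within B f"
  then obtain B where B: "test_within B f" by blast
  then have "{t. f t \<noteq> 0} \<subseteq> {-B..B}" by (force simp: test_within_def)
  then have "bounded {t. f t \<noteq> 0}" using bounded_subset bounded_closed_interval by blast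
  then show "f \<in> test_functions" using B by (auto simp: test_functions_def test_within_def compact_eq_bounded_closed)
qed

text \<open>The end points \<open>\<bar>t\<bar> = B\<close> are included, by continuity from
  outside: they are the boundary terms in the integrations by parts.\<close>

lemma test_within_iter_deriv:
  assumes f: "test_within B f" and t: "B \<le> \<bar>t\<bar>"
  shows "iter_deriv j f t = 0"
proof -
  have out: "iter_deriv j f t = 0" if "B < \<bar>t\<bar>" for j t
    using that
  proof (induction j arbitrary: t)
    case 0 then show ?case using f by (simp add: test_within_def)
  next
    case (Suc j)
    have o: "open {t::real. B < \<bar>t\<bar>}" by (intro open_Collect_less continuous_intros)
    have "(iter_deriv j f has_vector_derivative 0) (at t)"
      by (rule has_vector_derivative_transform_within_open[OF has_vector_derivative_const o])
        (use Suc in auto)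
    then show ?case using vector_derivative_at by (auto simp: iter_deriv_Suc)
  qed
  show ?thesis
  proof (cases "B < \<bar>t\<bar>")
    case False
    with t have t': "\<bar>t\<bar> = B" by simp
    have B: "0 < B" using f by (simp add: test_within_def)
    have "(\<lambda>n. iter_deriv j f (t * (1 + 1 / real (Suc n)))) \<longlonglongrightarrow> iter_deriv j f (t * (1 + 0))"
    proof (rule continuous_on_tendsto_compose[of UNIV "iter_deriv j f"])
      show "continuous_on UNIV (iter_deriv j f)" using f by (simp add: test_within_def smooth_continuous)
      show "(\<lambda>n. t * (1 + 1 / real (Suc n))) \<longlonglongrightarrow> t * (1 + 0)"
        by (intro tendsto_intros LIMSEQ_Suc[OF lim_1_over_n])
    qed auto
    moreover have "iter_deriv j f (t * (1 + 1 / real (Suc n))) = 0" for n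
    proof (rule out)
      have "B * 1 < B * (1 + 1 / real (Suc n))" using B by (intro mult_strict_left_mono) auto
      then show "B < \<bar>t * (1 + 1 / real (Suc n))\<bar>" using t' by (simp add: abs_mult)
    qed
    ultimately show ?thesis by (simp add: LIMSEQ_const_iff)
  qed (rule out)
qed

lemma compact_support_integrable:
  fixes g :: "real \<Rightarrow> complex"
  assumes c: "continuous_on UNIV g" and z: "\<And>t. B < \<bar>t\<bar> \<Longrightarrow> g t = 0"
  shows "integrable lborel g"
proof -
  have "set_integrable lborel {-B..B} g"
    by (intro borel_integrable_atLeastAtMost' continuous_on_subset[OF c]) auto
  moreover have "(\<lambda>t. indicator {-B..B} t *\<^sub>R g t) = g"
    using z by (auto simp: fun_eq_iff indicator_def)
  ultimately show ?thesis by (simp add: set_integrable_def)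
qed

lemma test_within_DL1: "test_within B f \<Longrightarrow> f \<in> DL1"
  unfolding DL1_def
  by (auto simp: test_within_def intro!: compact_support_integrable[of _ B] smooth_continuous test_within_iter_deriv[of B])

lemma test_within_deriv: "test_within B f \<Longrightarrow> test_within B (iter_deriv 1 f)"
  using test_within_iter_deriv[of B f _ 1] DL1_D(1)[OF DL1_deriv[OF test_within_DL1]]
  by (auto simp: test_within_def)

lemma test_within_by_parts:
  fixes f :: "real \<Rightarrow> 'a::complex_banach"
  assumes t: "test_within B r" and f: "loc_int f"
  shows "integral {-B..B} (\<lambda>t. r t *\<^sub>C f t) = - integral {-B..B} (\<lambda>t. iter_deriv 1 r t *\<^sub>C (primitive f t + y))"
proof -
  let ?r = "\<lambda>z. r (0 - z)" and ?r' = "\<lambda>z. - iter_deriv 1 r (- z)"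
  have rD: "r \<in> DL1" using t by (rule test_within_DL1)
  have d: "(?r has_vector_derivative ?r' z) (at z)" for z
    using DL1_D(3)[OF DL1_reflect[OF rD, of 0], of 0 z] iter_deriv_reflect[OF rD, of 1 0] by simp
  have c: "continuous_on UNIV ?r'"
    using t by (intro continuous_intros continuous_on_compose2[OF smooth_continuous[of r UNIV 1]]) (auto simp: test_within_def)
  have z: "?r B = 0" "?r (-B) = 0" using test_within_iter_deriv[OF t, of _ 0] t by (auto simp: test_within_def)
  have "trunc_conv B f ?r 0 = integral {-B..B} (\<lambda>z. ?r' z *\<^sub>C (primitive f (0 - z) + y))"
    by (rule trunc_conv_by_parts[OF f _ d c z]) (use t in \<open>simp add: test_within_def\<close>)
  moreover have "trunc_conv B f ?r 0 = integral {-B..B} (\<lambda>t. r t *\<^sub>C f t)"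
    using integral_reflect_translate[of B "\<lambda>t. r t *\<^sub>C f t" 0] by (simp add: trunc_conv_def)
  moreover have "integral {-B..B} (\<lambda>z. ?r' z *\<^sub>C (primitive f (0 - z) + y)) =
      integral {-B..B} (\<lambda>t. - (iter_deriv 1 r t *\<^sub>C (primitive f t + y)))"
    using integral_reflect_translate[of B "\<lambda>t. - (iter_deriv 1 r t *\<^sub>C (primitive f t + y))" 0]
    by (simp add: scaleC.minus_left)
  ultimately show ?thesis by simp
qed

lemma DL1_dual_I:
  fixes S :: "(real \<Rightarrow> complex) \<Rightarrow> 'a::complex_banach"
  assumes "\<And>f g. f \<in> DL1 \<Longrightarrow> g \<in> DL1 \<Longrightarrow> S (\<lambda>t. f t + g t) = S f + S g"
    and "\<And>c f. f \<in> DL1 \<Longrightarrow> S (\<lambda>t. c * f t) = c *\<^sub>C S f"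
    and b: "\<And>f. f \<in> DL1 \<Longrightarrow> norm (S f) \<le> C * L1norm f"
  shows "S \<in> DL1_dual"
  unfolding DL1_dual_def
proof (intro CollectI conjI ballI allI impI assms)
  fix F assume F: "DL1_null F"
  have lim: "(\<lambda>k. C * (LINT t|lborel. cmod (iter_deriv 0 (F k) t))) \<longlonglongrightarrow> C * 0"
    using F unfolding DL1_null_def by (intro tendsto_mult tendsto_const) blast
  show "(\<lambda>k. S (F k)) \<longlonglongrightarrow> 0"
  proof (rule Lim_null_comparison)
    show "\<forall>\<^sub>F k in sequentially. norm (S (F k)) \<le> C * (LINT t|lborel. cmod (iter_deriv 0 (F k) t))"
      using b F by (intro always_eventually) (auto simp: DL1_null_def L1norm_def)
    show "(\<lambda>k. C * (LINT t|lborel. cmod (iter_deriv 0 (F k) t))) \<longlonglongrightarrow> 0" using lim by simp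
  qed
qed

definition bdd_cont :: "(real \<Rightarrow> 'a::complex_banach) \<Rightarrow> bool" where
  "bdd_cont f \<longleftrightarrow> bounded (range f) \<and> continuous_on UNIV f"

text \<open>The extension is the improper integral of \<open>r\<close> against \<open>f\<close>. It
  converges because the increments of the truncated integrals are dominated by \<open>C\<close>
  times the increments of the truncated integrals of the modulus of \<open>r\<close>, which increase
  and are bounded by \<open>L1norm r\<close>.\<close>

lemma has_DL1_extension_bdd_cont:
  fixes f :: "real \<Rightarrow> 'a::complex_banach"
  assumes f: "bdd_cont f"
  shows "\<exists>S\<in>DL1_dual. \<forall>B r. test_within B r \<longrightarrow> S r = integral {-B..B} (\<lambda>t. r t *\<^sub>C f t)"
proof -
  obtain C where C: "C > 0" "\<And>t. norm (f t) \<le> C" using f by (auto simp: bdd_cont_def bounded_pos)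
  have fc: "continuous_on S f" for S using f continuous_on_subset by (auto simp: bdd_cont_def)
  define I where "I r n = integral {- real n..real n} (\<lambda>t. r t *\<^sub>C f t)" for r n
  define V where "V r n = integral {- real n..real n} (\<lambda>t. cmod (r t))" for r :: "real \<Rightarrow> complex" and n
  have rc: "continuous_on S r" if "r \<in> DL1" for r S using smooth_continuous[OF DL1_D(1)[OF that], of S 0] by simp
  have ri: "(\<lambda>t. r t *\<^sub>C f t) integrable_on {a..b}" if "r \<in> DL1" for r a b
    using that by (intro integrable_continuous_real continuous_intros fc rc)
  have ni: "(\<lambda>t. cmod (r t)) integrable_on {a..b}" if "r \<in> DL1" for r a b
    using that by (intro integrable_continuous_real continuous_intros rc)
  have Vb: "V r n \<le> L1norm r" if r: "r \<in> DL1" for r n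
  proof -
    have si: "set_integrable lborel {- real n..real n} (\<lambda>t. cmod (r t))"
      unfolding set_integrable_def using DL1_integrable[OF r] by (intro integrable_mult_indicator) auto
    have "V r n = (LINT t:{- real n..real n}|lborel. cmod (r t))"
      unfolding V_def using set_borel_integral_eq_integral(2)[OF si] by simp
    also have "\<dots> \<le> L1norm r"
      unfolding set_lebesgue_integral_def L1norm_def
      using si DL1_integrable[OF r] by (intro integral_mono) (auto simp: set_integrable_def indicator_def)
    finally show ?thesis .
  qed
  have step: "norm (integral {a..b} (\<lambda>t. r t *\<^sub>C f t)) \<le> C * integral {a..b} (\<lambda>t. cmod (r t))" if r: "r \<in> DL1" for r a b
  proof -
    have "norm (integral {a..b} (\<lambda>t. r t *\<^sub>C f t)) \<le> integral {a..b} (\<lambda>t. C * cmod (r t))"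
      by (rule integral_norm_bound_integral[OF ri[OF r]])
        (use ni[OF r, of a b] C in \<open>auto simp: norm_scaleC mult.commute[of C] intro!: mult_left_mono integrable_on_cmult_left\<close>)
    then show ?thesis by simp
  qed
  have diff: "norm (I r m - I r n) \<le> C * (V r m - V r n)" if r: "r \<in> DL1" and nm: "n \<le> m" for r n m
  proof -
    have 1: "integral {- real m..real m} g = integral {- real m..- real n} g + integral {- real n..real n} g + integral {real n..real m} g"
      if "\<And>a b. g integrable_on {a..b}" for g :: "real \<Rightarrow> 'c::banach"
    proof -
      have "integral {- real m..- real n} g + integral {- real n..real m} g = integral {- real m..real m} g"
        "integral {- real n..real n} g + integral {real n..real m} g = integral {- real n..real m} g"
        using that nm by (auto intro!: Henstock_Kurzweil_Integration.integral_combine)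
      then show ?thesis by (metis add.assoc)
    qed
    have "I r m - I r n = integral {- real m..- real n} (\<lambda>t. r t *\<^sub>C f t) + integral {real n..real m} (\<lambda>t. r t *\<^sub>C f t)"
      unfolding I_def 1[of "\<lambda>t. r t *\<^sub>C f t", OF ri[OF r]] by simp
    also have "norm \<dots> \<le> C * integral {- real m..- real n} (\<lambda>t. cmod (r t)) + C * integral {real n..real m} (\<lambda>t. cmod (r t))"
      by (intro norm_triangle_le add_mono step r)
    also have "\<dots> = C * (V r m - V r n)"
      unfolding V_def 1[of "\<lambda>t. cmod (r t)", OF ni[OF r]] by (simp add: algebra_simps)
    finally show ?thesis .
  qed
  have conv: "convergent (I r)" if r: "r \<in> DL1" for r
  proof -
    have "incseq (V r)"
      unfolding V_def incseq_def by (auto intro!: integral_subset_le ni[OF r])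
    then have "convergent (V r)"
    proof (intro Bseq_mono_convergent BseqI'[of _ "L1norm r"])
      have "0 \<le> V r n" for n unfolding V_def by (intro integral_nonneg ni[OF r]) auto
      then show "norm (V r n) \<le> L1norm r" for n using Vb[OF r, of n] by simp
    qed (auto simp: incseq_def)
    then have "Cauchy (V r)" by (rule convergent_Cauchy)
    have "Cauchy (I r)"
    proof (rule metric_CauchyI)
      fix e :: real assume e: "e > 0"
      then have "e / C > 0" using C by simp
      then obtain N where N: "\<And>m n. m \<ge> N \<Longrightarrow> n \<ge> N \<Longrightarrow> dist (V r m) (V r n) < e / C"
        using metric_CauchyD[OF \<open>Cauchy (V r)\<close>] by blast
      have *: "dist (I r m) (I r n) < e" if "n \<ge> N" "m \<ge> n" for m n
      proof -
        have "C * (V r m - V r n) \<le> C * dist (V r m) (V r n)" using C by (simp add: dist_real_def)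
        also have "\<dots> < e" using N[of m n] that C by (simp add: less_divide_eq mult.commute)
        finally show ?thesis using diff[OF r that(2)] by (simp add: dist_norm)
      qed
      show "\<exists>M. \<forall>m\<ge>M. \<forall>n\<ge>M. dist (I r m) (I r n) < e"
        using * by (metis dist_commute nat_le_linear)
    qed
    then show ?thesis by (rule Cauchy_convergent)
  qed
  define S where "S r = lim (I r)" for r
  have S: "I r \<longlonglongrightarrow> S r" if "r \<in> DL1" for r
    using conv[OF that] by (simp add: S_def convergent_LIMSEQ_iff)
  have "S \<in> DL1_dual"
  proof (rule DL1_dual_I)
    fix r s assume r: "r \<in> DL1" and s: "s \<in> DL1"
    have "I (\<lambda>t. r t + s t) n = I r n + I s n" for n
      unfolding I_def by (simp add: scaleC.add_left Henstock_Kurzweil_Integration.integral_add ri r s)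
    then have "I (\<lambda>t. r t + s t) = (\<lambda>n. I r n + I s n)" by auto
    then show "S (\<lambda>t. r t + s t) = S r + S s"
      using S[OF DL1_add[OF r s]] tendsto_add[OF S[OF r] S[OF s]] LIMSEQ_unique by auto
  next
    fix c r assume r: "r \<in> DL1"
    have "I (\<lambda>t. c * r t) n = c *\<^sub>C I r n" for n
      unfolding I_def by (simp add: scaleC_scaleC[symmetric] integral_scaleC_right ri r)
    then have "I (\<lambda>t. c * r t) = (\<lambda>n. c *\<^sub>C I r n)" by auto
    then show "S (\<lambda>t. c * r t) = c *\<^sub>C S r"
      using S[OF DL1_mult[OF r, of c]] scaleC.tendsto[OF tendsto_const S[OF r], of c] LIMSEQ_unique by auto
  next
    fix r assume r: "r \<in> DL1"
    have "norm (I r n) \<le> C * L1norm r" for n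
      using order_trans[OF step[OF r] mult_left_mono[OF Vb[OF r, unfolded V_def]]] C(1) unfolding I_def by simp
    then show "norm (S r) \<le> C * L1norm r"
      using Lim_norm_ubound[OF _ S[OF r]] by auto
  qed
  moreover have "S r = integral {-B..B} (\<lambda>t. r t *\<^sub>C f t)" if r: "test_within B r" for B r
  proof -
    have rD: "r \<in> DL1" using test_within_DL1[OF r] .
    obtain N :: nat where N: "B \<le> real N" using real_arch_simple by blast
    have "I r n = integral {-B..B} (\<lambda>t. r t *\<^sub>C f t)" if "n \<ge> N" for n
      unfolding I_def
    proof (rule integral_spike_set)
      have "{x \<in> {- real n..real n} - {-B..B}. r x *\<^sub>C f x \<noteq> 0} = {}"
        using r unfolding test_within_def by (smt (verit) Collect_empty_eq DiffD2 atLeastAtMost_iff scaleC.zero_left)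
      then show "negligible {x \<in> {- real n..real n} - {-B..B}. r x *\<^sub>C f x \<noteq> 0}" by (simp only: negligible_empty)
      have "{x \<in> {-B..B} - {- real n..real n}. r x *\<^sub>C f x \<noteq> 0} = {}" using N that by auto
      then show "negligible {x \<in> {-B..B} - {- real n..real n}. r x *\<^sub>C f x \<noteq> 0}" by (simp only: negligible_empty)
    qed
    then have "I r \<longlonglongrightarrow> integral {-B..B} (\<lambda>t. r t *\<^sub>C f t)"
      by (intro tendsto_eventually) (auto simp: eventually_sequentially)
    then show ?thesis using S[OF rD] LIMSEQ_unique by blast
  qed
  ultimately show ?thesis by blast
qed

text \<open>\<open>f = M\<^sub>1 f - K'\<close> with \<open>K(t) = \<integral>\<^sub>0\<^sup>1 window u f t du\<close> reduces the number of means by one at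
  the cost of a derivative on the test function.\<close>

lemma has_DL1_extension:
  fixes f :: "real \<Rightarrow> 'a::complex_banach"
  assumes "loc_int f" "iter_window bdd_cont m f"
  shows "\<exists>S\<in>DL1_dual. \<forall>B r. test_within B r \<longrightarrow> S r = integral {-B..B} (\<lambda>t. r t *\<^sub>C f t)"
  using assms
proof (induction m arbitrary: f)
  case 0
  then show ?case using has_DL1_extension_bdd_cont by simp
next
  case (Suc m)
  let ?M = "window 1 f" and ?E = "window_avg 1 (\<lambda>_. 1) f"
  have one: "continuous_on UNIV (\<lambda>_::real. 1::complex)" by (intro continuous_intros)
  have U: "forward_closed UNIV" by (simp add: forward_closed_def)
  have M: "loc_int ?M" "iter_window bdd_cont m ?M"
    using Suc.prems by (auto simp: window_loc_int iter_window_Suc)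
  have E: "loc_int ?E" "iter_window bdd_cont m ?E"
  proof -
    show "loc_int ?E" by (intro loc_int_continuous window_avg_continuous Suc.prems one)
    show "iter_window bdd_cont m ?E"
    proof (rule iter_window_window_avg[OF _ one _ Suc.prems])
      show "bdd_cont (window_avg 1 (\<lambda>_. 1) L)" if "loc_int L" "\<And>u. u > 0 \<Longrightarrow> bdd_cont (window u L)" for L :: "real \<Rightarrow> 'a"
        using that window_avg_bounded_uc(1)[OF U that(1) one] window_avg_continuous[OF that(1) one] by (simp add: bdd_cont_def)
    qed simp
  qed
  obtain S1 where S1: "S1 \<in> DL1_dual" "\<And>B r. test_within B r \<Longrightarrow> S1 r = integral {-B..B} (\<lambda>t. r t *\<^sub>C ?M t)"
    using Suc.IH[OF M] by blast
  obtain S2 where S2: "S2 \<in> DL1_dual" "\<And>B r. test_within B r \<Longrightarrow> S2 r = integral {-B..B} (\<lambda>t. r t *\<^sub>C ?E t)"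
    using Suc.IH[OF E] by blast
  \<comment> \<open>Pairing \<open>r\<close> with \<open>- K'\<close> moves the derivative to
    \<open>r\<close>; hence the plus sign in front of \<open>S2\<close>.\<close>
  define S where "S r = S1 r + S2 (iter_deriv 1 r)" for r
  have "S \<in> DL1_dual"
    unfolding DL1_dual_def
  proof (intro CollectI conjI ballI allI impI)
    fix r s assume rs: "r \<in> DL1" "s \<in> DL1"
    then show "S (\<lambda>t. r t + s t) = S r + S s"
      using S1(1) S2(1) DL1_deriv[OF rs(1)] DL1_deriv[OF rs(2)]
      by (simp add: S_def iter_deriv_add DL1_dual_def del: One_nat_def)
  next
    fix c r assume r: "r \<in> DL1"
    then show "S (\<lambda>t. c * r t) = c *\<^sub>C S r"
      using S1(1) S2(1) DL1_deriv[OF r]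
      by (simp add: S_def iter_deriv_mult DL1_dual_def scaleC_add_right del: One_nat_def)
  next
    fix F assume F: "DL1_null F"
    then have FD: "F k \<in> DL1" for k by (simp add: DL1_null_def)
    have "DL1_null (\<lambda>k. iter_deriv 1 (F k))"
      using F FD unfolding DL1_null_def by (auto simp: iter_deriv_deriv DL1_deriv simp del: One_nat_def)
    then have "(\<lambda>k. S1 (F k)) \<longlonglongrightarrow> 0" "(\<lambda>k. S2 (iter_deriv 1 (F k))) \<longlonglongrightarrow> 0"
      using S1(1) S2(1) F unfolding DL1_dual_def by blast+
    from tendsto_add[OF this] show "(\<lambda>k. S (F k)) \<longlonglongrightarrow> 0" by (simp add: S_def)
  qed
  moreover have "S r = integral {-B..B} (\<lambda>t. r t *\<^sub>C f t)" if r: "test_within B r" for B r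
  proof -
    let ?P = "primitive f" and ?r' = "iter_deriv 1 r"
    have lP: "loc_int ?P" by (intro loc_int_continuous primitive_continuous Suc.prems)
    have r'c: "continuous_on S ?r'" for S using r by (simp add: test_within_def smooth_continuous)
    have Eeq: "?E t = window 1 ?P t - ?P t" for t
    proof -
      have "?E t = integral {0..1} (\<lambda>u. ?P (t + u) - ?P t)"
        unfolding window_avg_def by (rule integral_cong) (use Suc.prems(1) in \<open>simp add: window_primitive scaleC_of_real[of 1, simplified]\<close>)
      also have "\<dots> = integral {0..1} (\<lambda>u. ?P (t + u)) - integral {0..1} (\<lambda>u::real. ?P t)"
        by (intro Henstock_Kurzweil_Integration.integral_diff integrable_continuous_real continuous_intros Suc.prems)
      finally show ?thesis by (simp add: integral_shift_Icc window_def)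
    qed
    \<comment> \<open>\<open>?E\<close> is \<open>window 1 ?P - ?P\<close>. Integrating the first
      summand by parts produces \<open>- window 1 ?P\<close> against \<open>?r'\<close>, which
      cancels with the same term from \<open>?E\<close>; the remainder is the integration by parts
      of \<open>f\<close> itself.\<close>
    have "integral {-B..B} (\<lambda>t. r t *\<^sub>C ?M t) = - integral {-B..B} (\<lambda>t. ?r' t *\<^sub>C (primitive ?M t + window 1 ?P 0))"
      by (rule test_within_by_parts[OF r M(1)])
    also have "(\<lambda>t. primitive ?M t + window 1 ?P 0) = window 1 ?P"
      using primitive_window[OF Suc.prems(1), of 1] by auto
    then have "(\<lambda>t. ?r' t *\<^sub>C (primitive ?M t + window 1 ?P 0)) = (\<lambda>t. ?r' t *\<^sub>C window 1 ?P t)" by metis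
    finally have 1: "S1 r = - integral {-B..B} (\<lambda>t. ?r' t *\<^sub>C window 1 ?P t)" using S1(2)[OF r] by simp
    have "S2 ?r' = integral {-B..B} (\<lambda>t. ?r' t *\<^sub>C window 1 ?P t - ?r' t *\<^sub>C ?P t)"
      using S2(2)[OF test_within_deriv[OF r]] by (simp add: Eeq scaleC.diff_right)
    also have "\<dots> = integral {-B..B} (\<lambda>t. ?r' t *\<^sub>C window 1 ?P t) - integral {-B..B} (\<lambda>t. ?r' t *\<^sub>C ?P t)"
      by (intro Henstock_Kurzweil_Integration.integral_diff integrable_continuous_real continuous_intros r'c
          continuous_on_subset[OF window_continuous[OF lP]] Suc.prems) auto
    finally have "S r = - integral {-B..B} (\<lambda>t. ?r' t *\<^sub>C (?P t + 0))" unfolding S_def 1 by simp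
    then show ?thesis using test_within_by_parts[OF r Suc.prems(1), of 0] by simp
  qed
  ultimately show ?case by blast
qed

section \<open>Smooth functions of compact support\<close>

primrec diff_times :: "nat \<Rightarrow> (real \<Rightarrow> complex) \<Rightarrow> bool" where
  "diff_times 0 f = True"
| "diff_times (Suc n) f = ((\<forall>t. f differentiable at t) \<and> diff_times n (\<lambda>t. vector_derivative f (at t)))"

text \<open>\<open>iter_deriv\<close> appends the last derivative, \<open>diff_times\<close> takes
  off the first one. In the second form the product rule for one derivative can be iterated by
  induction, for all factors at once.\<close>

lemma smooth_iff_diff_times: "smooth f \<longleftrightarrow> (\<forall>n. diff_times n f)"
proof -
  have sh: "iter_deriv (Suc j) f = iter_deriv j (\<lambda>t. vector_derivative f (at t))" for j f
    by (simp only: iter_deriv_def funpow_Suc_right comp_def)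
  have "diff_times n f \<longleftrightarrow> (\<forall>j<n. \<forall>t. iter_deriv j f differentiable at t)" for n
  proof (induction n arbitrary: f)
    case (Suc n)
    then show ?case
      by (auto simp: sh[symmetric] less_Suc_eq_0_disj simp del: One_nat_def)
  qed simp
  then show ?thesis unfolding smooth_def by blast
qed

lemma diff_times_Suc_D: "diff_times (Suc n) f \<Longrightarrow> diff_times n f"
  by (induction n arbitrary: f) auto

lemma diff_times_add: "diff_times n f \<Longrightarrow> diff_times n g \<Longrightarrow> diff_times n (\<lambda>t. f t + g t)"
proof (induction n arbitrary: f g)
  case (Suc n)
  have "vector_derivative (\<lambda>t. f t + g t) (at t) = vector_derivative f (at t) + vector_derivative g (at t)" for t
    using Suc.prems by (intro vector_derivative_at has_vector_derivative_add) (simp_all add: vector_derivative_works)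
  then show ?case using Suc by simp
qed simp

lemma diff_times_mult: "diff_times n f \<Longrightarrow> diff_times n g \<Longrightarrow> diff_times n (\<lambda>t. f t * g t)"
proof (induction n arbitrary: f g)
  case (Suc n)
  have "vector_derivative (\<lambda>t. f t * g t) (at t) = f t * vector_derivative g (at t) + vector_derivative f (at t) * g t" for t
    using Suc.prems by (intro vector_derivative_at has_vector_derivative_mult) (simp_all add: vector_derivative_works)
  moreover have "(\<lambda>t. f t * g t) differentiable at t" for t
    using Suc.prems by (intro differentiable_mult) auto
  ultimately show ?case using Suc diff_times_Suc_D[OF Suc.prems(1)] diff_times_Suc_D[OF Suc.prems(2)]
    by (auto intro!: diff_times_add)
qed simp

lemma smooth_mult: "smooth f \<Longrightarrow> smooth g \<Longrightarrow> smooth (\<lambda>t. f t * g t)"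
  by (simp add: smooth_iff_diff_times diff_times_mult)

lemma smooth_affine:
  assumes "smooth f"
  shows "smooth (\<lambda>t. f (c * t + a))"
proof (rule smoothI[where G="\<lambda>j t. of_real c ^ j * iter_deriv j f (c * t + a)"])
  fix j t
  have "((\<lambda>v. c * v + a) has_real_derivative c) (at t)" by (auto intro!: derivative_eq_intros)
  from vector_diff_chain_at[OF this[unfolded has_real_derivative_iff_has_vector_derivative] smooth_iter_deriv[OF assms, of j]]
  have "((\<lambda>v. iter_deriv j f (c * v + a)) has_vector_derivative c *\<^sub>R iter_deriv (Suc j) f (c * t + a)) (at t)"
    by (simp add: comp_def)
  from has_vector_derivative_mult_right[OF this, of "of_real c ^ j"]
  show "((\<lambda>t. of_real c ^ j * iter_deriv j f (c * t + a)) has_vector_derivative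
      of_real c ^ Suc j * iter_deriv (Suc j) f (c * t + a)) (at t)"
    by (simp add: scaleR_conv_of_real mult_ac)
qed simp

lemma smooth_cis: "smooth (\<lambda>t. cis (w * t))"
proof (rule smoothI[where G="\<lambda>j t. (\<i> * w) ^ j * cis (w * t)"])
  fix j and t :: real
  have "((\<lambda>t. cis (w * t)) has_vector_derivative \<i> * w * cis (w * t)) (at t)"
    unfolding has_vector_derivative_def
    by (auto intro!: derivative_eq_intros simp: scaleR_conv_of_real algebra_simps)
  from has_vector_derivative_mult_right[OF this, of "(\<i> * w) ^ j"]
  show "((\<lambda>t. (\<i> * w) ^ j * cis (w * t)) has_vector_derivative (\<i> * w) ^ Suc j * cis (w * t)) (at t)"
    by (simp add: mult_ac)
qed simp

lemma test_within_cis: "test_within B f \<Longrightarrow> test_within B (\<lambda>t. cis (w * t) * f t)"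
  by (auto simp: test_within_def smooth_mult smooth_cis)

text \<open>The functions \<open>p(1/t) exp(-1/t)\<close>, continued by 0, are closed under
  differentiation: the polynomial \<open>p(u)\<close> is replaced by \<open>u^2 (p - p')\<close>.
  Hence the whole sequence of derivatives is explicit and \<open>smoothI\<close> applies.\<close>

definition flat :: "real poly \<Rightarrow> real \<Rightarrow> real" where
  "flat p t = (if t > 0 then poly p (1 / t) * exp (- (1 / t)) else 0)"

lemma poly_exp_tendsto: "((\<lambda>u::real. poly p u / exp u) \<longlongrightarrow> 0) at_top"
proof -
  have "((\<lambda>u. \<Sum>i\<le>degree p. coeff p i * (u ^ i / exp u)) \<longlongrightarrow> (\<Sum>i\<le>degree p. coeff p i * 0)) at_top"
    by (intro tendsto_sum tendsto_mult tendsto_const tendsto_power_div_exp_0)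
  then show ?thesis by (simp add: poly_altdef sum_divide_distrib)
qed

lemma flat_tendsto_right: "((\<lambda>t::real. poly p (1 / t) * exp (- (1 / t))) \<longlongrightarrow> 0) (at_right 0)"
proof -
  have "filterlim (\<lambda>t::real. 1 / t) at_top (at_right 0)"
    using filterlim_inverse_at_top_right by (simp add: inverse_eq_divide)
  from filterlim_compose[OF poly_exp_tendsto[of p] this] show ?thesis
    by (simp add: exp_minus field_simps)
qed

lemma flat_deriv: "(flat p has_real_derivative flat ([:0, 0, 1:] * (p - pderiv p)) t) (at t)"
proof -
  consider "t > 0" | "t < 0" | "t = 0" by linarith
  then show ?thesis
  proof cases
    case 1
    have "((\<lambda>t. poly p (1 / t) * exp (- (1 / t))) has_real_derivative
        poly ([:0, 0, 1:] * (p - pderiv p)) (1 / t) * exp (- (1 / t))) (at t)"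
      using 1 by (auto intro!: derivative_eq_intros DERIV_chain2[OF poly_DERIV] simp: field_simps power2_eq_square)
    then have "((\<lambda>t. poly p (1 / t) * exp (- (1 / t))) has_real_derivative flat ([:0, 0, 1:] * (p - pderiv p)) t) (at t)"
      using 1 by (simp add: flat_def)
    then show ?thesis
      by (rule has_field_derivative_transform_within_open[where S="{0<..}"]) (use 1 in \<open>auto simp: flat_def\<close>)
  next
    case 2
    have "((\<lambda>t. 0) has_real_derivative flat ([:0, 0, 1:] * (p - pderiv p)) t) (at t)"
      using 2 by (simp add: flat_def)
    then show ?thesis
      by (rule has_field_derivative_transform_within_open[where S="{..<0}"]) (use 2 in \<open>auto simp: flat_def\<close>)
  next
    case 3
    \<comment> \<open>Dividing by \<open>h\<close> multiplies the polynomial by its variable, so the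
      difference quotient at 0 is again a function of the family and tends to 0.\<close>
    have "((\<lambda>h. flat p h / h) \<longlongrightarrow> 0) (at_right 0)"
    proof (rule Lim_transform_eventually[OF flat_tendsto_right[of "[:0, 1:] * p"]])
      show "\<forall>\<^sub>F h in at_right 0. poly ([:0, 1:] * p) (1 / h) * exp (- (1 / h)) = flat p h / h"
        by (auto simp: eventually_at_filter flat_def)
    qed
    moreover have "((\<lambda>h. flat p h / h) \<longlongrightarrow> 0) (at_left 0)"
      by (rule tendsto_eventually) (auto simp: eventually_at_filter flat_def)
    ultimately have "((\<lambda>h. flat p h / h) \<longlongrightarrow> 0) (at 0)" by (simp add: filterlim_split_at)
    moreover have z: "flat q 0 = 0" for q by (simp add: flat_def)
    ultimately have "(flat p has_real_derivative 0) (at 0)" unfolding DERIV_def by (simp add: z)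
    then show ?thesis using 3 z by simp
  qed
qed

lemma flat_smooth: "smooth (\<lambda>t. complex_of_real (flat p t))"
proof (rule smoothI[where G="\<lambda>j t. complex_of_real (flat (((\<lambda>p. [:0, 0, 1:] * (p - pderiv p)) ^^ j) p) t)"])
  fix j t
  show "((\<lambda>t. complex_of_real (flat (((\<lambda>p. [:0, 0, 1:] * (p - pderiv p)) ^^ j) p) t)) has_vector_derivative
      complex_of_real (flat (((\<lambda>p. [:0, 0, 1:] * (p - pderiv p)) ^^ Suc j) p) t)) (at t)"
    using flat_deriv[of "((\<lambda>p. [:0, 0, 1:] * (p - pderiv p)) ^^ j) p" t]
    by (intro has_vector_derivative_of_real) (simp add: has_real_derivative_iff_has_vector_derivative)
qed simp

text \<open>The support \<open>[- 1, 0]\<close> lies on the left so that a convolution with \<open>bump\<close> at a point of \<open>J\<close> only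
  uses values of the function on \<open>J\<close>.\<close>

definition bump :: "real \<Rightarrow> real" where
  "bump t = flat 1 (t + 1) * flat 1 (- t)"

lemma bump_pos: "bump t > 0 \<longleftrightarrow> -1 < t \<and> t < 0"
  and bump_nonneg: "bump t \<ge> 0"
  by (auto simp: bump_def flat_def)

lemma bump_zero: "t \<le> -1 \<or> 0 \<le> t \<Longrightarrow> bump t = 0"
  by (auto simp: bump_def flat_def)

lemma bump_test_within:
  assumes "0 < \<epsilon>"
  shows "test_within \<epsilon> (\<lambda>t. complex_of_real (bump (t / \<epsilon>)))"
proof -
  have "smooth (\<lambda>t. complex_of_real (flat 1 (1 * t + 1)) * complex_of_real (flat 1 (-1 * t + 0)))"
    by (intro smooth_mult smooth_affine flat_smooth)
  then have "smooth (\<lambda>t. complex_of_real (bump t))" by (simp add: bump_def)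
  from smooth_affine[OF this, of "1 / \<epsilon>" 0] have "smooth (\<lambda>t. complex_of_real (bump (t / \<epsilon>)))" by simp
  moreover have "bump (t / \<epsilon>) = 0" if "\<epsilon> < \<bar>t\<bar>" for t
    using that assms by (intro bump_zero) (auto simp: divide_le_eq abs_if split: if_splits)
  ultimately show ?thesis using assms by (simp add: test_within_def)
qed

section \<open>Fejer kernels\<close>

definition sinc2 :: "real \<Rightarrow> real" where
  "sinc2 x = (sinc (x / 2))\<^sup>2"

text \<open>Equal to \<open>2 * pi\<close>. It is kept symbolic, since it drops out of all
  normalised identities; positivity allows division by it.\<close>

definition fej_mass :: real where
  "fej_mass = (LINT x|lborel. sinc2 x)"

definition fejer :: "real \<Rightarrow> real \<Rightarrow> real" where
  "fejer L x = L * sinc2 (L * x) / fej_mass"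

definition tri :: "real \<Rightarrow> real \<Rightarrow> real" where
  "tri L \<xi> = max 0 (1 - \<bar>\<xi>\<bar> / L)"

lemma sinc_bounds: "\<bar>sinc x\<bar> \<le> 1" "\<bar>x\<bar> * \<bar>sinc x\<bar> \<le> 1"
  by (auto simp: abs_mult abs_divide divide_le_eq abs_sin_x_le_abs_x)

lemma sinc2_bound: "sinc2 x \<le> 8 * inverse (1 + x\<^sup>2)"
proof -
  have 1: "sinc2 x \<le> 1"
    unfolding sinc2_def using sinc_bounds(1)[of "x/2"] by (metis abs_le_square_iff abs_one one_power2)
  have "(\<bar>x/2\<bar> * \<bar>sinc (x/2)\<bar>)\<^sup>2 \<le> 1\<^sup>2" by (rule power_mono[OF sinc_bounds(2)]) simp
  then have "(x/2)\<^sup>2 * sinc2 x \<le> 1" by (simp only: power_mult_distrib power2_abs sinc2_def one_power2)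
  then have 2: "x\<^sup>2 * sinc2 x \<le> 4" by (simp add: power_divide)
  \<comment> \<open>The two bounds add up to 5; the constant 8 is a generous round value.\<close>
  have 3: "(1 + x\<^sup>2) * sinc2 x \<le> 8" unfolding distrib_right using 1 2 by linarith
  have "0 < 1 + x\<^sup>2" by (simp add: add_pos_nonneg)
  with 3 show ?thesis by (simp add: inverse_eq_divide pos_le_divide_eq mult.commute)
qed

lemma sinc2_nonneg [simp]: "0 \<le> sinc2 x"
  by (simp add: sinc2_def)

lemma sinc2_0 [simp]: "sinc2 0 = 1"
  by (simp add: sinc2_def)

lemma sinc2_minus [simp]: "sinc2 (- x) = sinc2 x"
  by (simp add: sinc2_def)

lemma sinc2_nonzero: "x \<noteq> 0 \<Longrightarrow> sinc2 x = 4 * (sin (x / 2))\<^sup>2 / x\<^sup>2"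
  by (simp add: sinc2_def power_divide)

lemma sinc2_continuous: "continuous_on S sinc2"
  unfolding sinc2_def[abs_def] by (intro continuous_intros continuous_on_sinc) auto

lemma sinc2_measurable [measurable]: "sinc2 \<in> borel_measurable borel"
  by (intro borel_measurable_continuous_onI sinc2_continuous)

lemma integrable_inverse_1_plus_sq: "integrable lborel (\<lambda>x::real. inverse (1 + x\<^sup>2))"
  using integrable_inverse_1_plus_square by (simp add: set_integrable_def)

lemma sinc2_integrable: "integrable lborel sinc2"
proof (rule Bochner_Integration.integrable_bound)
  show "integrable lborel (\<lambda>x::real. 8 * inverse (1 + x\<^sup>2))"
    using integrable_inverse_1_plus_sq by simp
  show "AE x in lborel. norm (sinc2 x) \<le> norm (8 * inverse (1 + x\<^sup>2))"
    by (intro always_eventually allI) (use sinc2_bound in \<open>simp add: abs_mult\<close>)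
qed measurable

lemma fej_mass_pos: "fej_mass > 0"
proof -
  have "fej_mass \<ge> 0" unfolding fej_mass_def by (intro Bochner_Integration.integral_nonneg) auto
  moreover have "fej_mass \<noteq> 0"
  proof
    assume "fej_mass = 0"
    then have "AE x in lborel. sinc2 x = 0"
      unfolding fej_mass_def using integral_nonneg_eq_0_iff_AE[OF sinc2_integrable] by simp
    then have "AE x in lborel. x \<notin> {0<..<1::real}"
    proof eventually_elim
      case (elim x)
      then show ?case using sin_gt_zero[of "x/2"] pi_gt3 by (auto simp: sinc2_def split: if_splits)
    qed
    then have "{0<..<1::real} \<in> null_sets lborel"
      by (subst (asm) AE_iff_null_sets[symmetric]) auto
    then show False by auto
  qed
  ultimately show ?thesis by simp
qed

lemma fejer_nonneg: "0 \<le> L \<Longrightarrow> 0 \<le> fejer L x"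
  using fej_mass_pos by (simp add: fejer_def)

lemma fejer_scale: "fejer L x = L * fejer 1 (L * x)"
  by (simp add: fejer_def)

lemma fejer_continuous: "continuous_on UNIV (fejer L)"
  unfolding fejer_def[abs_def]
  by (intro continuous_intros continuous_on_compose2[OF sinc2_continuous[of UNIV]]) (use fej_mass_pos in auto)

lemma fejer_measurable [measurable]: "fejer L \<in> borel_measurable borel"
  by (intro borel_measurable_continuous_onI fejer_continuous)

lemma fejer1_integrable: "integrable lborel (fejer 1)"
  using sinc2_integrable by (simp add: fejer_def[abs_def])

lemma fejer_integrable: "0 < L \<Longrightarrow> integrable lborel (fejer L)"
  using lborel_integrable_real_affine[OF fejer1_integrable, of L 0]
  by (subst fejer_scale[abs_def]) simp

lemma one_minus_cos_sinc2: "x \<noteq> 0 \<Longrightarrow> (1 - cos (a * x)) / x\<^sup>2 = a\<^sup>2 / 2 * sinc2 (a * x)"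
  using cos_double_sin[of "a * x / 2"]
  by (cases "a = 0") (auto simp: sinc2_nonzero power_divide power_mult_distrib field_simps)

text \<open>By scaling, the integral of \<open>(1 - cos (a * x)) / x\<^sup>2\<close> is proportional
  to \<open>\<bar>a\<bar>\<close>. Combinations of such kernels therefore have piecewise linear
  transforms, which is how the triangle arises.\<close>

lemma
  shows integrable_one_minus_cos: "integrable lborel (\<lambda>x. (1 - cos (a * x)) / x\<^sup>2)"
    and integral_one_minus_cos: "(LINT x|lborel. (1 - cos (a * x)) / x\<^sup>2) = fej_mass / 2 * \<bar>a\<bar>"
proof -
  have ae: "AE x in lborel. a\<^sup>2 / 2 * sinc2 (a * x) = (1 - cos (a * x)) / x\<^sup>2"
  proof -
    have "AE x in lborel. x \<noteq> (0::real)" by (rule AE_lborel_singleton)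
    then show ?thesis by eventually_elim (simp only: one_minus_cos_sinc2 not_False_eq_True)
  qed
  have i: "integrable lborel (\<lambda>x. a\<^sup>2 / 2 * sinc2 (a * x))"
    using lborel_integrable_real_affine[OF sinc2_integrable, of a 0] by (cases "a = 0") auto
  show "integrable lborel (\<lambda>x. (1 - cos (a * x)) / x\<^sup>2)"
    by (rule integrable_cong_AE_imp[OF i _ ae]) measurable
  have "(LINT x|lborel. (1 - cos (a * x)) / x\<^sup>2) = (LINT x|lborel. a\<^sup>2 / 2 * sinc2 (a * x))"
    by (rule integral_cong_AE) (use ae in \<open>auto elim: eventually_mono\<close>)
  also have "\<dots> = fej_mass / 2 * \<bar>a\<bar>"
  proof (cases "a = 0")
    case False
    have "fej_mass = \<bar>a\<bar> * (LINT x|lborel. sinc2 (a * x))"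
      unfolding fej_mass_def using lborel_integral_real_affine[of a sinc2 0] False by simp
    then have "fej_mass / 2 * \<bar>a\<bar> = (\<bar>a\<bar> * \<bar>a\<bar>) / 2 * (LINT x|lborel. sinc2 (a * x))"
      by (metis mult.assoc mult.commute times_divide_eq_left)
    then show ?thesis by (simp add: power2_eq_square)
  qed simp
  finally show "(LINT x|lborel. (1 - cos (a * x)) / x\<^sup>2) = fej_mass / 2 * \<bar>a\<bar>" .
qed

lemma integral_odd: "(\<And>x. g (- x) = - g x) \<Longrightarrow> (LINT x|lborel. g x) = (0::real)" for g :: "real \<Rightarrow> real"
  using lborel_integral_real_affine[of "-1" g 0] by simp

lemma even_fourier:
  assumes g: "integrable lborel g" "\<And>x. g (- x) = g x" and c: "(LINT x|lborel. g x * cos (c * x)) = b"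
  shows "(LINT x|lborel. complex_of_real (g x) * cis (c * x)) = complex_of_real b"
proof -
  have [measurable]: "g \<in> borel_measurable borel" using g by (auto dest: borel_measurable_integrable)
  have i: "integrable lborel (\<lambda>x. g x * cos (c * x))" "integrable lborel (\<lambda>x. g x * sin (c * x))"
    by (rule Bochner_Integration.integrable_bound[OF g(1)]; auto simp: abs_mult intro!: mult_left_le)+
  have "(LINT x|lborel. complex_of_real (g x) * cis (c * x)) =
    (LINT x|lborel. complex_of_real (g x * cos (c * x)) + \<i> * complex_of_real (g x * sin (c * x)))"
    by (intro Bochner_Integration.integral_cong refl) (simp add: complex_eq_iff)
  also have "\<dots> = (LINT x|lborel. complex_of_real (g x * cos (c * x))) + (LINT x|lborel. \<i> * complex_of_real (g x * sin (c * x)))"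
    by (intro Bochner_Integration.integral_add integrable_mult_right integrable_of_real i)
  also have "\<dots> = complex_of_real b + \<i> * complex_of_real (LINT x|lborel. g x * sin (c * x))"
    by (simp only: integral_mult_right_zero integral_complex_of_real c)
  also have "(LINT x|lborel. g x * sin (c * x)) = 0"
    by (rule integral_odd) (simp add: g)
  finally show ?thesis by simp
qed

text \<open>The product formula for cosines turns the integrand into a second difference, in the
  frequency, of the kernels \<open>(1 - cos (a * x)) / x\<^sup>2\<close>. The integral is thus a
  second difference of \<open>\<bar>\<xi>\<bar>\<close>, and that is the triangle.\<close>

lemma fejer1_cos: "(LINT x|lborel. fejer 1 x * cos (\<xi> * x)) = tri 1 \<xi>"
proof -
  define K where "K a x = (1 - cos (a * x)) / x\<^sup>2" for a x :: real
  have Ki: "integrable lborel (K a)" for a unfolding K_def by (rule integrable_one_minus_cos)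
  have KI: "(LINT x|lborel. K a x) = fej_mass / 2 * \<bar>a\<bar>" for a unfolding K_def by (rule integral_one_minus_cos)
  have "(LINT x|lborel. fejer 1 x * cos (\<xi> * x)) =
    (LINT x|lborel. (2 / fej_mass) * (K (1 + \<xi>) x / 2 + K (1 - \<xi>) x / 2 - K \<xi> x))"
  proof (rule integral_cong_AE)
    have "AE x in lborel. x \<noteq> (0::real)" by (rule AE_lborel_singleton)
    then show "AE x in lborel. fejer 1 x * cos (\<xi> * x) =
        (2 / fej_mass) * (K (1 + \<xi>) x / 2 + K (1 - \<xi>) x / 2 - K \<xi> x)"
    proof eventually_elim
      case (elim x)
      have "sinc2 x = 2 * ((1 - cos x) / x\<^sup>2)"
        using one_minus_cos_sinc2[OF elim, of 1] by (simp add: mult.commute)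
      then have f: "fejer 1 x = (2 / fej_mass) * ((1 - cos x) / x\<^sup>2)" by (simp add: fejer_def)
      have "cos x * cos (\<xi> * x) = (cos ((1 + \<xi>) * x) + cos ((1 - \<xi>) * x)) / 2"
        using cos_add[of x "\<xi> * x"] cos_diff[of x "\<xi> * x"] by (simp add: algebra_simps)
      moreover have "c * d = (a + b) / 2 \<Longrightarrow> (1 - c) * d = (1 - a) / 2 + (1 - b) / 2 - (1 - d)" for a b c d :: real
        by (simp add: field_simps)
      ultimately have "(1 - cos x) * cos (\<xi> * x) = (1 - cos ((1 + \<xi>) * x)) / 2 + (1 - cos ((1 - \<xi>) * x)) / 2 - (1 - cos (\<xi> * x))"
        by blast
      then have "((1 - cos x) / x\<^sup>2) * cos (\<xi> * x) = K (1 + \<xi>) x / 2 + K (1 - \<xi>) x / 2 - K \<xi> x"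
        unfolding K_def by (metis (no_types, lifting) add_divide_distrib diff_divide_distrib divide_divide_eq_left mult.commute times_divide_eq_left)
      then have "(2 / fej_mass) * (((1 - cos x) / x\<^sup>2) * cos (\<xi> * x)) = (2 / fej_mass) * (K (1 + \<xi>) x / 2 + K (1 - \<xi>) x / 2 - K \<xi> x)"
        by (simp only:)
      then show ?case unfolding f mult.assoc .
    qed
    have "K a \<in> borel_measurable lborel" for a using Ki by (rule borel_measurable_integrable)
    then show "(\<lambda>x. (2 / fej_mass) * (K (1 + \<xi>) x / 2 + K (1 - \<xi>) x / 2 - K \<xi> x)) \<in> borel_measurable lborel"
      by (intro borel_measurable_times borel_measurable_const borel_measurable_diff borel_measurable_add borel_measurable_divide)
  qed measurable
  also have "\<dots> = (2 / fej_mass) * (fej_mass / 2 * \<bar>1 + \<xi>\<bar> / 2 + fej_mass / 2 * \<bar>1 - \<xi>\<bar> / 2 - fej_mass / 2 * \<bar>\<xi>\<bar>)"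
    using Ki by (simp add: KI Bochner_Integration.integral_diff Bochner_Integration.integral_add)
  also have "\<dots> = (2 / fej_mass) * (fej_mass / 2) * (\<bar>1 + \<xi>\<bar> / 2 + \<bar>1 - \<xi>\<bar> / 2 - \<bar>\<xi>\<bar>)"
    by (simp add: algebra_simps)
  also have "\<dots> = \<bar>1 + \<xi>\<bar> / 2 + \<bar>1 - \<xi>\<bar> / 2 - \<bar>\<xi>\<bar>" using fej_mass_pos by simp
  also have "\<dots> = tri 1 \<xi>" by (auto simp: tri_def abs_if max_def field_simps)
  finally show ?thesis .
qed

lemma fejer_fourier:
  assumes L: "0 < L"
  shows "(LINT x|lborel. complex_of_real (fejer L x) * cis (\<xi> * x)) = complex_of_real (tri L \<xi>)"
proof -
  have 1: "(LINT x|lborel. complex_of_real (fejer 1 x) * cis (c * x)) = complex_of_real (tri 1 c)" for c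
    by (rule even_fourier[OF fejer1_integrable _ fejer1_cos]) (simp add: fejer_def)
  have "(LINT x|lborel. complex_of_real (fejer 1 x) * cis (\<xi> / L * x)) =
      \<bar>L\<bar> *\<^sub>R (LINT x|lborel. complex_of_real (fejer 1 (0 + L * x)) * cis (\<xi> / L * (0 + L * x)))"
    using L by (intro lborel_integral_real_affine) simp
  also have "\<dots> = (LINT x|lborel. complex_of_real (fejer L x) * cis (\<xi> * x))"
    using L unfolding integral_scaleR_right[symmetric]
    by (intro Bochner_Integration.integral_cong refl) (simp add: fejer_scale[of L] scaleR_conv_of_real)
  finally have "(LINT x|lborel. complex_of_real (fejer L x) * cis (\<xi> * x)) = complex_of_real (tri 1 (\<xi> / L))"
    using 1[of "\<xi> / L"] by simp
  also have "tri 1 (\<xi> / L) = tri L \<xi>" using L by (simp add: tri_def)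
  finally show ?thesis .
qed

lemma tri_continuous: "continuous_on UNIV (tri L)"
  unfolding tri_def[abs_def] divide_inverse by (intro continuous_intros)

lemma tri_zero: "0 < L \<Longrightarrow> L \<le> \<bar>\<xi>\<bar> \<Longrightarrow> tri L \<xi> = 0"
  by (simp add: tri_def)

lemma tri_integrable: "0 < L \<Longrightarrow> integrable lborel (\<lambda>\<xi>. complex_of_real (tri L \<xi>))"
  by (rule compact_support_integrable[where B=L]) (auto intro!: continuous_intros tri_continuous simp: tri_zero)

text \<open>The inversion formula for the one pair of functions that is used, computed from an
  explicit antiderivative on \<open>{0..1}\<close>.\<close>

lemma tri1_cos: "(LINT \<xi>|lborel. tri 1 \<xi> * cos (x * \<xi>)) = fej_mass * fejer 1 x"
proof -
  have c: "continuous_on S (\<lambda>\<xi>. tri 1 \<xi> * cos (x * \<xi>))" for S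
    by (intro continuous_intros continuous_on_subset[OF tri_continuous]) auto
  have "(LINT \<xi>|lborel. tri 1 \<xi> * cos (x * \<xi>)) = (LINT \<xi>:{-1..1}|lborel. tri 1 \<xi> * cos (x * \<xi>))"
    unfolding set_lebesgue_integral_def
  proof (intro Bochner_Integration.integral_cong refl)
    show "tri 1 \<xi> * cos (x * \<xi>) = indicator {-1..1} \<xi> *\<^sub>R (tri 1 \<xi> * cos (x * \<xi>))" for \<xi>
      using tri_zero[of 1 \<xi>] by (cases "\<bar>\<xi>\<bar> \<le> 1") (auto simp: abs_le_iff)
  qed
  also have "\<dots> = integral {-1..1} (\<lambda>\<xi>. tri 1 \<xi> * cos (x * \<xi>))"
    by (intro set_borel_integral_eq_integral borel_integrable_atLeastAtMost' c)
  also have "\<dots> = integral {-1..0} (\<lambda>\<xi>. tri 1 \<xi> * cos (x * \<xi>)) + integral {0..1} (\<lambda>\<xi>. tri 1 \<xi> * cos (x * \<xi>))"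
    by (intro Henstock_Kurzweil_Integration.integral_combine[symmetric] integrable_continuous_real c) auto
  also have "integral {-1..0} (\<lambda>\<xi>. tri 1 \<xi> * cos (x * \<xi>)) = integral {0..1} (\<lambda>\<xi>. tri 1 \<xi> * cos (x * \<xi>))"
    using Henstock_Kurzweil_Integration.integral_reflect_real[of 0 "-1" "\<lambda>\<xi>. tri 1 \<xi> * cos (x * \<xi>)"]
    by (simp add: tri_def)
  also have "integral {0..1} (\<lambda>\<xi>. tri 1 \<xi> * cos (x * \<xi>)) = sinc2 x / 2"
  proof (rule integral_unique)
    \<comment> \<open>With a name for \<open>1 / x\<close>, checking the derivative becomes a
      polynomial identity modulo \<open>x * c = 1\<close>. The point \<open>x = 0\<close> has an
      antiderivative of its own.\<close>
    define c where "c = inverse x"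
    define G where "G \<xi> = (if x = 0 then \<xi> - \<xi>\<^sup>2 / 2 else (1 - \<xi>) * sin (x * \<xi>) * c - cos (x * \<xi>) * (c * c))" for \<xi>
    have "((\<lambda>\<xi>. (1 - \<xi>) * cos (x * \<xi>)) has_integral (G 1 - G 0)) {0..1}"
    proof (rule fundamental_theorem_of_calculus)
      fix \<xi> :: real
      show "(G has_vector_derivative (1 - \<xi>) * cos (x * \<xi>)) (at \<xi> within {0..1})"
      proof (cases "x = 0")
        case True
        then show ?thesis unfolding G_def[abs_def] has_real_derivative_iff_has_vector_derivative[symmetric]
          by (auto intro!: derivative_eq_intros)
      next
        case False
        then have xc: "x * c = 1" by (simp add: c_def)
        have "((\<lambda>\<xi>. (1 - \<xi>) * sin (x * \<xi>) * c - cos (x * \<xi>) * (c * c)) has_real_derivative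
            ((1 - \<xi>) * (cos (x * \<xi>) * x) - sin (x * \<xi>)) * c + sin (x * \<xi>) * x * (c * c)) (at \<xi> within {0..1})"
          by (auto intro!: derivative_eq_intros simp: algebra_simps)
        moreover have "((1 - \<xi>) * (cos (x * \<xi>) * x) - sin (x * \<xi>)) * c + sin (x * \<xi>) * x * (c * c) = (1 - \<xi>) * cos (x * \<xi>)"
          using xc by algebra
        ultimately show ?thesis
          using False unfolding G_def[abs_def] has_real_derivative_iff_has_vector_derivative[symmetric] by simp
      qed
    qed simp
    then have "((\<lambda>\<xi>. tri 1 \<xi> * cos (x * \<xi>)) has_integral (G 1 - G 0)) {0..1}"
      by (rule has_integral_eq[rotated]) (simp add: tri_def)
    moreover have "G 1 - G 0 = sinc2 x / 2"
    proof (cases "x = 0")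
      case False
      then have "G 1 - G 0 = (1 - cos (1 * x)) / x\<^sup>2" by (simp add: G_def c_def left_diff_distrib power2_eq_square divide_inverse)
      then show ?thesis unfolding one_minus_cos_sinc2[OF False, of 1] by simp
    qed (simp add: G_def)
    ultimately show "((\<lambda>\<xi>. tri 1 \<xi> * cos (x * \<xi>)) has_integral sinc2 x / 2) {0..1}" by simp
  qed
  finally show ?thesis using fej_mass_pos by (simp add: fejer_def)
qed

lemma tri_fourier:
  assumes L: "0 < L"
  shows "(LINT \<xi>|lborel. complex_of_real (tri L \<xi>) * cis (x * \<xi>)) = complex_of_real (fej_mass * fejer L x)"
proof -
  have ti: "integrable lborel (tri 1)" using integrable_Re[OF tri_integrable[of 1]] by simp
  have 1: "(LINT x|lborel. complex_of_real (tri 1 x) * cis (c * x)) = complex_of_real (fej_mass * fejer 1 c)" for c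
    by (rule even_fourier[OF ti _ tri1_cos]) (simp add: tri_def)
  have "(LINT \<xi>|lborel. complex_of_real (tri L \<xi>) * cis (x * \<xi>)) =
      \<bar>L\<bar> *\<^sub>R (LINT \<xi>|lborel. complex_of_real (tri L (0 + L * \<xi>)) * cis (x * (0 + L * \<xi>)))"
    using L by (intro lborel_integral_real_affine) simp
  also have "\<dots> = \<bar>L\<bar> *\<^sub>R (LINT \<xi>|lborel. complex_of_real (tri 1 \<xi>) * cis ((L * x) * \<xi>))"
    using L by (intro arg_cong[where f="\<lambda>z. \<bar>L\<bar> *\<^sub>R z"] Bochner_Integration.integral_cong refl) (simp add: tri_def abs_mult mult_ac)
  also have "\<dots> = complex_of_real (fej_mass * fejer L x)"
    using L by (simp add: 1 fejer_scale[of L x] scaleR_conv_of_real)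
  finally show ?thesis .
qed

section \<open>Kernels centred at a given frequency\<close>

definition fejer_at :: "real \<Rightarrow> real \<Rightarrow> real \<Rightarrow> complex" where
  "fejer_at w L x = cis (w * x) * complex_of_real (fejer L x)"

definition poussin :: "real \<Rightarrow> real \<Rightarrow> real" where
  "poussin L x = 2 * fejer (2 * L) x - fejer L x"

definition poussin_at :: "real \<Rightarrow> real \<Rightarrow> real \<Rightarrow> complex" where
  "poussin_at w L x = cis (w * x) * complex_of_real (poussin L x)"

lemma cis_mult_integrable:
  "integrable lborel f \<Longrightarrow> integrable lborel (\<lambda>x. cis (w * x) * f x)"
  by (rule bounded_mult_integrable[where B=1]) auto

lemma fejer_at_integrable: "0 < L \<Longrightarrow> integrable lborel (fejer_at w L)"
  unfolding fejer_at_def[abs_def] by (intro cis_mult_integrable integrable_of_real fejer_integrable)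

lemma poussin_integrable: "0 < L \<Longrightarrow> integrable lborel (poussin L)"
  unfolding poussin_def[abs_def] by (intro Bochner_Integration.integrable_diff integrable_mult_right fejer_integrable) auto

lemma poussin_at_integrable: "0 < L \<Longrightarrow> integrable lborel (poussin_at w L)"
  unfolding poussin_at_def[abs_def] by (intro cis_mult_integrable integrable_of_real poussin_integrable)

lemma convol_cis: "convol (\<lambda>x. cis (w * x) * f x) (\<lambda>x. cis (w * x) * g x) x = cis (w * x) * convol f g x"
proof -
  have "cis (w * (x - y)) * f (x - y) * (cis (w * y) * g y) = cis (w * x) * (f (x - y) * g y)" for y
  proof -
    have "cis (w * x) = cis (w * (x - y)) * cis (w * y)" by (simp add: cis_mult algebra_simps)
    then show ?thesis by simp
  qed
  then show ?thesis unfolding convol_def by (simp only: integral_mult_right_zero)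
qed

text \<open>The transform of \<open>poussin L\<close> is a trapezoid that is \<open>1\<close> on \<open>[- L, L]\<close>.\<close>

lemma convol_poussin_fejer_at:
  assumes l: "0 < l" and al: "\<bar>a\<bar> + l \<le> L"
  shows "convol (\<lambda>x. complex_of_real (poussin L x)) (fejer_at a l) x = fejer_at a l x"
proof -
  have L: "0 < L" using l al by linarith
  \<comment> \<open>The kernel is written as an integral of characters with density
    \<open>v\<close>. Exchanging the integrals turns the convolution into multiplication of the
    shifted triangle by \<open>v\<close>, and \<open>\<bar>a\<bar> + l \<le> L\<close> places the
    support of that triangle where \<open>v = 1\<close>.\<close>
  define v where "v \<xi> = complex_of_real (2 * tri (2 * L) \<xi> - tri L \<xi>)" for \<xi>
  have vi: "integrable lborel v"
    unfolding v_def using tri_integrable[of L] tri_integrable[of "2*L"] L by simp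
  have [measurable]: "v \<in> borel_measurable borel" using vi by (auto dest: borel_measurable_integrable)
  have [measurable]: "fejer_at a l \<in> borel_measurable borel" unfolding fejer_at_def[abs_def] by measurable
  have vf: "(LINT \<xi>|lborel. v \<xi> * cis (u * \<xi>)) = fej_mass * poussin L u" for u
  proof -
    have i: "integrable lborel (\<lambda>\<xi>. cis (u * \<xi>) * complex_of_real (tri M \<xi>))" if "0 < M" for M
      by (rule cis_mult_integrable[OF tri_integrable[OF that]])
    have "(LINT \<xi>|lborel. v \<xi> * cis (u * \<xi>)) =
      (LINT \<xi>|lborel. 2 * (complex_of_real (tri (2 * L) \<xi>) * cis (u * \<xi>)) - complex_of_real (tri L \<xi>) * cis (u * \<xi>))"
      by (simp add: v_def left_diff_distrib mult.assoc)
    also have "\<dots> = 2 * complex_of_real (fej_mass * fejer (2 * L) u) - complex_of_real (fej_mass * fejer L u)"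
      using i[of L] i[of "2*L"] L tri_fourier[of L u] tri_fourier[of "2*L" u]
      by (subst Bochner_Integration.integral_diff) (auto simp: mult.commute)
    also have "\<dots> = fej_mass * poussin L u" by (simp add: poussin_def algebra_simps)
    finally show ?thesis .
  qed
  have pi: "integrable (lborel \<Otimes>\<^sub>M lborel) (\<lambda>(y, \<xi>). v \<xi> * cis ((x - y) * \<xi>) * fejer_at a l y)"
  proof (rule lborel_pair.Fubini_integrable)
    show "(\<lambda>(y, \<xi>). v \<xi> * cis ((x - y) * \<xi>) * fejer_at a l y) \<in> borel_measurable (lborel \<Otimes>\<^sub>M lborel)" by measurable
    have "(\<lambda>y. LINT \<xi>|lborel. norm (case (y, \<xi>) of (y, \<xi>) \<Rightarrow> v \<xi> * cis ((x - y) * \<xi>) * fejer_at a l y)) = (\<lambda>y. L1norm v * cmod (fejer_at a l y))"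
      by (simp add: L1norm_def norm_mult)
    then show "integrable lborel (\<lambda>y. LINT \<xi>|lborel. norm (case (y, \<xi>) of (y, \<xi>) \<Rightarrow> v \<xi> * cis ((x - y) * \<xi>) * fejer_at a l y))"
      using fejer_at_integrable[OF l] by simp
    have "integrable lborel (\<lambda>\<xi>. v \<xi> * cis ((x - y) * \<xi>) * fejer_at a l y)" for y
      using cis_mult_integrable[OF vi, of "x - y"] by (simp add: mult.commute[of "v _"])
    then show "AE y in lborel. integrable lborel (\<lambda>\<xi>. case (y, \<xi>) of (y, \<xi>) \<Rightarrow> v \<xi> * cis ((x - y) * \<xi>) * fejer_at a l y)" by simp
  qed
  have "fej_mass * convol (\<lambda>x. complex_of_real (poussin L x)) (fejer_at a l) x =
      (LINT y|lborel. (LINT \<xi>|lborel. v \<xi> * cis ((x - y) * \<xi>) * fejer_at a l y))"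
  proof -
    have "(LINT \<xi>|lborel. v \<xi> * cis ((x - y) * \<xi>) * fejer_at a l y) = fej_mass * (complex_of_real (poussin L (x - y)) * fejer_at a l y)" for y
    proof -
      have "(LINT \<xi>|lborel. v \<xi> * cis ((x - y) * \<xi>) * fejer_at a l y) = (LINT \<xi>|lborel. v \<xi> * cis ((x - y) * \<xi>)) * fejer_at a l y"
        by (rule integral_mult_left_zero)
      then show ?thesis unfolding vf by simp
    qed
    then have "(LINT y|lborel. (LINT \<xi>|lborel. v \<xi> * cis ((x - y) * \<xi>) * fejer_at a l y)) =
        (LINT y|lborel. fej_mass * (complex_of_real (poussin L (x - y)) * fejer_at a l y))"
      by (intro Bochner_Integration.integral_cong refl)
    also have "\<dots> = fej_mass * convol (\<lambda>x. complex_of_real (poussin L x)) (fejer_at a l) x"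
      unfolding convol_def by (rule integral_mult_right_zero)
    finally show ?thesis by (rule sym)
  qed
  also have "\<dots> = (LINT \<xi>|lborel. (LINT y|lborel. v \<xi> * cis ((x - y) * \<xi>) * fejer_at a l y))"
    using lborel_pair.Fubini_integral[OF pi] by simp
  also have "\<dots> = (LINT \<xi>|lborel. complex_of_real (tri l (\<xi> - a)) * cis (x * \<xi>))"
  proof (rule Bochner_Integration.integral_cong[OF refl])
    fix \<xi>
    have "v \<xi> * cis ((x - y) * \<xi>) * fejer_at a l y = (v \<xi> * cis (x * \<xi>)) * (complex_of_real (fejer l y) * cis ((a - \<xi>) * y))" for y
    proof -
      have "cis ((x - y) * \<xi>) * cis (a * y) = cis (x * \<xi>) * cis ((a - \<xi>) * y)"
        by (simp add: cis_mult algebra_simps)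
      then show ?thesis unfolding fejer_at_def by (metis (no_types, lifting) mult.assoc mult.commute)
    qed
    then have "(LINT y|lborel. v \<xi> * cis ((x - y) * \<xi>) * fejer_at a l y) = v \<xi> * cis (x * \<xi>) * complex_of_real (tri l (a - \<xi>))"
      by (simp only: integral_mult_right_zero fejer_fourier[OF l])
    also have "tri l (a - \<xi>) = tri l (\<xi> - a)" by (simp add: tri_def abs_minus_commute)
    also have "v \<xi> * cis (x * \<xi>) * complex_of_real (tri l (\<xi> - a)) = complex_of_real (tri l (\<xi> - a)) * cis (x * \<xi>)"
    proof (cases "l \<le> \<bar>\<xi> - a\<bar>")
      case True
      then show ?thesis using tri_zero[OF l] by simp
    next
      case False
      then have "\<bar>\<xi>\<bar> \<le> L" using al by linarith
      then have "2 * tri (2 * L) \<xi> - tri L \<xi> = 1" using L by (simp add: tri_def max_def field_simps)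
      then show ?thesis by (simp add: v_def mult.commute)
    qed
    finally show "(LINT y|lborel. v \<xi> * cis ((x - y) * \<xi>) * fejer_at a l y) = complex_of_real (tri l (\<xi> - a)) * cis (x * \<xi>)" .
  qed
  also have "\<dots> = (LINT \<xi>|lborel. cis (a * x) * (complex_of_real (tri l \<xi>) * cis (x * \<xi>)))"
  proof -
    have "(LINT \<xi>|lborel. complex_of_real (tri l (\<xi> - a)) * cis (x * \<xi>)) =
      (LINT \<xi>|lborel. complex_of_real (tri l \<xi>) * cis (x * (a + \<xi>)))"
      using lborel_integral_real_affine[of 1 "\<lambda>\<xi>. complex_of_real (tri l (\<xi> - a)) * cis (x * \<xi>)" a] by simp
    also have "\<dots> = (LINT \<xi>|lborel. cis (a * x) * (complex_of_real (tri l \<xi>) * cis (x * \<xi>)))"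
    proof (intro Bochner_Integration.integral_cong refl)
      fix \<xi>
      have "cis (x * (a + \<xi>)) = cis (a * x) * cis (x * \<xi>)" by (simp add: cis_mult algebra_simps)
      then show "complex_of_real (tri l \<xi>) * cis (x * (a + \<xi>)) = cis (a * x) * (complex_of_real (tri l \<xi>) * cis (x * \<xi>))" by simp
    qed
    finally show ?thesis .
  qed
  also have "\<dots> = fej_mass * fejer_at a l x"
  proof -
    have "(LINT \<xi>|lborel. cis (a * x) * (complex_of_real (tri l \<xi>) * cis (x * \<xi>))) =
        cis (a * x) * complex_of_real (fej_mass * fejer l x)"
      by (simp only: integral_mult_right_zero tri_fourier[OF l])
    then show ?thesis by (simp add: fejer_at_def mult_ac)
  qed
  finally show ?thesis using fej_mass_pos by simp
qed

text \<open>The frequencies of \<open>fejer_at w' l\<close> lie within \<open>l\<close> of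
  \<open>w'\<close>, hence within \<open>L\<close> of \<open>w\<close>, where
  \<open>poussin_at w L\<close> acts as the identity. Pulling out the character of frequency
  \<open>w\<close> reduces this to the kernel centred at 0.\<close>

lemma convol_poussin_at_fejer_at:
  assumes l: "0 < l" and al: "\<bar>w' - w\<bar> + l \<le> L"
  shows "convol (fejer_at w' l) (poussin_at w L) = fejer_at w' l"
proof
  fix x
  have g: "fejer_at w' l = (\<lambda>x. cis (w * x) * fejer_at (w' - w) l x)"
  proof
    fix x
    have "cis (w' * x) = cis (w * x) * cis ((w' - w) * x)" by (simp add: cis_mult algebra_simps)
    then show "fejer_at w' l x = cis (w * x) * fejer_at (w' - w) l x" by (simp add: fejer_at_def)
  qed
  have "convol (fejer_at w' l) (poussin_at w L) x = convol (poussin_at w L) (fejer_at w' l) x" by (rule convol_commute)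
  also have "\<dots> = cis (w * x) * convol (\<lambda>x. complex_of_real (poussin L x)) (fejer_at (w' - w) l) x"
    unfolding g poussin_at_def[abs_def] by (rule convol_cis)
  also have "\<dots> = fejer_at w' l x" unfolding convol_poussin_fejer_at[OF l al] g ..
  finally show "convol (fejer_at w' l) (poussin_at w L) x = fejer_at w' l x" .
qed

lemma norm_cis_minus_1: "(cmod (cis \<theta> - 1))\<^sup>2 = 4 * (sin (\<theta> / 2))\<^sup>2"
proof -
  have "(cmod (cis \<theta> - 1))\<^sup>2 = (cos \<theta> - 1)\<^sup>2 + (sin \<theta>)\<^sup>2" by (simp add: cmod_power2)
  also have "\<dots> = 2 - 2 * cos \<theta>" using sin_cos_squared_add[of \<theta>] by (simp add: power2_eq_square algebra_simps)
  also have "\<dots> = 4 * (sin (\<theta> / 2))\<^sup>2" using cos_double_sin[of "\<theta> / 2"] by simp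
  finally show ?thesis .
qed

text \<open>On the side of the transforms, a wide triangle is the piecewise linear interpolation of
  its values at multiples of \<open>l\<close> by narrow triangles: a difference
  \<open>i - j = k\<close> occurs \<open>n - \<bar>k\<bar>\<close> times, and division by
  \<open>n\<close> gives the height at \<open>k * l\<close>. The double sum of characters is the
  squared modulus of a geometric sum \<open>Z\<close>, a quotient of squared sines, which converts
  the narrow kernel into the wide one.\<close>

lemma fejer_grid:
  assumes n: "0 < n"
  shows "complex_of_real (fejer (real n * l) x) =
    (1 / real n) * (\<Sum>i<n. \<Sum>j<n. fejer_at ((real i - real j) * l) l x)"
proof -
  let ?u = "l * x"
  define Z where "Z = (\<Sum>i<n. cis (real i * ?u))"
  have "(\<Sum>i<n. \<Sum>j<n. cis ((real i - real j) * l * x)) = Z * cnj Z"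
    unfolding Z_def cnj_sum sum_product cis_cnj cis_mult
    by (intro sum.cong refl) (simp add: algebra_simps)
  also have "\<dots> = complex_of_real ((cmod Z)\<^sup>2)" by (simp only: complex_norm_square)
  finally have S: "(\<Sum>i<n. \<Sum>j<n. fejer_at ((real i - real j) * l) l x) = complex_of_real ((cmod Z)\<^sup>2 * fejer l x)"
    by (simp add: fejer_at_def sum_distrib_right[symmetric])
  have geo: "(cis ?u - 1) * Z = cis (real n * ?u) - 1"
  proof -
    have "Z = (\<Sum>i<n. cis ?u ^ i)" unfolding Z_def by (rule sum.cong[OF refl]) (rule Complex.DeMoivre[symmetric])
    moreover have "cis ?u ^ n - 1 = (cis ?u - 1) * (\<Sum>i<n. cis ?u ^ i)" by (rule power_diff_1_eq)
    ultimately show ?thesis unfolding Complex.DeMoivre[symmetric] by argo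
  qed
  have "4 * (sin (?u / 2))\<^sup>2 * (cmod Z)\<^sup>2 = (cmod ((cis ?u - 1) * Z))\<^sup>2"
    unfolding norm_mult power_mult_distrib norm_cis_minus_1 ..
  also have "\<dots> = 4 * (sin (real n * ?u / 2))\<^sup>2" unfolding geo norm_cis_minus_1 ..
  finally have k: "(sin (?u / 2))\<^sup>2 * (cmod Z)\<^sup>2 = (sin (real n * ?u / 2))\<^sup>2" by simp
  have "real n * fejer (real n * l) x = (cmod Z)\<^sup>2 * fejer l x"
  proof (cases "?u = 0")
    case True
    then have "Z = of_nat n" unfolding Z_def True by simp
    then show ?thesis using True by (auto simp: fejer_def power2_eq_square mult.assoc)
  next
    case False
    then have nz: "l \<noteq> 0" "x \<noteq> 0" by auto
    have s1: "?u\<^sup>2 * sinc2 (l * x) = 4 * (sin (?u / 2))\<^sup>2" using nz by (simp add: sinc2_nonzero)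
    have s2: "(real n * ?u)\<^sup>2 * sinc2 (real n * l * x) = 4 * (sin (real n * ?u / 2))\<^sup>2"
      using nz n by (simp add: sinc2_nonzero mult.assoc)
    have "?u\<^sup>2 * ((real n)\<^sup>2 * sinc2 (real n * l * x)) = 4 * (sin (real n * ?u / 2))\<^sup>2"
      using s2 by (simp only: power_mult_distrib mult.assoc mult.left_commute)
    also have "\<dots> = (4 * (sin (?u / 2))\<^sup>2) * (cmod Z)\<^sup>2" unfolding k[symmetric] by simp
    also have "\<dots> = ?u\<^sup>2 * ((cmod Z)\<^sup>2 * sinc2 (l * x))" unfolding s1[symmetric] by simp
    finally have "(real n)\<^sup>2 * sinc2 (real n * l * x) = (cmod Z)\<^sup>2 * sinc2 (l * x)"
      using False by (metis mult_left_cancel power_not_zero)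
    then have "l * ((real n)\<^sup>2 * sinc2 (real n * l * x)) / fej_mass = l * ((cmod Z)\<^sup>2 * sinc2 (l * x)) / fej_mass" by simp
    then show ?thesis by (simp add: fejer_def power2_eq_square mult_ac)
  qed
  then have "fejer (real n * l) x = (1 / real n) * ((cmod Z)\<^sup>2 * fejer l x)" using n by (simp add: field_simps)
  then show ?thesis unfolding S by simp
qed

lemma fejer_at_grid:
  assumes n: "0 < n"
  shows "fejer_at w (real n * l) x = (1 / real n) * (\<Sum>i<n. \<Sum>j<n. fejer_at (w + (real i - real j) * l) l x)"
proof -
  have "fejer_at (w + c) l x = cis (w * x) * fejer_at c l x" for c
  proof -
    have "cis ((w + c) * x) = cis (w * x) * cis (c * x)" by (simp add: cis_mult distrib_right)
    then show ?thesis by (simp add: fejer_at_def)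
  qed
  then have "(\<Sum>i<n. \<Sum>j<n. fejer_at (w + (real i - real j) * l) l x) = cis (w * x) * (\<Sum>i<n. \<Sum>j<n. fejer_at ((real i - real j) * l) l x)"
    unfolding sum_distrib_left by (intro sum.cong refl)
  then show ?thesis unfolding fejer_at_def[of w "real n * l"] fejer_grid[OF n] by (simp only: mult.left_commute)
qed

section \<open>Translation seminorms and their spectrum\<close>

lemma L1norm_integral:
  assumes i: "integrable (lborel \<Otimes>\<^sub>M lborel) (\<lambda>(y, x). D x y :: complex)"
  shows "L1norm (\<lambda>x. LINT y|lborel. D x y) \<le> (LINT y|lborel. L1norm (\<lambda>x. D x y))"
proof -
  have ni: "integrable (lborel \<Otimes>\<^sub>M lborel) (\<lambda>(y, x). cmod (D x y))"
    using integrable_norm[OF i] by (simp add: case_prod_unfold)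
  have "L1norm (\<lambda>x. LINT y|lborel. D x y) \<le> (LINT x|lborel. LINT y|lborel. cmod (D x y))"
    unfolding L1norm_def
  proof (rule integral_mono)
    show "integrable lborel (\<lambda>x. cmod (LINT y|lborel. D x y))"
      using lborel_pair.integrable_fst'[OF lborel_pair.integrable_product_swap[OF i]] by simp
    show "integrable lborel (\<lambda>x. LINT y|lborel. cmod (D x y))"
      using lborel_pair.integrable_fst'[OF lborel_pair.integrable_product_swap[OF ni]] by simp
  qed (rule integral_norm_bound)
  also have "\<dots> = (LINT y|lborel. L1norm (\<lambda>x. D x y))"
    unfolding L1norm_def by (rule lborel_pair.Fubini_integral) (rule ni)
  finally show ?thesis .
qed

lemma poussin_scale: "poussin L x = L * poussin 1 (L * x)"
  by (simp add: poussin_def fejer_def algebra_simps)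

lemma poussin_bound: "\<bar>poussin 1 x\<bar> \<le> (40 / fej_mass) * inverse (1 + x\<^sup>2)"
proof -
  have p: "0 < 1 + x\<^sup>2" by (simp add: add_pos_nonneg)
  have "sinc2 (2 * x) \<le> 8 * inverse (1 + (2 * x)\<^sup>2)" by (rule sinc2_bound)
  also have "\<dots> \<le> 8 * inverse (1 + x\<^sup>2)"
    using p by (intro mult_left_mono le_imp_inverse_le) (auto simp: power_mult_distrib)
  \<comment> \<open>The constant is \<open>40 = 4 * 8 + 8\<close>, with 8 from
    \<open>sinc2_bound\<close>.\<close>
  finally have 1: "4 * sinc2 (2 * x) + sinc2 x \<le> 40 * inverse (1 + x\<^sup>2)" using sinc2_bound[of x] by linarith
  have "\<bar>4 * sinc2 (2 * x) - sinc2 x\<bar> \<le> 40 * inverse (1 + x\<^sup>2)"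
    using 1 sinc2_nonneg[of "2 * x"] sinc2_nonneg[of x] by linarith
  then have "\<bar>4 * sinc2 (2 * x) - sinc2 x\<bar> / fej_mass \<le> 40 * inverse (1 + x\<^sup>2) / fej_mass"
    using fej_mass_pos by (simp add: divide_right_mono)
  moreover have "poussin 1 x = (4 * sinc2 (2 * x) - sinc2 x) / fej_mass"
    by (simp add: poussin_def fejer_def diff_divide_distrib)
  ultimately show ?thesis using fej_mass_pos by (simp add: abs_divide)
qed

text \<open>Modulus of continuity in mean of the kernel with parameter 1. The other kernels are
  dilates of it, so for parameter \<open>L\<close> and shift \<open>u\<close> the modulus is this
  one at \<open>L * u\<close>: for small \<open>L\<close> every fixed shift does little.\<close>

definition poussin_modulus :: "real \<Rightarrow> real" where
  "poussin_modulus u = L1norm (\<lambda>x. complex_of_real (poussin 1 (x + u) - poussin 1 x))"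

lemma poussin_measurable [measurable]: "poussin L \<in> borel_measurable borel"
  unfolding poussin_def[abs_def] by measurable

lemma poussin_continuous: "continuous_on UNIV (poussin L)"
  unfolding poussin_def[abs_def] by (intro continuous_intros fejer_continuous)

lemma poussin_modulus_measurable [measurable]: "poussin_modulus \<in> borel_measurable borel"
  unfolding poussin_modulus_def[abs_def] L1norm_def by measurable

lemma poussin_modulus_bound: "poussin_modulus u \<le> 2 * L1norm (\<lambda>x. complex_of_real (poussin 1 x))"
proof -
  have i: "integrable lborel (\<lambda>x. complex_of_real (poussin 1 x))" by (intro integrable_of_real poussin_integrable) simp
  show ?thesis
    using L1norm_diff[OF integrable_translate[OF i, of u] i] L1norm_translate[of "\<lambda>x. complex_of_real (poussin 1 x)" u]
    by (simp add: poussin_modulus_def)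
qed

lemma poussin_modulus_nonneg [simp]: "0 \<le> poussin_modulus u"
  by (simp add: poussin_modulus_def)

text \<open>Dominated convergence, after discarding finitely many terms so that all shifts are below
  1. Such a shift changes the weight \<open>inverse (1 + x\<^sup>2)\<close> by a factor of at most
  3, and the majorant of the difference has the factor \<open>3 + 1 = 4\<close>.\<close>

lemma poussin_modulus_tendsto:
  assumes u: "u \<longlonglongrightarrow> 0"
  shows "(\<lambda>n. poussin_modulus (u n)) \<longlonglongrightarrow> 0"
proof -
  have "\<forall>\<^sub>F n in sequentially. dist (u n) 0 < 1" using tendstoD[OF u] by simp
  then obtain N where N: "\<And>n. n \<ge> N \<Longrightarrow> \<bar>u n\<bar> < 1" by (auto simp: eventually_sequentially dist_real_def)
  define v where "v n = u (n + N)" for n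
  have v: "v \<longlonglongrightarrow> 0" unfolding v_def using u by (rule LIMSEQ_ignore_initial_segment)
  have v1: "\<bar>v n\<bar> \<le> 1" for n using N[of "n + N"] by (simp add: v_def less_imp_le)
  let ?K = "40 / fej_mass"
  have K: "0 \<le> ?K" using fej_mass_pos by simp
  have "(\<lambda>n. LINT x|lborel. cmod (complex_of_real (poussin 1 (x + v n) - poussin 1 x))) \<longlonglongrightarrow> integral\<^sup>L lborel (\<lambda>x::real. 0::real)"
  proof (rule integral_dominated_convergence[where w="\<lambda>x. (4 * ?K) * inverse (1 + x\<^sup>2)"])
    show "integrable lborel (\<lambda>x::real. (4 * ?K) * inverse (1 + x\<^sup>2))"
      using integrable_inverse_1_plus_sq by (rule integrable_mult_right)
    show "AE x in lborel. (\<lambda>n. cmod (complex_of_real (poussin 1 (x + v n) - poussin 1 x))) \<longlonglongrightarrow> 0"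
    proof (intro always_eventually allI)
      fix x :: real
      have "(\<lambda>n. poussin 1 (x + v n)) \<longlonglongrightarrow> poussin 1 (x + 0)"
      proof (rule continuous_on_tendsto_compose[OF poussin_continuous])
        show "(\<lambda>n. x + v n) \<longlonglongrightarrow> x + 0" by (intro tendsto_intros v)
      qed auto
      then have "(\<lambda>n. poussin 1 (x + v n) - poussin 1 x) \<longlonglongrightarrow> poussin 1 x - poussin 1 x" by (intro tendsto_intros) simp
      then show "(\<lambda>n. cmod (complex_of_real (poussin 1 (x + v n) - poussin 1 x))) \<longlonglongrightarrow> 0"
        by (simp only: norm_of_real diff_self) (rule tendsto_rabs_zero)
    qed
    show "AE x in lborel. norm (cmod (complex_of_real (poussin 1 (x + v n) - poussin 1 x))) \<le> (4 * ?K) * inverse (1 + x\<^sup>2)" for n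
    proof (intro always_eventually allI)
      fix x :: real
      have p: "0 < 1 + x\<^sup>2" "0 < 1 + (x + v n)\<^sup>2" by (simp_all add: add_pos_nonneg)
      have "(v n)\<^sup>2 \<le> 1" using v1[of n] by (simp add: abs_square_le_1)
      moreover have "x\<^sup>2 \<le> 2 * (x + v n)\<^sup>2 + 2 * (v n)\<^sup>2"
        using zero_le_power2[of "x + 2 * v n"] by (simp add: power2_eq_square algebra_simps)
      moreover have "t \<le> 1 \<Longrightarrow> y \<le> 2 * s + 2 * t \<Longrightarrow> 0 \<le> s \<Longrightarrow> 1 + y \<le> 3 * (1 + s)" for s t y :: real
        by (simp add: distrib_left)
      ultimately have "1 + x\<^sup>2 \<le> 3 * (1 + (x + v n)\<^sup>2)" using zero_le_power2 by blast
      then have "inverse (1 + (x + v n)\<^sup>2) \<le> 3 * inverse (1 + x\<^sup>2)"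
        using p by (simp add: inverse_eq_divide divide_simps)
      then have "?K * inverse (1 + (x + v n)\<^sup>2) \<le> ?K * (3 * inverse (1 + x\<^sup>2))" using K by (rule mult_left_mono)
      then have "\<bar>poussin 1 (x + v n)\<bar> \<le> 3 * (?K * inverse (1 + x\<^sup>2))" using poussin_bound[of "x + v n"] by linarith
      moreover have "\<bar>poussin 1 x\<bar> \<le> ?K * inverse (1 + x\<^sup>2)" by (rule poussin_bound)
      ultimately have "\<bar>poussin 1 (x + v n) - poussin 1 x\<bar> \<le> 4 * (?K * inverse (1 + x\<^sup>2))" by linarith
      then show "norm (cmod (complex_of_real (poussin 1 (x + v n) - poussin 1 x))) \<le> (4 * ?K) * inverse (1 + x\<^sup>2)"
        by (simp only: norm_of_real real_norm_def abs_idempotent mult.assoc)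
    qed
  qed measurable
  then have "(\<lambda>n. poussin_modulus (u (n + N))) \<longlonglongrightarrow> 0" by (simp add: poussin_modulus_def L1norm_def v_def)
  then show ?thesis by (rule LIMSEQ_offset)
qed

lemma L1norm_poussin_increment: "0 < L \<Longrightarrow> L1norm (\<lambda>x. complex_of_real (poussin L (x + u) - poussin L x)) = poussin_modulus (L * u)"
proof -
  assume L: "0 < L"
  have "complex_of_real (poussin L (x + u) - poussin L x) = complex_of_real L * complex_of_real (poussin 1 (\<bar>L\<bar> * x + L * u) - poussin 1 (\<bar>L\<bar> * x))" for x
    using L by (simp add: poussin_scale[of L] algebra_simps)
  then show ?thesis
    using L1norm_scale[of L "\<lambda>x. complex_of_real (poussin 1 (x + L * u) - poussin 1 x)"] L
    by (simp only: poussin_modulus_def)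
qed

text \<open>For small \<open>L\<close> the kernel lives at frequencies near \<open>w\<close>, where
  the transform of \<open>\<theta>\<close> is nearly constant, so convolving with
  \<open>\<theta>\<close> amounts to multiplying by its value at \<open>w\<close>. The error is
  estimated without transforms: apart from the character, translating the kernel by \<open>y\<close>
  changes it only by \<open>poussin_modulus (- (L * y))\<close>.\<close>

lemma fourier_localize:
  assumes th: "\<theta> \<in> DL1" and L: "0 < L"
  shows "L1norm (\<lambda>x. convol \<theta> (poussin_at w L) x - fourier \<theta> w * poussin_at w L x) \<le> (LINT y|lborel. cmod (\<theta> y) * poussin_modulus (- (L * y)))"
proof -
  have ti: "integrable lborel \<theta>" using th by (rule DL1_integrable)
  have Vi: "integrable lborel (poussin_at w L)" using L by (rule poussin_at_integrable)
  have [measurable]: "\<theta> \<in> borel_measurable borel" "poussin_at w L \<in> borel_measurable borel"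
    using ti Vi by (auto dest: borel_measurable_integrable)
  define D where "D x y = poussin_at w L (x - y) * \<theta> y - poussin_at w L x * (cis (- w * y) * \<theta> y)" for x y
  have ci: "integrable lborel (\<lambda>y. cis (- w * y) * \<theta> y)" by (rule cis_mult_integrable[OF ti])
  have i2: "integrable (lborel \<Otimes>\<^sub>M lborel) (\<lambda>(y, x). poussin_at w L x * (cis (- w * y) * \<theta> y))"
  proof (rule lborel_pair.Fubini_integrable)
    show "(\<lambda>(y, x). poussin_at w L x * (cis (- w * y) * \<theta> y)) \<in> borel_measurable (lborel \<Otimes>\<^sub>M lborel)" by measurable
    have "(\<lambda>y. LINT x|lborel. norm (case (y, x) of (y, x) \<Rightarrow> poussin_at w L x * (cis (- w * y) * \<theta> y))) = (\<lambda>y. L1norm (poussin_at w L) * cmod (\<theta> y))"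
      by (simp add: L1norm_def norm_mult)
    then show "integrable lborel (\<lambda>y. LINT x|lborel. norm (case (y, x) of (y, x) \<Rightarrow> poussin_at w L x * (cis (- w * y) * \<theta> y)))"
      using ti by simp
    show "AE y in lborel. integrable lborel (\<lambda>x. case (y, x) of (y, x) \<Rightarrow> poussin_at w L x * (cis (- w * y) * \<theta> y))"
      using Vi by (auto intro!: always_eventually integrable_mult_left)
  qed
  have i: "integrable (lborel \<Otimes>\<^sub>M lborel) (\<lambda>(y, x). D x y)"
    using Bochner_Integration.integrable_diff[OF convol_integrable_prod[OF Vi ti] i2]
    by (simp add: D_def case_prod_unfold)
  have "convol \<theta> (poussin_at w L) x - fourier \<theta> w * poussin_at w L x = (LINT y|lborel. D x y)" for x
  proof -
    have "bounded (range (poussin L))"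
    proof -
      have "\<bar>poussin L x\<bar> \<le> L * (40 / fej_mass)" for x
      proof -
        have "inverse (1 + (L * x)\<^sup>2) \<le> 1" by (rule inverse_le_1_iff[THEN iffD2]) simp
        then have "(40 / fej_mass) * inverse (1 + (L * x)\<^sup>2) \<le> 40 / fej_mass"
          using fej_mass_pos by (intro mult_left_le) auto
        with poussin_bound[of "L * x"] have "\<bar>poussin 1 (L * x)\<bar> \<le> 40 / fej_mass" by linarith
        then show ?thesis using L by (subst poussin_scale) (simp only: abs_mult abs_of_pos mult_left_mono less_imp_le)
      qed
      then show ?thesis by (auto simp: bounded_iff)
    qed
    then obtain B where B: "\<And>x. \<bar>poussin L x\<bar> \<le> B" by (auto simp: bounded_iff)
    have gi: "integrable lborel (\<lambda>y. poussin_at w L (x - y) * \<theta> y)"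
      by (rule bounded_mult_integrable[OF _ _ ti, where B=B]) (use B in \<open>auto simp: poussin_at_def norm_mult\<close>)
    have "convol \<theta> (poussin_at w L) x - fourier \<theta> w * poussin_at w L x =
        (LINT y|lborel. poussin_at w L (x - y) * \<theta> y) - (LINT y|lborel. poussin_at w L x * (cis (- w * y) * \<theta> y))"
      unfolding convol_commute[of \<theta>] unfolding convol_def fourier_def by (simp add: mult.commute)
    also have "\<dots> = (LINT y|lborel. D x y)"
      unfolding D_def by (intro Bochner_Integration.integral_diff[symmetric] gi integrable_mult_right ci)
    finally show ?thesis .
  qed
  then have "L1norm (\<lambda>x. convol \<theta> (poussin_at w L) x - fourier \<theta> w * poussin_at w L x) \<le> (LINT y|lborel. L1norm (\<lambda>x. D x y))"
    using L1norm_integral[OF i] by simp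
  moreover have "L1norm (\<lambda>x. D x y) = cmod (\<theta> y) * poussin_modulus (- (L * y))" for y
  proof -
    have "cmod (D x y) = cmod (\<theta> y) * cmod (complex_of_real (poussin L (x + - y) - poussin L x))" for x
    proof -
      have c: "cis (w * (x - y)) = cis (w * x) * cis (- w * y)" by (simp add: cis_mult algebra_simps)
      have "D x y = (cis (w * x) * cis (- w * y) * \<theta> y) * complex_of_real (poussin L (x + - y) - poussin L x)"
        unfolding D_def poussin_at_def c by (simp add: algebra_simps)
      then show ?thesis by (simp add: norm_mult)
    qed
    then show ?thesis
      using L1norm_poussin_increment[OF L, of "- y"] by (simp add: L1norm_def)
  qed
  ultimately show ?thesis by simp
qed

lemma fourier_localize_small:
  assumes th: "\<theta> \<in> DL1" and e: "0 < e"
  obtains L where "0 < L" "L1norm (\<lambda>x. convol \<theta> (poussin_at w L) x - fourier \<theta> w * poussin_at w L x) < e"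
proof -
  have ti: "integrable lborel \<theta>" using th by (rule DL1_integrable)
  have [measurable]: "\<theta> \<in> borel_measurable borel" using ti by (auto dest: borel_measurable_integrable)
  let ?C = "2 * L1norm (\<lambda>x. complex_of_real (poussin 1 x))"
  have "(\<lambda>n. LINT y|lborel. cmod (\<theta> y) * poussin_modulus (- (1 / real (Suc n) * y))) \<longlonglongrightarrow> integral\<^sup>L lborel (\<lambda>x::real. 0::real)"
  proof (rule integral_dominated_convergence[where w="\<lambda>y. cmod (\<theta> y) * ?C"])
    show "integrable lborel (\<lambda>y. cmod (\<theta> y) * ?C)" using ti by simp
    show "AE y in lborel. (\<lambda>n. cmod (\<theta> y) * poussin_modulus (- (1 / real (Suc n) * y))) \<longlonglongrightarrow> 0"
    proof (intro always_eventually allI)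
      fix y :: real
      have "(\<lambda>n. - (1 / real (Suc n) * y)) \<longlonglongrightarrow> - (0 * y)"
        by (intro tendsto_intros LIMSEQ_Suc[OF lim_1_over_n])
      then have "(\<lambda>n. poussin_modulus (- (1 / real (Suc n) * y))) \<longlonglongrightarrow> 0" by (intro poussin_modulus_tendsto) simp
      then show "(\<lambda>n. cmod (\<theta> y) * poussin_modulus (- (1 / real (Suc n) * y))) \<longlonglongrightarrow> 0" by (rule tendsto_mult_right_zero)
    qed
    show "AE y in lborel. norm (cmod (\<theta> y) * poussin_modulus (- (1 / real (Suc n) * y))) \<le> cmod (\<theta> y) * ?C" for n
      by (intro always_eventually allI) (simp add: abs_mult mult_left_mono[OF poussin_modulus_bound])
  qed measurable
  then have "(\<lambda>n. LINT y|lborel. cmod (\<theta> y) * poussin_modulus (- (1 / real (Suc n) * y))) \<longlonglongrightarrow> 0" by simp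
  from order_tendstoD(2)[OF this e] obtain n where
    "(LINT y|lborel. cmod (\<theta> y) * poussin_modulus (- (1 / real (Suc n) * y))) < e"
    by (auto simp: eventually_sequentially)
  then show ?thesis
    using that[of "1 / real (Suc n)"] fourier_localize[OF th, of "1 / real (Suc n)" w] by force
qed

text \<open>The kernel has integral 1, so the error is a mean of the translation moduli
  \<open>m\<close> of \<open>g\<close>. Rescaling moves the parameter from the kernel into the
  argument of \<open>m\<close>, where \<open>m u \<le> \<bar>u\<bar> * L1norm g'\<close> gives the
  limit and \<open>m u \<le> 2 * L1norm g\<close> the majorant.\<close>

lemma fejer_approx:
  assumes g: "\<And>t. (g has_vector_derivative g' t) (at t)" "integrable lborel g" "integrable lborel g'"
    and b: "\<And>x. cmod (g x) \<le> B"
  shows "(\<lambda>n. L1norm (\<lambda>x. g x - convol g (fejer_at 0 (real (Suc n))) x)) \<longlonglongrightarrow> 0"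
proof -
  have [measurable]: "g \<in> borel_measurable borel" using g by (auto dest: borel_measurable_integrable)
  define m where "m u = L1norm (\<lambda>x. g x - g (x - u))" for u
  have [measurable]: "m \<in> borel_measurable borel" unfolding m_def[abs_def] L1norm_def by measurable
  have m0: "0 \<le> m u" for u by (simp add: m_def)
  have m1: "m u \<le> \<bar>u\<bar> * L1norm g'" for u
    using L1norm_increment[OF g(1) g(3) g(2), of 0 "-u"] by (simp add: m_def)
  have m2: "m u \<le> 2 * L1norm g" for u
    using L1norm_diff[OF g(2) integrable_translate[OF g(2), of "-u"]] L1norm_translate[of g "-u"] by (simp add: m_def)
  have est: "L1norm (\<lambda>x. g x - convol g (fejer_at 0 R) x) \<le> (LINT u|lborel. fejer 1 u * m (u / R))" if R: "0 < R" for R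
  proof -
    have Fi: "integrable lborel (fejer_at 0 R)" by (rule fejer_at_integrable[OF R])
    have [measurable]: "fejer_at 0 R \<in> borel_measurable borel" using Fi by (auto dest: borel_measurable_integrable)
    have F1: "(LINT y|lborel. fejer_at 0 R y) = 1"
      using fejer_fourier[OF R, of 0] by (simp add: fejer_at_def[abs_def] tri_def)
    define D where "D x y = g x * fejer_at 0 R y - g (x - y) * fejer_at 0 R y" for x y
    have i2: "integrable (lborel \<Otimes>\<^sub>M lborel) (\<lambda>(y, x). g x * fejer_at 0 R y)"
    proof (rule lborel_pair.Fubini_integrable)
      show "(\<lambda>(y, x). g x * fejer_at 0 R y) \<in> borel_measurable (lborel \<Otimes>\<^sub>M lborel)" by measurable
      have "(\<lambda>y. LINT x|lborel. norm (case (y, x) of (y, x) \<Rightarrow> g x * fejer_at 0 R y)) = (\<lambda>y. L1norm g * cmod (fejer_at 0 R y))"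
        by (simp add: L1norm_def norm_mult)
      then show "integrable lborel (\<lambda>y. LINT x|lborel. norm (case (y, x) of (y, x) \<Rightarrow> g x * fejer_at 0 R y))"
        using Fi by simp
      show "AE y in lborel. integrable lborel (\<lambda>x. case (y, x) of (y, x) \<Rightarrow> g x * fejer_at 0 R y)"
        using g(2) by (auto intro!: always_eventually integrable_mult_left)
    qed
    have i: "integrable (lborel \<Otimes>\<^sub>M lborel) (\<lambda>(y, x). D x y)"
      using Bochner_Integration.integrable_diff[OF i2 convol_integrable_prod[OF g(2) Fi]]
      by (simp add: D_def case_prod_unfold)
    have "g x - convol g (fejer_at 0 R) x = (LINT y|lborel. D x y)" for x
    proof -
      have "integrable lborel (\<lambda>y. g (x - y) * fejer_at 0 R y)"
        using b by (intro bounded_mult_integrable[OF _ _ Fi]) auto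
      then show ?thesis
        unfolding D_def convol_def using Fi F1 by (simp add: Bochner_Integration.integral_diff)
    qed
    then have "L1norm (\<lambda>x. g x - convol g (fejer_at 0 R) x) \<le> (LINT y|lborel. L1norm (\<lambda>x. D x y))"
      using L1norm_integral[OF i] by simp
    also have "\<dots> = (LINT y|lborel. fejer R y * m y)"
    proof (intro Bochner_Integration.integral_cong refl)
      fix y
      have "D x y = fejer_at 0 R y * (g x - g (x - y))" for x by (simp add: D_def algebra_simps)
      then have "L1norm (\<lambda>x. D x y) = cmod (fejer_at 0 R y) * m y" by (simp add: L1norm_mult m_def)
      then show "L1norm (\<lambda>x. D x y) = fejer R y * m y" using R by (simp add: fejer_at_def norm_mult fejer_nonneg)
    qed
    also have "\<dots> = (LINT u|lborel. fejer 1 u * m (u / R))"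
      using lborel_integral_real_affine[of R "\<lambda>u. fejer 1 u * m (u / R)" 0] R
      by (simp add: fejer_scale[of R] mult.assoc)
    finally show ?thesis .
  qed
  have lim: "(\<lambda>n. LINT u|lborel. fejer 1 u * m (u / real (Suc n))) \<longlonglongrightarrow> integral\<^sup>L lborel (\<lambda>x::real. 0::real)"
  proof (rule integral_dominated_convergence[where w="\<lambda>u. fejer 1 u * (2 * L1norm g)"])
    show "integrable lborel (\<lambda>u. fejer 1 u * (2 * L1norm g))" using fejer1_integrable by (rule integrable_mult_left)
    show "AE u in lborel. (\<lambda>n. fejer 1 u * m (u / real (Suc n))) \<longlonglongrightarrow> 0"
    proof (intro always_eventually allI)
      fix u :: real
      have l: "(\<lambda>n. \<bar>u\<bar> / real (Suc n) * L1norm g') \<longlonglongrightarrow> 0 * L1norm g'"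
        by (intro tendsto_intros LIMSEQ_Suc[OF lim_const_over_n])
      have "(\<lambda>n. m (u / real (Suc n))) \<longlonglongrightarrow> 0"
      proof (rule tendsto_sandwich[OF _ _ tendsto_const])
        show "\<forall>\<^sub>F n in sequentially. 0 \<le> m (u / real (Suc n))" using m0 by simp
        show "\<forall>\<^sub>F n in sequentially. m (u / real (Suc n)) \<le> \<bar>u\<bar> / real (Suc n) * L1norm g'"
          using m1[of "u / real (Suc _)"] by (intro always_eventually allI) (simp only: abs_divide abs_of_nat)
        show "(\<lambda>n. \<bar>u\<bar> / real (Suc n) * L1norm g') \<longlonglongrightarrow> 0" using l by simp
      qed
      then show "(\<lambda>n. fejer 1 u * m (u / real (Suc n))) \<longlonglongrightarrow> 0" by (rule tendsto_mult_right_zero)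
    qed
    show "AE u in lborel. norm (fejer 1 u * m (u / real (Suc n))) \<le> fejer 1 u * (2 * L1norm g)" for n
      by (intro always_eventually allI) (simp add: abs_mult m0 fejer_nonneg mult_left_mono[OF m2])
  qed measurable
  show ?thesis
  proof (rule tendsto_sandwich[OF _ _ tendsto_const])
    show "\<forall>\<^sub>F n in sequentially. L1norm (\<lambda>x. g x - convol g (fejer_at 0 (real (Suc n))) x) \<le> (LINT u|lborel. fejer 1 u * m (u / real (Suc n)))"
      using est by (intro always_eventually allI) simp
    show "(\<lambda>n. LINT u|lborel. fejer 1 u * m (u / real (Suc n))) \<longlonglongrightarrow> 0" using lim by simp
  qed auto
qed

text \<open>What the spectral argument uses of a distance to a class. The null functions form a
  subspace of \<open>DL1\<close> invariant under translation and under convolution with integrable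
  kernels, and \<open>spec\<close> is its hull. \<open>N_bound\<close> lets approximation in a
  Sobolev norm pass to \<open>N\<close>.\<close>

locale translation_seminorm =
  fixes N :: "(real \<Rightarrow> complex) \<Rightarrow> real" and C :: real and p :: nat
  assumes N_nonneg: "0 \<le> N f"
    and N_add: "f \<in> DL1 \<Longrightarrow> g \<in> DL1 \<Longrightarrow> N (\<lambda>x. f x + g x) \<le> N f + N g"
    and N_mult: "f \<in> DL1 \<Longrightarrow> N (\<lambda>x. c * f x) \<le> cmod c * N f"
    and N_translate: "f \<in> DL1 \<Longrightarrow> N (\<lambda>x. f (x + a)) \<le> N f"
    and N_convol: "f \<in> DL1 \<Longrightarrow> integrable lborel k \<Longrightarrow> N (convol f k) \<le> L1norm k * N f"
    and N_bound: "f \<in> DL1 \<Longrightarrow> N f \<le> C * sobolev p f"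
begin

definition spec :: "real set" where
  "spec = {w. \<forall>f\<in>DL1. N f = 0 \<longrightarrow> fourier f w = 0}"

lemma N_diff:
  assumes "f \<in> DL1" "g \<in> DL1"
  shows "N (\<lambda>x. f x - g x) \<le> N f + N g"
  using N_add[OF assms(1) DL1_mult[OF assms(2), of "-1"]] N_mult[OF assms(2), of "-1"] by simp

lemma N_null_I: "N f \<le> 0 \<Longrightarrow> N f = 0"
  using N_nonneg[of f] by simp

lemma N_add_null:
  assumes "f \<in> DL1" "g \<in> DL1" "N f = 0" "N g = 0"
  shows "N (\<lambda>x. f x + g x) = 0"
  using N_add[OF assms(1,2)] assms(3,4) by (intro N_null_I) simp

lemma N_mult_null: "f \<in> DL1 \<Longrightarrow> N f = 0 \<Longrightarrow> N (\<lambda>x. c * f x) = 0"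
  using N_mult[of f c] by (intro N_null_I) simp

lemma N_sum_null:
  assumes "finite I" "\<And>i. i \<in> I \<Longrightarrow> f i \<in> DL1" "\<And>i. i \<in> I \<Longrightarrow> N (f i) = 0"
  shows "N (\<lambda>x. \<Sum>i\<in>I. f i x) = 0"
  using assms
proof (induction I rule: finite_induct)
  case empty
  have "(\<lambda>x. 0) \<in> DL1" using DL1_sum[of "{}" "\<lambda>_. undefined"] by simp
  from N_mult[OF this, of 0] show ?case by (intro N_null_I) simp
next
  case (insert i I)
  then show ?case by (simp add: N_add_null DL1_sum)
qed

text \<open>With \<open>\<kappa> = V - \<theta> * V / c\<close> one has \<open>\<eta> = \<eta> * \<kappa>\<close> modulo the null space, and \<open>\<kappa>\<close> is a
  contraction; this replaces Wiener's division lemma.\<close>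

lemma local_null:
  assumes w: "w \<notin> spec"
  shows "\<exists>\<delta>>0. \<forall>w' l f. \<bar>w' - w\<bar> \<le> \<delta> \<longrightarrow> 0 < l \<longrightarrow> l \<le> \<delta> \<longrightarrow> f \<in> DL1 \<longrightarrow> N (convol f (fejer_at w' l)) = 0"
proof -
  from w obtain \<theta> where th: "\<theta> \<in> DL1" "N \<theta> = 0" "fourier \<theta> w \<noteq> 0" by (auto simp: spec_def)
  define c where "c = fourier \<theta> w"
  have c: "c \<noteq> 0" using th by (simp add: c_def)
  then have c2: "0 < cmod c / 2" by simp
  obtain L where L: "0 < L" "L1norm (\<lambda>x. convol \<theta> (poussin_at w L) x - c * poussin_at w L x) < cmod c / 2"
    using fourier_localize_small[OF th(1) c2] unfolding c_def by blast
  have ti: "integrable lborel \<theta>" using th(1) by (rule DL1_integrable)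
  have Vi: "integrable lborel (poussin_at w L)" using L(1) by (rule poussin_at_integrable)
  show ?thesis
  \<comment> \<open>With distance of centres and width both at most \<open>L / 2\<close>, the
    frequencies of the narrow kernel stay within \<open>L\<close> of \<open>w\<close>.\<close>
  proof (intro exI[of _ "L/2"] conjI allI impI)
    show "0 < L / 2" using L by simp
    fix w' l f assume a: "\<bar>w' - w\<bar> \<le> L / 2" "0 < l" "l \<le> L / 2" and f: "f \<in> DL1"
    have gi: "integrable lborel (fejer_at w' l)" using a(2) by (rule fejer_at_integrable)
    define \<eta> where "\<eta> = convol f (fejer_at w' l)"
    have \<eta>: "\<eta> \<in> DL1" unfolding \<eta>_def by (rule DL1_convol[OF f gi])
    have \<eta>i: "integrable lborel \<eta>" using \<eta> by (rule DL1_integrable)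
    obtain B where B: "\<And>x. cmod (f x) \<le> B" using DL1_bounded[OF f, of 0] by auto
    obtain B1 where B1: "\<And>x. cmod (\<eta> x) \<le> B1" using DL1_bounded[OF \<eta>, of 0] by auto
    obtain B2 where B2: "\<And>x. cmod (\<theta> x) \<le> B2" using DL1_bounded[OF th(1), of 0] by auto
    have fm: "f \<in> borel_measurable borel" using DL1_D(4)[OF f, of 0] by simp
    have \<eta>m: "\<eta> \<in> borel_measurable borel" using DL1_D(4)[OF \<eta>, of 0] by simp
    have th_meas: "\<theta> \<in> borel_measurable borel" using DL1_D(4)[OF th(1), of 0] by simp
    have \<eta>V: "convol \<eta> (poussin_at w L) = \<eta>"
    proof
      fix x
      have "convol \<eta> (poussin_at w L) x = convol f (convol (fejer_at w' l) (poussin_at w L)) x"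
        unfolding \<eta>_def by (rule convol_assoc[OF fm B gi Vi])
      also have "convol (fejer_at w' l) (poussin_at w L) = fejer_at w' l" using a by (intro convol_poussin_at_fejer_at) auto
      finally show "convol \<eta> (poussin_at w L) x = \<eta> x" by (simp add: \<eta>_def)
    qed
    \<comment> \<open>This is \<open>- c\<close> times the contraction kernel, so that its norm has
      to be compared with \<open>cmod c / 2\<close>; the factor returns as \<open>inverse c\<close>
      when \<open>\<eta>\<close> is recovered.\<close>
    define \<kappa> where "\<kappa> x = convol \<theta> (poussin_at w L) x - c * poussin_at w L x" for x
    have csi: "integrable lborel (convol \<theta> (poussin_at w L))" by (rule convol_integrable[OF ti Vi])
    have \<kappa>i: "integrable lborel \<kappa>" unfolding \<kappa>_def using csi Vi by simp
    have null: "N (convol \<theta> \<eta>) = 0" using N_convol[OF th(1) \<eta>i] th(2) by (intro N_null_I) simp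
    have "convol \<eta> \<kappa> x = convol \<theta> \<eta> x - c * \<eta> x" for x
    proof -
      have i1: "integrable lborel (\<lambda>y. \<eta> (x - y) * convol \<theta> (poussin_at w L) y)"
        using B1 \<eta>m by (intro bounded_mult_integrable[OF _ _ csi]) auto
      have i2: "integrable lborel (\<lambda>y. \<eta> (x - y) * poussin_at w L y)"
        using B1 \<eta>m by (intro bounded_mult_integrable[OF _ _ Vi]) auto
      have "convol \<eta> \<kappa> x = (LINT y|lborel. \<eta> (x - y) * convol \<theta> (poussin_at w L) y - c * (\<eta> (x - y) * poussin_at w L y))"
        unfolding convol_def[of \<eta> \<kappa>] by (intro Bochner_Integration.integral_cong refl) (simp add: \<kappa>_def algebra_simps)
      also have "\<dots> = convol \<eta> (convol \<theta> (poussin_at w L)) x - c * convol \<eta> (poussin_at w L) x"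
        using i1 i2 by (simp add: convol_def[of \<eta>])
      also have "convol \<eta> (convol \<theta> (poussin_at w L)) x = convol (convol \<eta> \<theta>) (poussin_at w L) x"
        by (rule convol_assoc[OF \<eta>m B1 ti Vi, symmetric])
      also have "convol \<eta> \<theta> = convol \<theta> \<eta>" by (rule ext) (rule convol_commute)
      also have "convol (convol \<theta> \<eta>) (poussin_at w L) x = convol \<theta> (convol \<eta> (poussin_at w L)) x"
        by (rule convol_assoc[OF th_meas B2 \<eta>i Vi])
      finally show ?thesis by (simp add: \<eta>V)
    qed
    then have "\<eta> x = inverse c * (convol \<theta> \<eta> x - convol \<eta> \<kappa> x)" for x using c by (simp add: field_simps)
    then have eq: "\<eta> = (\<lambda>x. inverse c * (convol \<theta> \<eta> x - convol \<eta> \<kappa> x))" by blast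
    have D: "convol \<theta> \<eta> \<in> DL1" "convol \<eta> \<kappa> \<in> DL1" by (rule DL1_convol[OF th(1) \<eta>i], rule DL1_convol[OF \<eta> \<kappa>i])
    have "N \<eta> \<le> cmod (inverse c) * N (\<lambda>x. convol \<theta> \<eta> x - convol \<eta> \<kappa> x)"
      using N_mult[OF DL1_diff[OF D], of "inverse c"] eq by simp
    also have "\<dots> \<le> cmod (inverse c) * (cmod c / 2 * N \<eta>)"
    proof (rule mult_left_mono)
      have "N (\<lambda>x. convol \<theta> \<eta> x - convol \<eta> \<kappa> x) \<le> N (convol \<theta> \<eta>) + N (convol \<eta> \<kappa>)" by (rule N_diff[OF D])
      also have "\<dots> \<le> L1norm \<kappa> * N \<eta>" using null N_convol[OF \<eta> \<kappa>i] by simp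
      also have "\<dots> \<le> cmod c / 2 * N \<eta>"
        using L(2) unfolding \<kappa>_def[symmetric] by (intro mult_right_mono N_nonneg) simp
      finally show "N (\<lambda>x. convol \<theta> \<eta> x - convol \<eta> \<kappa> x) \<le> cmod c / 2 * N \<eta>" .
    qed simp
    also have "\<dots> = N \<eta> / 2" using c by (simp add: norm_inverse)
    finally have "N \<eta> \<le> 0" by simp
    then show "N (convol f (fejer_at w' l)) = 0" unfolding \<eta>_def by (rule N_null_I)
  qed
qed

text \<open>One width for all centres in \<open>K\<close>: otherwise there are failures with widths
  tending to 0, their centres accumulate at a point of \<open>K\<close> outside the spectrum, and
  \<open>local_null\<close> at that point excludes them.\<close>

lemma compact_null:
  assumes K: "compact K" "K \<inter> spec = {}"
  shows "\<exists>\<delta>>0. \<forall>w l f. w \<in> K \<longrightarrow> 0 < l \<longrightarrow> l \<le> \<delta> \<longrightarrow> f \<in> DL1 \<longrightarrow> N (convol f (fejer_at w l)) = 0"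
proof (rule ccontr)
  assume no: "\<not> ?thesis"
  have "\<exists>w l f. w \<in> K \<and> 0 < l \<and> l \<le> 1 / real (Suc n) \<and> f \<in> DL1 \<and> N (convol f (fejer_at w l)) \<noteq> 0" for n
  proof -
    have "0 < 1 / real (Suc n)" by simp
    with no show ?thesis by blast
  qed
  then obtain w l f where wl: "\<And>n. w n \<in> K" "\<And>n. 0 < l n" "\<And>n. l n \<le> 1 / real (Suc n)"
     "\<And>n. f n \<in> DL1" "\<And>n. N (convol (f n) (fejer_at (w n) (l n))) \<noteq> 0" by metis
  obtain w0 r where w0: "w0 \<in> K" and r: "strict_mono r" "(w \<circ> r) \<longlonglongrightarrow> w0"
    using K(1) wl(1) unfolding compact_def by blast
  then have "w0 \<notin> spec" using K(2) by blast
  from local_null[OF this] obtain \<delta> where d: "\<delta> > 0"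
    "\<And>w' l f. \<bar>w' - w0\<bar> \<le> \<delta> \<Longrightarrow> 0 < l \<Longrightarrow> l \<le> \<delta> \<Longrightarrow> f \<in> DL1 \<Longrightarrow> N (convol f (fejer_at w' l)) = 0" by blast
  have "\<forall>\<^sub>F n in sequentially. dist ((w \<circ> r) n) w0 < \<delta>" using tendstoD[OF r(2) d(1)] .
  moreover have "\<forall>\<^sub>F n in sequentially. 1 / real (Suc n) < \<delta>"
    using order_tendstoD(2)[OF LIMSEQ_Suc[OF lim_1_over_n] d(1)] .
  ultimately have "\<forall>\<^sub>F n in sequentially. dist ((w \<circ> r) n) w0 < \<delta> \<and> 1 / real (Suc n) < \<delta>"
    by (rule eventually_conj)
  then obtain n where n: "dist ((w \<circ> r) n) w0 < \<delta>" "1 / real (Suc n) < \<delta>"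
    by (auto simp: eventually_sequentially)
  have "l (r n) \<le> 1 / real (Suc (r n))" by (rule wl(3))
  also have "\<dots> \<le> 1 / real (Suc n)" using seq_suble[OF r(1), of n] by (intro divide_left_mono) auto
  finally have "l (r n) \<le> \<delta>" using n(2) by simp
  then have "N (convol (f (r n)) (fejer_at (w (r n)) (l (r n)))) = 0"
    using n(1) wl(2,4) by (intro d(2)) (auto simp: dist_real_def)
  then show False using wl(5) by blast
qed

lemma convol_fejer_at_grid:
  assumes n: "0 < n" and l: "0 < l" and f: "f \<in> DL1"
  shows "convol f (fejer_at w (real n * l)) =
    (\<lambda>x. \<Sum>i<n. \<Sum>j<n. (1 / real n) * convol f (fejer_at (w + (real i - real j) * l) l) x)"
proof
  fix x
  obtain B where B: "\<And>x. cmod (f x) \<le> B" using DL1_bounded[OF f, of 0] by auto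
  have fm: "f \<in> borel_measurable borel" using DL1_D(4)[OF f, of 0] by simp
  have i: "integrable lborel (\<lambda>y. (1 / real n) * (f (x - y) * fejer_at v l y))" for v
    using B fm by (intro integrable_mult_right bounded_mult_integrable[OF _ _ fejer_at_integrable[OF l]]) auto
  have "convol f (fejer_at w (real n * l)) x = (LINT y|lborel. (\<Sum>i<n. \<Sum>j<n. (1 / real n) * (f (x - y) * fejer_at (w + (real i - real j) * l) l y)))"
    unfolding convol_def fejer_at_grid[OF n] by (simp add: sum_distrib_left mult_ac)
  also have "\<dots> = (\<Sum>i<n. (LINT y|lborel. (\<Sum>j<n. (1 / real n) * (f (x - y) * fejer_at (w + (real i - real j) * l) l y))))"
    by (intro Bochner_Integration.integral_sum Bochner_Integration.integrable_sum i)
  also have "\<dots> = (\<Sum>i<n. \<Sum>j<n. (LINT y|lborel. (1 / real n) * (f (x - y) * fejer_at (w + (real i - real j) * l) l y)))"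
    by (intro sum.cong refl Bochner_Integration.integral_sum i)
  also have "\<dots> = (\<Sum>i<n. \<Sum>j<n. (1 / real n) * convol f (fejer_at (w + (real i - real j) * l) l) x)"
    unfolding convol_def by (simp only: integral_mult_right_zero)
  finally show "convol f (fejer_at w (real n * l)) x = (\<Sum>i<n. \<Sum>j<n. (1 / real n) * convol f (fejer_at (w + (real i - real j) * l) l) x)" .
qed

lemma grid_dist:
  assumes "i < n" "j < n" "0 < l"
  shows "\<bar>(real i - real j) * l\<bar> + l \<le> real n * l"
proof -
  have "\<bar>real i - real j\<bar> + 1 \<le> real n" using assms by linarith
  then have "(\<bar>real i - real j\<bar> + 1) * l \<le> real n * l" using assms by (intro mult_right_mono) auto
  then show ?thesis using assms by (simp add: abs_mult distrib_right)
qed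

lemma obtain_fine_grid:
  assumes "0 < R" "0 < (\<delta>::real)"
  obtains n l where "0 < n" "0 < l" "l \<le> \<delta>" "R = real n * l"
proof -
  obtain n :: nat where n: "R / \<delta> \<le> real n" using real_arch_simple by blast
  moreover have "0 < R / \<delta>" using assms by simp
  ultimately have n0: "0 < n" by (cases n) auto
  show ?thesis
    using that[of n "R / real n"] n n0 assms by (simp add: divide_le_eq mult.commute)
qed

text \<open>For fixed \<open>R\<close> compactness of \<open>{-R..R}\<close> gives an admissible
  width, and the kernel of parameter \<open>R\<close> is a combination of kernels of that width
  centred in \<open>{-R..R}\<close>, so the convolution of \<open>f\<close> with it is null. As
  \<open>R\<close> grows these convolutions tend to \<open>f\<close> in every Sobolev norm.\<close>

theorem null_if_spec_empty:
  assumes sp: "spec = {}" and f: "f \<in> DL1"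
  shows "N f = 0"
proof -
  have null: "N (convol f (fejer_at 0 R)) = 0" if R: "0 < R" for R
  proof -
    obtain \<delta> where d: "\<delta> > 0" "\<And>w l f. w \<in> {-R..R} \<Longrightarrow> 0 < l \<Longrightarrow> l \<le> \<delta> \<Longrightarrow> f \<in> DL1 \<Longrightarrow> N (convol f (fejer_at w l)) = 0"
      using compact_null[of "{-R..R}"] sp by auto
    obtain n l where nl: "0 < n" "0 < l" "l \<le> \<delta>" "R = real n * l" using obtain_fine_grid[OF R d(1)] .
    have "N (convol f (fejer_at ((real i - real j) * l) l)) = 0" if "i < n" "j < n" for i j
    proof (rule d(2)[OF _ nl(2,3) f])
      have "\<bar>(real i - real j) * l\<bar> \<le> R" using grid_dist[OF that nl(2)] nl by linarith
      then show "(real i - real j) * l \<in> {-R..R}" unfolding abs_le_iff atLeastAtMost_iff by linarith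
    qed
    then show ?thesis
      unfolding nl(4) convol_fejer_at_grid[OF nl(1,2) f]
      by (intro N_sum_null N_mult_null DL1_sum DL1_mult DL1_convol f fejer_at_integrable nl) auto
  qed
  have bnd: "N f \<le> C * sobolev p (\<lambda>x. f x - convol f (fejer_at 0 (real (Suc n))) x)" for n
  proof -
    have D: "convol f (fejer_at 0 (real (Suc n))) \<in> DL1" by (intro DL1_convol f fejer_at_integrable) simp
    have "N f = N (\<lambda>x. (f x - convol f (fejer_at 0 (real (Suc n))) x) + convol f (fejer_at 0 (real (Suc n))) x)" by simp
    also have "\<dots> \<le> N (\<lambda>x. f x - convol f (fejer_at 0 (real (Suc n))) x) + N (convol f (fejer_at 0 (real (Suc n))))"
      by (intro N_add DL1_diff D f)
    also have "N (convol f (fejer_at 0 (real (Suc n)))) = 0" by (rule null) simp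
    finally show ?thesis using N_bound[OF DL1_diff[OF f D]] by simp
  qed
  have "(\<lambda>n. C * (\<Sum>j\<le>p. L1norm (\<lambda>x. iter_deriv j f x - convol (iter_deriv j f) (fejer_at 0 (real (Suc n))) x))) \<longlonglongrightarrow> C * (\<Sum>j\<le>p. 0)"
  proof (intro tendsto_mult tendsto_const tendsto_sum)
    fix j
    obtain B where "\<And>x. cmod (iter_deriv j f x) \<le> B" using DL1_bounded[OF f, of j] by auto
    then show "(\<lambda>n. L1norm (\<lambda>x. iter_deriv j f x - convol (iter_deriv j f) (fejer_at 0 (real (Suc n))) x)) \<longlonglongrightarrow> 0"
      by (intro fejer_approx[OF DL1_D(3)[OF f] DL1_D(2)[OF f] DL1_D(2)[OF f]])
  qed
  moreover have "sobolev p (\<lambda>x. f x - convol f (fejer_at 0 (real (Suc n))) x) =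
      (\<Sum>j\<le>p. L1norm (\<lambda>x. iter_deriv j f x - convol (iter_deriv j f) (fejer_at 0 (real (Suc n))) x))" for n
  proof -
    have i: "integrable lborel (fejer_at 0 (real (Suc n)))" by (rule fejer_at_integrable) simp
    show ?thesis unfolding sobolev_def by (simp only: iter_deriv_diff[OF f DL1_convol[OF f i]] iter_deriv_convol[OF f i])
  qed
  ultimately have "(\<lambda>n. C * sobolev p (\<lambda>x. f x - convol f (fejer_at 0 (real (Suc n))) x)) \<longlonglongrightarrow> 0" by simp
  then have "N f \<le> 0" using bnd by (intro LIMSEQ_le_const) auto
  then show ?thesis by (rule N_null_I)
qed

text \<open>The localised function splits into pieces away from \<open>w\<close>, which are null by
  \<open>compact_null\<close>, and pieces within \<open>L\<close> of \<open>w\<close>, which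
  \<open>poussin_at w L\<close> reproduces. On the latter the twisted difference acts as convolution
  with the twisted difference of the kernel, whose norm is \<open>poussin_modulus (L * h)\<close>.
  This tends to 0 with \<open>L\<close>, while the left-hand side does not depend on
  \<open>L\<close>.\<close>

theorem isolated_spec_point:
  assumes r: "0 < r" and iso: "\<And>w'. w' \<noteq> w \<Longrightarrow> \<bar>w' - w\<bar> \<le> r \<Longrightarrow> w' \<notin> spec" and f: "f \<in> DL1"
  shows "N (\<lambda>x. cis (- (w * h)) * convol f (fejer_at w r) (x + h) - convol f (fejer_at w r) x) = 0"
proof -
  define T where "T g x = cis (- (w * h)) * g (x + h) - g x" for g :: "real \<Rightarrow> complex" and x
  have TD: "T g \<in> DL1" if "g \<in> DL1" for g
    unfolding T_def[abs_def] by (intro DL1_diff DL1_mult DL1_translate that)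
  have TN: "N (T g) \<le> 2 * N g" if g: "g \<in> DL1" for g
  proof -
    have "N (T g) \<le> N (\<lambda>x. cis (- (w * h)) * g (x + h)) + N g"
      unfolding T_def[abs_def] by (intro N_diff DL1_mult DL1_translate g)
    also have "N (\<lambda>x. cis (- (w * h)) * g (x + h)) \<le> cmod (cis (- (w * h))) * N (\<lambda>x. g (x + h))"
      by (intro N_mult DL1_translate g)
    also have "\<dots> \<le> N g" using N_translate[OF g, of h] by simp
    finally show ?thesis by simp
  qed
  define \<eta> where "\<eta> = convol f (fejer_at w r)"
  have \<eta>: "\<eta> \<in> DL1" unfolding \<eta>_def by (intro DL1_convol f fejer_at_integrable r)
  have main: "N (T \<eta>) \<le> poussin_modulus (L * h) * N \<eta>" if L: "0 < L" "L < r" for L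
  proof -
    define K where "K = {w - r..w + r} - {w - L/2<..<w + L/2}"
    have "compact K" unfolding K_def by (intro compact_diff) auto
    moreover have "K \<inter> spec = {}" using iso L by (auto simp: K_def abs_le_iff)
    ultimately obtain \<delta> where d: "\<delta> > 0" "\<And>w l f. w \<in> K \<Longrightarrow> 0 < l \<Longrightarrow> l \<le> \<delta> \<Longrightarrow> f \<in> DL1 \<Longrightarrow> N (convol f (fejer_at w l)) = 0"
      using compact_null by blast
    \<comment> \<open>The width must be admissible for the far pieces and, for the near ones with
      centres within \<open>L / 2\<close> of \<open>w\<close>, must leave the frequencies within
      \<open>L\<close> of \<open>w\<close>.\<close>
    have "0 < min \<delta> (L/2)" using d(1) L by simp
    then obtain n l where nl: "0 < n" "0 < l" "l \<le> min \<delta> (L/2)" "r = real n * l" using obtain_fine_grid[OF r] by metis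
    define e where "e i j = (\<lambda>x. (1 / complex_of_real (real n)) * convol f (fejer_at (w + (real i - real j) * l) l) x)" for i j
    have eD: "e i j \<in> DL1" for i j unfolding e_def by (intro DL1_mult DL1_convol f fejer_at_integrable nl)
    define near where "near i j \<longleftrightarrow> \<bar>(real i - real j) * l\<bar> < L/2" for i j :: nat
    define \<rho> where "\<rho> = (\<lambda>x. \<Sum>i<n. \<Sum>j<n. (if near i j then 1 else 0) * e i j x)"
    define \<sigma> where "\<sigma> = (\<lambda>x. \<Sum>i<n. \<Sum>j<n. (if near i j then 0 else 1) * e i j x)"
    have \<rho>: "\<rho> \<in> DL1" and \<sigma>: "\<sigma> \<in> DL1"
      unfolding \<rho>_def \<sigma>_def by (intro DL1_sum DL1_mult eD finite_lessThan)+
    have eq: "\<eta> x = \<rho> x + \<sigma> x" for x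
    proof -
      have "\<eta> x = (\<Sum>i<n. \<Sum>j<n. e i j x)"
        unfolding \<eta>_def nl(4) convol_fejer_at_grid[OF nl(1,2) f] e_def by simp
      also have "\<dots> = \<rho> x + \<sigma> x"
        unfolding \<rho>_def \<sigma>_def sum.distrib[symmetric] by (intro sum.cong refl) simp
      finally show ?thesis .
    qed
    have N\<sigma>: "N \<sigma> = 0"
      unfolding \<sigma>_def
    proof (intro N_sum_null DL1_sum DL1_mult eD finite_lessThan)
      fix i j assume ij: "i \<in> {..<n}" "j \<in> {..<n}"
      show "N (\<lambda>x. (if near i j then 0 else 1) * e i j x) = 0"
      proof (cases "near i j")
        case True
        then show ?thesis using N_mult[OF eD, of 0 i j] by (intro N_null_I) simp
      next
        case False
        have "w + (real i - real j) * l \<in> K"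
        proof -
          have "\<bar>(real i - real j) * l\<bar> + l \<le> r" using grid_dist[of i n j l] ij nl by simp
          then have "\<bar>(real i - real j) * l\<bar> \<le> r" using nl(2) by linarith
          moreover have "\<bar>z\<bar> \<le> r \<Longrightarrow> \<not> \<bar>z\<bar> < L/2 \<Longrightarrow> w + z \<in> K" for z
            unfolding K_def by (auto simp: abs_if split: if_splits)
          ultimately show ?thesis using False unfolding near_def by blast
        qed
        then have "N (convol f (fejer_at (w + (real i - real j) * l) l)) = 0" using nl f by (intro d(2)) auto
        then have "N (e i j) = 0" unfolding e_def by (intro N_mult_null DL1_convol f fejer_at_integrable nl)
        then show ?thesis using False by simp
      qed
    qed
    obtain B where B: "\<And>x. cmod (f x) \<le> B" using DL1_bounded[OF f, of 0] by auto
    have fm: "f \<in> borel_measurable borel" using DL1_D(4)[OF f, of 0] by simp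
    have Vi: "integrable lborel (poussin_at w L)" using L(1) by (rule poussin_at_integrable)
    have eV: "convol (e i j) (poussin_at w L) x = e i j x" if "near i j" for i j x
    proof -
      have "convol (e i j) (poussin_at w L) x = (1 / complex_of_real (real n)) * convol (convol f (fejer_at (w + (real i - real j) * l) l)) (poussin_at w L) x"
        unfolding e_def convol_def[of _ "poussin_at w L"] by (simp only: mult.assoc integral_mult_right_zero)
      also have "convol (convol f (fejer_at (w + (real i - real j) * l) l)) (poussin_at w L) x = convol f (convol (fejer_at (w + (real i - real j) * l) l) (poussin_at w L)) x"
        by (rule convol_assoc[OF fm B fejer_at_integrable[OF nl(2)] Vi])
      also have "convol (fejer_at (w + (real i - real j) * l) l) (poussin_at w L) = fejer_at (w + (real i - real j) * l) l"
        using that nl by (intro convol_poussin_at_fejer_at) (auto simp: near_def)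
      finally show ?thesis by (simp add: e_def)
    qed
    have \<rho>V: "\<rho> x = convol \<rho> (poussin_at w L) x" for x
    proof -
      have i: "integrable lborel (\<lambda>y. (if near i j then 1 else 0) * e i j (x - y) * poussin_at w L y)" for i j
      proof -
        obtain B where "\<And>x. cmod (e i j x) \<le> B" using DL1_bounded[OF eD[of i j], of 0] by auto
        moreover from this have "0 \<le> B" using norm_ge_zero order_trans by blast
        moreover have "e i j \<in> borel_measurable borel" using DL1_D(4)[OF eD[of i j], of 0] by simp
        ultimately show ?thesis by (intro bounded_mult_integrable[OF _ _ Vi, of _ B]) auto
      qed
      have "convol \<rho> (poussin_at w L) x = (LINT y|lborel. (\<Sum>i<n. \<Sum>j<n. (if near i j then 1 else 0) * e i j (x - y) * poussin_at w L y))"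
        unfolding convol_def \<rho>_def by (simp only: sum_distrib_right)
      also have "\<dots> = (\<Sum>i<n. (LINT y|lborel. (\<Sum>j<n. (if near i j then 1 else 0) * e i j (x - y) * poussin_at w L y)))"
        by (intro Bochner_Integration.integral_sum Bochner_Integration.integrable_sum i)
      also have "\<dots> = (\<Sum>i<n. \<Sum>j<n. (LINT y|lborel. (if near i j then 1 else 0) * e i j (x - y) * poussin_at w L y))"
        by (intro sum.cong refl Bochner_Integration.integral_sum i)
      also have "\<dots> = (\<Sum>i<n. \<Sum>j<n. (if near i j then 1 else 0) * e i j x)"
      proof (intro sum.cong refl)
        fix i j
        show "(LINT y|lborel. (if near i j then 1 else 0) * e i j (x - y) * poussin_at w L y) = (if near i j then 1 else 0) * e i j x"
          using eV[of i j x] by (simp add: convol_def)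
      qed
      finally show ?thesis by (simp add: \<rho>_def)
    qed
    define V1 where "V1 x = cis (- (w * h)) * poussin_at w L (x + h) - poussin_at w L x" for x
    have V1i: "integrable lborel V1" unfolding V1_def using Vi integrable_translate[OF Vi, of h] by simp
    have LV1: "L1norm V1 = poussin_modulus (L * h)"
    proof -
      have "V1 x = cis (w * x) * complex_of_real (poussin L (x + h) - poussin L x)" for x
      proof -
        have "cis (w * (x + h)) = cis (w * x) * cis (w * h)" by (simp add: cis_mult distrib_left)
        then have "V1 x = (cis (- (w * h)) * cis (w * h)) * (cis (w * x) * complex_of_real (poussin L (x + h))) - cis (w * x) * complex_of_real (poussin L x)"
          unfolding V1_def poussin_at_def by (simp only: mult_ac)
        then show ?thesis by (simp add: cis_mult right_diff_distrib)
      qed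
      then have "V1 = (\<lambda>x. cis (w * x) * complex_of_real (poussin L (x + h) - poussin L x))" by blast
      then show ?thesis using L1norm_poussin_increment[OF L(1), of h] by (simp only: L1norm_cis)
    qed
    have T\<rho>: "T \<rho> = convol \<rho> V1"
    proof
      fix x
      obtain B where B: "\<And>x. cmod (\<rho> x) \<le> B" using DL1_bounded[OF \<rho>, of 0] by auto
      have \<rho>m: "\<rho> \<in> borel_measurable borel" using DL1_D(4)[OF \<rho>, of 0] by simp
      have "\<rho> (x + h) = (LINT y|lborel. \<rho> (x - y) * poussin_at w L (y + h))"
        using \<rho>V[of "x + h"] lborel_integral_real_affine[of 1 "\<lambda>y. \<rho> (x + h - y) * poussin_at w L y" h]
        by (simp add: convol_def add.commute)
      then have "T \<rho> x = cis (- (w * h)) * (LINT y|lborel. \<rho> (x - y) * poussin_at w L (y + h)) - (LINT y|lborel. \<rho> (x - y) * poussin_at w L y)"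
        using \<rho>V[of x] by (simp add: T_def convol_def)
      also have "\<dots> = (LINT y|lborel. cis (- (w * h)) * (\<rho> (x - y) * poussin_at w L (y + h)) - \<rho> (x - y) * poussin_at w L y)"
      proof -
        have "integrable lborel (\<lambda>y. \<rho> (x - y) * poussin_at w L (y + h))" "integrable lborel (\<lambda>y. \<rho> (x - y) * poussin_at w L y)"
          using B \<rho>m Vi integrable_translate[OF Vi, of h] by (auto intro!: bounded_mult_integrable)
        then show ?thesis by simp
      qed
      also have "\<dots> = convol \<rho> V1 x"
        unfolding convol_def V1_def by (intro Bochner_Integration.integral_cong refl) (simp add: algebra_simps)
      finally show "T \<rho> x = convol \<rho> V1 x" .
    qed
    \<comment> \<open>The near part is compared with \<open>\<eta>\<close> itself by means of the
      null far part. The bound thus does not involve the number of pieces, which grows as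
      \<open>L\<close> shrinks.\<close>
    have "N \<rho> \<le> N \<eta> + N \<sigma>" using N_diff[OF \<eta> \<sigma>] eq by simp
    then have N\<rho>: "N \<rho> \<le> N \<eta>" using N\<sigma> by simp
    have "T \<eta> = (\<lambda>x. T \<rho> x + T \<sigma> x)" by (auto simp: T_def eq algebra_simps)
    then have "N (T \<eta>) \<le> N (T \<rho>) + N (T \<sigma>)" using N_add[OF TD[OF \<rho>] TD[OF \<sigma>]] by simp
    also have "N (T \<sigma>) \<le> 0" using TN[OF \<sigma>] N\<sigma> by simp
    also have "N (T \<rho>) \<le> poussin_modulus (L * h) * N \<rho>" unfolding T\<rho> using N_convol[OF \<rho> V1i] LV1 by simp
    also have "\<dots> \<le> poussin_modulus (L * h) * N \<eta>" by (intro mult_left_mono N\<rho>) simp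
    finally show ?thesis by simp
  qed
  \<comment> \<open>The sequence is \<open>L = r / (n + 2)\<close>, because \<open>main\<close> asks
    for \<open>L < r\<close> strictly.\<close>
  have l: "(\<lambda>n. r / real (Suc (Suc n)) * h) \<longlonglongrightarrow> 0 * h"
    by (intro tendsto_intros LIMSEQ_Suc[OF LIMSEQ_Suc[OF lim_const_over_n]])
  then have "(\<lambda>n. poussin_modulus (r / real (Suc (Suc n)) * h)) \<longlonglongrightarrow> 0"
    by (intro poussin_modulus_tendsto) (simp only: mult_zero_left)
  then have "(\<lambda>n. poussin_modulus (r / real (Suc (Suc n)) * h) * N \<eta>) \<longlonglongrightarrow> 0"
    by (rule tendsto_mult_left_zero)
  moreover have "N (T \<eta>) \<le> poussin_modulus (r / real (Suc (Suc n)) * h) * N \<eta>" for n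
  proof (rule main)
    show "0 < r / real (Suc (Suc n))" using r by simp
    have "r * 1 < r * real (Suc (Suc n))" using r by (intro mult_strict_left_mono) auto
    then show "r / real (Suc (Suc n)) < r" using r by (simp only: divide_less_eq) simp
  qed
  ultimately have "N (T \<eta>) \<le> 0" by (intro LIMSEQ_le_const) auto
  then have "N (T \<eta>) = 0" by (rule N_null_I)
  then show ?thesis by (simp add: T_def[abs_def] \<eta>_def)
qed

end

section \<open>Bounded uniformly continuous extensions of a class\<close>

lemma forward_closed_admissible: "admissible_interval J \<Longrightarrow> forward_closed J"
  by (auto simp: admissible_interval_def forward_closed_def)

lemma Cub_iff: "f \<in> Cub UNIV \<longleftrightarrow> bdd_uc UNIV f"
  by (auto simp: Cub_def Cu_def bdd_uc_def)

lemma bdd_uc_add: "bdd_uc J f \<Longrightarrow> bdd_uc J g \<Longrightarrow> bdd_uc J (\<lambda>t. f t + g t)"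
  by (auto simp: bdd_uc_def intro!: bounded_plus_comp uniformly_continuous_on_add)

lemma bdd_uc_zero: "bdd_uc J (\<lambda>t. 0)"
  by (auto simp: bdd_uc_def bounded_iff uniformly_continuous_on_const)

lemma bdd_uc_translate:
  assumes "bdd_uc UNIV f"
  shows "bdd_uc UNIV (\<lambda>t. f (t + a))"
proof -
  have "bounded (range (\<lambda>t. f (t + a)))"
    using assms by (auto simp: bdd_uc_def intro: bounded_subset)
  moreover have "uniformly_continuous_on UNIV (\<lambda>t. f (t + a))"
    unfolding uniformly_continuous_on_def
  proof (intro allI impI)
    fix e :: real assume "e > 0"
    then obtain d where "d > 0" "\<And>x x'. dist x' x < d \<Longrightarrow> dist (f x') (f x) < e"
      using assms unfolding bdd_uc_def uniformly_continuous_on_def by (metis UNIV_I)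
    then show "\<exists>d>0. \<forall>x\<in>UNIV. \<forall>x'\<in>UNIV. dist x' x < d \<longrightarrow> dist (f (x' + a)) (f (x + a)) < e"
      by (intro exI[of _ d]) (auto simp: dist_real_def)
  qed
  ultimately show ?thesis by (simp add: bdd_uc_def)
qed

lemma bdd_uc_continuous: "bdd_uc UNIV f \<Longrightarrow> continuous_on S f"
  unfolding bdd_uc_def using uniformly_continuous_imp_continuous continuous_on_subset by blast

lemma bdd_uc_loc_int: "bdd_uc UNIV f \<Longrightarrow> loc_int f"
  by (intro loc_int_continuous bdd_uc_continuous)

lemma bdd_uc_modulus:
  assumes "bdd_uc J f" "e > 0"
  obtains d where "d > 0" "\<And>x y. x \<in> J \<Longrightarrow> y \<in> J \<Longrightarrow> \<bar>x - y\<bar> < d \<Longrightarrow> norm (f x - f y) < e"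
  using assms unfolding bdd_uc_def uniformly_continuous_on_def by (metis dist_norm dist_real_def)

definition good_class :: "real set \<Rightarrow> (real \<Rightarrow> 'a::complex_banach) set \<Rightarrow> bool" where
  "good_class J B \<longleftrightarrow> linear_class J B \<and> uniformly_closed J B \<and> Cub_invariant J B"

text \<open>A class on \<open>J\<close> has no translations of its own, since a translate may need
  values outside \<open>J\<close>. Passing to functions on the line whose restrictions lie in the
  class gives a space that is linear, closed under uniform limits and, by
  \<open>Cub_invariant\<close>, invariant under all translations.\<close>

definition lift :: "real set \<Rightarrow> (real \<Rightarrow> 'a::complex_banach) set \<Rightarrow> (real \<Rightarrow> 'a) set" where
  "lift J B = {f. bdd_uc UNIV f \<and> restrict f J \<in> B}"

context
  fixes J :: "real set" and B :: "(real \<Rightarrow> 'a::complex_banach) set"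
  assumes B: "good_class J B"
begin

lemma lift_zero: "(\<lambda>t. 0) \<in> lift J B"
  using B by (simp add: lift_def good_class_def linear_class_def bdd_uc_zero)

lemma lift_add: "f \<in> lift J B \<Longrightarrow> g \<in> lift J B \<Longrightarrow> (\<lambda>t. f t + g t) \<in> lift J B"
proof -
  assume f: "f \<in> lift J B" and g: "g \<in> lift J B"
  then have "(\<lambda>t\<in>J. restrict f J t + restrict g J t) \<in> B"
    using B unfolding lift_def good_class_def linear_class_def by blast
  moreover have "(\<lambda>t\<in>J. restrict f J t + restrict g J t) = restrict (\<lambda>t. f t + g t) J" by auto
  ultimately show ?thesis using f g by (simp add: lift_def bdd_uc_add)
qed

lemma restrict_scaleC: "restrict f J \<in> B \<Longrightarrow> restrict (\<lambda>t. c *\<^sub>C f t) J \<in> B"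
proof -
  assume "restrict f J \<in> B"
  then have "(\<lambda>t\<in>J. c *\<^sub>C restrict f J t) \<in> B"
    using B unfolding good_class_def linear_class_def by blast
  moreover have "(\<lambda>t\<in>J. c *\<^sub>C restrict f J t) = restrict (\<lambda>t. c *\<^sub>C f t) J" by auto
  ultimately show ?thesis by simp
qed

lemma restrict_scaleR: "restrict f J \<in> B \<Longrightarrow> restrict (\<lambda>t. c *\<^sub>R f t) J \<in> B"
  using restrict_scaleC[of f "complex_of_real c"] by (simp add: scaleC_of_real)

lemma lift_scaleC: "f \<in> lift J B \<Longrightarrow> (\<lambda>t. c *\<^sub>C f t) \<in> lift J B"
  by (simp add: lift_def restrict_scaleC bdd_uc_const_scaleC)

lemma lift_sum: "finite I \<Longrightarrow> (\<And>i. i \<in> I \<Longrightarrow> f i \<in> lift J B) \<Longrightarrow> (\<lambda>t. \<Sum>i\<in>I. f i t) \<in> lift J B"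
proof (induction I rule: finite_induct)
  case empty
  then show ?case using lift_zero by simp
next
  case (insert i I)
  then show ?case using lift_add[of "f i" "\<lambda>t. \<Sum>i\<in>I. f i t"] by simp
qed

lemma lift_translate: "f \<in> lift J B \<Longrightarrow> (\<lambda>t. f (t + a)) \<in> lift J B"
  using B by (auto simp: lift_def good_class_def Cub_invariant_def Cub_iff bdd_uc_translate)

lemma lift_limit:
  assumes f: "bdd_uc UNIV f" and ap: "\<And>e. e > 0 \<Longrightarrow> \<exists>g\<in>lift J B. \<forall>x. norm (f x - g x) \<le> e"
  shows "f \<in> lift J B"
proof -
  have "\<exists>g. \<forall>n. g n \<in> lift J B \<and> (\<forall>x. norm (f x - g n x) \<le> 1 / real (Suc n))"
    using ap[of "1 / real (Suc _)"] by (intro choice) (auto simp: Bex_def)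
  then obtain g where g: "\<And>n. g n \<in> lift J B" "\<And>n x. norm (f x - g n x) \<le> 1 / real (Suc n)" by blast
  have "uniform_limit J (\<lambda>n. restrict (g n) J) (restrict f J) sequentially"
  proof (rule uniform_limitI)
    fix e :: real assume "e > 0"
    then have "\<forall>\<^sub>F n in sequentially. 1 / real (Suc n) < e"
      using order_tendstoD(2)[OF LIMSEQ_Suc[OF lim_1_over_n]] by blast
    then show "\<forall>\<^sub>F n in sequentially. \<forall>x\<in>J. dist (restrict (g n) J x) (restrict f J x) < e"
    proof eventually_elim
      case (elim n)
      show ?case
      proof
        fix x assume "x \<in> J"
        then show "dist (restrict (g n) J x) (restrict f J x) < e"
          using g(2)[of x n] elim by (simp add: dist_norm norm_minus_commute)
      qed
    qed
  qed
  moreover have "restrict (g n) J \<in> B" for n using g(1) by (simp add: lift_def)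
  ultimately have "restrict f J \<in> B"
    using B[unfolded good_class_def uniformly_closed_def, THEN conjunct2, THEN conjunct1, rule_format,
        of "\<lambda>n. restrict (g n) J" "restrict f J"] by simp
  then show ?thesis using f by (simp add: lift_def)
qed

text \<open>Riemann sums, with the integrals of \<open>c\<close> over the cells as weights.\<close>

lemma lift_integral:
  assumes f: "f \<in> lift J B" and ab: "a \<le> b" and c: "continuous_on UNIV c"
  shows "(\<lambda>x. integral {a..b} (\<lambda>z. c z *\<^sub>C f (x - z))) \<in> lift J B"
proof -
  let ?F = "\<lambda>x. integral {a..b} (\<lambda>z. c z *\<^sub>C f (x - z))"
  have fu: "bdd_uc UNIV f" using f by (simp add: lift_def)
  have fi: "(\<lambda>z. c z *\<^sub>C f (x - z)) integrable_on {s..t}" for x s t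
    by (intro integrable_continuous_real continuous_intros continuous_on_subset[OF c]
        continuous_on_compose2[OF bdd_uc_continuous[OF fu, of UNIV]]) auto
  have ci: "(\<lambda>z. norm (c z)) integrable_on {s..t}" for s t
    by (intro integrable_continuous_real continuous_intros continuous_on_subset[OF c]) auto
  have ci': "c integrable_on {s..t}" for s t
    by (intro integrable_continuous_real continuous_on_subset[OF c]) auto
  define M where "M = integral {a..b} (\<lambda>z. norm (c z))"
  have M: "0 \<le> M" unfolding M_def by (intro integral_nonneg ci) auto
  obtain C where C: "\<And>x. norm (f x) \<le> C" using fu by (auto simp: bdd_uc_def bounded_iff)
  have Fu: "bdd_uc UNIV ?F"
    unfolding bdd_uc_def
  proof
    show "bounded (range ?F)"
      unfolding bounded_iff
    proof (intro exI ballI)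
      fix y assume "y \<in> range ?F"
      then obtain x where y: "y = ?F x" by auto
      show "norm y \<le> integral {a..b} (\<lambda>z. norm (c z) * C)"
        unfolding y by (rule integral_norm_bound_integral[OF fi integrable_on_mult_left[OF ci]])
          (auto simp: norm_scaleC intro!: mult_left_mono C)
    qed
    show "uniformly_continuous_on UNIV ?F"
      unfolding uniformly_continuous_on_def
    proof (intro allI impI)
      fix e :: real assume e: "e > 0"
      then have "e / (M + 1) > 0" using M by simp
      then obtain d where d: "d > 0" "\<And>x y. \<bar>x - y\<bar> < d \<Longrightarrow> norm (f x - f y) < e / (M + 1)"
        using bdd_uc_modulus[OF fu] by (metis UNIV_I)
      show "\<exists>d>0. \<forall>x\<in>UNIV. \<forall>x'\<in>UNIV. dist x' x < d \<longrightarrow> dist (?F x') (?F x) < e"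
      proof (intro exI[of _ d] conjI d(1) ballI impI)
        fix x x' :: real assume x: "dist x' x < d"
        have "?F x' - ?F x = integral {a..b} (\<lambda>z. c z *\<^sub>C f (x' - z) - c z *\<^sub>C f (x - z))"
          by (rule Henstock_Kurzweil_Integration.integral_diff[symmetric]) (rule fi)+
        also have "norm \<dots> \<le> integral {a..b} (\<lambda>z. norm (c z) * (e / (M + 1)))"
        proof (rule integral_norm_bound_integral[OF Henstock_Kurzweil_Integration.integrable_diff[OF fi fi] integrable_on_mult_left[OF ci]])
          fix z
          have "norm (f (x' - z) - f (x - z)) < e / (M + 1)" by (rule d(2)) (use x in \<open>simp add: dist_real_def\<close>)
          then show "norm (c z *\<^sub>C f (x' - z) - c z *\<^sub>C f (x - z)) \<le> norm (c z) * (e / (M + 1))"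
            unfolding scaleC.diff_right[symmetric] norm_scaleC by (intro mult_left_mono) auto
        qed
        also have "\<dots> = M * (e / (M + 1))" by (simp add: M_def)
        also have "\<dots> < e" using e M by (simp add: field_simps)
        finally show "dist (?F x') (?F x) < e" by (simp add: dist_norm)
      qed
    qed
  qed
  show ?thesis
  proof (rule lift_limit[OF Fu])
    fix e :: real assume e: "e > 0"
    then have "e / (M + 1) > 0" using M by simp
    then obtain d where d: "d > 0" "\<And>x y. \<bar>x - y\<bar> < d \<Longrightarrow> norm (f x - f y) < e / (M + 1)"
      using bdd_uc_modulus[OF fu] by (metis UNIV_I)
    obtain n :: nat where n: "(b - a) / d < real n" using reals_Archimedean2 by blast
    have n0: "0 < real n" using n ab d(1) by (smt (verit) divide_nonneg_pos)
    define \<delta> where "\<delta> = (b - a) / real n"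
    have \<delta>: "0 \<le> \<delta>" "\<delta> < d" "real n * \<delta> = b - a"
      using n n0 ab d(1) by (auto simp: \<delta>_def divide_less_eq mult.commute)
    define p where "p i = a + real i * \<delta>" for i
    have p0: "p 0 = a" and pn: "p n = b" using \<delta> by (simp_all add: p_def)
    have pS: "p (Suc i) = p i + \<delta>" for i by (simp add: p_def algebra_simps)
    define w where "w i = integral {p i..p (Suc i)} c" for i
    let ?g = "\<lambda>x. \<Sum>i<n. w i *\<^sub>C f (x + - p i)"
    have "?g \<in> lift J B"
      by (intro lift_sum lift_scaleC lift_translate f finite_lessThan)
    moreover have "norm (?F x - ?g x) \<le> e" for x
    proof -
      have split: "integral {a..p k} h = (\<Sum>i<k. integral {p i..p (Suc i)} h)" if h: "\<And>s t. h integrable_on {s..t}" for k and h :: "real \<Rightarrow> 'c::banach"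
      proof (induction k)
        case (Suc k)
        have "a \<le> p k" using \<delta> by (simp add: p_def)
        moreover have "p k \<le> p (Suc k)" using \<delta> by (simp only: pS le_add_same_cancel1)
        moreover note h Suc
        ultimately show ?case
          using Henstock_Kurzweil_Integration.integral_combine[of a "p k" "p (Suc k)" h] by simp
      qed (simp add: p0)
      have "?F x - ?g x = (\<Sum>i<n. integral {p i..p (Suc i)} (\<lambda>z. c z *\<^sub>C f (x - z)) - w i *\<^sub>C f (x - p i))"
        using split[of "\<lambda>z. c z *\<^sub>C f (x - z)" n, OF fi] by (simp add: pn sum_subtractf)
      also have "norm \<dots> \<le> (\<Sum>i<n. integral {p i..p (Suc i)} (\<lambda>z. norm (c z)) * (e / (M + 1)))"
      proof (rule sum_norm_le)
        fix i
        have cc: "(\<lambda>z. c z *\<^sub>C f (x - p i)) integrable_on {p i..p (Suc i)}"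
          by (intro integrable_continuous_real continuous_intros continuous_on_subset[OF c]) auto
        have "integral {p i..p (Suc i)} (\<lambda>z. c z *\<^sub>C f (x - z)) - w i *\<^sub>C f (x - p i) =
          integral {p i..p (Suc i)} (\<lambda>z. c z *\<^sub>C f (x - z) - c z *\<^sub>C f (x - p i))"
          unfolding w_def integral_scaleC_left[OF ci', symmetric]
          by (rule Henstock_Kurzweil_Integration.integral_diff[symmetric]) (rule fi, rule cc)
        also have "norm \<dots> \<le> integral {p i..p (Suc i)} (\<lambda>z. norm (c z) * (e / (M + 1)))"
        proof (rule integral_norm_bound_integral[OF Henstock_Kurzweil_Integration.integrable_diff[OF fi cc] integrable_on_mult_left[OF ci]])
          fix z assume z: "z \<in> {p i..p (Suc i)}"
          have "norm (f (x - z) - f (x - p i)) < e / (M + 1)"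
            by (rule d(2)) (use z \<delta> in \<open>auto simp: pS\<close>)
          then show "norm (c z *\<^sub>C f (x - z) - c z *\<^sub>C f (x - p i)) \<le> norm (c z) * (e / (M + 1))"
            unfolding scaleC.diff_right[symmetric] norm_scaleC by (intro mult_left_mono) auto
        qed
        also have "\<dots> = integral {p i..p (Suc i)} (\<lambda>z. norm (c z)) * (e / (M + 1))" by simp
        finally show "norm (integral {p i..p (Suc i)} (\<lambda>z. c z *\<^sub>C f (x - z)) - w i *\<^sub>C f (x - p i))
            \<le> integral {p i..p (Suc i)} (\<lambda>z. norm (c z)) * (e / (M + 1))" .
      qed
      also have "\<dots> = M * (e / (M + 1))"
        unfolding sum_distrib_right[symmetric] using split[of "\<lambda>z. norm (c z)" n, OF ci] by (simp only: pn M_def)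
      also have "\<dots> \<le> e" using e M by (simp add: field_simps)
      finally show ?thesis .
    qed
    ultimately show "\<exists>g\<in>lift J B. \<forall>x. norm (?F x - g x) \<le> e" by (intro bexI[of _ ?g] allI)
  qed
qed

lemma lift_window:
  assumes f: "f \<in> lift J B" and h: "0 < h"
  shows "window h f \<in> lift J B"
proof -
  have "window h f = (\<lambda>x. integral {-h..0} (\<lambda>z. 1 *\<^sub>C f (x - z)))"
  proof
    fix x
    have "integral {-h..0} (\<lambda>z. 1 *\<^sub>C f (x - z)) = integral {0..h} (\<lambda>z. f (x + z))"
      using Henstock_Kurzweil_Integration.integral_reflect_real[of h 0 "\<lambda>z. f (x + z)"]
      by (simp add: scaleC_of_real[of 1, simplified])
    then show "window h f x = integral {-h..0} (\<lambda>z. 1 *\<^sub>C f (x - z))"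
      by (simp add: integral_shift_Icc window_def)
  qed
  moreover have "(\<lambda>x. integral {-h..0} (\<lambda>z. 1 *\<^sub>C f (x - z))) \<in> lift J B"
    by (rule lift_integral[OF f]) (use h in auto)
  ultimately show ?thesis by simp
qed

lemma lift_fold_window: "f \<in> lift J B \<Longrightarrow> \<forall>h\<in>set hs. 0 < h \<Longrightarrow> fold window hs f \<in> lift J B"
  by (induction hs arbitrary: f) (auto simp: lift_window)

text \<open>Means with small windows are uniformly close to a bounded uniformly continuous function.\<close>

lemma lift_if_fold_window:
  shows "bdd_uc UNIV f \<Longrightarrow> (\<And>hs. length hs = q \<Longrightarrow> \<forall>h\<in>set hs. 0 < h \<Longrightarrow> fold window hs f \<in> lift J B) \<Longrightarrow> f \<in> lift J B"
proof (induction q arbitrary: f)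
  case 0
  then show ?case using "0.prems"(2)[of "[]"] by simp
next
  case (Suc q)
  have fl: "loc_int f" using bdd_uc_loc_int[OF Suc.prems(1)] .
  have D: "window h f \<in> lift J B" if h: "0 < h" for h
  proof (rule Suc.IH)
    show "bdd_uc UNIV (window h f)"
      by (rule bdd_uc_window[OF _ fl Suc.prems(1) h]) (simp add: forward_closed_def)
    fix hs :: "real list" assume "length hs = q" "\<forall>h\<in>set hs. 0 < h"
    then show "fold window hs (window h f) \<in> lift J B" using Suc.prems(2)[of "h # hs"] h by simp
  qed
  show ?case
  proof (rule lift_limit[OF Suc.prems(1)])
    fix e :: real assume e: "e > 0"
    obtain d where d: "d > 0" "\<And>x y. \<bar>x - y\<bar> < d \<Longrightarrow> norm (f x - f y) < e"
      using bdd_uc_modulus[OF Suc.prems(1) e] by (metis UNIV_I)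
    define h where "h = d / 2"
    have h: "0 < h" "h < d" using d(1) by (simp_all add: h_def)
    let ?g = "\<lambda>x. complex_of_real (1 / h) *\<^sub>C window h f x"
    have cl: "loc_int (\<lambda>_. f x)" for x by (rule loc_int_continuous) auto
    have "?g \<in> lift J B" by (intro lift_scaleC D h)
    moreover have "norm (f x - ?g x) \<le> e" for x
    proof -
      have "integral {x..x+h} (\<lambda>y. f x - f y) = h *\<^sub>R f x - window h f x"
        unfolding window_def using h by (simp add: Henstock_Kurzweil_Integration.integral_diff loc_int_integrable[OF fl] loc_int_integrable[OF cl])
      moreover have "norm (integral {x..x+h} (\<lambda>y. f x - f y)) \<le> integral {x..x+h} (\<lambda>y. e)"
      proof (rule integral_norm_bound_integral)
        show "(\<lambda>y. f x - f y) integrable_on {x..x + h}"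
          by (intro Henstock_Kurzweil_Integration.integrable_diff loc_int_integrable fl cl)
        show "norm (f x - f y) \<le> e" if "y \<in> {x..x+h}" for y
          using that h by (intro less_imp_le d(2)) auto
      qed auto
      ultimately have 1: "norm (h *\<^sub>R f x - window h f x) \<le> h * e" using h by simp
      have "f x - ?g x = (1 / h) *\<^sub>R (h *\<^sub>R f x - window h f x)"
        using h by (simp only: scaleC_of_real scaleR_diff_right) simp
      then have "norm (f x - ?g x) = norm (h *\<^sub>R f x - window h f x) / h" using h by simp
      also have "\<dots> \<le> e" using 1 h by (simp add: divide_le_eq mult.commute)
      finally show ?thesis .
    qed
    ultimately show "\<exists>g\<in>lift J B. \<forall>x. norm (f x - g x) \<le> e" by (intro bexI[of _ ?g] allI)
  qed
qed

end

section \<open>Convolution with a bounded distribution\<close>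

lemma conv_add:
  assumes "S \<in> DL1_dual" "f \<in> DL1" "g \<in> DL1"
  shows "conv S (\<lambda>t. f t + g t) x = conv S f x + conv S g x"
  using assms(1) DL1_reflect[OF assms(2), of x] DL1_reflect[OF assms(3), of x]
  by (simp add: conv_def DL1_dual_def)

lemma conv_mult:
  assumes "S \<in> DL1_dual" "f \<in> DL1"
  shows "conv S (\<lambda>t. c * f t) x = c *\<^sub>C conv S f x"
  using assms(1) DL1_reflect[OF assms(2), of x] by (simp add: conv_def DL1_dual_def)

lemma conv_diff:
  fixes S :: "(real \<Rightarrow> complex) \<Rightarrow> 'a::complex_banach"
  assumes "S \<in> DL1_dual" "f \<in> DL1" "g \<in> DL1"
  shows "conv S (\<lambda>t. f t - g t) x = conv S f x - conv S g x"
proof -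
  have "conv S (\<lambda>t. f t + (-1) * g t) x = conv S f x + (-1) *\<^sub>C conv S g x"
    using conv_add[OF assms(1,2) DL1_mult[OF assms(3)], of "-1"] conv_mult[OF assms(1,3), of "-1"] by simp
  also have "(-1) *\<^sub>C conv S g x = - conv S g x"
    using scaleC_of_real[of "-1" "conv S g x"] by simp
  finally show ?thesis by simp
qed

lemma conv_sum:
  assumes S: "S \<in> DL1_dual" and "finite I" "\<And>i. i \<in> I \<Longrightarrow> f i \<in> DL1"
  shows "conv S (\<lambda>t. \<Sum>i\<in>I. f i t) x = (\<Sum>i\<in>I. conv S (f i) x)"
  using assms(2,3)
proof (induction I rule: finite_induct)
  case empty
  have "(\<lambda>x. 0) \<in> DL1" using DL1_sum[of "{}" "\<lambda>_. undefined"] by simp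
  from conv_mult[OF S this, of 0 x] show ?case by (simp add: scaleC.zero_left)
next
  case (insert i I)
  then have D: "f i \<in> DL1" "(\<lambda>t. \<Sum>i\<in>I. f i t) \<in> DL1" by (auto intro: DL1_sum)
  show ?case using insert conv_add[OF S D, of x] by simp
qed

lemma conv_translate: "conv S (\<lambda>t. f (t + a)) x = conv S f (x + a)"
  by (simp add: conv_def algebra_simps)

lemma conv_norm:
  assumes "\<And>f. f \<in> DL1 \<Longrightarrow> norm (S f) \<le> C * sobolev p f" "f \<in> DL1"
  shows "norm (conv S f x) \<le> C * sobolev p f"
  using assms(1)[OF DL1_reflect[OF assms(2), of x]] sobolev_reflect[OF assms(2)] by (simp add: conv_def)

text \<open>Increments of the convolution are convolutions with increments of \<open>f\<close>,
  whose Sobolev norm is Lipschitz in the shift at the price of one more derivative. The convolution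
  is therefore bounded and even Lipschitz, whatever the order of \<open>S\<close>.\<close>

lemma conv_bdd_uc:
  fixes S :: "(real \<Rightarrow> complex) \<Rightarrow> 'a::complex_banach"
  assumes S: "S \<in> DL1_dual" and f: "f \<in> DL1"
  shows "bdd_uc UNIV (conv S f)"
proof -
  obtain C p where C: "0 \<le> C" "\<And>f. f \<in> DL1 \<Longrightarrow> norm (S f) \<le> C * sobolev p f" by (rule DL1_dual_bound[OF S]) blast
  define K where "K = C * (\<Sum>j\<le>p. L1norm (iter_deriv (Suc j) f))"
  have K: "0 \<le> K" using C by (auto simp: K_def intro!: mult_nonneg_nonneg sum_nonneg)
  have lip: "norm (conv S f x - conv S f y) \<le> K * \<bar>x - y\<bar>" for x y
  proof -
    have tr: "(\<lambda>t. f (t + (x - y))) \<in> DL1" by (rule DL1_translate[OF f])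
    have "conv S f x - conv S f y = conv S (\<lambda>t. f (t + (x - y)) - f t) y"
      using conv_diff[OF S tr f] conv_translate[of S f "x - y" y] by simp
    also have "norm \<dots> \<le> C * sobolev p (\<lambda>t. f (t + (x - y)) - f t)"
      by (rule conv_norm[OF C(2) DL1_diff[OF tr f]])
    also have "\<dots> \<le> C * (\<Sum>j\<le>p. \<bar>x - y\<bar> * L1norm (iter_deriv (Suc j) f))"
      unfolding sobolev_def iter_deriv_diff[OF tr f] iter_deriv_translate[OF f]
      using L1norm_increment[OF DL1_D(3)[OF f] DL1_D(2)[OF f] DL1_D(2)[OF f], of _ "x - y" 0]
      by (intro mult_left_mono C sum_mono) simp
    finally show ?thesis by (simp add: K_def sum_distrib_left mult_ac)
  qed
  have "uniformly_continuous_on UNIV (conv S f)"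
    unfolding uniformly_continuous_on_def
  proof (intro allI impI)
    fix e :: real assume e: "e > 0"
    show "\<exists>d>0. \<forall>x\<in>UNIV. \<forall>x'\<in>UNIV. dist x' x < d \<longrightarrow> dist (conv S f x') (conv S f x) < e"
    proof (intro exI[of _ "e / (K + 1)"] conjI ballI impI)
      fix x x' :: real assume "dist x' x < e / (K + 1)"
      then have "(K + 1) * \<bar>x' - x\<bar> < e" using K by (simp add: dist_real_def pos_less_divide_eq mult.commute)
      moreover have "K * \<bar>x' - x\<bar> \<le> (K + 1) * \<bar>x' - x\<bar>" by (intro mult_right_mono) auto
      ultimately show "dist (conv S f x') (conv S f x) < e" using lip[of x' x] by (simp add: dist_norm)
    qed (use e K in simp)
  qed
  moreover have "bounded (range (conv S f))"
    unfolding bounded_iff using conv_norm[OF C(2) f] by blast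
  ultimately show ?thesis by (simp add: bdd_uc_def)
qed

text \<open>The bound of \<open>S\<close> by a Sobolev norm holds at every point \<open>x\<close>
  with the same constant, because these norms do not change under the reflections in
  \<open>conv\<close>. So the approximation of the kernel becomes uniform on the line.\<close>

lemma conv_convol_approx:
  fixes S :: "(real \<Rightarrow> complex) \<Rightarrow> 'a::complex_banach"
  assumes S: "S \<in> DL1_dual" and f: "f \<in> DL1" and k: "integrable lborel k" and e: "e > 0"
  obtains I w and y :: "int \<Rightarrow> real" where "finite I" "(\<Sum>i\<in>I. cmod (w i)) \<le> L1norm k"
    "\<And>x. norm (conv S (convol f k) x - (\<Sum>i\<in>I. w i *\<^sub>C conv S f (x + - y i))) < e"
proof -
  obtain C p where C: "0 \<le> C" "\<And>f. f \<in> DL1 \<Longrightarrow> norm (S f) \<le> C * sobolev p f" by (rule DL1_dual_bound[OF S]) blast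
  have "e / (C + 1) > 0" using e C by simp
  from convol_approx[OF f k this, of p] obtain I :: "int set" and w y where I: "finite I" "(\<Sum>i\<in>I. cmod (w i)) \<le> L1norm k"
    "sobolev p (\<lambda>x. convol f k x - (\<Sum>i\<in>I. w i * f (x - y i))) < e / (C + 1)" by blast
  have tr: "(\<lambda>x. f (x - a)) \<in> DL1" for a using DL1_translate[OF f, of "-a"] by simp
  have D: "(\<lambda>x. \<Sum>i\<in>I. w i * f (x - y i)) \<in> DL1" "convol f k \<in> DL1"
    by (intro DL1_sum I DL1_mult tr, rule DL1_convol[OF f k])
  show ?thesis
  proof (rule that[OF I(1,2)])
    fix x
    have "conv S (\<lambda>x. \<Sum>i\<in>I. w i * f (x - y i)) x = (\<Sum>i\<in>I. w i *\<^sub>C conv S f (x + - y i))"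
    proof -
      have "conv S (\<lambda>x. \<Sum>i\<in>I. w i * f (x - y i)) x = (\<Sum>i\<in>I. conv S (\<lambda>x. w i * f (x - y i)) x)"
        by (rule conv_sum[OF S I(1)]) (rule DL1_mult[OF tr])
      also have "\<dots> = (\<Sum>i\<in>I. w i *\<^sub>C conv S f (x + - y i))"
      proof (rule sum.cong[OF refl])
        fix i
        show "conv S (\<lambda>x. w i * f (x - y i)) x = w i *\<^sub>C conv S f (x + - y i)"
          using conv_mult[OF S tr[of "y i"], of "w i" x] conv_translate[of S f "- y i" x] by simp
      qed
      finally show ?thesis .
    qed
    then have "conv S (convol f k) x - (\<Sum>i\<in>I. w i *\<^sub>C conv S f (x + - y i)) =
      conv S (\<lambda>x. convol f k x - (\<Sum>i\<in>I. w i * f (x - y i))) x"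
      using conv_diff[OF S D(2,1)] by simp
    also have "norm \<dots> \<le> C * sobolev p (\<lambda>x. convol f k x - (\<Sum>i\<in>I. w i * f (x - y i)))"
      by (rule conv_norm[OF C(2) DL1_diff[OF D(2,1)]])
    also have "\<dots> \<le> C * (e / (C + 1))" using I(3) C(1) by (intro mult_left_mono) auto
    also have "\<dots> < e" using e C(1) by (simp add: field_simps)
    finally show "norm (conv S (convol f k) x - (\<Sum>i\<in>I. w i *\<^sub>C conv S f (x + - y i))) < e" .
  qed
qed

definition dist_lift :: "real set \<Rightarrow> (real \<Rightarrow> 'a::complex_banach) set \<Rightarrow> (real \<Rightarrow> 'a) \<Rightarrow> real" where
  "dist_lift J A f = Inf {r. 0 \<le> r \<and> (\<exists>g\<in>lift J A. \<forall>x. norm (f x - g x) \<le> r)}"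

context
  fixes J :: "real set" and A :: "(real \<Rightarrow> 'a::complex_banach) set"
  assumes A: "good_class J A"
begin

lemma dist_lift_le: "0 \<le> r \<Longrightarrow> g \<in> lift J A \<Longrightarrow> (\<And>x. norm (f x - g x) \<le> r) \<Longrightarrow> dist_lift J A f \<le> r"
  unfolding dist_lift_def by (rule cInf_lower) (blast, rule bdd_belowI[of _ 0], blast)

lemma dist_lift_approx:
  assumes f: "bounded (range f)" and r: "dist_lift J A f < r"
  obtains g where "g \<in> lift J A" "\<And>x. norm (f x - g x) \<le> r"
proof -
  let ?R = "{r. 0 \<le> r \<and> (\<exists>g\<in>lift J A. \<forall>x. norm (f x - g x) \<le> r)}"
  obtain B where B: "B > 0" "\<And>x. norm (f x) \<le> B" using f by (auto simp: bounded_pos)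
  then have "B \<in> ?R" using lift_zero[OF A] by (auto intro!: bexI[of _ "\<lambda>t. 0"])
  then have "?R \<noteq> {}" by blast
  from cInf_lessD[OF this r[unfolded dist_lift_def]] obtain s where s: "s \<in> ?R" "s < r" by (rule bexE)
  from s(1) obtain g where g: "g \<in> lift J A" "\<And>x. norm (f x - g x) \<le> s" by blast
  show ?thesis
  proof (rule that[OF g(1)])
    show "norm (f x - g x) \<le> r" for x using g(2)[of x] s(2) by linarith
  qed
qed

lemma dist_lift_nonneg: "bounded (range f) \<Longrightarrow> 0 \<le> dist_lift J A f"
proof -
  assume "bounded (range f)"
  then obtain B where B: "B > 0" "\<And>x. norm (f x) \<le> B" by (auto simp: bounded_pos)
  then have "B \<in> {r. 0 \<le> r \<and> (\<exists>g\<in>lift J A. \<forall>x. norm (f x - g x) \<le> r)}"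
    using lift_zero[OF A] by (auto intro!: bexI[of _ "\<lambda>t. 0"])
  then show ?thesis unfolding dist_lift_def by (intro cInf_greatest) auto
qed

text \<open>Closedness of the class under uniform limits turns distance 0 into membership; this is
  what identifies the hull of the null space with \<open>sp_DL1\<close>.\<close>

lemma dist_lift_zero_iff:
  assumes f: "bdd_uc UNIV f"
  shows "dist_lift J A f = 0 \<longleftrightarrow> restrict f J \<in> A"
proof
  assume z: "dist_lift J A f = 0"
  have "f \<in> lift J A"
  proof (rule lift_limit[OF A f])
    fix e :: real assume "e > 0"
    then have "dist_lift J A f < e" using z by simp
    then obtain g where "g \<in> lift J A" "\<And>x. norm (f x - g x) \<le> e"
      using dist_lift_approx[of f e] f unfolding bdd_uc_def by metis
    then show "\<exists>g\<in>lift J A. \<forall>x. norm (f x - g x) \<le> e" by blast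
  qed
  then show "restrict f J \<in> A" by (simp add: lift_def)
next
  assume "restrict f J \<in> A"
  then have "f \<in> lift J A" using f by (simp add: lift_def)
  then have "dist_lift J A f \<le> 0" by (intro dist_lift_le[of 0 f]) auto
  moreover have "0 \<le> dist_lift J A f" using f by (intro dist_lift_nonneg) (simp add: bdd_uc_def)
  ultimately show "dist_lift J A f = 0" by simp
qed

text \<open>The value 0 off \<open>DL1\<close> is a default: \<open>N_nonneg\<close> speaks of all
  functions, while the infimum is meaningful only for bounded convolutions. On \<open>DL1\<close>
  each property is obtained by applying the same operation to a nearly optimal approximant in
  \<open>lift J A\<close>.\<close>

lemma translation_seminorm_dist_lift:
  assumes S: "S \<in> DL1_dual"
  shows "\<exists>C p. translation_seminorm (\<lambda>f. if f \<in> DL1 then dist_lift J A (conv S f) else 0) C p"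
proof -
  obtain C p where C: "0 \<le> C" "\<And>f. f \<in> DL1 \<Longrightarrow> norm (S f) \<le> C * sobolev p f" by (rule DL1_dual_bound[OF S]) blast
  let ?d = "\<lambda>f. dist_lift J A (conv S f)"
  have bd: "bounded (range (conv S f))" if "f \<in> DL1" for f
    using conv_bdd_uc[OF S that] by (simp add: bdd_uc_def)
  have nn: "0 \<le> ?d f" if "f \<in> DL1" for f by (rule dist_lift_nonneg[OF bd[OF that]])
  have ap: "\<exists>g\<in>lift J A. \<forall>x. norm (conv S f x - g x) \<le> ?d f + e" if "f \<in> DL1" "e > 0" for f e
    using dist_lift_approx[OF bd[OF that(1)], of "?d f + e"] that(2) by (metis less_add_same_cancel1)
  have add: "?d (\<lambda>x. f x + g x) \<le> ?d f + ?d g" if f: "f \<in> DL1" and g: "g \<in> DL1" for f g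
  proof (rule field_le_epsilon)
    fix e :: real assume e: "0 < e"
    then have e2: "e / 2 > 0" by simp
    obtain f' where f': "f' \<in> lift J A" "\<And>x. norm (conv S f x - f' x) \<le> ?d f + e/2" using ap[OF f e2] by blast
    obtain g' where g': "g' \<in> lift J A" "\<And>x. norm (conv S g x - g' x) \<le> ?d g + e/2" using ap[OF g e2] by blast
    show "?d (\<lambda>x. f x + g x) \<le> ?d f + ?d g + e"
    proof (rule dist_lift_le[OF _ lift_add[OF A f'(1) g'(1)]])
      show "0 \<le> ?d f + ?d g + e" using nn[OF f] nn[OF g] e by simp
      fix x
      have eq: "conv S (\<lambda>x. f x + g x) x - (f' x + g' x) = (conv S f x - f' x) + (conv S g x - g' x)"
        by (simp add: conv_add[OF S f g])
      show "norm (conv S (\<lambda>x. f x + g x) x - (f' x + g' x)) \<le> ?d f + ?d g + e"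
        unfolding eq
        using norm_triangle_ineq[of "conv S f x - f' x" "conv S g x - g' x"] f'(2)[of x] g'(2)[of x] by linarith
    qed
  qed
  have mult: "?d (\<lambda>x. c * f x) \<le> cmod c * ?d f" if f: "f \<in> DL1" for c f
  proof (rule field_le_epsilon)
    fix e :: real assume e: "0 < e"
    then have e2: "e / (cmod c + 1) > 0" by (simp add: add_nonneg_pos)
    obtain f' where f': "f' \<in> lift J A" "\<And>x. norm (conv S f x - f' x) \<le> ?d f + e / (cmod c + 1)" using ap[OF f e2] by blast
    have "cmod c * (e / (cmod c + 1)) \<le> (cmod c + 1) * (e / (cmod c + 1))" using e2 by (intro mult_right_mono) auto
    also have "\<dots> = e" using norm_ge_zero[of c] by (simp add: add_nonneg_eq_0_iff)
    finally have ce: "cmod c * (e / (cmod c + 1)) \<le> e" .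
    show "?d (\<lambda>x. c * f x) \<le> cmod c * ?d f + e"
    proof (rule dist_lift_le[OF _ lift_scaleC[OF A f'(1), of c]])
      show "0 \<le> cmod c * ?d f + e" using nn[OF f] e by simp
      fix x
      have "norm (conv S (\<lambda>x. c * f x) x - c *\<^sub>C f' x) = cmod c * norm (conv S f x - f' x)"
        by (simp add: conv_mult[OF S f] scaleC.diff_right[symmetric] norm_scaleC)
      also have "\<dots> \<le> cmod c * (?d f + e / (cmod c + 1))" by (intro mult_left_mono f') simp
      also have "\<dots> \<le> cmod c * ?d f + e" using ce by (simp only: distrib_left)
      finally show "norm (conv S (\<lambda>x. c * f x) x - c *\<^sub>C f' x) \<le> cmod c * ?d f + e" .
    qed
  qed
  have trans: "?d (\<lambda>x. f (x + a)) \<le> ?d f" if f: "f \<in> DL1" for f a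
  proof (rule field_le_epsilon)
    fix e :: real assume e: "0 < e"
    obtain f' where f': "f' \<in> lift J A" "\<And>x. norm (conv S f x - f' x) \<le> ?d f + e" using ap[OF f e] by blast
    show "?d (\<lambda>x. f (x + a)) \<le> ?d f + e"
      by (rule dist_lift_le[OF _ lift_translate[OF A f'(1), of a]])
        (use nn[OF f] e f'(2) in \<open>simp_all add: conv_translate\<close>)
  qed
  have cv: "?d (convol f k) \<le> L1norm k * ?d f" if f: "f \<in> DL1" and k: "integrable lborel k" for f k
  proof (rule field_le_epsilon)
    fix e :: real assume e: "0 < e"
    have L: "0 < 2 * (L1norm k + 1)" by (simp add: add_nonneg_pos)
    then have e2: "e / (2 * (L1norm k + 1)) > 0" using e by simp
    obtain f' where f': "f' \<in> lift J A" "\<And>x. norm (conv S f x - f' x) \<le> ?d f + e / (2 * (L1norm k + 1))" using ap[OF f e2] by blast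
    have "e / 2 > 0" using e by simp
    then obtain I w and y :: "int \<Rightarrow> real" where I: "finite I" "(\<Sum>i\<in>I. cmod (w i)) \<le> L1norm k"
      "\<And>x. norm (conv S (convol f k) x - (\<Sum>i\<in>I. w i *\<^sub>C conv S f (x + - y i))) < e / 2"
      using conv_convol_approx[OF S f k] by blast
    \<comment> \<open>The combination of translates that approximates \<open>convol f k\<close> is
      applied to the approximant \<open>f'\<close>. As the weights add up to at most
      \<open>L1norm k\<close>, this is the factor by which the distance grows.\<close>
    let ?g = "\<lambda>x. \<Sum>i\<in>I. w i *\<^sub>C f' (x + - y i)"
    have g: "?g \<in> lift J A" by (intro lift_sum[OF A I(1)] lift_scaleC[OF A] lift_translate[OF A] f')
    have ke: "L1norm k * (e / (2 * (L1norm k + 1))) \<le> e / 2"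
    proof -
      have "L1norm k * (e / (2 * (L1norm k + 1))) \<le> (L1norm k + 1) * (e / (2 * (L1norm k + 1)))" using e2 by (intro mult_right_mono) auto
      also have "\<dots> = e / 2" using L by (simp add: field_simps)
      finally show ?thesis .
    qed
    show "?d (convol f k) \<le> L1norm k * ?d f + e"
    proof (rule dist_lift_le[OF _ g])
      show "0 \<le> L1norm k * ?d f + e" using nn[OF f] e by simp
      fix x
      have "norm ((\<Sum>i\<in>I. w i *\<^sub>C conv S f (x + - y i)) - ?g x) \<le> (\<Sum>i\<in>I. cmod (w i) * (?d f + e / (2 * (L1norm k + 1))))"
        unfolding sum_subtractf[symmetric] scaleC.diff_right[symmetric]
        by (rule sum_norm_le) (auto simp: norm_scaleC intro!: mult_left_mono order_trans[OF f'(2)])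
      also have "\<dots> = (\<Sum>i\<in>I. cmod (w i)) * (?d f + e / (2 * (L1norm k + 1)))" by (simp only: sum_distrib_right)
      also have "\<dots> \<le> L1norm k * (?d f + e / (2 * (L1norm k + 1)))" using nn[OF f] e2 by (intro mult_right_mono I) auto
      also have "\<dots> \<le> L1norm k * ?d f + e / 2" using ke by (simp only: distrib_left)
      finally have 1: "norm ((\<Sum>i\<in>I. w i *\<^sub>C conv S f (x + - y i)) - ?g x) \<le> L1norm k * ?d f + e / 2" .
      have "norm (conv S (convol f k) x - ?g x) \<le> norm (conv S (convol f k) x - (\<Sum>i\<in>I. w i *\<^sub>C conv S f (x + - y i)))
          + norm ((\<Sum>i\<in>I. w i *\<^sub>C conv S f (x + - y i)) - ?g x)"
        using norm_triangle_ineq[of "conv S (convol f k) x - (\<Sum>i\<in>I. w i *\<^sub>C conv S f (x + - y i))" "(\<Sum>i\<in>I. w i *\<^sub>C conv S f (x + - y i)) - ?g x"] by simp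
      then show "norm (conv S (convol f k) x - ?g x) \<le> L1norm k * ?d f + e" using 1 I(3)[of x] by linarith
    qed
  qed
  have bound: "?d f \<le> C * sobolev p f" if f: "f \<in> DL1" for f
    by (rule dist_lift_le[OF _ lift_zero[OF A]]) (use C conv_norm[OF C(2) f] in simp_all)
  show ?thesis
  proof (intro exI, unfold_locales)
    show "(if convol f k \<in> DL1 then ?d (convol f k) else 0) \<le> L1norm k * (if f \<in> DL1 then ?d f else 0)"
      if "f \<in> DL1" "integrable lborel k" for f k
      using cv[OF that] DL1_convol[OF that] that by simp
    show "(if f \<in> DL1 then ?d f else 0) \<le> C * sobolev p f" if "f \<in> DL1" for f using bound[OF that] that by simp
    show "0 \<le> (if f \<in> DL1 then ?d f else 0)" for f using nn by simp
    show "(if (\<lambda>x. f x + g x) \<in> DL1 then ?d (\<lambda>x. f x + g x) else 0) \<le> (if f \<in> DL1 then ?d f else 0) + (if g \<in> DL1 then ?d g else 0)"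
      if "f \<in> DL1" "g \<in> DL1" for f g using add[OF that] DL1_add[OF that] that by simp
    show "(if (\<lambda>x. c * f x) \<in> DL1 then ?d (\<lambda>x. c * f x) else 0) \<le> cmod c * (if f \<in> DL1 then ?d f else 0)"
      if "f \<in> DL1" for f c using mult[OF that, of c] DL1_mult[OF that, of c] that by simp
    show "(if (\<lambda>x. f (x + a)) \<in> DL1 then ?d (\<lambda>x. f (x + a)) else 0) \<le> (if f \<in> DL1 then ?d f else 0)"
      if "f \<in> DL1" for f a using trans[OF that, of a] DL1_translate[OF that, of a] that by simp
  qed
qed

end

section \<open>Closedness of the spectrum and existence of isolated points\<close>

lemma fourier_continuous:
  assumes f: "integrable lborel f"
  shows "continuous_on UNIV (fourier f)"
  unfolding continuous_on_sequentially
proof (intro allI ballI impI, elim conjE)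
  fix x :: "nat \<Rightarrow> real" and a assume x: "x \<longlonglongrightarrow> a"
  have [measurable]: "f \<in> borel_measurable borel" using f by (auto dest: borel_measurable_integrable)
  have "(\<lambda>n. LINT t|lborel. cis (- x n * t) * f t) \<longlonglongrightarrow> (LINT t|lborel. cis (- a * t) * f t)"
  proof (rule integral_dominated_convergence[where w="\<lambda>t. cmod (f t)"])
    show "integrable lborel (\<lambda>t. cmod (f t))" using f by simp
    show "AE t in lborel. (\<lambda>n. cis (- x n * t) * f t) \<longlonglongrightarrow> cis (- a * t) * f t"
      by (intro always_eventually allI tendsto_intros x)
    show "AE t in lborel. norm (cis (- x n * t) * f t) \<le> cmod (f t)" for n
      by (simp add: norm_mult)
  qed measurable
  then show "(fourier f \<circ> x) \<longlonglongrightarrow> fourier f a" by (simp add: fourier_def comp_def)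
qed

text \<open>Without isolated points every \<open>Z - {z}\<close> would be open and dense in
  \<open>Z\<close>, and the intersection of these countably many sets, which is empty, would be
  dense as well.\<close>

lemma countable_closed_isolated:
  fixes Z :: "real set"
  assumes "closed Z" "countable Z" "Z \<noteq> {}"
  obtains z e where "z \<in> Z" "0 < e" "\<And>y. y \<noteq> z \<Longrightarrow> \<bar>y - z\<bar> \<le> e \<Longrightarrow> y \<notin> Z"
proof -
  have "\<exists>z\<in>Z. \<not> Z \<subseteq> closure (Z - {z})"
  proof (rule ccontr)
    assume no: "\<not> ?thesis"
    have "Z \<subseteq> closure (\<Inter>((\<lambda>z. Z - {z}) ` Z))"
    proof (rule Baire[OF assms(1)])
      show "countable ((\<lambda>z. Z - {z}) ` Z)" using assms(2) by simp
      fix T assume "T \<in> (\<lambda>z. Z - {z}) ` Z"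
      then obtain z where z: "z \<in> Z" "T = Z - {z}" by auto
      have "openin (top_of_set Z) (Z \<inter> - {z})" by (intro openin_open_Int) auto
      moreover have "Z \<inter> - {z} = T" using z by auto
      ultimately show "openin (top_of_set Z) T \<and> Z \<subseteq> closure T" using no z by auto
    qed
    moreover have "\<Inter>((\<lambda>z. Z - {z}) ` Z) = {}" using assms(3) by auto
    ultimately show False using assms(3) by simp
  qed
  then obtain z y where z: "z \<in> Z" "y \<in> Z" "y \<notin> closure (Z - {z})" by blast
  then have "y = z" using closure_subset[of "Z - {z}"] by blast
  then obtain e where e: "e > 0" "\<And>y. y \<in> Z - {z} \<Longrightarrow> \<not> dist y z < e"
    using z(3) unfolding closure_approachable by blast
  show ?thesis
  proof (rule that[OF z(1)])
    show "0 < e / 2" using e(1) by simp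
    fix y assume y: "y \<noteq> z" "\<bar>y - z\<bar> \<le> e / 2"
    then have "dist y z < e" using e(1) by (simp add: dist_real_def)
    then show "y \<notin> Z" using e(2)[of y] y(1) by blast
  qed
qed

section \<open>Iterated means\<close>

lemma bint_cong:
  assumes "\<And>t. t \<in> K \<Longrightarrow> f t = g t"
  shows "bint K f = bint K g"
proof -
  have "has_bint K f x \<longleftrightarrow> has_bint K g x" for x
  proof -
    have "f \<in> borel_measurable (lebesgue_on K) \<longleftrightarrow> g \<in> borel_measurable (lebesgue_on K)"
      using assms by (intro measurable_cong) simp
    moreover have "(\<integral>\<^sup>+t. norm (f t - s t) \<partial>lebesgue_on K) = (\<integral>\<^sup>+t. norm (g t - s t) \<partial>lebesgue_on K)" for s
      using assms by (intro nn_integral_cong) simp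
    ultimately show ?thesis by (simp add: has_bint_def)
  qed
  then show ?thesis by (simp add: bint_def)
qed

lemma mean_restrict:
  assumes J: "forward_closed J" and f: "loc_int f" and h: "0 < h"
  shows "mean J h (restrict f J) = restrict (\<lambda>t. (1 / h) *\<^sub>R window h f t) J"
proof
  fix t
  show "mean J h (restrict f J) t = restrict (\<lambda>t. (1 / h) *\<^sub>R window h f t) J t"
  proof (cases "t \<in> J")
    case True
    have "bint {0..h} (\<lambda>s. restrict f J (t + s)) = bint {0..h} (\<lambda>s. f (t + s))"
      using J True by (intro bint_cong) (auto simp: forward_closed_def)
    also have "\<dots> = window h f t" unfolding window_def using f by (intro bint_shift) (simp add: loc_int_def)
    finally show ?thesis using True by (simp add: mean_def)
  qed (simp add: mean_def)
qed

lemma loc_int_scaleR: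
  fixes f :: "real \<Rightarrow> 'a::complex_banach"
  assumes "loc_int f"
  shows "loc_int (\<lambda>t. c *\<^sub>R f t)"
  using loc_int_scaleC[OF assms continuous_on_const, of "complex_of_real c"] by (simp add: scaleC_of_real)

text \<open>Passage from normalised means to windows. The factors \<open>1 / h\<close> are pulled
  out of the iteration one by one, so \<open>P\<close> has to survive scaling; it is used for
  essential boundedness, uniform continuity on \<open>J\<close> and membership in
  \<open>U\<close>.\<close>

lemma mean_power_fold_window:
  fixes f :: "real \<Rightarrow> 'a::complex_banach"
  assumes J: "forward_closed J"
    and PB: "\<And>f. restrict f J \<in> B \<Longrightarrow> P f" and P: "\<And>f c. P f \<Longrightarrow> P (\<lambda>t. c *\<^sub>R f t)"
  shows "loc_int f \<Longrightarrow> restrict f J \<in> mean_power J m B \<Longrightarrow> length hs = m \<Longrightarrow> \<forall>h\<in>set hs. 0 < h \<Longrightarrow> P (fold window hs f)"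
proof (induction m arbitrary: f hs)
  case 0
  have "restrict f J \<in> B" using "0.prems"(2) by (simp only: mean_power.simps)
  moreover have "hs = []" using "0.prems"(3) by (simp only: length_0_conv)
  ultimately show ?case using PB[of f] by (simp only: fold_simps)
next
  case (Suc m)
  then obtain h ks where hs: "hs = h # ks" by (cases hs) auto
  then have h: "0 < h" using Suc.prems by simp
  let ?g = "\<lambda>t. (1 / h) *\<^sub>R window h f t"
  have "mean J h (restrict f J) \<in> mean_power J m B"
    using Suc.prems(2) h unfolding mean_power.simps mean_class_def by blast
  then have "restrict ?g J \<in> mean_power J m B" unfolding mean_restrict[OF J Suc.prems(1) h] .
  then have "P (fold window ks ?g)"
    using Suc.prems(1,3,4) hs h by (intro Suc.IH) (auto intro!: loc_int_scaleR window_loc_int simp del: restrict_apply)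
  then have "P (\<lambda>t. h *\<^sub>R fold window ks ?g t)" by (rule P)
  moreover have "(\<lambda>t. h *\<^sub>R fold window ks ?g t) = fold window hs f" using h by (simp add: fold_window_scaleR hs)
  ultimately show ?case by simp
qed

text \<open>Membership in \<open>mean_power J m B\<close> for another class \<open>B\<close>
  supplies local integrability on \<open>J\<close> at each of the \<open>m\<close> stages, so that
  only the innermost condition has to be established for \<open>A\<close>.\<close>

lemma mean_power_if_fold_window:
  fixes f :: "real \<Rightarrow> 'a::complex_banach"
  assumes J: "forward_closed J" and A: "good_class J A"
  shows "loc_int f \<Longrightarrow> restrict f J \<in> mean_power J m B \<Longrightarrow>
    (\<And>hs. length hs = m \<Longrightarrow> \<forall>h\<in>set hs. 0 < h \<Longrightarrow> restrict (fold window hs f) J \<in> A) \<Longrightarrow> restrict f J \<in> mean_power J m A"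
proof (induction m arbitrary: f)
  case 0
  then show ?case using "0.prems"(3)[of "[]"] by simp
next
  case (Suc m)
  have "mean J h (restrict f J) \<in> mean_power J m A" if h: "0 < h" for h
  proof -
    let ?g = "\<lambda>t. (1 / h) *\<^sub>R window h f t"
    have "restrict ?g J \<in> mean_power J m A"
    proof (rule Suc.IH)
      show "loc_int ?g" using Suc.prems(1) h by (intro loc_int_scaleR window_loc_int) auto
      show "restrict ?g J \<in> mean_power J m B"
        unfolding mean_restrict[OF J Suc.prems(1) h, symmetric]
        using Suc.prems(2) h unfolding mean_power.simps mean_class_def by blast
      fix hs :: "real list" assume "length hs = m" "\<forall>h\<in>set hs. 0 < h"
      then have "restrict (fold window (h # hs) f) J \<in> A" using h by (intro Suc.prems(3)) auto
      then show "restrict (fold window hs ?g) J \<in> A"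
        unfolding fold_window_scaleR by (intro restrict_scaleR[OF A]) simp
    qed
    then show ?thesis unfolding mean_restrict[OF J Suc.prems(1) h] .
  qed
  moreover have "restrict f J \<in> L1loc J" using Suc.prems(2) unfolding mean_power.simps mean_class_def by blast
  ultimately show ?case unfolding mean_power.simps mean_class_def by blast
qed

lemma window_ess_bound:
  fixes f :: "real \<Rightarrow> 'a::complex_banach"
  assumes f: "loc_int f" and C: "AE t in lebesgue. norm (f t) \<le> C" and h: "0 \<le> h"
  shows "norm (window h f t) \<le> C * h"
proof -
  have b: "bintegrable {t..t+h} f" using f by (simp add: loc_int_def)
  have "norm (window h f t) \<le> integral {t..t+h} (\<lambda>s. norm (f s))"
    unfolding window_def by (rule loc_int_norm_integral[OF f])
  also have "\<dots> = integral\<^sup>L (lebesgue_on {t..t+h}) (\<lambda>s. norm (f s))"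
    using bintegrable_norm_has_integral[OF b] by (rule integral_unique)
  also have "\<dots> \<le> integral\<^sup>L (lebesgue_on {t..t+h}) (\<lambda>s. C)"
  proof (rule integral_mono_AE[OF bintegrable_norm[OF b]])
    show "integrable (lebesgue_on {t..t+h}) (\<lambda>s. C)" by (simp add: emeasure_restrict_space)
    show "AE s in lebesgue_on {t..t+h}. norm (f s) \<le> C"
      using C by (simp add: AE_restrict_space_iff) (auto elim: eventually_mono)
  qed
  also have "\<dots> = C * h" using h by (simp add: measure_restrict_space)
  finally show ?thesis .
qed

lemma L1loc_loc_int: "f \<in> L1loc UNIV \<Longrightarrow> loc_int f"
  by (auto simp: L1loc_def loc_int_def)

text \<open>Essential boundedness of the \<open>m\<close>-fold windows is not yet pointwise
  boundedness. One further window makes them bounded and continuous, and this explains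
  \<open>Suc m\<close> in the last claim.\<close>

lemma
  fixes f :: "real \<Rightarrow> 'a::complex_banach"
  assumes f: "f \<in> mean_power UNIV m (Linf UNIV)"
  shows mean_power_Linf_loc_int: "loc_int f"
    and mean_power_Linf_ess: "length hs = m \<Longrightarrow> \<forall>h\<in>set hs. 0 < h \<Longrightarrow> \<exists>C. AE t in lebesgue. norm (fold window hs f t) \<le> C"
    and mean_power_Linf_iter_window: "iter_window bdd_cont (Suc m) f"
proof -
  have U: "forward_closed UNIV" by (simp add: forward_closed_def)
  have "f \<in> L1loc UNIV" using f by (cases m) (auto simp: Linf_def mean_class_def)
  then show loc_int: "loc_int f" by (rule L1loc_loc_int)
  have ess: "\<exists>C. AE t in lebesgue. norm (fold window hs f t) \<le> C" if "length hs = m" "\<forall>h\<in>set hs. 0 < h" for hs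
  proof (rule mean_power_fold_window[OF U _ _ loc_int _ that])
    have "restrict f UNIV = f" by (rule ext) simp
    then show "restrict f UNIV \<in> mean_power UNIV m (Linf UNIV)" using f by (simp only:)
    show "\<exists>C. AE t in lebesgue. norm (g t) \<le> C" if "restrict g UNIV \<in> Linf UNIV" for g :: "real \<Rightarrow> 'a"
    proof -
      have "restrict g UNIV = g" by (rule ext) simp
      then show ?thesis using that unfolding Linf_def lebesgue_on_UNIV_eq by auto
    qed
    fix g :: "real \<Rightarrow> 'a" and c assume "\<exists>C. AE t in lebesgue. norm (g t) \<le> C"
    then obtain C where "AE t in lebesgue. norm (g t) \<le> C" ..
    then have "AE t in lebesgue. norm (c *\<^sub>R g t) \<le> \<bar>c\<bar> * C" by eventually_elim (simp add: mult_left_mono)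
    then show "\<exists>C. AE t in lebesgue. norm (c *\<^sub>R g t) \<le> C" ..
  qed
  then show "length hs = m \<Longrightarrow> \<forall>h\<in>set hs. 0 < h \<Longrightarrow> \<exists>C. AE t in lebesgue. norm (fold window hs f t) \<le> C" .
  show "iter_window bdd_cont (Suc m) f"
    unfolding iter_window_def
  proof (intro allI impI)
    fix hs :: "real list" assume hs: "length hs = Suc m" "\<forall>h\<in>set hs. 0 < h"
    obtain ks h where k: "hs = ks @ [h]" using hs by (cases hs rule: rev_cases) auto
    let ?g = "fold window ks f"
    have h: "0 < h" and ks: "length ks = m" "\<forall>h\<in>set ks. 0 < h" using hs k by auto
    have g: "loc_int ?g" by (rule loc_int_fold_window[OF loc_int ks(2)])
    obtain C where C: "AE t in lebesgue. norm (?g t) \<le> C" using ess[OF ks] ..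
    have "bounded (range (window h ?g))" unfolding bounded_iff using window_ess_bound[OF g C] h by (intro exI[of _ "C * h"]) auto
    moreover have "continuous_on UNIV (window h ?g)" using window_continuous[OF g] h by simp
    ultimately show "bdd_cont (fold window hs f)" by (simp add: k bdd_cont_def)
  qed
qed

text \<open>An essential bound says nothing about single points. Uniform continuity compares
  \<open>f x\<close> with its mean over a short window to the right, which stays in
  \<open>J\<close>, and that mean obeys the essential bound.\<close>

lemma Cu_bdd_uc:
  fixes f :: "real \<Rightarrow> 'a::complex_banach"
  assumes J: "forward_closed J" and f: "loc_int f" and C: "AE t in lebesgue. norm (f t) \<le> C"
    and uc: "uniformly_continuous_on J f"
  shows "bdd_uc J f"
proof -
  obtain d where d: "d > 0" "\<And>x y. x \<in> J \<Longrightarrow> y \<in> J \<Longrightarrow> dist y x < d \<Longrightarrow> dist (f y) (f x) < 1"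
    using uc unfolding uniformly_continuous_on_def by (metis zero_less_one)
  define h where "h = d / 2"
  have h: "0 < h" "h < d" using d(1) by (simp_all add: h_def)
  have cl: "loc_int (\<lambda>_. f x)" for x by (rule loc_int_continuous) auto
  have "norm (f x) \<le> 1 + C" if x: "x \<in> J" for x
  proof -
    have "integral {x..x+h} (\<lambda>y. f x - f y) = h *\<^sub>R f x - window h f x"
      unfolding window_def using h by (simp add: Henstock_Kurzweil_Integration.integral_diff loc_int_integrable[OF f] loc_int_integrable[OF cl])
    moreover have "norm (integral {x..x+h} (\<lambda>y. f x - f y)) \<le> integral {x..x+h} (\<lambda>y. 1)"
    proof (rule integral_norm_bound_integral)
      show "(\<lambda>y. f x - f y) integrable_on {x..x + h}"
        by (intro Henstock_Kurzweil_Integration.integrable_diff loc_int_integrable f cl)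
      show "norm (f x - f y) \<le> 1" if y: "y \<in> {x..x+h}" for y
      proof -
        have "x + (y - x) \<in> J" using J x y unfolding forward_closed_def by (metis atLeastAtMost_iff diff_ge_0_iff_ge)
        then have "dist (f y) (f x) < 1" using x y h by (intro d(2)) (auto simp: dist_real_def)
        then show ?thesis by (simp add: dist_norm norm_minus_commute)
      qed
    qed auto
    ultimately have "norm (h *\<^sub>R f x - window h f x) \<le> h" using h by simp
    moreover have "norm (window h f x) \<le> C * h" using window_ess_bound[OF f C, of h x] h by simp
    ultimately have "norm (h *\<^sub>R f x) \<le> h + C * h"
      using norm_triangle_sub[of "h *\<^sub>R f x" "window h f x"] by linarith
    then have "h * norm (f x) \<le> h * (1 + C)" using h by (simp add: distrib_left mult.commute)
    then show ?thesis using h(1) by (simp only: mult_le_cancel_left_pos)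
  qed
  then have "bounded (f ` J)" by (auto simp: bounded_iff)
  then show ?thesis using uc by (simp add: bdd_uc_def)
qed

lemma mean_power_Cu_bdd_uc:
  fixes f :: "real \<Rightarrow> 'a::complex_banach"
  assumes J: "forward_closed J" and f: "f \<in> mean_power UNIV m (Linf UNIV)"
    and r: "restrict f J \<in> mean_power J m (Cu J)"
  shows "iter_window (bdd_uc J) m f"
  unfolding iter_window_def
proof (intro allI impI)
  fix hs :: "real list" assume hs: "length hs = m" "\<forall>h\<in>set hs. 0 < h"
  have loc_int: "loc_int f" by (rule mean_power_Linf_loc_int[OF f])
  have "uniformly_continuous_on J (fold window hs f)"
  proof (rule mean_power_fold_window[OF J _ _ loc_int r hs])
    show "uniformly_continuous_on J g" if "restrict g J \<in> Cu J" for g :: "real \<Rightarrow> 'a"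
      using that unfolding Cu_def uniformly_continuous_on_def by (simp cong: ball_cong)
  qed (rule uniformly_continuous_on_cmul)
  moreover obtain C where "AE t in lebesgue. norm (fold window hs f t) \<le> C" using mean_power_Linf_ess[OF f hs] ..
  ultimately show "bdd_uc J (fold window hs f)" by (intro Cu_bdd_uc[OF J loc_int_fold_window[OF loc_int hs(2)]])
qed

section \<open>The extended distribution and its convolutions with test functions\<close>

lemma DL1_extension_props:
  fixes f :: "real \<Rightarrow> 'a::complex_banach"
  assumes f: "loc_int f" "iter_window bdd_cont k f"
  shows "DL1_extension f \<in> DL1_dual"
    and "test_within B r \<Longrightarrow> DL1_extension f r = integral {-B..B} (\<lambda>t. r t *\<^sub>C f t)"
proof -
  have bi: "bint UNIV (\<lambda>t. r t *\<^sub>C f t) = integral {-B..B} (\<lambda>t. r t *\<^sub>C f t)" if r: "test_within B r" for B r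
  proof (rule bint_UNIV)
    have "loc_int (\<lambda>t. r t *\<^sub>C f t)"
      using r smooth_continuous[of r UNIV 0] by (intro loc_int_scaleC f) (simp add: test_within_def)
    then show "bintegrable {-B..B} (\<lambda>t. r t *\<^sub>C f t)" by (simp add: loc_int_def)
    show "r t *\<^sub>C f t = 0" if "t \<notin> {-B..B}" for t
    proof -
      have "B < \<bar>t\<bar>" using that by (auto simp: abs_if)
      then show ?thesis using r by (simp add: test_within_def scaleC.zero_left)
    qed
  qed
  obtain S where S: "S \<in> DL1_dual" "\<And>B r. test_within B r \<Longrightarrow> S r = integral {-B..B} (\<lambda>t. r t *\<^sub>C f t)"
    using has_DL1_extension[OF f] by blast
  have "\<exists>S. S \<in> DL1_dual \<and> (\<forall>\<phi>\<in>test_functions. S \<phi> = bint UNIV (\<lambda>t. \<phi> t *\<^sub>C f t))"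
  proof (intro exI[of _ S] conjI ballI S(1))
    fix r assume "r \<in> test_functions"
    then obtain B where "test_within B r" using test_functions_iff by blast
    then show "S r = bint UNIV (\<lambda>t. r t *\<^sub>C f t)" using S(2) bi by simp
  qed
  from someI_ex[OF this]
  have D: "DL1_extension f \<in> DL1_dual" "\<forall>\<phi>\<in>test_functions. DL1_extension f \<phi> = bint UNIV (\<lambda>t. \<phi> t *\<^sub>C f t)"
    unfolding DL1_extension_def by blast+
  show "DL1_extension f \<in> DL1_dual" by (rule D)
  show "DL1_extension f r = integral {-B..B} (\<lambda>t. r t *\<^sub>C f t)" if "test_within B r"
  proof -
    have "r \<in> test_functions" using test_functions_iff that by blast
    then show ?thesis using D(2) bi[OF that] by simp
  qed
qed

lemma conv_eq_trunc_conv: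
  fixes f :: "real \<Rightarrow> 'a::complex_banach"
  assumes S: "\<And>B r. test_within B r \<Longrightarrow> S r = integral {-B..B} (\<lambda>t. r t *\<^sub>C f t)" and r: "test_within B r"
  shows "conv S r = trunc_conv B f r"
proof
  fix x
  have z: "r t = 0" if "B < \<bar>t\<bar>" for t using r that by (simp add: test_within_def)
  have B: "0 < B" using r by (simp add: test_within_def)
  have "smooth (\<lambda>y. r ((-1) * y + x))" using r by (intro smooth_affine) (simp add: test_within_def)
  \<comment> \<open>The support of the reflected translate is centred at \<open>x\<close>, whereas
    \<open>test_within\<close> measures from 0; hence the radius
    \<open>B + \<bar>x\<bar>\<close>.\<close>
  then have t: "test_within (B + \<bar>x\<bar>) (\<lambda>y. r (x - y))"
    using B unfolding test_within_def by (auto intro!: z)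
  have "conv S r x = integral {-(B + \<bar>x\<bar>)..B + \<bar>x\<bar>} (\<lambda>y. r (x - y) *\<^sub>C f y)"
    unfolding conv_def by (rule S[OF t])
  also have "\<dots> = integral {x-B..x+B} (\<lambda>y. r (x - y) *\<^sub>C f y)"
  proof (rule integral_spike_set)
    have "r (x - y) *\<^sub>C f y = 0" if "y \<notin> {x-B..x+B}" for y
    proof -
      have "B < \<bar>x - y\<bar>" using that by (auto simp: abs_if)
      then show ?thesis using z by (simp add: scaleC.zero_left)
    qed
    then have "{y \<in> {-(B + \<bar>x\<bar>)..B + \<bar>x\<bar>} - {x-B..x+B}. r (x - y) *\<^sub>C f y \<noteq> 0} = {}" by blast
    then show "negligible {y \<in> {-(B + \<bar>x\<bar>)..B + \<bar>x\<bar>} - {x-B..x+B}. r (x - y) *\<^sub>C f y \<noteq> 0}" by (simp only: negligible_empty)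
    have "{x-B..x+B} - {-(B + \<bar>x\<bar>)..B + \<bar>x\<bar>} = {}" by (auto simp: abs_if)
    then have "{y \<in> {x-B..x+B} - {-(B + \<bar>x\<bar>)..B + \<bar>x\<bar>}. r (x - y) *\<^sub>C f y \<noteq> 0} = {}" by blast
    then show "negligible {y \<in> {x-B..x+B} - {-(B + \<bar>x\<bar>)..B + \<bar>x\<bar>}. r (x - y) *\<^sub>C f y \<noteq> 0}" by (simp only: negligible_empty)
  qed
  also have "\<dots> = trunc_conv B f r x"
    using integral_reflect_translate[of B "\<lambda>y. r (x - y) *\<^sub>C f y" x] by (simp add: trunc_conv_def)
  finally show "conv S r x = trunc_conv B f r x" .
qed

lemma fold_window_trunc_conv_test_within:
  fixes f :: "real \<Rightarrow> 'a::complex_banach"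
  assumes r: "test_within B r" and f: "loc_int f" and hs: "\<forall>h\<in>set hs. 0 < h"
  shows "fold window hs (trunc_conv B f r) = trunc_conv B (fold window hs f) r"
proof (rule fold_window_trunc_conv[OF _ _ _ _ _ f hs])
  have B: "0 < B" and sm: "smooth r" using r by (simp_all add: test_within_def)
  show "0 \<le> B" using B by simp
  show "(r has_vector_derivative iter_deriv (Suc 0) r t) (at t)" for t using smooth_iter_deriv[OF sm, of 0 t] by simp
  show "continuous_on UNIV (iter_deriv (Suc 0) r)" by (rule smooth_continuous[OF sm])
  show "r B = 0" "r (- B) = 0" using test_within_iter_deriv[OF r, of _ 0] B by auto
qed

text \<open>To the left of a half-line the function is continued by its value at the end point; for
  an open half-line that value is first obtained from uniform continuity. This brings functions
  controlled on \<open>J\<close> only into the range of \<open>lift\<close>.\<close>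

lemma bdd_uc_extend:
  fixes f :: "real \<Rightarrow> 'a::complex_banach"
  assumes J: "admissible_interval J" and f: "bdd_uc J f"
  obtains g where "bdd_uc UNIV g" "\<And>t. t \<in> J \<Longrightarrow> g t = f t"
proof -
  have half: "\<exists>g. bdd_uc UNIV g \<and> (\<forall>t\<ge>\<alpha>. g t = f' t)" if f': "bdd_uc {\<alpha>..} f'" for \<alpha> and f' :: "real \<Rightarrow> 'a"
  proof (intro exI conjI allI impI)
    let ?g = "\<lambda>t. f' (max \<alpha> t)"
    have "bounded (range ?g)"
      using f' unfolding bdd_uc_def by (auto intro: bounded_subset[of "f' ` {\<alpha>..}"])
    moreover have "uniformly_continuous_on UNIV ?g"
      unfolding uniformly_continuous_on_def
    proof (intro allI impI)
      fix e :: real assume "e > 0"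
      then obtain d where d: "d > 0" "\<And>x y. x \<in> {\<alpha>..} \<Longrightarrow> y \<in> {\<alpha>..} \<Longrightarrow> dist y x < d \<Longrightarrow> dist (f' y) (f' x) < e"
        using f' unfolding bdd_uc_def uniformly_continuous_on_def by metis
      show "\<exists>d>0. \<forall>x\<in>UNIV. \<forall>x'\<in>UNIV. dist x' x < d \<longrightarrow> dist (?g x') (?g x) < e"
        by (intro exI[of _ d] conjI d(1) ballI impI d(2)) (auto simp: dist_real_def)
    qed
    ultimately show "bdd_uc UNIV ?g" by (simp add: bdd_uc_def)
  qed simp
  consider "J = UNIV" | \<alpha> where "J = {\<alpha><..}" | \<alpha> where "J = {\<alpha>..}"
    using J by (auto simp: admissible_interval_def)
  then show ?thesis
  proof cases
    case 1
    then show ?thesis using that[of f] f by simp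
  next
    case 3
    then show ?thesis using half[of \<alpha> f] f that by auto
  next
    case 2
    obtain g where g: "uniformly_continuous_on (closure J) g" "\<And>t. t \<in> J \<Longrightarrow> f t = g t"
      using uniformly_continuous_on_extension_on_closure[of J f] f unfolding bdd_uc_def by metis
    have cl: "closure J = {\<alpha>..}" using 2 by simp
    obtain C where C: "\<And>t. t \<in> J \<Longrightarrow> norm (f t) \<le> C" using f by (auto simp: bdd_uc_def bounded_iff)
    have "norm (g t) \<le> max C (norm (g \<alpha>))" if "\<alpha> \<le> t" for t
      using C[of t] g(2)[of t] that 2 by (cases "t = \<alpha>") auto
    then have "bounded (g ` {\<alpha>..})" by (auto simp: bounded_iff)
    then have "bdd_uc {\<alpha>..} g" using g(1) cl by (simp add: bdd_uc_def)
    from half[OF this] obtain g' where g': "bdd_uc UNIV g'" "\<And>t. \<alpha> \<le> t \<Longrightarrow> g' t = g t" by blast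
    then show ?thesis using that[of g'] g(2) 2 by auto
  qed
qed

text \<open>A character passes through a convolution by modulating both factors. So the twisted
  convolution is a convolution of the modulated \<open>f\<close>, whose \<open>q\<close>-fold
  windows restrict to \<open>U\<close> and extend from \<open>J\<close> to the line. This puts the
  \<open>q\<close>-fold windows of the convolution into \<open>lift J U\<close>, and since the
  convolution is bounded and uniformly continuous, \<open>lift_if_fold_window\<close> removes the
  windows.\<close>

lemma twisted_conv_lift:
  fixes f :: "real \<Rightarrow> 'a::complex_banach"
  assumes J: "admissible_interval J" and U: "good_class J U"
    and SD: "S \<in> DL1_dual" and S: "\<And>B r. test_within B r \<Longrightarrow> S r = integral {-B..B} (\<lambda>t. r t *\<^sub>C f t)"
    and f: "loc_int f" "iter_window (bdd_uc J) m f" and mq: "m \<le> q"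
    and q: "restrict (char_mult w f) J \<in> mean_power J q U"
    and r: "test_within B r"
  shows "(\<lambda>x. cis (w * x) *\<^sub>C conv S r x) \<in> lift J U"
proof -
  have fJ: "forward_closed J" using J by (rule forward_closed_admissible)
  define G where "G = char_mult w f"
  have Gl: "loc_int G" unfolding G_def char_mult_def by (intro loc_int_scaleC f continuous_intros)
  have Gq: "iter_window (bdd_uc J) q G"
    using iter_window_bdd_uc_mono[OF fJ Gl _ mq] iter_window_bdd_uc_char_mult[OF fJ f, of w] by (simp add: G_def)
  let ?r = "\<lambda>z. cis (w * z) * r z"
  have r': "test_within B ?r" by (rule test_within_cis[OF r])
  have B: "0 < B" using r by (simp add: test_within_def)
  have eq: "(\<lambda>x. cis (w * x) *\<^sub>C conv S r x) = trunc_conv B G ?r"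
  proof
    fix x
    have c: "continuous_on UNIV (\<lambda>t. r (x - t))"
      using r smooth_continuous[of r UNIV 0] unfolding test_within_def
      by (intro continuous_on_compose2[of UNIV r UNIV "\<lambda>t. x - t"] continuous_intros) auto
    have "cis (w * x) *\<^sub>C trunc_conv B f r x = cis (w * x) *\<^sub>C integral {x-B..x+B} (\<lambda>t. r (x - t) *\<^sub>C f t)"
      using integral_reflect_translate[of B "\<lambda>t. r (x - t) *\<^sub>C f t" x] by (simp add: trunc_conv_def)
    also have "\<dots> = integral {x-B..x+B} (\<lambda>t. cis (w * x) *\<^sub>C (r (x - t) *\<^sub>C f t))"
      by (intro integral_scaleC_right[symmetric] loc_int_integrable loc_int_scaleC f c)
    also have "\<dots> = integral {x-B..x+B} (\<lambda>t. ?r (x - t) *\<^sub>C G t)"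
    proof (rule integral_cong)
      fix t
      have "cis (w * x) = cis (w * (x - t)) * cis (w * t)" by (simp add: cis_mult algebra_simps)
      then show "cis (w * x) *\<^sub>C (r (x - t) *\<^sub>C f t) = ?r (x - t) *\<^sub>C G t"
        by (simp add: G_def char_mult_def scaleC_scaleC mult_ac)
    qed
    also have "\<dots> = trunc_conv B G ?r x"
      using integral_reflect_translate[of B "\<lambda>t. ?r (x - t) *\<^sub>C G t" x] by (simp add: trunc_conv_def)
    finally show "cis (w * x) *\<^sub>C conv S r x = trunc_conv B G ?r x" using conv_eq_trunc_conv[OF S r] by simp
  qed
  have rD: "r \<in> DL1" by (rule test_within_DL1[OF r])
  have bu: "bdd_uc UNIV (\<lambda>x. cis (w * x) *\<^sub>C conv S r x)" by (intro bdd_uc_cis conv_bdd_uc SD rD)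
  show ?thesis
  proof (rule lift_if_fold_window[OF U bu, where q=q])
    fix hs :: "real list" assume hs: "length hs = q" "\<forall>h\<in>set hs. 0 < h"
    define H where "H = fold window hs G"
    have HU: "restrict H J \<in> U"
      unfolding H_def
    proof (rule mean_power_fold_window[OF fJ _ _ Gl _ hs, where P="\<lambda>g. restrict g J \<in> U" and B=U])
      show "restrict G J \<in> mean_power J q U" using q by (simp add: G_def)
    qed (auto intro: restrict_scaleR[OF U])
    have "bdd_uc J H" unfolding H_def using Gq hs by (simp add: iter_window_def)
    then obtain H' where H': "bdd_uc UNIV H'" "\<And>t. t \<in> J \<Longrightarrow> H' t = H t" using bdd_uc_extend[OF J] by blast
    then have "restrict H' J = restrict H J" by (auto simp: restrict_def)
    then have H'U: "H' \<in> lift J U" using HU H'(1) by (simp add: lift_def)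
    let ?k = "fold window hs (\<lambda>x. cis (w * x) *\<^sub>C conv S r x)"
    have keq: "?k = trunc_conv B H ?r" unfolding eq H_def by (rule fold_window_trunc_conv_test_within[OF r' Gl hs(2)])
    have ku: "bdd_uc UNIV ?k"
    proof -
      \<comment> \<open>Applied to the class of all functions on the line,
        \<open>lift_fold_window\<close> says that windows preserve bounded uniform
        continuity.\<close>
      have "good_class UNIV (UNIV :: (real \<Rightarrow> 'a) set)"
        by (simp add: good_class_def linear_class_def uniformly_closed_def Cub_invariant_def)
      from lift_fold_window[OF this _ hs(2)] show ?thesis using bu by (simp add: lift_def)
    qed
    have "(\<lambda>x. integral {-B..B} (\<lambda>z. ?r z *\<^sub>C H' (x - z))) \<in> lift J U"
      using r' smooth_continuous[of ?r UNIV 0] B by (intro lift_integral[OF U H'U]) (simp_all add: test_within_def)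
    \<comment> \<open>At \<open>x + B\<close> the convolution uses only values at
      \<open>x + B - z \<ge> x\<close>, hence on \<open>J\<close>, where the extension
      \<open>H'\<close> agrees with \<open>H\<close>. The shift is undone at the end by translation
      in \<open>lift\<close>.\<close>
    from lift_translate[OF U this, of B]
    have 1: "(\<lambda>x. integral {-B..B} (\<lambda>z. ?r z *\<^sub>C H' (x + B - z))) \<in> lift J U" .
    have "restrict (\<lambda>x. ?k (x + B)) J = restrict (\<lambda>x. integral {-B..B} (\<lambda>z. ?r z *\<^sub>C H' (x + B - z))) J"
    proof (rule restrict_ext)
      fix x assume x: "x \<in> J"
      show "?k (x + B) = integral {-B..B} (\<lambda>z. ?r z *\<^sub>C H' (x + B - z))"
        unfolding keq trunc_conv_def
      proof (rule integral_cong)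
        fix z assume z: "z \<in> {-B..B}"
        then have "x + (B - z) \<in> J" using fJ x by (auto simp: forward_closed_def)
        then show "?r z *\<^sub>C H (x + B - z) = ?r z *\<^sub>C H' (x + B - z)" using H'(2) by (simp add: algebra_simps)
      qed
    qed
    then have "(\<lambda>x. ?k (x + B)) \<in> lift J U" using 1 bdd_uc_translate[OF ku] by (simp add: lift_def)
    from lift_translate[OF U this, of "-B"] show "?k \<in> lift J U" by simp
  qed
qed

text \<open>A bump modulated with frequency \<open>w\<close> has at \<open>w\<close> the positive
  integral of the bump as its transform.\<close>

lemma exists_test_fourier_nonzero: "\<exists>B r. test_within B r \<and> fourier r w \<noteq> 0"
proof -
  define r where "r t = complex_of_real (bump (t / 1))" for t
  have r: "test_within 1 r" unfolding r_def by (rule bump_test_within) simp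
  have ri: "integrable lborel r" by (rule DL1_integrable[OF test_within_DL1[OF r]])
  have bi: "integrable lborel bump" using integrable_Re[OF ri] by (simp add: r_def)
  let ?s = "\<lambda>t. cis (w * t) * r t"
  have "fourier ?s w = (LINT t|lborel. r t)"
    unfolding fourier_def by (intro Bochner_Integration.integral_cong refl) (simp add: cis_mult flip: mult.assoc)
  also have "\<dots> = complex_of_real (LINT t|lborel. bump t)" by (simp add: r_def)
  also have "\<dots> \<noteq> 0"
  proof -
    have "(LINT t|lborel. bump t) \<noteq> 0"
    proof
      assume "(LINT t|lborel. bump t) = 0"
      then have "AE t in lborel. bump t = 0"
        using integral_nonneg_eq_0_iff_AE[OF bi] bump_nonneg by simp
      then have "AE t in lborel. t \<notin> {-1<..<0::real}"
        by eventually_elim (metis bump_pos greaterThanLessThan_iff less_irrefl)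
      then have "{-1<..<0::real} \<in> null_sets lborel" by (subst (asm) AE_iff_null_sets[symmetric]) auto
      then show False by auto
    qed
    then show ?thesis by simp
  qed
  finally show ?thesis using test_within_cis[OF r, of w] by blast
qed

lemma fejer_at_fourier: "0 < L \<Longrightarrow> fourier (fejer_at w L) w = 1"
proof -
  assume L: "0 < L"
  have "fourier (fejer_at w L) w = (LINT t|lborel. complex_of_real (fejer L t) * cis (0 * t))"
    unfolding fourier_def by (intro Bochner_Integration.integral_cong refl) (simp add: fejer_at_def cis_mult flip: mult.assoc)
  then show ?thesis using fejer_fourier[OF L, of 0] by (simp add: tri_def)
qed

text \<open>A function localised in frequency is not compactly supported, so
  \<open>twisted_conv_lift\<close> does not reach it directly. Approximating the convolution by
  translates does: translating the twisted function changes the character only by a constant factor,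
  which goes into the coefficients.\<close>

lemma twisted_conv_convol_lift:
  fixes S :: "(real \<Rightarrow> complex) \<Rightarrow> 'a::complex_banach"
  assumes U: "good_class J U" and S: "S \<in> DL1_dual" and r: "r \<in> DL1"
    and l: "(\<lambda>x. cis (w * x) *\<^sub>C conv S r x) \<in> lift J U" and k: "integrable lborel k"
  shows "(\<lambda>x. cis (w * x) *\<^sub>C conv S (convol r k) x) \<in> lift J U"
proof (rule lift_limit[OF U])
  show "bdd_uc UNIV (\<lambda>x. cis (w * x) *\<^sub>C conv S (convol r k) x)"
    by (intro bdd_uc_cis conv_bdd_uc S DL1_convol r k)
  fix e :: real assume "e > 0"
  from conv_convol_approx[OF S r k this] obtain I :: "int set" and c y where I: "finite I"
    "\<And>x. norm (conv S (convol r k) x - (\<Sum>i\<in>I. c i *\<^sub>C conv S r (x + - y i))) < e" by metis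
  let ?g = "\<lambda>x. \<Sum>i\<in>I. (c i * cis (w * y i)) *\<^sub>C (cis (w * (x + - y i)) *\<^sub>C conv S r (x + - y i))"
  have "?g \<in> lift J U" by (intro lift_sum[OF U] I lift_scaleC[OF U] lift_translate[OF U l])
  moreover have "norm (cis (w * x) *\<^sub>C conv S (convol r k) x - ?g x) \<le> e" for x
  proof -
    have "?g x = (\<Sum>i\<in>I. cis (w * x) *\<^sub>C (c i *\<^sub>C conv S r (x + - y i)))"
    proof (rule sum.cong[OF refl])
      fix i
      have "cis (w * x) = cis (w * y i) * cis (w * (x + - y i))" by (simp add: cis_mult algebra_simps)
      then show "(c i * cis (w * y i)) *\<^sub>C (cis (w * (x + - y i)) *\<^sub>C conv S r (x + - y i)) =
          cis (w * x) *\<^sub>C (c i *\<^sub>C conv S r (x + - y i))"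
        by (simp only: scaleC_scaleC mult_ac)
    qed
    then have "cis (w * x) *\<^sub>C conv S (convol r k) x - ?g x =
        cis (w * x) *\<^sub>C (conv S (convol r k) x - (\<Sum>i\<in>I. c i *\<^sub>C conv S r (x + - y i)))"
      by (simp only: scaleC.diff_right scaleC.sum_right)
    then show ?thesis using I(2)[of x] by (simp add: norm_scaleC)
  qed
  ultimately show "\<exists>g\<in>lift J U. \<forall>x. norm (cis (w * x) *\<^sub>C conv S (convol r k) x - g x) \<le> e" by (intro bexI[of _ ?g] allI)
qed

lemma closed_sp_DL1: "closed (sp_DL1 J A S)"
proof -
  have "sp_DL1 J A S = (\<Inter>\<phi>\<in>{\<phi>\<in>DL1. restrict (conv S \<phi>) J \<in> A}. {\<omega>. fourier \<phi> \<omega> = 0})"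
    unfolding sp_DL1_def by blast
  moreover have "closed {\<omega>. fourier \<phi> \<omega> = 0}" if "\<phi> \<in> DL1" for \<phi>
    using fourier_continuous[OF DL1_integrable[OF that]] by (intro closed_Collect_eq) auto
  ultimately show ?thesis by (auto intro!: closed_INT)
qed

lemma conv_in_class:
  fixes S :: "(real \<Rightarrow> complex) \<Rightarrow> 'a::complex_banach"
  assumes A: "good_class J A" and U: "good_class J U" and J: "forward_closed J" and L: "cond_L J U A" and S: "S \<in> DL1_dual"
    and sp: "countable (sp_DL1 J A S)"
    and inv: "\<And>w. w \<in> sp_DL1 J A S \<Longrightarrow> char_invariant J w A \<and> char_invariant J (- w) A"
    and tw: "\<And>w B r. w \<in> sp_DL1 J A S \<Longrightarrow> test_within B r \<Longrightarrow> (\<lambda>x. cis (- w * x) *\<^sub>C conv S r x) \<in> lift J U"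
    and f: "f \<in> DL1"
  shows "restrict (conv S f) J \<in> A"
proof -
  define N where "N f = (if f \<in> DL1 then dist_lift J A (conv S f) else 0)" for f
  obtain C p where "translation_seminorm N C p"
    using translation_seminorm_dist_lift[OF A S] unfolding N_def[abs_def] by blast
  then interpret translation_seminorm N C p .
  have N0: "N f = 0 \<longleftrightarrow> restrict (conv S f) J \<in> A" if "f \<in> DL1" for f
    using dist_lift_zero_iff[OF A conv_bdd_uc[OF S that]] that unfolding N_def by presburger
  \<comment> \<open>On \<open>DL1\<close>, \<open>N\<close> vanishes exactly at the functions that
    compete in the definition of \<open>sp_DL1\<close>.\<close>
  have spec: "spec = sp_DL1 J A S" unfolding spec_def sp_DL1_def using N0 by blast
  have "sp_DL1 J A S = {}"
  proof (rule ccontr)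
    assume "sp_DL1 J A S \<noteq> {}"
    from countable_closed_isolated[OF closed_sp_DL1 sp this] obtain w e
      where w: "w \<in> sp_DL1 J A S" "0 < e" "\<And>y. y \<noteq> w \<Longrightarrow> \<bar>y - w\<bar> \<le> e \<Longrightarrow> y \<notin> sp_DL1 J A S" by metis
    \<comment> \<open>The test function gives access to \<open>U\<close>, the Fejer kernel of width
      \<open>e\<close> restricts the frequencies to the neighbourhood where \<open>w\<close> is the
      only point of the spectrum. The transform of their convolution at \<open>w\<close> is that of
      \<open>r\<close>, because the kernel has transform 1 at its centre.\<close>
    obtain B r where r: "test_within B r" "fourier r w \<noteq> 0" using exists_test_fourier_nonzero by blast
    have rD: "r \<in> DL1" by (rule test_within_DL1[OF r(1)])
    have ki: "integrable lborel (fejer_at w e)" by (rule fejer_at_integrable[OF w(2)])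
    define \<eta> where "\<eta> = convol r (fejer_at w e)"
    have \<eta>D: "\<eta> \<in> DL1" unfolding \<eta>_def by (rule DL1_convol[OF rD ki])
    have F: "fourier \<eta> w \<noteq> 0"
      unfolding \<eta>_def fourier_convol[OF DL1_integrable[OF rD] ki] fejer_at_fourier[OF w(2)] using r(2) by simp
    define \<psi> where "\<psi> x = cis (- w * x) *\<^sub>C conv S \<eta> x" for x
    have "\<psi> \<in> lift J U"
      unfolding \<psi>_def[abs_def] \<eta>_def by (rule twisted_conv_convol_lift[OF U S rD tw[OF w(1) r(1)] ki])
    then have \<psi>U: "restrict \<psi> J \<in> U" by (simp only: lift_def mem_Collect_eq)
    have "(\<lambda>t\<in>J. restrict \<psi> J (t + h) - restrict \<psi> J t) \<in> A" if h: "0 < h" for h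
    proof -
      \<comment> \<open>The twisted difference of \<open>\<eta>\<close> becomes the ordinary
        difference of \<open>\<psi>\<close> after multiplication by the character of frequency
        \<open>- w\<close>. Invariance of \<open>A\<close> under this character is used here;
        invariance under the opposite one leads back from \<open>\<psi>\<close> to the convolution
        with \<open>\<eta>\<close>.\<close>
      define T where "T = (\<lambda>x. cis (- (w * h)) * \<eta> (x + h) - \<eta> x)"
      have tD: "(\<lambda>x. \<eta> (x + h)) \<in> DL1" by (rule DL1_translate[OF \<eta>D])
      have mD: "(\<lambda>x. cis (- (w * h)) * \<eta> (x + h)) \<in> DL1" by (rule DL1_mult[OF tD])
      have TD: "T \<in> DL1" unfolding T_def by (rule DL1_diff[OF mD \<eta>D])
      have "N T = 0"
        unfolding T_def \<eta>_def using w(3) spec by (intro isolated_spec_point[OF w(2) _ rD]) blast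
      then have "restrict (conv S T) J \<in> A" using N0[OF TD] by blast
      then have "restrict (char_mult (- w) (restrict (conv S T) J)) J \<in> A"
        using inv[OF w(1)] unfolding char_invariant_def by blast
      moreover have "restrict (char_mult (- w) (restrict (conv S T) J)) J = (\<lambda>t\<in>J. restrict \<psi> J (t + h) - restrict \<psi> J t)"
      proof (rule restrict_ext)
        fix t assume t: "t \<in> J"
        then have th: "t + h \<in> J" using J h by (simp add: forward_closed_def)
        have "conv S T t = cis (- (w * h)) *\<^sub>C conv S \<eta> (t + h) - conv S \<eta> t"
          unfolding T_def conv_diff[OF S mD \<eta>D] conv_mult[OF S tD] conv_translate ..
        moreover have "cis (- w * (t + h)) = cis (- w * t) * cis (- (w * h))" by (simp add: cis_mult algebra_simps)
        ultimately show "char_mult (- w) (restrict (conv S T) J) t = restrict \<psi> J (t + h) - restrict \<psi> J t"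
          using t th by (simp add: char_mult_def \<psi>_def scaleC.diff_right scaleC_scaleC)
      qed
      ultimately show ?thesis by simp
    qed
    then have "restrict \<psi> J \<in> A" using L \<psi>U J unfolding cond_L_def by blast
    then have "restrict (char_mult w (restrict \<psi> J)) J \<in> A"
      using inv[OF w(1)] unfolding char_invariant_def by blast
    moreover have "restrict (char_mult w (restrict \<psi> J)) J = restrict (conv S \<eta>) J"
    proof (rule restrict_ext)
      fix t assume "t \<in> J"
      then show "char_mult w (restrict \<psi> J) t = conv S \<eta> t"
        by (simp add: char_mult_def \<psi>_def scaleC_scaleC cis_mult scaleC_of_real[of 1, simplified])
    qed
    ultimately have "restrict (conv S \<eta>) J \<in> A" by simp
    \<comment> \<open>\<open>\<eta>\<close> is now a competitor in the definition of the spectrum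
      whose transform does not vanish at the spectral point \<open>w\<close>.\<close>
    then show False using F w(1) \<eta>D unfolding sp_DL1_def by blast
  qed
  then show ?thesis using null_if_spec_empty[OF _ f] N0[OF f] spec by blast
qed

section \<open>Return from convolutions to the means\<close>

lemma mollifier:
  assumes e: "0 < (\<epsilon>::real)"
  obtains b where "test_within \<epsilon> (\<lambda>t. complex_of_real (b t))" "\<And>t. 0 \<le> b t" "\<And>t. 0 \<le> t \<Longrightarrow> b t = 0" "(b has_integral 1) {-\<epsilon>..\<epsilon>}"
proof -
  define g where "g t = bump (t / \<epsilon>)" for t
  have g: "test_within \<epsilon> (\<lambda>t. complex_of_real (g t))" unfolding g_def by (rule bump_test_within[OF e])
  then have "continuous_on UNIV (\<lambda>t. Re (complex_of_real (g t)))"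
    using smooth_continuous[of "\<lambda>t. complex_of_real (g t)" UNIV 0] by (intro continuous_intros) (simp add: test_within_def)
  then have c: "continuous_on S g" for S using continuous_on_subset by auto
  define M where "M = integral {-\<epsilon>..\<epsilon>} g"
  have hi: "(g has_integral M) {-\<epsilon>..\<epsilon>}"
    unfolding M_def by (intro integrable_integral integrable_continuous_real c)
  have g0: "0 \<le> g t" for t by (simp add: g_def bump_nonneg)
  have "0 \<le> M" unfolding M_def using g0 by (intro Henstock_Kurzweil_Integration.integral_nonneg integrable_continuous_real c) auto
  moreover have "M \<noteq> 0"
  proof
    assume "M = 0"
    then have "g (- \<epsilon> / 2) = 0"
      using has_integral_0_cbox_imp_0[of "-\<epsilon>" \<epsilon> g "- \<epsilon> / 2"] hi c g0 e by (simp add: cbox_interval)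
    moreover have "0 < g (- \<epsilon> / 2)" using e unfolding g_def by (subst bump_pos) (simp add: divide_simps)
    ultimately show False by simp
  qed
  ultimately have M: "0 < M" by simp
  show ?thesis
  proof (rule that[of "\<lambda>t. (1 / M) * g t"])
    have "smooth (\<lambda>t. complex_of_real (1 / M) * complex_of_real (g t))"
      using DL1_D(1)[OF DL1_mult[OF test_within_DL1[OF g]]] .
    then show "test_within \<epsilon> (\<lambda>t. complex_of_real (1 / M * g t))"
      using g by (simp add: test_within_def)
    show "0 \<le> 1 / M * g t" for t using M g0[of t] by simp
    show "1 / M * g t = 0" if "0 \<le> t" for t using e that by (simp add: g_def bump_zero)
    show "((\<lambda>t. 1 / M * g t) has_integral 1) {-\<epsilon>..\<epsilon>}"
      using has_integral_mult_right[OF hi, of "1 / M"] M by simp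
  qed
qed

text \<open>\<open>\<Phi>\<close> is uniformly continuous on \<open>J\<close> only. As the mollifier
  vanishes on the nonnegative axis, the value at \<open>x\<close> is compared with values at points
  to the right of \<open>x\<close>, which lie in \<open>J\<close>. The approximation is uniform on
  \<open>J\<close> but not on the line, so closedness is applied to the restrictions themselves and
  not to \<open>lift\<close>.\<close>

lemma restrict_in_class_if_trunc_conv:
  fixes \<Phi> :: "real \<Rightarrow> 'a::complex_banach"
  assumes A: "good_class J A" and J: "forward_closed J" and l: "loc_int \<Phi>" and u: "bdd_uc J \<Phi>"
    and cv: "\<And>B r. test_within B r \<Longrightarrow> restrict (trunc_conv B \<Phi> r) J \<in> A"
  shows "restrict \<Phi> J \<in> A"
proof -
  have ap: "\<exists>g. restrict g J \<in> A \<and> (\<forall>x\<in>J. norm (g x - \<Phi> x) \<le> e)" if e: "0 < e" for e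
  proof -
    obtain d where d: "d > 0" "\<And>x y. x \<in> J \<Longrightarrow> y \<in> J \<Longrightarrow> \<bar>x - y\<bar> < d \<Longrightarrow> norm (\<Phi> x - \<Phi> y) < e"
      using bdd_uc_modulus[OF u e] by metis
    define \<epsilon> where "\<epsilon> = d / 2"
    have \<epsilon>: "0 < \<epsilon>" "\<epsilon> < d" using d(1) by (simp_all add: \<epsilon>_def)
    obtain b where b: "test_within \<epsilon> (\<lambda>t. complex_of_real (b t))" "\<And>t. 0 \<le> b t" "\<And>t. 0 \<le> t \<Longrightarrow> b t = 0" "(b has_integral 1) {-\<epsilon>..\<epsilon>}"
      using mollifier[OF \<epsilon>(1)] by metis
    let ?b = "\<lambda>t. complex_of_real (b t)"
    have "norm (trunc_conv \<epsilon> \<Phi> ?b x - \<Phi> x) \<le> e" if x: "x \<in> J" for x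
    proof -
      have c: "continuous_on UNIV (\<lambda>t. ?b (x - t))"
        using b(1) smooth_continuous[of ?b UNIV 0] unfolding test_within_def
        by (intro continuous_on_compose2[of UNIV ?b UNIV "\<lambda>t. x - t"] continuous_intros) auto
      have loc_int: "loc_int (\<lambda>t. ?b (x - t) *\<^sub>C \<Phi> t)" "loc_int (\<lambda>t. ?b (x - t) *\<^sub>C \<Phi> x)"
        by (intro loc_int_scaleC l c loc_int_continuous continuous_on_const)+
      have I1: "trunc_conv \<epsilon> \<Phi> ?b x = integral {x-\<epsilon>..x+\<epsilon>} (\<lambda>t. ?b (x - t) *\<^sub>C \<Phi> t)"
        using integral_reflect_translate[of \<epsilon> "\<lambda>t. ?b (x - t) *\<^sub>C \<Phi> t" x] by (simp add: trunc_conv_def)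
      have "((\<lambda>t. b t *\<^sub>R \<Phi> x) has_integral 1 *\<^sub>R \<Phi> x) {-\<epsilon>..\<epsilon>}" by (rule has_integral_scaleR_left[OF b(4)])
      then have "integral {-\<epsilon>..\<epsilon>} (\<lambda>t. ?b t *\<^sub>C \<Phi> x) = \<Phi> x" by (simp add: scaleC_of_real integral_unique)
      then have I2: "\<Phi> x = integral {x-\<epsilon>..x+\<epsilon>} (\<lambda>t. ?b (x - t) *\<^sub>C \<Phi> x)"
        using integral_reflect_translate[of \<epsilon> "\<lambda>t. ?b (x - t) *\<^sub>C \<Phi> x" x] by simp
      have bc: "continuous_on UNIV (\<lambda>t. b (x - t))" using continuous_on_Re[OF c] by simp
      have "integral {x-\<epsilon>..x+\<epsilon>} (\<lambda>t. b (x - t) * e) = integral {-\<epsilon>..\<epsilon>} (\<lambda>t. b t * e)"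
        using integral_reflect_translate[of \<epsilon> "\<lambda>t. b (x - t) * e" x, symmetric] by simp
      also have "\<dots> = e" using b(4) by (simp add: integral_unique)
      finally have I3: "integral {x-\<epsilon>..x+\<epsilon>} (\<lambda>t. b (x - t) * e) = e" .
      have "trunc_conv \<epsilon> \<Phi> ?b x - \<Phi> x = integral {x-\<epsilon>..x+\<epsilon>} (\<lambda>t. ?b (x - t) *\<^sub>C \<Phi> t) - integral {x-\<epsilon>..x+\<epsilon>} (\<lambda>t. ?b (x - t) *\<^sub>C \<Phi> x)"
        using I1 I2 by argo
      also have "\<dots> = integral {x-\<epsilon>..x+\<epsilon>} (\<lambda>t. ?b (x - t) *\<^sub>C \<Phi> t - ?b (x - t) *\<^sub>C \<Phi> x)"
        by (rule Henstock_Kurzweil_Integration.integral_diff[symmetric]) (intro loc_int_integrable loc_int)+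
      finally have "norm (trunc_conv \<epsilon> \<Phi> ?b x - \<Phi> x) = norm (integral {x-\<epsilon>..x+\<epsilon>} (\<lambda>t. ?b (x - t) *\<^sub>C \<Phi> t - ?b (x - t) *\<^sub>C \<Phi> x))"
        by (rule arg_cong)
      also have "\<dots> \<le> integral {x-\<epsilon>..x+\<epsilon>} (\<lambda>t. b (x - t) * e)"
      proof (rule integral_norm_bound_integral)
        show "(\<lambda>t. ?b (x - t) *\<^sub>C \<Phi> t - ?b (x - t) *\<^sub>C \<Phi> x) integrable_on {x-\<epsilon>..x+\<epsilon>}"
          by (intro Henstock_Kurzweil_Integration.integrable_diff loc_int_integrable loc_int)
        show "(\<lambda>t. b (x - t) * e) integrable_on {x-\<epsilon>..x+\<epsilon>}"
          by (intro integrable_continuous_real continuous_intros continuous_on_subset[OF bc]) auto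
        fix t assume t: "t \<in> {x-\<epsilon>..x+\<epsilon>}"
        have "norm (?b (x - t) *\<^sub>C \<Phi> t - ?b (x - t) *\<^sub>C \<Phi> x) = b (x - t) * norm (\<Phi> t - \<Phi> x)"
          by (simp add: scaleC.diff_right[symmetric] norm_scaleC b(2))
        also have "\<dots> \<le> b (x - t) * e"
        proof (cases "t < x")
          case False
          then have "x + (t - x) \<in> J" using J x unfolding forward_closed_def by (metis diff_ge_0_iff_ge not_less)
          then have "norm (\<Phi> t - \<Phi> x) < e" using x t \<epsilon> by (intro d(2)) auto
          then show ?thesis using b(2) by (intro mult_left_mono) auto
        qed (simp add: b(3))
        finally show "norm (?b (x - t) *\<^sub>C \<Phi> t - ?b (x - t) *\<^sub>C \<Phi> x) \<le> b (x - t) * e" .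
      qed
      finally show ?thesis by (simp only: I3)
    qed
    then show ?thesis using cv[OF b(1)] by blast
  qed
  have "\<forall>n. \<exists>g. restrict g J \<in> A \<and> (\<forall>x\<in>J. norm (g x - \<Phi> x) \<le> 1 / real (Suc n))" using ap by simp
  then obtain g where g: "\<And>n. restrict (g n) J \<in> A" "\<And>n x. x \<in> J \<Longrightarrow> norm (g n x - \<Phi> x) \<le> 1 / real (Suc n)" by metis
  have "uniform_limit J (\<lambda>n. restrict (g n) J) (restrict \<Phi> J) sequentially"
  proof (rule uniform_limitI)
    fix e :: real assume "e > 0"
    have "(\<lambda>n. 1 / real (Suc n)) \<longlonglongrightarrow> 0" by (rule lim_1_over_n[THEN LIMSEQ_Suc])
    then have "\<forall>\<^sub>F n in sequentially. 1 / real (Suc n) < e" using \<open>e > 0\<close> by (rule order_tendstoD)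
    then show "\<forall>\<^sub>F n in sequentially. \<forall>x\<in>J. dist (restrict (g n) J x) (restrict \<Phi> J x) < e"
      by eventually_elim (use g(2) in \<open>fastforce simp: dist_norm intro: le_less_trans\<close>)
  qed
  then show ?thesis using A g(1) unfolding good_class_def uniformly_closed_def by (metis restrict_extensional)
qed

theorem theorem9p7:
  fixes J :: "real set"
    and A U :: "(real \<Rightarrow> 'a::complex_banach) set"
    and m :: nat
    and \<phi> :: "real \<Rightarrow> 'a"
  assumes "admissible_interval J"
    and "A \<subseteq> L1loc J" "linear_class J A" "uniformly_closed J A" "Cub_invariant J A"
    and "U \<subseteq> L1loc J" "linear_class J U" "uniformly_closed J U" "Cub_invariant J U"
    and "cond_L J U A"
    and "\<phi> \<in> mean_power UNIV m (Linf UNIV)"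
    and "countable (sp_DL1 J A (DL1_extension \<phi>))"
    and "restrict \<phi> J \<in> mean_power J m (Cu J)"
    and "\<And>\<omega>. \<omega> \<in> sp_DL1 J A (DL1_extension \<phi>) \<Longrightarrow>
           char_invariant J \<omega> A \<and> char_invariant J (- \<omega>) A \<and>
           (\<exists>q\<ge>m. restrict (char_mult (- \<omega>) \<phi>) J \<in> mean_power J q U)"
  shows "restrict \<phi> J \<in> mean_power J m A"
proof -
  define S where "S = DL1_extension \<phi>"
  have A: "good_class J A" and U: "good_class J U" using assms by (simp_all add: good_class_def)
  have J: "forward_closed J" by (rule forward_closed_admissible[OF assms(1)])
  have \<phi>: "loc_int \<phi>" by (rule mean_power_Linf_loc_int[OF assms(11)])
  note S = DL1_extension_props[OF \<phi> mean_power_Linf_iter_window[OF assms(11)], folded S_def]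
  have u: "iter_window (bdd_uc J) m \<phi>" by (rule mean_power_Cu_bdd_uc[OF J assms(11,13)])
  have cA: "restrict (conv S r) J \<in> A" if r: "r \<in> DL1" for r
  proof (rule conv_in_class[OF A U J assms(10) S(1) _ _ _ r])
    show "countable (sp_DL1 J A S)" using assms(12) by (simp only: S_def)
    fix w assume w: "w \<in> sp_DL1 J A S"
    show "char_invariant J w A \<and> char_invariant J (- w) A" using assms(14) w unfolding S_def by blast
    fix B r assume r: "test_within B r"
    obtain q where "q \<ge> m" "restrict (char_mult (- w) \<phi>) J \<in> mean_power J q U"
      using assms(14) w unfolding S_def by blast
    from twisted_conv_lift[OF assms(1) U S(1) S(2) \<phi> u this r]
    show "(\<lambda>x. cis (- w * x) *\<^sub>C conv S r x) \<in> lift J U" by simp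
  qed
  show ?thesis
  proof (rule mean_power_if_fold_window[OF J A \<phi> assms(13)])
    fix hs :: "real list" assume hs: "length hs = m" "\<forall>h\<in>set hs. 0 < h"
    show "restrict (fold window hs \<phi>) J \<in> A"
    proof (rule restrict_in_class_if_trunc_conv[OF A J])
      show "loc_int (fold window hs \<phi>)" by (rule loc_int_fold_window[OF \<phi> hs(2)])
      show "bdd_uc J (fold window hs \<phi>)" using u hs by (simp add: iter_window_def)
      fix B r assume r: "test_within B r"
      have rD: "r \<in> DL1" by (rule test_within_DL1[OF r])
      \<comment> \<open>Windows preserve \<open>lift J A\<close> and commute with the convolution.
        Hence the mollified \<open>m\<close>-fold windows of \<open>\<phi>\<close> restrict to
        \<open>A\<close>, and shrinking the mollifier gives the windows themselves.\<close>
      have "conv S r \<in> lift J A" unfolding lift_def using cA[OF rD] conv_bdd_uc[OF S(1) rD] by blast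
      then have "fold window hs (conv S r) \<in> lift J A" by (rule lift_fold_window[OF A _ hs(2)])
      moreover have "fold window hs (conv S r) = trunc_conv B (fold window hs \<phi>) r"
      proof -
        have "conv S r = trunc_conv B \<phi> r" by (rule conv_eq_trunc_conv[OF S(2) r])
        then show ?thesis using fold_window_trunc_conv_test_within[OF r \<phi> hs(2)] by (simp only:)
      qed
      ultimately show "restrict (trunc_conv B (fold window hs \<phi>) r) J \<in> A" by (simp only: lift_def mem_Collect_eq)
    qed
  qed
qed

end
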